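(* Let $k>0$, $\sigma>0$, $p\in\mathbb{R}^2$ and $N_1,N_2\in\mathbb{N}$. For any $\gamma_2\in(N_2+1,\,N_1+N_2+1)$ (or any $\gamma_1>N_1+N_2+1$) there exists a 1-parameter family of finite-energy solutions of the self-dual system (SD) (see context) in $\mathbb{R}^2$ such that the complex scalar fields $\phi_1$, $\phi_2$ vanish only at $p$, with multiplicity $N_1$ and $N_2$ respectively, and $$\gamma_2=\frac1{2\pi}\Phi_2\qquad\Big(\text{or, respectively, } \gamma_1=\frac1{2\pi}\Phi_1\Big)$$ for every member of the family. Equivalently, for any assigned energy level $E>0$ there exists a 1-parameter family of finite-energy solutions of (SD) with $\phi_1,\phi_2$ vanishing only at $p$ with multiplicities $N_1$, $N_2$ respectively, which all carry total energy $E$, namely $$E=\frac{N(N-1)\sigma k}{4\pi}\int_{\mathbb{R}^2}\left(f_{12}^{(1)}-f_{12}^{(2)}\right)dx.$$ For all such solutions, setting $\beta_i=\frac{1}{2\pi}\Phi_i-N_i$ ($i=1,2$), one has, as $|x|\to\infty$, $$|\phi_i|^2=O(|x|^{-2\beta_i}),\qquad |D_j\phi_i|^2=O(|x|^{-2(\beta_i+1)})\ (i,j=1,2),\qquad f_{12}^{(1)}=O(|x|^{-2\beta_2}),\qquad f_{12}^{(2)}=O(|x|^{-2\beta_1}),$$ together with $$0<(\beta_1-1)(\beta_2-1)<(N_1+1)(N_2+1),\qquad \beta_2(\beta_1-1)>N_2(N_1+1),\qquad 0<\beta_1(\beta_2-1)<N_1(N_2+1).$$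
   Context: $\mathbb{N}$ denotes the positive integers; $N\ge2$ is a fixed integer (size of the gauge group). The unknowns are real-valued functions $a_1^{(i)},a_2^{(i)}$ and complex-valued functions $\phi_i$ on $\mathbb{R}^2$, $i=1,2$. Notation: $D_j\phi_i=\partial_j\phi_i+\mathrm{i}\,a_j^{(i)}\phi_i$ ($j=1,2$), $f_{12}^{(i)}=\partial_1a_2^{(i)}-\partial_2a_1^{(i)}$, and $c^2=\frac{\sigma k}{2\pi}$. The self-dual system (SD) on $\mathbb{R}^2$ is $$D_1\phi_1-\mathrm{i}D_2\phi_1=0,\qquad D_1\phi_2-\mathrm{i}D_2\phi_2=0,$$ $$f_{12}^{(1)}=\frac{8\pi^2}{k^2}|\phi_2|^2\left(|\phi_1|^2+c^2\right),\qquad f_{12}^{(2)}=\frac{8\pi^2}{k^2}|\phi_1|^2\left(|\phi_2|^2-c^2\right).$$ A zero $p$ of $\phi_i$ has multiplicity $N_i$ if $|\phi_i(x)|\,|x-p|^{-N_i}$ extends to a continuous positive function near $p$. A solution has finite energy (and fluxes) if $|\phi_1|^2,\ |\phi_2|^2,\ |\phi_1|^2|\phi_2|^2\in L^1(\mathbb{R}^2)$. The total fluxes are $\Phi_i=\int_{\mathbb{R}^2}f_{12}^{(i)}\,dx$, $i=1,2$. A 1-parameter family of solutions means a family indexed by a parameter $L\in\mathbb{R}$ whose members are pairwise different (not gauge equivalent: different values of $L$ give different pairs $(|\phi_1|,|\phi_2|)$). *)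

theory Defs
  imports "HOL-Analysis.Analysis" "HOL-Library.Landau_Symbols"
begin

definition partial_deriv :: "2 \<Rightarrow> (real^2 \<Rightarrow> 'b::real_normed_vector) \<Rightarrow> real^2 \<Rightarrow> 'b" where
  "partial_deriv j f x = frechet_derivative f (at x) (axis j 1)"

definition C1_plane :: "(real^2 \<Rightarrow> 'b::real_normed_vector) \<Rightarrow> bool" where
  "C1_plane f \<longleftrightarrow>
     (\<forall>x. f differentiable (at x)) \<and> (\<forall>j. continuous_on UNIV (partial_deriv j f))"

text \<open>
  A gauge potential is a planar vector field \<open>A = (a\<^sub>1, a\<^sub>2)\<close>, so that \<open>a\<^sub>j\<close> is \<open>\<lambda>x. A x $ j\<close>.
  The index type \<open>2\<close> has exactly the two elements \<open>1\<close> and \<open>2\<close> (where \<open>2 = 0\<close>).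
\<close>

record configuration =
  A1 :: "real^2 \<Rightarrow> real^2"
  A2 :: "real^2 \<Rightarrow> real^2"
  phi1 :: "real^2 \<Rightarrow> complex"
  phi2 :: "real^2 \<Rightarrow> complex"

definition cov_deriv :: "(real^2 \<Rightarrow> real^2) \<Rightarrow> 2 \<Rightarrow> (real^2 \<Rightarrow> complex) \<Rightarrow> real^2 \<Rightarrow> complex" where
  "cov_deriv A j \<phi> x = partial_deriv j \<phi> x + \<i> * of_real (A x $ j) * \<phi> x"

definition curvature :: "(real^2 \<Rightarrow> real^2) \<Rightarrow> real^2 \<Rightarrow> real" where
  "curvature A x = partial_deriv 1 (\<lambda>y. A y $ 2) x - partial_deriv 2 (\<lambda>y. A y $ 1) x"

definition SD_solution :: "real \<Rightarrow> real \<Rightarrow> configuration \<Rightarrow> bool" where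
  "SD_solution k \<sigma> S \<longleftrightarrow>
     C1_plane (A1 S) \<and> C1_plane (A2 S) \<and> C1_plane (phi1 S) \<and> C1_plane (phi2 S) \<and>
     (let c2 = \<sigma> * k / (2 * pi) in
      \<forall>x. cov_deriv (A1 S) 1 (phi1 S) x - \<i> * cov_deriv (A1 S) 2 (phi1 S) x = 0 \<and>
          cov_deriv (A2 S) 1 (phi2 S) x - \<i> * cov_deriv (A2 S) 2 (phi2 S) x = 0 \<and>
          curvature (A1 S) x =
            8 * pi^2 / k^2 * (norm (phi2 S x))^2 * ((norm (phi1 S x))^2 + c2) \<and>
          curvature (A2 S) x =
            8 * pi^2 / k^2 * (norm (phi1 S x))^2 * ((norm (phi2 S x))^2 - c2))"

definition finite_energy :: "configuration \<Rightarrow> bool" where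
  "finite_energy S \<longleftrightarrow>
     integrable lborel (\<lambda>x. (norm (phi1 S x))^2) \<and>
     integrable lborel (\<lambda>x. (norm (phi2 S x))^2) \<and>
     integrable lborel (\<lambda>x. (norm (phi1 S x))^2 * (norm (phi2 S x))^2)"

definition zero_of_multiplicity :: "(real^2 \<Rightarrow> complex) \<Rightarrow> real^2 \<Rightarrow> nat \<Rightarrow> bool" where
  "zero_of_multiplicity \<phi> p n \<longleftrightarrow>
     \<phi> p = 0 \<and>
     (\<exists>r>0. \<exists>g :: real^2 \<Rightarrow> real.
        continuous_on (ball p r) g \<and> (\<forall>x\<in>ball p r. g x > 0) \<and>
        (\<forall>x\<in>ball p r - {p}. norm (\<phi> x) / norm (x - p) ^ n = g x))"

definition flux :: "(real^2 \<Rightarrow> real^2) \<Rightarrow> real" where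
  "flux A = (\<integral>x. curvature A x \<partial>lborel)"

text \<open>The self-dual value of the energy; \<open>N\<close> is the size of the gauge group.\<close>

definition total_energy :: "nat \<Rightarrow> real \<Rightarrow> real \<Rightarrow> configuration \<Rightarrow> real" where
  "total_energy N k \<sigma> S =
     real N * (real N - 1) * \<sigma> * k / (4 * pi) *
     (\<integral>x. curvature (A1 S) x - curvature (A2 S) x \<partial>lborel)"

definition vortex_solution ::
    "real \<Rightarrow> real \<Rightarrow> real^2 \<Rightarrow> nat \<Rightarrow> nat \<Rightarrow> configuration \<Rightarrow> bool" where
  "vortex_solution k \<sigma> p N1 N2 S \<longleftrightarrow>
     SD_solution k \<sigma> S \<and> finite_energy S \<and>
     (\<forall>x. phi1 S x = 0 \<longrightarrow> x = p) \<and> zero_of_multiplicity (phi1 S) p N1 \<and>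
     (\<forall>x. phi2 S x = 0 \<longrightarrow> x = p) \<and> zero_of_multiplicity (phi2 S) p N2"

text \<open>
  Injectivity is required of the gauge-invariant pair of moduli, so distinct parameters
  give gauge-inequivalent solutions.
\<close>

definition vortex_family ::
    "real \<Rightarrow> real \<Rightarrow> real^2 \<Rightarrow> nat \<Rightarrow> nat \<Rightarrow> (real \<Rightarrow> configuration) \<Rightarrow> bool" where
  "vortex_family k \<sigma> p N1 N2 F \<longleftrightarrow>
     (\<forall>L. vortex_solution k \<sigma> p N1 N2 (F L)) \<and>
     inj (\<lambda>L. (\<lambda>x. norm (phi1 (F L) x), \<lambda>x. norm (phi2 (F L) x)))"

end

theory Submission
  imports Defs "HOL-Complex_Analysis.Complex_Analysis" "HOL-Real_Asymp.Real_Asymp"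
begin

text \<open>
  Asymptotics. The self-dual equation makes \<open>ln |\<phi>\<^sub>i|\<close> a solution of a Liouville equation, so
  \<open>ln |\<phi>\<^sub>i|\<^sup>2 - 2 N\<^sub>i ln |x - p|\<close> plus the logarithmic potential of the curvature is harmonic and entire;
  integrability forces it to be constant. This representation yields the decay exponents, and a
  Pohozaev identity turns them into the inequalities between \<open>\<beta>\<^sub>1\<close> and \<open>\<beta>\<^sub>2\<close>.

  Existence. Radial solutions in the variable \<open>s = |x - p|\<^sup>2\<close> form a family with two parameters \<open>h\<^sub>1, h\<^sub>2 \<ge> 0\<close>.
  For \<open>h\<^sub>1 = h\<^sub>2 = 0\<close> the fluxes are both \<open>N\<^sub>1 + N\<^sub>2 + 1\<close>; fixing a small \<open>h\<^sub>2\<close> and increasing \<open>h\<^sub>1\<close> drives the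
  first flux continuously to infinity, and the inequalities above then control the second. The
  intermediate value theorem gives a solution for every small \<open>h\<^sub>2\<close>, which is the free parameter.
\<close>

text \<open>Finite energy does not bound the moduli, and the second curvature changes sign, so decay
  has to be bootstrapped. The positive part of a density has little mass far out; exponential
  integrability then bounds local integrals of fourth powers of the squared moduli polynomially.
  Hence the potentials exceed their leading term by o(ln |z|) at most on the side that matters, and
  exponents larger than one turn this into decay. For the radial equations the variable |x - p|^2
  produces integer powers and an equation s Z'' + Z' = -G that is regular at 0 in averaged form.
  Rescaling removes k and \<sigma>; the constant c^2 is replaced by the two masses h1 and h2. The
  corner h1 = h2 = 0 is not a vortex solution, but there both partial fluxes coincide and obey a
  logistic equation, so it is the one place where the fluxes are known, and they are continued from
  there. Each existence claim prescribes one linear combination of the fluxes; the inequality for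
  \<beta>1 (\<beta>2 - 1) tells how that combination behaves when the first flux is large.\<close>

section \<open>Lebesgue measure of the plane: radial integrals, rotations, the kernel 1/|z|\<close>

text \<open>The set \<open>(cmod z)^2 \<le> a\<close> is a disc of area pi times a, so the two
  measures agree on half-lines, which generate the Borel sets. This stands in for polar coordinates:
  with the square as radial variable the density is the constant pi.\<close>

lemma distr_cmod_square:
  "distr (lborel :: complex measure) borel (\<lambda>z. (cmod z)\<^sup>2)
     = density lborel (\<lambda>s. ennreal pi * indicator {0..} s)" (is "?M = ?N")
proof (rule measure_eqI_generator_eq[where E="range atMost" and \<Omega>=UNIV and A="\<lambda>n. {..real n}"])
  show "Int_stable (range (atMost :: real \<Rightarrow> _))"
    by (auto simp: Int_stable_def intro!: image_eqI[where x="min _ _"])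
  show "range atMost \<subseteq> Pow (UNIV::real set)" by auto
  show "sets ?M = sigma_sets UNIV (range atMost)" "sets ?N = sigma_sets UNIV (range atMost)"
    by (simp_all add: borel_eq_atMost)
  have M: "emeasure ?M {..a} = ennreal (pi * max 0 a)" for a :: real
  proof -
    have "emeasure ?M {..a} = emeasure lborel ((\<lambda>z::complex. (cmod z)\<^sup>2) -` {..a} \<inter> space lborel)"
      by (rule emeasure_distr) auto
    also have "(\<lambda>z::complex. (cmod z)\<^sup>2) -` {..a} \<inter> space lborel = (if a < 0 then {} else cball 0 (sqrt a))"
    proof (cases "a < 0")
      case True
      then show ?thesis by (auto simp: not_le) (metis zero_le_power2 not_less order_trans)
    next
      case False
      have "(cmod z)\<^sup>2 \<le> a \<longleftrightarrow> cmod z \<le> sqrt a" for z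
        using False by (metis norm_ge_zero not_less real_sqrt_le_iff real_sqrt_abs abs_of_nonneg)
      then show ?thesis using False by auto
    qed
    also have "emeasure lborel \<dots> = ennreal (pi * max 0 a)"
      by (auto simp: emeasure_cball unit_ball_vol_2)
    finally show ?thesis .
  qed
  have N: "emeasure ?N {..a} = ennreal (pi * max 0 a)" for a :: real
  proof -
    have "emeasure ?N {..a} = (\<integral>\<^sup>+s. ennreal pi * indicator {0..} s * indicator {..a} s \<partial>lborel)"
      by (rule emeasure_density) auto
    also have "\<dots> = (\<integral>\<^sup>+s. ennreal pi * indicator {0..a} s \<partial>lborel)"
      by (intro nn_integral_cong) (auto split: split_indicator)
    also have "\<dots> = ennreal (pi * max 0 a)"
      by (subst nn_integral_cmult) (auto simp: ennreal_mult' max_def)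
    finally show ?thesis .
  qed
  show "emeasure ?M X = emeasure ?N X" if "X \<in> range atMost" for X
    using that M N by auto
  show "range (\<lambda>n. {..real n}) \<subseteq> range atMost" by auto
  show "(\<Union>i. {..real i}) = UNIV" by (auto intro: real_arch_simple)
  show "emeasure ?M {..real i} \<noteq> \<infinity>" for i by (simp add: M)
qed

lemma nn_integral_cmod_square:
  assumes [measurable]: "g \<in> borel_measurable borel"
  shows "(\<integral>\<^sup>+z. g ((cmod z)\<^sup>2) \<partial>lborel) = ennreal pi * (\<integral>\<^sup>+s. g s * indicator {0..} s \<partial>lborel)"
proof -
  have "(\<integral>\<^sup>+z. g ((cmod z)\<^sup>2) \<partial>lborel) = (\<integral>\<^sup>+s. g s \<partial>distr (lborel :: complex measure) borel (\<lambda>z. (cmod z)\<^sup>2))"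
    by (rule nn_integral_distr[symmetric]) auto
  also have "\<dots> = (\<integral>\<^sup>+s. (ennreal pi * indicator {0..} s) * g s \<partial>lborel)"
    unfolding distr_cmod_square by (rule nn_integral_density) auto
  also have "\<dots> = ennreal pi * (\<integral>\<^sup>+s. g s * indicator {0..} s \<partial>lborel)"
    by (subst nn_integral_cmult[symmetric]) (auto simp: mult_ac)
  finally show ?thesis .
qed

text \<open>The problem is posed on \<open>real^2\<close>, while contour integrals and holomorphy
  live on \<open>complex\<close>; this isometry carries fields and integrals from one to the
  other.\<close>

definition of_plane :: "complex \<Rightarrow> real^2" where
  "of_plane z = vector [Re z, Im z]"

lemma of_plane_nth [simp]: "of_plane z $ 1 = Re z" "of_plane z $ 2 = Im z"
  by (simp_all add: of_plane_def)

lemma linear_of_plane: "linear of_plane"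
  by (rule linearI) (simp_all add: vec_eq_iff forall_2)

lemma norm_of_plane [simp]: "norm (of_plane z) = cmod z"
  by (simp add: norm_vec_def L2_set_def sum_2 cmod_def)

lemma bounded_linear_of_plane: "bounded_linear of_plane"
  using linear_of_plane by (simp add: linear_conv_bounded_linear)

lemma of_plane_measurable [measurable]: "of_plane \<in> borel_measurable borel"
  by (intro borel_measurable_continuous_onI linear_continuous_on bounded_linear_of_plane)

lemma ex_of_plane: "\<exists>z. x = of_plane z"
  by (rule exI[of _ "Complex (x$1) (x$2)"]) (simp add: vec_eq_iff forall_2)

lemma prod_Basis_complex: "(\<Prod>b\<in>Basis. g b) = g 1 * g \<i>" for g :: "complex \<Rightarrow> 'a::comm_monoid_mult"
  by (simp add: Basis_complex_def)

lemma Basis_vec2: "(Basis :: (real^2) set) = {axis 1 1, axis 2 1}"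
  by (auto simp: Basis_vec_def axis_eq_axis) (metis exhaust_2)

lemma prod_Basis_vec2: "(\<Prod>b\<in>Basis. g b) = g (axis 1 1) * g (axis 2 1)" for g :: "real^2 \<Rightarrow> 'a::comm_monoid_mult"
proof -
  have "axis 1 1 \<noteq> (axis 2 1 :: real^2)" by (simp add: axis_eq_axis)
  then show ?thesis unfolding Basis_vec2 by simp
qed

lemma distr_of_plane: "distr lborel borel of_plane = lborel"
proof (rule lborel_eqI[symmetric])
  fix l u :: "real^2"
  assume *: "\<And>b. b \<in> Basis \<Longrightarrow> l \<bullet> b \<le> u \<bullet> b"
  have "of_plane -` box l u \<inter> space lborel = box (Complex (l$1) (l$2)) (Complex (u$1) (u$2))"
    by (auto simp: mem_box Basis_complex_def Basis_vec_def inner_axis forall_2 exhaust_2)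
  then have "emeasure (distr lborel borel of_plane) (box l u)
      = emeasure lborel (box (Complex (l$1) (l$2)) (Complex (u$1) (u$2)))"
    by (subst emeasure_distr) auto
  also have "\<dots> = ennreal (\<Prod>b\<in>Basis. (u - l) \<bullet> b)"
    using *[of "axis 1 1"] *[of "axis 2 1"]
    unfolding prod_Basis_vec2
    by (subst emeasure_lborel_box)
       (auto simp: prod_Basis_complex inner_axis Basis_complex_def Basis_vec2)
  finally show "emeasure (distr lborel borel of_plane) (box l u) = ennreal (\<Prod>b\<in>Basis. (u - l) \<bullet> b)"
    by simp
qed auto

lemma distr_Complex:
  "distr (lborel \<Otimes>\<^sub>M lborel) borel (\<lambda>(x, y). Complex x y) = lborel"
proof (rule lborel_eqI[symmetric])
  fix l u :: complex
  assume *: "\<And>b. b \<in> Basis \<Longrightarrow> l \<bullet> b \<le> u \<bullet> b"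
  have [measurable]: "(\<lambda>(x, y). Complex x y) \<in> borel_measurable (borel \<Otimes>\<^sub>M borel)"
    unfolding Complex_eq split_beta' by measurable
  have "(\<lambda>(x, y). Complex x y) -` box l u \<inter> space (lborel \<Otimes>\<^sub>M lborel) = {Re l<..<Re u} \<times> {Im l<..<Im u}"
    by (auto simp: mem_box Basis_complex_def space_pair_measure)
  then have "emeasure (distr (lborel \<Otimes>\<^sub>M lborel) borel (\<lambda>(x, y). Complex x y)) (box l u)
      = emeasure (lborel \<Otimes>\<^sub>M lborel) ({Re l<..<Re u} \<times> {Im l<..<Im u})"
    by (subst emeasure_distr) auto
  also have "\<dots> = ennreal (\<Prod>b\<in>Basis. (u - l) \<bullet> b)"
    using *[of 1] *[of \<i>] 
    by (subst lborel.emeasure_pair_measure_Times)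
       (auto simp: prod_Basis_complex Basis_complex_def ennreal_mult')
  finally show "emeasure (distr (lborel \<Otimes>\<^sub>M lborel) borel (\<lambda>(x, y). Complex x y)) (box l u)
      = ennreal (\<Prod>b\<in>Basis. (u - l) \<bullet> b)" .
qed auto


text \<open>The preimage of a box is its image under the inverse orthogonal map, which has the same
  Lebesgue measure; agreement with \<open>lborel\<close> on boxes is enough.\<close>

lemma distr_isometry_plane:
  fixes g :: "real^2 \<Rightarrow> real^2"
  assumes g: "linear g" and iso: "\<And>x. norm (g x) = norm x"
  shows "distr lborel borel g = (lborel :: (real^2) measure)"
proof (rule lborel_eqI[symmetric])
  fix l u :: "real^2"
  have ot: "orthogonal_transformation g"
    using g iso by (simp add: orthogonal_transformation)
  have bij: "bij g" by (rule orthogonal_transformation_bij[OF ot])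
  have ot': "orthogonal_transformation (inv g)" by (rule orthogonal_transformation_inv[OF ot])
  have [measurable]: "g \<in> borel_measurable borel"
    using g by (intro borel_measurable_continuous_onI linear_continuous_on) (simp add: linear_conv_bounded_linear)
  have "emeasure (distr lborel borel g) (box l u) = emeasure lborel (g -` box l u)"
    by (subst emeasure_distr) auto
  also have "g -` box l u = inv g ` box l u"
    by (simp add: bij bij_vimage_eq_inv_image)
  also have "emeasure lborel (inv g ` box l u) = emeasure lebesgue (inv g ` box l u)"
  proof -
    have "g -` box l u \<in> sets borel"
      by (rule measurable_sets_borel[of g borel]) auto
    then have "inv g ` box l u \<in> sets borel"
      by (simp add: bij bij_vimage_eq_inv_image)
    then show ?thesis by (simp add: emeasure_completion)
  qed
  also have "\<dots> = ennreal (measure lebesgue (inv g ` box l u))"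
    by (rule emeasure_eq_measure2[OF measurable_orthogonal_image[OF ot']]) simp
  also have "\<dots> = ennreal (measure lebesgue (box l u))"
    by (subst measure_orthogonal_image[OF ot']) auto
  also have "\<dots> = emeasure lebesgue (box l u)"
    by (rule emeasure_eq_measure2[symmetric]) simp
  also have "\<dots> = emeasure lborel (box l u)"
    by (simp add: emeasure_completion)
  finally show "(\<And>b. b \<in> Basis \<Longrightarrow> l \<bullet> b \<le> u \<bullet> b) \<Longrightarrow> emeasure (distr lborel borel g) (box l u) = ennreal (\<Prod>b\<in>Basis. (u - l) \<bullet> b)"
    by (simp add: emeasure_lborel_box)
qed auto

definition to_complex :: "real^2 \<Rightarrow> complex" where
  "to_complex x = Complex (x$1) (x$2)"

lemma to_complex_simps [simp]: "to_complex (of_plane z) = z" "of_plane (to_complex x) = x"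
  by (simp_all add: to_complex_def of_plane_def vec_eq_iff forall_2 complex_eq_iff)

lemma linear_to_complex: "linear to_complex"
  by (rule linearI) (simp_all add: to_complex_def complex_eq_iff)

lemma to_complex_measurable [measurable]: "to_complex \<in> borel_measurable borel"
  using linear_to_complex by (intro borel_measurable_continuous_onI linear_continuous_on) (simp add: linear_conv_bounded_linear)

text \<open>Conjugation with \<open>of_plane\<close> turns multiplication by a unit complex number
  into an orthogonal map of \<open>real^2\<close>. Rotation invariance is what produces circular
  means under radial weights.\<close>

lemma distr_rotation:
  assumes u: "cmod u = 1"
  shows "distr lborel borel ((*) u) = (lborel :: complex measure)"
proof -
  define g where "g x = of_plane (u * to_complex x)" for x
  have lin: "linear g"
    unfolding g_def using linear_of_plane linear_to_complex
    by (intro linearI) (simp_all add: linear_add linear_scale distrib_left)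
  have iso: "norm (g x) = norm x" for x
    using norm_of_plane[of "to_complex x"] u by (simp add: g_def norm_mult)
  have gm [measurable]: "g \<in> borel_measurable borel" unfolding g_def by measurable
  have "distr lborel borel ((*) u) = distr (distr lborel borel of_plane) borel (to_complex \<circ> g)"
    by (subst distr_distr) (auto simp: g_def o_def)
  also have "\<dots> = distr (distr lborel borel g) borel to_complex"
    by (simp add: distr_of_plane distr_distr)
  also have "\<dots> = distr (distr lborel borel of_plane) borel to_complex"
    by (simp add: distr_isometry_plane[OF lin iso] distr_of_plane)
  also have "\<dots> = lborel"
    by (subst distr_distr) (auto simp: o_def distr_id2)
  finally show ?thesis .
qed

thm_deps distr_rotation

lemma distr_minus_complex: "distr lborel borel (\<lambda>w. z - w) = (lborel :: complex measure)"
  using lborel_affine[of "-1" z] by (simp add: density_1)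

lemma nn_integral_inverse_sqrt:
  assumes "0 \<le> \<delta>"
  shows "(\<integral>\<^sup>+s. ennreal (indicator {..<\<delta>\<^sup>2} s / sqrt s) * indicator {0..} s \<partial>lborel) = ennreal (2 * \<delta>)"
proof -
  have "((\<lambda>x. x powr (-1/2)) has_integral (2 * \<delta>)) {0..\<delta>\<^sup>2}"
    using has_integral_powr_from_0[of "-1/2" "\<delta>\<^sup>2"] assms by (simp add: powr_half_sqrt mult.commute)
  then have "((\<lambda>x. if x \<in> {0..\<delta>\<^sup>2} then x powr (-1/2) else 0) has_integral (2 * \<delta>)) UNIV"
    by (subst has_integral_restrict_UNIV)
  also have "(\<lambda>x. if x \<in> {0..\<delta>\<^sup>2} then x powr (-1/2) else 0) = (\<lambda>x. indicator {0..\<delta>\<^sup>2} x *\<^sub>R x powr (-1/2))"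
    by auto
  finally have "((\<lambda>x. indicator {0..\<delta>\<^sup>2} x *\<^sub>R x powr (-1/2)) has_integral (2 * \<delta>)) UNIV" .
  then have "integral\<^sup>N lborel (\<lambda>x. ennreal (indicator {0..\<delta>\<^sup>2} x *\<^sub>R x powr (-1/2))) = ennreal (2 * \<delta>)"
    by (intro nn_integral_has_integral_lborel) auto
  also have "integral\<^sup>N lborel (\<lambda>x. ennreal (indicator {0..\<delta>\<^sup>2} x *\<^sub>R x powr (-1/2)))
     = (\<integral>\<^sup>+s. ennreal (indicator {..<\<delta>\<^sup>2} s / sqrt s) * indicator {0..} s \<partial>lborel)"
  proof (rule nn_integral_cong_AE)
    have "AE x in lborel. x \<noteq> \<delta>\<^sup>2 \<and> x \<noteq> (0::real)" by (intro AE_conjI AE_lborel_singleton)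
    then show "AE x in lborel. ennreal (indicator {0..\<delta>\<^sup>2} x *\<^sub>R x powr (-1/2))
       = ennreal (indicator {..<\<delta>\<^sup>2} x / sqrt x) * indicator {0..} x"
      by eventually_elim
        (auto split: split_indicator simp: powr_minus powr_half_sqrt inverse_eq_divide)
  qed
  finally show ?thesis .
qed

text \<open>The singularity 1/|z - w| is integrable in the plane, and its mass on a disc about the
  pole is linear in the radius. The estimates of singular kernels below rest on this value.\<close>

lemma nn_integral_inverse_dist:
  assumes "0 \<le> \<delta>"
  shows "(\<integral>\<^sup>+w. ennreal (indicator (ball z \<delta>) w / cmod (z - w)) \<partial>lborel) = ennreal (2 * pi * \<delta>)"
proof -
  have "(\<integral>\<^sup>+w. ennreal (indicator (ball z \<delta>) w / cmod (z - w)) \<partial>lborel)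
     = (\<integral>\<^sup>+w. ennreal (indicator {..<\<delta>\<^sup>2} ((cmod (z - w))\<^sup>2) / sqrt ((cmod (z - w))\<^sup>2)) \<partial>lborel)"
    using assms
    by (intro nn_integral_cong)
       (auto split: split_indicator simp: dist_norm power_strict_mono dest: power_less_imp_less_base)
  also have "\<dots> = (\<integral>\<^sup>+w. ennreal (indicator {..<\<delta>\<^sup>2} ((cmod w)\<^sup>2) / sqrt ((cmod w)\<^sup>2)) \<partial>distr lborel borel (\<lambda>w. z - w))"
    by (rule nn_integral_distr[symmetric]) auto
  also have "\<dots> = (\<integral>\<^sup>+w. ennreal (indicator {..<\<delta>\<^sup>2} ((cmod w)\<^sup>2) / sqrt ((cmod w)\<^sup>2)) \<partial>lborel)"
    by (simp add: distr_minus_complex)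
  also have "\<dots> = ennreal pi * (\<integral>\<^sup>+s. ennreal (indicator {..<\<delta>\<^sup>2} s / sqrt s) * indicator {0..} s \<partial>lborel)"
    by (rule nn_integral_cmod_square[where g="\<lambda>s. ennreal (indicator {..<\<delta>\<^sup>2} s / sqrt s)"]) measurable
  also have "\<dots> = ennreal (2 * pi * \<delta>)"
    unfolding nn_integral_inverse_sqrt[OF assms] by (simp add: ennreal_mult'[symmetric] assms mult_ac)
  finally show ?thesis .
qed

lemma inverse_dist_measurable [measurable]:
  "(\<lambda>w. indicator (ball z \<delta>) w / cmod (z - w)) \<in> borel_measurable borel"
proof -
  have [measurable]: "ball z \<delta> \<in> sets borel" by simp
  show ?thesis by measurable
qed

lemma
  assumes "0 \<le> \<delta>"
  shows integrable_inverse_dist: "integrable lborel (\<lambda>w. indicator (ball z \<delta>) w / cmod (z - w))"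
    and integral_inverse_dist: "(\<integral>w. indicator (ball z \<delta>) w / cmod (z - w) \<partial>lborel) = 2 * pi * \<delta>"
proof -
  show "integrable lborel (\<lambda>w. indicator (ball z \<delta>) w / cmod (z - w))"
    by (rule integrableI_nonneg) (use nn_integral_inverse_dist[OF assms, of z] in \<open>auto simp: inverse_dist_measurable\<close>)
  show "(\<integral>w. indicator (ball z \<delta>) w / cmod (z - w) \<partial>lborel) = 2 * pi * \<delta>"
    using nn_integral_inverse_dist[OF assms, of z] assms
    by (subst integral_eq_nn_integral) (auto simp del: mem_ball)
qed

section \<open>Cauchy and logarithmic potentials of a planar density\<close>

text \<open>The convolution of \<open>f\<close> with 1/z, hence, up to the factor pi, a solution of
  the inhomogeneous Cauchy-Riemann equation with right-hand side \<open>f\<close>. It is the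
  conjugate of the gradient of \<open>log_pot\<close>.\<close>

definition cauchy_pot :: "(complex \<Rightarrow> real) \<Rightarrow> complex \<Rightarrow> complex" where
  "cauchy_pot f z = (\<integral>w. of_real (f w) / (z - w) \<partial>lborel)"

text \<open>The subtracted \<open>ln (1 + cmod w)\<close> does not depend on \<open>z\<close>, so
  derivatives are unaffected, but it keeps the kernel bounded as \<open>w\<close> tends to infinity.
  No logarithmic moment of \<open>f\<close> is then required.\<close>

definition log_pot :: "(complex \<Rightarrow> real) \<Rightarrow> complex \<Rightarrow> real" where
  "log_pot f z = (\<integral>w. (ln (cmod (z - w)) - ln (1 + cmod w)) * f w \<partial>lborel)"

locale planar_density =
  fixes f :: "complex \<Rightarrow> real"
  assumes cont: "continuous_on UNIV f" and int: "integrable lborel f"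
begin

lemma meas [measurable]: "f \<in> borel_measurable borel"
  using cont by (rule borel_measurable_continuous_onI)

lemma int_abs: "integrable lborel (\<lambda>w. \<bar>f w\<bar>)"
  using int by (rule integrable_abs)

definition L1 :: real where "L1 = (\<integral>w. \<bar>f w\<bar> \<partial>lborel)"

lemma L1_nonneg: "0 \<le> L1" by (simp add: L1_def)

text \<open>Near the pole the density is bounded by \<open>M\<close> and the kernel has mass 2 pi on
  the unit disc; outside, the kernel is at most one and the total mass \<open>L1\<close>
  pays.\<close>

lemma inverse_dist_bound:
  assumes M: "\<And>w. w \<in> ball z 1 \<Longrightarrow> \<bar>f w\<bar> \<le> M"
  shows "integrable lborel (\<lambda>w. \<bar>f w\<bar> / cmod (z - w))" 
    and "(\<integral>w. \<bar>f w\<bar> / cmod (z - w) \<partial>lborel) \<le> 2 * pi * M + L1"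
proof -
  have M0: "0 \<le> M" using M[of z] by force
  define g where "g w = M * (indicator (ball z 1) w / cmod (z - w)) + \<bar>f w\<bar>" for w
  have g: "integrable lborel g"
    unfolding g_def by (intro Bochner_Integration.integrable_add integrable_mult_right integrable_inverse_dist int_abs) simp
  have le: "\<bar>f w\<bar> / cmod (z - w) \<le> g w" for w
  proof (cases "w \<in> ball z 1")
    case True
    then have "\<bar>f w\<bar> / cmod (z - w) \<le> M / cmod (z - w)" by (intro divide_right_mono M) auto
    then show ?thesis using True by (simp add: g_def)
  next
    case False
    then have "\<bar>f w\<bar> / cmod (z - w) \<le> \<bar>f w\<bar> / 1" by (intro divide_left_mono) (auto simp: dist_norm)
    then show ?thesis using False by (simp add: g_def)
  qed
  show i: "integrable lborel (\<lambda>w. \<bar>f w\<bar> / cmod (z - w))"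
    by (rule Bochner_Integration.integrable_bound[OF g]) (use le in \<open>auto intro: order_trans[OF _ abs_ge_self]\<close>)
  have "(\<integral>w. \<bar>f w\<bar> / cmod (z - w) \<partial>lborel) \<le> (\<integral>w. g w \<partial>lborel)"
    by (rule integral_mono[OF i g le])
  also have "\<dots> = 2 * pi * M + L1"
    unfolding g_def L1_def
    using integral_inverse_dist[of 1 z] integrable_inverse_dist[of 1 z]
    by (subst Bochner_Integration.integral_add) (simp_all add: int_abs del: times_divide_eq_right)
  finally show "(\<integral>w. \<bar>f w\<bar> / cmod (z - w) \<partial>lborel) \<le> 2 * pi * M + L1" .
qed

lemma bounded_near_compact:
  assumes "compact S"
  obtains M where "0 \<le> M" "\<And>z w. z \<in> S \<Longrightarrow> w \<in> cball z 1 \<Longrightarrow> \<bar>f w\<bar> \<le> M"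
proof -
  have "compact {x + y |x y. x \<in> S \<and> y \<in> cball 0 1}"
    using assms by (intro compact_sums) auto
  then have "bounded (f ` {x + y |x y. x \<in> S \<and> y \<in> cball 0 1})"
    by (intro compact_imp_bounded compact_continuous_image continuous_on_subset[OF cont]) auto
  then obtain M where M: "\<And>w. w \<in> {x + y |x y. x \<in> S \<and> y \<in> cball 0 1} \<Longrightarrow> \<bar>f w\<bar> \<le> M"
    unfolding bounded_iff by auto
  have "\<bar>f w\<bar> \<le> max M 0" if "z \<in> S" "w \<in> cball z 1" for z w
  proof -
    have "w = z + (w - z)" "w - z \<in> cball 0 1" using that by (auto simp: dist_norm norm_minus_commute)
    then have "w \<in> {x + y |x y. x \<in> S \<and> y \<in> cball 0 1}" using that by blast
    from M[OF this] show ?thesis by simp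
  qed
  then show ?thesis using that[of "max M 0"] by auto
qed

lemma integrable_inverse_dist_density: "integrable lborel (\<lambda>w. \<bar>f w\<bar> / cmod (z - w))"
proof -
  obtain M where "0 \<le> M" "\<And>x w. x \<in> {z} \<Longrightarrow> w \<in> cball x 1 \<Longrightarrow> \<bar>f w\<bar> \<le> M"
    using bounded_near_compact[of "{z}"] by auto
  then show ?thesis by (intro inverse_dist_bound(1)[of z M]) auto
qed

lemma integrable_cauchy: "integrable lborel (\<lambda>w. of_real (f w) / (z - w))"
  by (rule Bochner_Integration.integrable_bound[OF integrable_inverse_dist_density[of z]])
     (auto simp: norm_divide)

lemma norm_cauchy_pot_le: "cmod (cauchy_pot f z) \<le> (\<integral>w. \<bar>f w\<bar> / cmod (z - w) \<partial>lborel)"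
  unfolding cauchy_pot_def
  by (rule order_trans[OF integral_norm_bound]) (simp add: norm_divide)

text \<open>Cutting off the pole gives bounded continuous kernels \<open>K n\<close>, whose
  convolutions \<open>C n\<close> with an integrable function are continuous by dominated
  convergence. The parts cut off are small uniformly on compact sets, because \<open>f\<close> is
  locally bounded.\<close>

lemma cauchy_pot_continuous: "continuous_on UNIV (cauchy_pot f)"
proof -
  \<comment> \<open>Coincides with 1/\<zeta> as soon as |\<zeta>| is at least 1/(n+1), because cnj
    \<zeta> / |\<zeta>|^2 = 1/\<zeta>. Inside that disc it is a real multiple of cnj \<zeta> and
    stays bounded by n+1.\<close>
  define K where "K n \<zeta> = cnj \<zeta> / of_real ((max (cmod \<zeta>) (1 / real (Suc n)))\<^sup>2)" for n \<zeta>
  have Kpos: "0 < max (cmod \<zeta>) (1 / real (Suc n))" for n \<zeta>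
    by (simp add: less_max_iff_disj)
  have K_cont: "continuous_on UNIV (K n)" for n
    unfolding K_def using Kpos[of _ n] by (intro continuous_intros) (auto simp: less_le)
  have [measurable]: "K n \<in> borel_measurable borel" for n
    by (rule borel_measurable_continuous_onI[OF K_cont])
  have K_bound: "cmod (K n \<zeta>) \<le> real (Suc n)" for n \<zeta>
  proof -
    let ?m = "max (cmod \<zeta>) (1 / real (Suc n))"
    have "cmod (K n \<zeta>) = cmod \<zeta> / ?m\<^sup>2" by (simp add: K_def norm_divide norm_power del: of_nat_Suc)
    also have "\<dots> \<le> ?m / ?m\<^sup>2" by (intro divide_right_mono) auto
    also have "\<dots> = 1 / ?m" using Kpos[of \<zeta> n] by (simp add: power2_eq_square)
    also have "\<dots> \<le> 1 / (1 / real (Suc n))" using Kpos[of \<zeta> n] by (intro divide_left_mono) auto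
    finally show ?thesis by simp
  qed
  have K_diff: "cmod (1 / \<zeta> - K n \<zeta>) \<le> indicator (ball 0 (1 / real (Suc n))) \<zeta> / cmod \<zeta>" for n \<zeta>
  proof (cases "cmod \<zeta> < 1 / real (Suc n)")
    case False
    then have "K n \<zeta> = cnj \<zeta> / of_real ((cmod \<zeta>)\<^sup>2)" by (simp add: K_def max_def)
    also have "\<dots> = 1 / \<zeta>" by (cases "\<zeta> = 0") (simp_all add: complex_norm_square del: of_real_power)
    finally show ?thesis using False by simp
  next
    case True
    show ?thesis
    proof (cases "\<zeta> = 0")
      case True then show ?thesis by (simp add: K_def)
    next
      case False
      let ?m = "1 / real (Suc n)"
      have "K n \<zeta> = cnj \<zeta> / of_real (?m\<^sup>2)" using True by (simp add: K_def max_def)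
      also have "\<dots> = of_real ((cmod \<zeta>)\<^sup>2 / ?m\<^sup>2) / \<zeta>"
        using False complex_norm_square[of \<zeta>] by (simp add: field_simps del: of_nat_Suc)
      finally have "1 / \<zeta> - K n \<zeta> = of_real (1 - (cmod \<zeta>)\<^sup>2 / ?m\<^sup>2) / \<zeta>"
        by (simp add: diff_divide_distrib)
      then have "cmod (1 / \<zeta> - K n \<zeta>) = \<bar>1 - (cmod \<zeta>)\<^sup>2 / ?m\<^sup>2\<bar> / cmod \<zeta>"
        by (simp only: norm_divide norm_of_real)
      also have "\<dots> \<le> 1 / cmod \<zeta>"
      proof -
        have "(cmod \<zeta>)\<^sup>2 \<le> ?m\<^sup>2" using True by (intro power_mono) auto
        then have "(cmod \<zeta>)\<^sup>2 / ?m\<^sup>2 \<le> 1" by (simp add: divide_le_eq)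
        moreover have "0 \<le> (cmod \<zeta>)\<^sup>2 / ?m\<^sup>2" by simp
        ultimately show ?thesis by (intro divide_right_mono) (auto simp: abs_le_iff)
      qed
      finally show ?thesis using True by simp
    qed
  qed
  define C where "C n z = (\<integral>w. of_real (f w) * K n (z - w) \<partial>lborel)" for n z
  have C_int: "integrable lborel (\<lambda>w. of_real (f w) * K n (z - w))" for n z
    by (rule Bochner_Integration.integrable_bound[OF integrable_mult_left[OF int, of "real (Suc n)"]])
       (use K_bound in \<open>auto simp: norm_mult abs_mult intro!: mult_left_mono simp del: of_nat_Suc\<close>)
  have C_cont: "continuous_on UNIV (C n)" for n
    unfolding continuous_on_eq_continuous_at[OF open_UNIV] continuous_at_sequentially
  proof (intro ballI allI impI)
    fix z and x :: "nat \<Rightarrow> complex" assume x: "x \<longlonglongrightarrow> z"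
    show "(C n \<circ> x) \<longlonglongrightarrow> C n z"
      unfolding C_def o_def
    proof (rule integral_dominated_convergence[where w="\<lambda>w. \<bar>f w\<bar> * real (Suc n)"])
      show "AE w in lborel. (\<lambda>i. of_real (f w) * K n (x i - w)) \<longlonglongrightarrow> of_real (f w) * K n (z - w)"
        using K_cont[of n] x
        by (intro AE_I2 tendsto_intros isCont_tendsto_compose[where g="K n"]) (auto simp: continuous_on_eq_continuous_at)
      show "integrable lborel (\<lambda>w. \<bar>f w\<bar> * real (Suc n))" by (intro integrable_mult_left int_abs)
    qed (use K_bound in \<open>auto simp: norm_mult intro!: mult_left_mono simp del: of_nat_Suc\<close>)
  qed
  have diff: "cmod (C n z - cauchy_pot f z) \<le> M * (2 * pi / real (Suc n))"
    if M: "\<And>w. w \<in> cball z 1 \<Longrightarrow> \<bar>f w\<bar> \<le> M" for n z M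
  proof -
    let ?\<delta> = "1 / real (Suc n)"
    have ptw: "cmod (of_real (f w) * K n (z - w) - of_real (f w) / (z - w)) \<le> M * (indicator (ball z ?\<delta>) w / cmod (z - w))" for w
    proof -
      have "cmod (of_real (f w) * K n (z - w) - of_real (f w) / (z - w)) = \<bar>f w\<bar> * cmod (1 / (z - w) - K n (z - w))"
        unfolding norm_of_real[of "f w", where ?'a=complex, symmetric] norm_mult[symmetric]
        by (simp add: norm_minus_commute right_diff_distrib)
      also have "\<dots> \<le> \<bar>f w\<bar> * (indicator (ball 0 ?\<delta>) (z - w) / cmod (z - w))"
        by (intro mult_left_mono K_diff) auto
      also have "\<dots> = \<bar>f w\<bar> * (indicator (ball z ?\<delta>) w / cmod (z - w))"
        by (auto split: split_indicator simp: dist_norm norm_minus_commute)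
      also have "\<dots> \<le> M * (indicator (ball z ?\<delta>) w / cmod (z - w))"
      proof (cases "w \<in> ball z ?\<delta>")
        case True
        have "?\<delta> \<le> 1" by simp
        then have "w \<in> cball z 1" using True unfolding mem_ball mem_cball by linarith
        then show ?thesis by (intro mult_right_mono M) auto
      qed auto
      finally show ?thesis .
    qed
    have "C n z - cauchy_pot f z = (\<integral>w. of_real (f w) * K n (z - w) - of_real (f w) / (z - w) \<partial>lborel)"
      unfolding C_def cauchy_pot_def by (rule Bochner_Integration.integral_diff[symmetric, OF C_int integrable_cauchy])
    also have "cmod \<dots> \<le> (\<integral>w. M * (indicator (ball z ?\<delta>) w / cmod (z - w)) \<partial>lborel)"
      using ptw
      by (intro Bochner_Integration.integral_norm_bound_integral integrable_mult_right integrable_inverse_dist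
           Bochner_Integration.integrable_diff C_int integrable_cauchy) auto
    also have "\<dots> = M * (2 * pi / real (Suc n))"
      using integral_inverse_dist[of ?\<delta> z] by (simp del: of_nat_Suc times_divide_eq_right) simp
    finally show ?thesis .
  qed
  have "isCont (cauchy_pot f) z" for z
  proof -
    obtain M where M: "0 \<le> M" "\<And>x w. x \<in> cball z 1 \<Longrightarrow> w \<in> cball x 1 \<Longrightarrow> \<bar>f w\<bar> \<le> M"
      using bounded_near_compact[of "cball z 1"] by auto
    have "uniform_limit (cball z 1) C (cauchy_pot f) sequentially"
    proof (rule uniform_limitI)
      fix e :: real assume "0 < e"
      have "(\<lambda>n. M * (2 * pi / real (Suc n))) \<longlonglongrightarrow> M * 0"
        by (intro tendsto_mult tendsto_const) (rule LIMSEQ_Suc[OF lim_const_over_n])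
      then have "\<forall>\<^sub>F n in sequentially. M * (2 * pi / real (Suc n)) < e"
        using \<open>0 < e\<close> by (auto intro: order_tendstoD)
      then show "\<forall>\<^sub>F n in sequentially. \<forall>x\<in>cball z 1. dist (C n x) (cauchy_pot f x) < e"
      proof eventually_elim
        case (elim n)
        then show ?case using diff[of _ M n] M(2) by (auto simp: dist_norm intro: le_less_trans simp del: mem_cball)
      qed
    qed
    then have "continuous_on (cball z 1) (cauchy_pot f)"
      by (rule uniform_limit_theorem[rotated]) (auto intro!: always_eventually continuous_on_subset[OF C_cont])
    then show ?thesis by (rule continuous_on_interior) auto
  qed
  then show ?thesis by (simp add: continuous_on_eq_continuous_at)
qed

end

text \<open>The contour integral of 1/(z - w) along a segment, written as a Lebesgue integral over
  the parameter: in this form it is measurable in \<open>w\<close> everywhere, also where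
  \<open>w\<close> lies on the segment, and Fubini applies to it.\<close>

definition segment_kernel :: "complex \<Rightarrow> complex \<Rightarrow> complex \<Rightarrow> complex" where
  "segment_kernel a b w = (\<integral>t. indicator {0..1::real} t *\<^sub>R (1 / (linepath a b t - w) * (b - a)) \<partial>lborel)"

lemma linepath_measurable [measurable]: "linepath a b \<in> borel_measurable borel" for a b :: complex
  unfolding linepath_def by measurable

lemma segment_kernel_measurable [measurable]: "segment_kernel a b \<in> borel_measurable borel"
  unfolding segment_kernel_def by measurable

text \<open>The segment lies in a line, namely a level set of the inner product with the normal
  \<open>\<i> * (b - a)\<close>.\<close>

lemma AE_not_closed_segment: "AE w in lborel. w \<notin> closed_segment a (b::complex)"
proof (cases "a = b")
  case True
  then show ?thesis by (simp add: AE_lborel_singleton)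
next
  case False
  define n where "n = \<i> * (b - a)"
  have n: "n \<noteq> 0" using False by (simp add: n_def)
  have "n \<bullet> ((1 - u) *\<^sub>R a + u *\<^sub>R b) = n \<bullet> a" for u
  proof -
    have "(1 - u) *\<^sub>R a + u *\<^sub>R b = a + u *\<^sub>R (b - a)" by (simp add: algebra_simps)
    moreover have "n \<bullet> (b - a) = 0" unfolding n_def inner_complex_def by (simp add: algebra_simps)
    ultimately show ?thesis by (simp add: inner_add_right)
  qed
  then have "closed_segment a b \<subseteq> {x. n \<bullet> x = n \<bullet> a}"
    by (auto simp: closed_segment_def)
  then have "negligible (closed_segment a b)"
    using negligible_hyperplane[of n "n \<bullet> a"] n negligible_subset by blast
  then have "closed_segment a b \<in> null_sets lborel"
    by (simp add: negligible_iff_null_sets null_sets_completion_iff borel_closed)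
  then show ?thesis by (rule AE_not_in)
qed

lemma contour_integral_linepath_lborel:
  assumes "continuous_on (closed_segment a b) g"
  shows "integrable lborel (\<lambda>t. indicator {0..1} t *\<^sub>R (g (linepath a b t) * (b - a)))"
    and "(\<integral>t. indicator {0..1} t *\<^sub>R (g (linepath a b t) * (b - a)) \<partial>lborel) = contour_integral (linepath a b) g"
proof -
  have c: "continuous_on {0..1} (\<lambda>t. g (linepath a b t) * (b - a))"
    by (intro continuous_intros continuous_on_compose2[OF assms]) (auto simp: linepath_in_path)
  show i: "integrable lborel (\<lambda>t. indicator {0..1} t *\<^sub>R (g (linepath a b t) * (b - a)))"
    using borel_integrable_compact[OF _ c] by (simp add: if_distrib[where f="\<lambda>x. x *\<^sub>R _"] indicator_scaleR_eq_if)
  have "(LINT t:{0..1}|lborel. g (linepath a b t) * (b - a)) = integral {0..1} (\<lambda>t. g (linepath a b t) * (b - a))"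
    by (rule set_borel_integral_eq_integral) (use i in \<open>simp add: set_integrable_def\<close>)
  then show "(\<integral>t. indicator {0..1} t *\<^sub>R (g (linepath a b t) * (b - a)) \<partial>lborel) = contour_integral (linepath a b) g"
    unfolding set_lebesgue_integral_def contour_integral_integral vector_derivative_linepath_at .
qed

text \<open>The exponential of the contour integral is the quotient of the differences at the end
  points. Taking moduli removes the imaginary part, so no branch of the logarithm has to be
  chosen.\<close>

lemma Re_contour_integral_inverse:
  assumes "w \<notin> closed_segment a b"
  shows "Re (contour_integral (linepath a b) (\<lambda>z. 1 / (z - w))) = ln (cmod (b - w)) - ln (cmod (a - w))"
proof -
  have "exp (- (integral {0..1} (\<lambda>x. vector_derivative (linepath a b) (at x) / (linepath a b x - w)))) * (linepath a b 1 - w) = linepath a b 0 - w"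
    by (rule winding_number_exp_integral(2)) (use assms in \<open>auto simp: linepath_image_01 intro: linear_imp_differentiable[THEN differentiable_imp_piecewise_differentiable] valid_path_linepath[unfolded valid_path_def]\<close>)
  also have "integral {0..1} (\<lambda>x. vector_derivative (linepath a b) (at x) / (linepath a b x - w)) = contour_integral (linepath a b) (\<lambda>z. 1 / (z - w))"
    by (simp add: contour_integral_integral)
  finally have *: "exp (- contour_integral (linepath a b) (\<lambda>z. 1 / (z - w))) * (b - w) = a - w"
    by (simp add: linepath_def)
  have "a \<noteq> w" "b \<noteq> w" using assms by auto
  moreover have "exp (- Re (contour_integral (linepath a b) (\<lambda>z. 1 / (z - w)))) * cmod (b - w) = cmod (a - w)"
    using arg_cong[OF *, of cmod] by (simp add: norm_mult)
  ultimately have "ln (exp (- Re (contour_integral (linepath a b) (\<lambda>z. 1 / (z - w)))) * cmod (b - w)) = ln (cmod (a - w))"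
    by simp
  then show ?thesis using \<open>b \<noteq> w\<close> by (simp add: ln_mult_pos)
qed

lemma segment_kernel_eq:
  assumes "w \<notin> closed_segment a b"
  shows "segment_kernel a b w = contour_integral (linepath a b) (\<lambda>z. 1 / (z - w))"
proof -
  have c: "continuous_on (closed_segment a b) (\<lambda>z. 1 / (z - w))"
    using assms by (intro continuous_intros) auto
  show ?thesis using contour_integral_linepath_lborel(2)[OF c] by (simp add: segment_kernel_def)
qed

lemma log_kernel_le: "w \<noteq> z \<Longrightarrow> ln (cmod (z - w)) - ln (1 + cmod w) \<le> ln (1 + cmod z)"
proof -
  assume "w \<noteq> z"
  have "cmod (z - w) \<le> cmod z + cmod w" by (rule norm_triangle_ineq4)
  also have "\<dots> \<le> (1 + cmod z) * (1 + cmod w)" by (simp add: algebra_simps)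
  finally have "ln (cmod (z - w)) \<le> ln ((1 + cmod z) * (1 + cmod w))"
    using \<open>w \<noteq> z\<close> by (intro ln_mono) (auto intro!: mult_pos_pos add_pos_nonneg)
  also have "\<dots> = ln (1 + cmod z) + ln (1 + cmod w)" by (rule ln_mult_pos) (auto simp: add_pos_nonneg)
  finally show ?thesis by simp
qed

text \<open>The singularity sits in this lower bound only; \<open>log_kernel_le\<close> has none.
  The asymmetry pays off for densities of variable sign: only their positive part meets the singular
  term.\<close>

lemma log_kernel_ge: 
  assumes "w \<noteq> z" 
  shows "- ln (1 + cmod z) - ln (1 + 1 / cmod (z - w)) \<le> ln (cmod (z - w)) - ln (1 + cmod w)"
proof -
  have *: "0 < cmod (z - w)" using assms by simp
  have "cmod w \<le> cmod z + cmod (z - w)" by (metis norm_minus_commute norm_triangle_sub add.commute)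
  then have "1 + cmod w \<le> (1 + cmod z) * (1 + cmod (z - w))"
    using mult_nonneg_nonneg[OF norm_ge_zero[of z] norm_ge_zero[of "z - w"]] unfolding distrib_right distrib_left by linarith
  also have "\<dots> = (1 + cmod z) * ((1 + 1 / cmod (z - w)) * cmod (z - w))"
    using * by (simp add: field_simps)
  finally have "ln (1 + cmod w) \<le> ln ((1 + cmod z) * ((1 + 1 / cmod (z - w)) * cmod (z - w)))"
    using * by (intro ln_mono) (auto intro!: mult_pos_pos add_pos_nonneg)
  also have "\<dots> = ln (1 + cmod z) + (ln (1 + 1 / cmod (z - w)) + ln (cmod (z - w)))"
    using * by (subst ln_mult_pos, (auto intro!: mult_pos_pos add_pos_nonneg)[2], subst ln_mult_pos) (auto intro!: add_pos_nonneg)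
  finally show ?thesis by simp
qed

lemma abs_log_kernel_le:
  assumes "w \<noteq> z"
  shows "\<bar>ln (cmod (z - w)) - ln (1 + cmod w)\<bar> \<le> ln (1 + cmod z) + 1 / cmod (z - w)"
proof -
  have "0 < cmod (z - w)" using assms by simp
  then have "ln (1 + 1 / cmod (z - w)) \<le> 1 / cmod (z - w)" by (intro ln_add_one_self_le_self) auto
  moreover have "0 \<le> 1 / cmod (z - w)" by simp
  ultimately show ?thesis using log_kernel_le[OF assms] log_kernel_ge[OF assms]
    by (intro abs_leI) linarith+
qed

context planar_density begin

lemma integrable_log_kernel: "integrable lborel (\<lambda>w. (ln (cmod (z - w)) - ln (1 + cmod w)) * f w)"
proof (rule Bochner_Integration.integrable_bound)
  show "integrable lborel (\<lambda>w. ln (1 + cmod z) * \<bar>f w\<bar> + \<bar>f w\<bar> / cmod (z - w))"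
    by (intro Bochner_Integration.integrable_add integrable_mult_right int_abs integrable_inverse_dist_density)
  have "AE w in lborel. w \<noteq> z" by (rule AE_lborel_singleton)
  then show "AE w in lborel. norm ((ln (cmod (z - w)) - ln (1 + cmod w)) * f w)
      \<le> norm (ln (1 + cmod z) * \<bar>f w\<bar> + \<bar>f w\<bar> / cmod (z - w))"
  proof eventually_elim
    case (elim w)
    have "norm ((ln (cmod (z - w)) - ln (1 + cmod w)) * f w) \<le> (ln (1 + cmod z) + 1 / cmod (z - w)) * \<bar>f w\<bar>"
      using abs_log_kernel_le[OF elim] by (auto simp: abs_mult intro!: mult_right_mono)
    also have "\<dots> = ln (1 + cmod z) * \<bar>f w\<bar> + \<bar>f w\<bar> / cmod (z - w)" by (simp add: algebra_simps)
    finally show ?case by (rule order_trans) simp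
  qed
qed measurable

text \<open>Fubini on the product of the parameter interval and the plane. The inner absolute
  integrals are bounded along the whole segment by \<open>inverse_dist_bound\<close>, which makes
  the double integral absolutely convergent.\<close>

lemma cauchy_pot_linepath:
  shows "integrable lborel (\<lambda>w. of_real (f w) * segment_kernel a b w)"
    and "contour_integral (linepath a b) (cauchy_pot f) =
           (\<integral>w. of_real (f w) * segment_kernel a b w \<partial>lborel)"
proof -
  define h where "h t w = indicator {0..1::real} t *\<^sub>R (of_real (f w) / (linepath a b t - w) * (b - a))" for t w
  have h_meas [measurable]: "case_prod h \<in> borel_measurable (lborel \<Otimes>\<^sub>M lborel)"
    unfolding h_def by measurable
  obtain M where M: "0 \<le> M" "\<And>z w. z \<in> closed_segment a b \<Longrightarrow> w \<in> cball z 1 \<Longrightarrow> \<bar>f w\<bar> \<le> M"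
    using bounded_near_compact[OF compact_segment[of a b]] by blast
  have int_h: "integrable lborel (h t)" for t
    unfolding h_def by (intro integrable_scaleR_right integrable_mult_left integrable_cauchy)
  have int2: "integrable (lborel \<Otimes>\<^sub>M lborel) (case_prod h)"
  proof (rule lborel_pair.Fubini_integrable)
    show "integrable lborel (\<lambda>t. \<integral>w. norm (case_prod h (t, w)) \<partial>lborel)"
    proof (rule Bochner_Integration.integrable_bound)
      show "integrable lborel (\<lambda>t. indicator {0..1::real} t * ((2 * pi * M + L1) * cmod (b - a)))"
        by (intro integrable_mult_left integrable_real_indicator) auto
      show "AE t in lborel. norm (\<integral>w. norm (case_prod h (t, w)) \<partial>lborel)
          \<le> norm (indicator {0..1} t * ((2 * pi * M + L1) * cmod (b - a)))"
      proof (rule AE_I2)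
        fix t :: real
        have "(\<integral>w. norm (h t w) \<partial>lborel) = (\<integral>w. (indicator {0..1} t * cmod (b - a)) * (\<bar>f w\<bar> / cmod (linepath a b t - w)) \<partial>lborel)"
          by (rule Bochner_Integration.integral_cong) (auto simp: h_def norm_mult norm_divide)
        also have "\<dots> = indicator {0..1} t * (cmod (b - a) * (\<integral>w. \<bar>f w\<bar> / cmod (linepath a b t - w) \<partial>lborel))"
          by (simp only: integral_mult_right_zero mult.assoc)
        also have "\<dots> \<le> indicator {0..1} t * (cmod (b - a) * (2 * pi * M + L1))"
        proof (cases "t \<in> {0..1}")
          case True
          then have "linepath a b t \<in> closed_segment a b" by (auto simp: linepath_in_path)
          then show ?thesis using M(2) by (intro mult_left_mono inverse_dist_bound(2)) auto
        qed auto
        finally show "norm (\<integral>w. norm (case_prod h (t, w)) \<partial>lborel)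
          \<le> norm (indicator {0..1} t * ((2 * pi * M + L1) * cmod (b - a)))"
          using M(1) L1_nonneg by (simp add: mult_ac abs_mult)
      qed
    qed measurable
    show "AE t in lborel. integrable lborel (\<lambda>w. case_prod h (t, w))"
      by (simp add: int_h)
  qed measurable
  have eq1: "(\<integral>t. h t w \<partial>lborel) = of_real (f w) * segment_kernel a b w" for w
  proof -
    have "(\<integral>t. h t w \<partial>lborel) = (\<integral>t. of_real (f w) * (indicator {0..1} t *\<^sub>R (1 / (linepath a b t - w) * (b - a))) \<partial>lborel)"
      by (rule Bochner_Integration.integral_cong) (auto simp: h_def)
    then show ?thesis
      by (simp only: integral_mult_right_zero segment_kernel_def)
  qed
  show "integrable lborel (\<lambda>w. of_real (f w) * segment_kernel a b w)"
    using lborel_pair.integrable_snd[OF int2] by (simp add: eq1)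
  have "contour_integral (linepath a b) (cauchy_pot f) = (\<integral>t. indicator {0..1} t *\<^sub>R (cauchy_pot f (linepath a b t) * (b - a)) \<partial>lborel)"
    using contour_integral_linepath_lborel(2)[OF continuous_on_subset[OF cauchy_pot_continuous]] by simp
  also have "\<dots> = (\<integral>t. (\<integral>w. h t w \<partial>lborel) \<partial>lborel)"
    unfolding h_def cauchy_pot_def by (simp only: integral_scaleR_right integral_mult_left_zero)
  also have "\<dots> = (\<integral>w. (\<integral>t. h t w \<partial>lborel) \<partial>lborel)"
    by (rule lborel_pair.Fubini_integral[OF int2, symmetric])
  finally show "contour_integral (linepath a b) (cauchy_pot f) =
           (\<integral>w. of_real (f w) * segment_kernel a b w \<partial>lborel)" by (simp add: eq1)
qed


lemma log_pot_diff:
  "log_pot f b - log_pot f a = Re (contour_integral (linepath a b) (cauchy_pot f))"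
proof -
  have "log_pot f b - log_pot f a = (\<integral>w. (ln (cmod (b - w)) - ln (1 + cmod w)) * f w - (ln (cmod (a - w)) - ln (1 + cmod w)) * f w \<partial>lborel)"
    unfolding log_pot_def by (rule Bochner_Integration.integral_diff[symmetric]) (rule integrable_log_kernel)+
  also have "\<dots> = (\<integral>w. Re (of_real (f w) * segment_kernel a b w) \<partial>lborel)"
  proof (rule integral_cong_AE)
    show "AE w in lborel. (ln (cmod (b - w)) - ln (1 + cmod w)) * f w - (ln (cmod (a - w)) - ln (1 + cmod w)) * f w
       = Re (of_real (f w) * segment_kernel a b w)"
      using AE_not_closed_segment[of a b]
      by eventually_elim (simp add: segment_kernel_eq Re_contour_integral_inverse algebra_simps)
  qed measurable
  also have "\<dots> = Re (\<integral>w. of_real (f w) * segment_kernel a b w \<partial>lborel)"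
    by (rule integral_Re[OF cauchy_pot_linepath(1)])
  finally show ?thesis by (simp add: cauchy_pot_linepath(2))
qed

text \<open>By \<open>log_pot_diff\<close> the increment is the real part of a contour integral of
  the continuous function \<open>cauchy_pot f\<close>. The derivative is read off from this
  increment, and no singular integral has to be differentiated.\<close>

lemma log_pot_has_derivative:
  "(log_pot f has_derivative (\<lambda>h. Re (cauchy_pot f z * h))) (at z)"
  unfolding has_derivative_at_alt
proof (intro conjI allI impI)
  show "bounded_linear (\<lambda>h. Re (cauchy_pot f z * h))"
    by (intro bounded_linear_compose[OF bounded_linear_Re] bounded_linear_mult_right)
  fix e :: real assume "0 < e"
  then obtain d where d: "0 < d" "\<And>x. cmod (x - z) < d \<Longrightarrow> cmod (cauchy_pot f x - cauchy_pot f z) < e"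
    using cauchy_pot_continuous by (force simp: continuous_on_iff dist_norm)
  show "\<exists>d>0. \<forall>y. norm (y - z) < d \<longrightarrow> norm (log_pot f y - log_pot f z - Re (cauchy_pot f z * (y - z))) \<le> e * norm (y - z)"
  proof (intro exI conjI allI impI)
    fix y assume y: "norm (y - z) < d"
    let ?C = "cauchy_pot f" and ?L = "linepath z y"
    have ci: "?C contour_integrable_on ?L"
      by (intro contour_integrable_continuous_linepath continuous_on_subset[OF cauchy_pot_continuous]) auto
    have "log_pot f y - log_pot f z - Re (?C z * (y - z)) = Re (contour_integral ?L ?C - contour_integral ?L (\<lambda>_. ?C z))"
      by (simp add: log_pot_diff)
    also have "contour_integral ?L ?C - contour_integral ?L (\<lambda>_. ?C z) = contour_integral ?L (\<lambda>x. ?C x - ?C z)"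
      by (rule contour_integral_diff[symmetric, OF ci]) simp
    also have "\<bar>Re \<dots>\<bar> \<le> cmod \<dots>" by (rule abs_Re_le_cmod)
    also have "\<dots> \<le> e * norm (y - z)"
    proof (rule contour_integral_bound_linepath)
      show "(\<lambda>x. ?C x - ?C z) contour_integrable_on ?L"
        by (intro contour_integrable_diff ci) simp
      show "cmod (?C x - ?C z) \<le> e" if "x \<in> closed_segment z y" for x
        using d(2)[of x] segment_bound1[OF that] y by (auto intro: less_imp_le)
    qed (use \<open>0 < e\<close> in simp)
    finally show "norm (log_pot f y - log_pot f z - Re (?C z * (y - z))) \<le> e * norm (y - z)" by simp
  qed (rule d)
qed

lemma contour_integral_rectpath_join:
  assumes "continuous_on (path_image (rectpath a c)) g"
  shows "contour_integral (rectpath a c) g =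
     contour_integral (linepath a (Complex (Re c) (Im a))) g + contour_integral (linepath (Complex (Re c) (Im a)) c) g
   + contour_integral (linepath c (Complex (Re a) (Im c))) g + contour_integral (linepath (Complex (Re a) (Im c)) a) g"
proof -
  have c: "continuous_on (closed_segment a (Complex (Re c) (Im a))) g" "continuous_on (closed_segment (Complex (Re c) (Im a)) c) g"
     "continuous_on (closed_segment c (Complex (Re a) (Im c))) g" "continuous_on (closed_segment (Complex (Re a) (Im c)) a) g"
    using assms by (auto simp: rectpath_def Let_def path_image_join intro: continuous_on_subset)
  then show ?thesis
    unfolding rectpath_def Let_def
    by (subst contour_integral_join contour_integrable_join valid_path_join;
        (simp add: contour_integrable_continuous_linepath contour_integrable_join valid_path_join)?)+
qed

text \<open>Exchanging the integrals leaves the winding number of the rectangle about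
  \<open>w\<close>. This is the integrated form of the Cauchy-Riemann equation with source pi times
  \<open>f\<close>; it involves no derivative of the potential, which a merely continuous
  \<open>f\<close> might not provide.\<close>

lemma cauchy_pot_rectpath:
  assumes "Re a < Re c" "Im a < Im c"
  shows "contour_integral (rectpath a c) (cauchy_pot f) = 2 * pi * \<i> * of_real (\<integral>w. indicator (box a c) w * f w \<partial>lborel)"
proof -
  let ?p = "Complex (Re c) (Im a)" and ?q = "Complex (Re a) (Im c)"
  let ?S = "\<lambda>w. segment_kernel a ?p w + segment_kernel ?p c w + segment_kernel c ?q w + segment_kernel ?q a w"
  note i = cauchy_pot_linepath(1)
  have "contour_integral (rectpath a c) (cauchy_pot f) =
     (\<integral>w. of_real (f w) * segment_kernel a ?p w \<partial>lborel) + (\<integral>w. of_real (f w) * segment_kernel ?p c w \<partial>lborel)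
   + (\<integral>w. of_real (f w) * segment_kernel c ?q w \<partial>lborel) + (\<integral>w. of_real (f w) * segment_kernel ?q a w \<partial>lborel)"
    by (subst contour_integral_rectpath_join)
       (auto simp: cauchy_pot_linepath(2) intro: continuous_on_subset[OF cauchy_pot_continuous])
  also have "\<dots> = (\<integral>w. of_real (f w) * ?S w \<partial>lborel)"
    unfolding distrib_left by (simp only: Bochner_Integration.integral_add Bochner_Integration.integrable_add i)
  also have "\<dots> = (\<integral>w. (2 * pi * \<i>) * of_real (indicator (box a c) w * f w) \<partial>lborel)"
  proof (rule integral_cong_AE)
    \<comment> \<open>Points on the boundary, where the winding number has no meaning, form a null
      set.\<close>
    have "negligible (cbox a c - box a c)" by (rule negligible_frontier_interval)
    then have "cbox a c - box a c \<in> null_sets lborel"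
      by (simp add: negligible_iff_null_sets null_sets_completion_iff)
    then have "AE w in lborel. w \<notin> cbox a c - box a c" by (rule AE_not_in)
    then show "AE w in lborel. of_real (f w) * ?S w = (2 * pi * \<i>) * of_real (indicator (box a c) w * f w)"
      using AE_not_closed_segment[of a ?p] AE_not_closed_segment[of ?p c] AE_not_closed_segment[of c ?q] AE_not_closed_segment[of ?q a]
    proof eventually_elim
      case (elim w)
      then have w: "w \<notin> path_image (rectpath a c)"
        by (simp add: rectpath_def Let_def path_image_join)
      have "?S w = contour_integral (rectpath a c) (\<lambda>z. 1 / (z - w))"
        using elim by (subst contour_integral_rectpath_join) (use w in \<open>auto intro!: continuous_intros simp: segment_kernel_eq\<close>)
      also have "\<dots> = 2 * pi * \<i> * winding_number (rectpath a c) w"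
        using winding_number_valid_path[OF valid_path_rectpath w] by simp
      also have "winding_number (rectpath a c) w = indicator (box a c) w"
        using winding_number_rectpath[of w a c] winding_number_rectpath_outside[of a c w] assms elim(1)
        by (auto split: split_indicator)
      finally show ?case by (auto split: split_indicator)
    qed
  qed measurable
  also have "\<dots> = (2 * pi * \<i>) * of_real (\<integral>w. indicator (box a c) w * f w \<partial>lborel)"
    by (simp only: integral_mult_right_zero integral_complex_of_real)
  finally show ?thesis .
qed

thm_deps cauchy_pot_rectpath

end

section \<open>Closed forms, mean values and a Liouville theorem for entire functions\<close>

lemma distr_plus_complex: "distr lborel borel (\<lambda>z. c + z) = (lborel :: complex measure)"
  using lborel_affine[of 1 c] by (simp add: density_1)

text \<open>Multiplication by \<open>\<i>\<close> turns the horizontal segment into a vertical one,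
  to which \<open>contour_integral_linepath_same_Re\<close> applies.\<close>

lemma contour_integral_linepath_horizontal:
  assumes "a < b"
  shows "contour_integral (linepath (Complex a c) (Complex b c)) f = integral {a..b} (\<lambda>x. f (Complex x c))"
proof -
  let ?z = "Complex a c" and ?z' = "Complex b c"
  have l: "linepath (\<i> * ?z) (\<i> * ?z') t = \<i> * linepath ?z ?z' t" for t
    by (simp add: linepath_def scaleR_conv_of_real algebra_simps)
  have "contour_integral (linepath (\<i> * ?z) (\<i> * ?z')) (\<lambda>w. f (- \<i> * w)) = \<i> * integral {a..b} (\<lambda>x. f (- \<i> * Complex (- c) x))"
    by (rule contour_integral_linepath_same_Re) (use assms in auto)
  moreover have "contour_integral (linepath (\<i> * ?z) (\<i> * ?z')) (\<lambda>w. f (- \<i> * w)) = \<i> * contour_integral (linepath ?z ?z') f"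
    unfolding contour_integral_integral vector_derivative_linepath_at l integral_mult_right[symmetric]
    by (intro integral_cong) (simp add: algebra_simps)
  moreover have "- \<i> * Complex (- c) x = Complex x c" for x
    by (simp add: complex_eq_iff)
  ultimately show ?thesis by simp
qed

lemma continuous_on_Complex [continuous_intros]:
  assumes "continuous_on S f" "continuous_on S g"
  shows "continuous_on S (\<lambda>x. Complex (f x) (g x))"
  unfolding Complex_eq by (intro continuous_intros assms)

lemma integral_box_complex:
  fixes g :: "complex \<Rightarrow> real"
  assumes c: "continuous_on UNIV g" 
  shows "(\<integral>w. indicator (box a c) w * g w \<partial>lborel) = integral {Re a..Re c} (\<lambda>x. integral {Im a..Im c} (\<lambda>y. g (Complex x y)))"
proof -
  define G where "G = (\<lambda>p. indicator ({Re a..Re c} \<times> {Im a..Im c}) p *\<^sub>R g (Complex (fst p) (snd p)))"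
  have cG: "continuous_on UNIV (\<lambda>p::real \<times> real. g (Complex (fst p) (snd p)))"
    by (intro continuous_on_compose2[OF c] continuous_intros) auto
  have iG: "integrable lborel G"
    using borel_integrable_compact[OF _ continuous_on_subset[OF cG], of "{Re a..Re c} \<times> {Im a..Im c}"]
    by (simp add: G_def compact_Times indicator_scaleR_eq_if)
  then have iG: "integrable (lborel \<Otimes>\<^sub>M lborel) G" by (simp add: lborel_prod)
  have [measurable]: "g \<in> borel_measurable borel" by (rule borel_measurable_continuous_onI[OF c])
  have [measurable]: "(\<lambda>(x, y). Complex x y) \<in> borel_measurable (borel \<Otimes>\<^sub>M borel)"
    unfolding Complex_eq split_beta' by measurable
  have "negligible (cbox a c - box a c)" by (rule negligible_frontier_interval)
  then have "cbox a c - box a c \<in> null_sets lborel"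
    by (simp add: negligible_iff_null_sets null_sets_completion_iff)
  then have ae: "AE w in lborel. w \<notin> cbox a c - box a c" by (rule AE_not_in)
  have "(\<integral>w. indicator (box a c) w * g w \<partial>lborel) = (\<integral>w. indicator (cbox a c) w * g w \<partial>lborel)"
    by (rule integral_cong_AE) (use ae box_subset_cbox[of a c] in \<open>auto elim!: eventually_mono split: split_indicator\<close>)
  also have "\<dots> = (\<integral>w. indicator (cbox a c) w * g w \<partial>distr (lborel \<Otimes>\<^sub>M lborel) borel (\<lambda>(x, y). Complex x y))"
    by (simp add: distr_Complex)
  also have "\<dots> = (\<integral>p. G p \<partial>(lborel \<Otimes>\<^sub>M lborel))"
    by (subst integral_distr) (auto intro!: Bochner_Integration.integral_cong simp: G_def in_cbox_complex_iff split: split_indicator)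
  also have "\<dots> = (\<integral>x. (\<integral>y. G (x, y) \<partial>lborel) \<partial>lborel)"
    by (rule lborel_pair.integral_fst'[OF iG, symmetric])
  also have "\<dots> = (\<integral>x. indicator {Re a..Re c} x *\<^sub>R integral {Im a..Im c} (\<lambda>y. g (Complex x y)) \<partial>lborel)"
  proof (rule Bochner_Integration.integral_cong[OF refl])
    fix x
    have "(\<integral>y. G (x, y) \<partial>lborel) = indicator {Re a..Re c} x *\<^sub>R (LINT y:{Im a..Im c}|lborel. g (Complex x y))"
      unfolding set_lebesgue_integral_def integral_scaleR_right[symmetric]
      by (intro Bochner_Integration.integral_cong) (auto simp: G_def split: split_indicator)
    also have "(LINT y:{Im a..Im c}|lborel. g (Complex x y)) = integral {Im a..Im c} (\<lambda>y. g (Complex x y))"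
      by (intro set_borel_integral_eq_integral borel_integrable_atLeastAtMost' continuous_on_compose2[OF c] continuous_intros) auto
    finally show "(\<integral>y. G (x, y) \<partial>lborel) = indicator {Re a..Re c} x *\<^sub>R integral {Im a..Im c} (\<lambda>y. g (Complex x y))" .
  qed
  also have "\<dots> = integral {Re a..Re c} (\<lambda>x. integral {Im a..Im c} (\<lambda>y. g (Complex x y)))"
    unfolding set_lebesgue_integral_def[symmetric]
    by (intro set_borel_integral_eq_integral borel_integrable_atLeastAtMost'
        integral_continuous_on_param[where 'b=real, unfolded cbox_interval])
       (auto simp: split_beta' intro!: continuous_on_compose2[OF c] continuous_intros)
  finally show ?thesis .
qed

text \<open>Continuous coefficients with vanishing rectangle integrals suffice; no derivatives of
  the coefficients occur. Integrating first along the x-axis and then vertically agrees with the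
  opposite order, so both partial derivatives of the potential are explicit, and continuity of one
  of them gives the total derivative.\<close>

lemma closed_planar_form_exact:
  fixes b1 b2 :: "complex \<Rightarrow> real"
  assumes b1: "continuous_on UNIV b1" and b2: "continuous_on UNIV b2"
    and rect: "\<And>x0 x1 y0 y1. x0 < x1 \<Longrightarrow> y0 < y1 \<Longrightarrow>
        integral {x0..x1} (\<lambda>x. b1 (Complex x y0)) - integral {x0..x1} (\<lambda>x. b1 (Complex x y1))
      + integral {y0..y1} (\<lambda>y. b2 (Complex x1 y)) - integral {y0..y1} (\<lambda>y. b2 (Complex x0 y)) = 0"
  obtains \<theta> where "\<And>z. (\<theta> has_derivative (\<lambda>h. Re h * b1 z + Im h * b2 z)) (at z)"
proof -
  have anti: "\<exists>F. F 0 = 0 \<and> (\<forall>x. (F has_real_derivative g x) (at x))" if g: "continuous_on UNIV g" for g :: "real \<Rightarrow> real"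
  proof -
    have "\<And>x. isCont g x" using g by (simp add: continuous_on_eq_continuous_at)
    then obtain F where "\<And>x. (F has_vector_derivative g x) (at x)"
      using einterval_antiderivative[of "-\<infinity>" \<infinity> g] by auto
    then have "\<And>x. ((\<lambda>x. F x - F 0) has_real_derivative g x) (at x)"
      by (auto intro!: derivative_eq_intros simp: has_real_derivative_iff_has_vector_derivative)
    then show ?thesis by (intro exI[of _ "\<lambda>x. F x - F 0"]) auto
  qed
  have "\<forall>y. \<exists>F. F 0 = 0 \<and> (\<forall>x. (F has_real_derivative b1 (Complex x y)) (at x))"
    by (intro allI anti continuous_on_compose2[OF b1] continuous_intros) auto
  then obtain G1 where G1: "\<And>y. G1 y 0 = 0" "\<And>x y. (G1 y has_real_derivative b1 (Complex x y)) (at x)"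
    by metis
  have "\<forall>x. \<exists>F. F 0 = 0 \<and> (\<forall>y. (F has_real_derivative b2 (Complex x y)) (at y))"
    by (intro allI anti continuous_on_compose2[OF b2] continuous_intros) auto
  then obtain G2 where G2: "\<And>x. G2 x 0 = 0" "\<And>x y. (G2 x has_real_derivative b2 (Complex x y)) (at y)"
    by metis
  define E where "E x0 x1 y0 y1 = (G1 y0 x1 - G1 y0 x0) - (G1 y1 x1 - G1 y1 x0) + (G2 x1 y1 - G2 x1 y0) - (G2 x0 y1 - G2 x0 y0)" for x0 x1 y0 y1
  have E1: "E x0 x1 y0 y1 = 0" if "x0 < x1" "y0 < y1" for x0 x1 y0 y1
  proof -
    have i1: "integral {x0..x1} (\<lambda>x. b1 (Complex x y)) = G1 y x1 - G1 y x0" for y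
      by (intro integral_unique fundamental_theorem_of_calculus)
         (use that G1(2) in \<open>auto simp: has_real_derivative_iff_has_vector_derivative intro: has_vector_derivative_at_within\<close>)
    have i2: "integral {y0..y1} (\<lambda>y. b2 (Complex x y)) = G2 x y1 - G2 x y0" for x
      by (intro integral_unique fundamental_theorem_of_calculus)
         (use that G2(2) in \<open>auto simp: has_real_derivative_iff_has_vector_derivative intro: has_vector_derivative_at_within\<close>)
    show ?thesis using rect[OF that] unfolding i1 i2 E_def by simp
  qed
  \<comment> \<open>Antisymmetry in each pair of end points extends the identity to reversed and
    degenerate rectangles.\<close>
  have E: "E x0 x1 y0 y1 = 0" for x0 x1 y0 y1
  proof -
    have "E x0 x1 y0 y1 = - E x1 x0 y0 y1" "E x0 x1 y0 y1 = - E x0 x1 y1 y0" "E x0 x1 y0 y1 = E x1 x0 y1 y0"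
      "E x0 x0 y0 y1 = 0" "E x0 x1 y0 y0 = 0"
      by (simp_all add: E_def)
    then show ?thesis
      using E1[of x0 x1 y0 y1] E1[of x1 x0 y0 y1] E1[of x0 x1 y1 y0] E1[of x1 x0 y1 y0]
      by (cases x0 x1 rule: linorder_cases; cases y0 y1 rule: linorder_cases) auto
  qed
  define \<theta> where "\<theta> x y = G1 0 x + G2 x y" for x y
  \<comment> \<open>The same potential along the other two sides of the rectangle; this form gives
    the partial derivative in x, the defining one that in y.\<close>
  have \<theta>': "\<theta> x y = G1 y x + G2 0 y" for x y
    using E[of 0 x 0 y] by (simp add: E_def \<theta>_def G1 G2)
  have d: "((\<lambda>(x, y). \<theta> x y) has_derivative (\<lambda>(tx, ty). tx * b1 (Complex x y) + blinfun_apply (blinfun_scaleR_left (b2 (Complex x y))) ty)) (at (x, y) within UNIV \<times> UNIV)" for x y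
  proof (rule has_derivative_partialsI)
    have "((\<lambda>x. \<theta> x y) has_real_derivative b1 (Complex x y)) (at x)"
      unfolding \<theta>' by (auto intro!: derivative_eq_intros G1(2))
    then show "((\<lambda>x. \<theta> x y) has_derivative (\<lambda>tx. tx * b1 (Complex x y))) (at x)"
      by (simp add: has_field_derivative_def mult.commute[of _ "b1 _"])
    show "((\<lambda>y. \<theta> x y) has_derivative blinfun_apply (blinfun_scaleR_left (b2 (Complex x y)))) (at y)" for x y
    proof -
      have "((\<lambda>y. \<theta> x y) has_real_derivative b2 (Complex x y)) (at y)"
        unfolding \<theta>_def by (auto intro!: derivative_eq_intros G2(2))
      then show ?thesis
        by (simp add: has_field_derivative_def blinfun_scaleR_left.rep_eq mult.commute[of _ "b2 _"])
    qed
    have "continuous_on UNIV (\<lambda>p. blinfun_scaleR_left (b2 (Complex (fst p) (snd p))) :: real \<Rightarrow>\<^sub>L real)"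
      by (intro continuous_intros continuous_on_compose2[OF b2]) auto
    then show "continuous (at (x, y) within UNIV \<times> UNIV) (\<lambda>(x, y). blinfun_scaleR_left (b2 (Complex x y)))"
      by (simp add: split_beta' continuous_on_eq_continuous_at)
  qed auto
  have "((\<lambda>z. \<theta> (Re z) (Im z)) has_derivative (\<lambda>h. Re h * b1 z + Im h * b2 z)) (at z)" for z
  proof -
    have r: "((\<lambda>z. (Re z, Im z)) has_derivative (\<lambda>h. (Re h, Im h))) (at z)"
      by (intro bounded_linear_imp_has_derivative bounded_linear_Pair bounded_linear_Re bounded_linear_Im)
    have d': "((\<lambda>(x, y). \<theta> x y) has_derivative (\<lambda>(tx, ty). tx * b1 z + blinfun_apply (blinfun_scaleR_left (b2 z)) ty)) (at (Re z, Im z))"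
      using d[of "Re z" "Im z"] by simp
    show ?thesis
      using diff_chain_at[OF r d'] by (simp add: o_def blinfun_scaleR_left.rep_eq)
  qed
  then show ?thesis by (rule that)
qed

text \<open>Cauchy's formula at the centre for the entire function of \<open>u\<close> given by
  \<open>k (x + z * u)\<close>. Keeping \<open>z\<close> as a factor makes the mean an average over
  rotations, which can be combined with the rotation invariance of area.\<close>

lemma entire_circle_mean:
  assumes k: "k holomorphic_on UNIV"
  shows "integral {0..1} (\<lambda>t. k (x + z * exp (2 * of_real pi * \<i> * of_real t))) = k x"
proof -
  define g where "g u = k (x + z * u)" for u
  have g: "g holomorphic_on A" for A
    unfolding g_def using k
    by (intro holomorphic_on_compose_gen[of "\<lambda>u. x + z * u" A k UNIV, unfolded o_def] holomorphic_intros) auto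
  have "((\<lambda>u. g u / (u - 0)) has_contour_integral (2 * of_real pi * \<i> * g 0)) (circlepath 0 1)"
    by (rule Cauchy_integral_circlepath) (use g in \<open>auto intro: holomorphic_on_imp_continuous_on\<close>)
  then have "contour_integral (circlepath 0 1) (\<lambda>u. g u / u) = 2 * of_real pi * \<i> * g 0"
    by (simp add: contour_integral_unique)
  moreover have "contour_integral (circlepath 0 1) (\<lambda>u. g u / u) = 2 * of_real pi * \<i> * integral {0..1} (\<lambda>t. g (exp (2 * of_real pi * \<i> * of_real t)))"
    unfolding contour_integral_integral vector_derivative_circlepath integral_mult_right[symmetric]
    by (intro integral_cong) (simp add: circlepath)
  ultimately show ?thesis by (simp add: g_def)
qed

lemma integral_rotate:
  fixes h :: "complex \<Rightarrow> real"
  assumes u: "cmod u = 1" and [measurable]: "h \<in> borel_measurable borel"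
  shows "(\<integral>z. h (u * z) \<partial>lborel) = (\<integral>z. h z \<partial>lborel)"
proof -
  have "(\<integral>z. h z \<partial>lborel) = (\<integral>z. h z \<partial>distr lborel borel ((*) u))"
    by (simp add: distr_rotation[OF u])
  also have "\<dots> = (\<integral>z. h (u * z) \<partial>lborel)" by (rule integral_distr) auto
  finally show ?thesis by simp
qed

lemma integrable_cball_continuous:
  fixes h :: "complex \<Rightarrow> real"
  assumes "continuous_on UNIV h" and [measurable]: "\<rho> \<in> borel_measurable borel"
    and \<rho>: "\<And>z. \<bar>\<rho> z\<bar> \<le> M" "\<And>z. R < cmod z \<Longrightarrow> \<rho> z = 0"
  shows "integrable lborel (\<lambda>z. \<rho> z * h z)"
proof (rule Bochner_Integration.integrable_bound)
  have "integrable lborel (\<lambda>z. indicator (cball 0 R) z *\<^sub>R h z)"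
    using borel_integrable_compact[OF compact_cball continuous_on_subset[OF assms(1)], of 0 R] by simp
  then show "integrable lborel (\<lambda>z. M * \<bar>indicator (cball 0 R) z *\<^sub>R h z\<bar>)"
    by (intro integrable_mult_right integrable_abs)
  have [measurable]: "h \<in> borel_measurable borel" by (rule borel_measurable_continuous_onI[OF assms(1)])
  show "(\<lambda>z. \<rho> z * h z) \<in> borel_measurable lborel" by measurable
  have M: "0 \<le> M" using \<rho>(1)[of 0] by linarith
  have "\<bar>\<rho> z * h z\<bar> \<le> M * \<bar>indicator (cball 0 R) z *\<^sub>R h z\<bar>" for z
    using \<rho>(1)[of z] \<rho>(2)[of z] M by (cases "cmod z \<le> R") (auto simp: abs_mult intro: mult_right_mono)
  then show "AE z in lborel. norm (\<rho> z * h z) \<le> norm (M * \<bar>indicator (cball 0 R) z *\<^sub>R h z\<bar>)"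
    using M by (auto simp: abs_mult)
qed

text \<open>For each \<open>t\<close> the integral is unchanged when \<open>z\<close> is rotated by
  \<open>e t\<close>, since the weight is radial. Averaging over \<open>t\<close> and exchanging the
  integrals lets the circle mean replace \<open>h (x + z)\<close> by \<open>h x\<close>.\<close>

lemma entire_radial_mean:
  assumes k: "k holomorphic_on UNIV" and h: "\<And>z. h z = Re (k z)"
    and [measurable]: "\<rho> \<in> borel_measurable borel"
    and \<rho>: "\<And>r. \<bar>\<rho> r\<bar> \<le> M" "\<And>r. R < r \<Longrightarrow> \<rho> r = 0"
  shows "(\<integral>z. \<rho> (cmod z) * h (x + z) \<partial>lborel) = h x * (\<integral>z. \<rho> (cmod z) \<partial>lborel)"
proof -
  have kc: "continuous_on UNIV k" using k by (rule holomorphic_on_imp_continuous_on)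
  have hc: "continuous_on UNIV h" unfolding h by (intro continuous_intros kc)
  have hx: "continuous_on UNIV (\<lambda>z. h (x + u * z))" for u
    by (intro continuous_on_compose2[OF hc] continuous_intros) auto
  have [measurable]: "h \<in> borel_measurable borel" by (rule borel_measurable_continuous_onI[OF hc])
  define e where "e t = exp (2 * of_real pi * \<i> * of_real t)" for t :: real
  have e1: "cmod (e t) = 1" for t by (simp add: e_def)
  have [measurable]: "e \<in> borel_measurable borel"
    unfolding e_def by (intro borel_measurable_continuous_onI continuous_intros)
  define H where "H t z = indicator {0..1::real} t * (\<rho> (cmod z) * h (x + e t * z))" for t z
  have [measurable]: "case_prod H \<in> borel_measurable (lborel \<Otimes>\<^sub>M lborel)"
    unfolding H_def by measurable
  obtain B where B: "\<And>z. z \<in> cball x R \<Longrightarrow> \<bar>h z\<bar> \<le> B"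
    using compact_imp_bounded[OF compact_continuous_image[OF continuous_on_subset[OF hc] compact_cball[of x R]]]
    unfolding bounded_iff by (metis imageI real_norm_def subset_UNIV)
  have bd: "\<bar>H t z\<bar> \<le> indicator {0..1} t * (indicator (cball 0 R) z * (M * \<bar>B\<bar>))" for t z
  proof (cases "cmod z \<le> R")
    case True
    have "x + e t * z \<in> cball x R" using True by (simp add: dist_norm norm_mult e1)
    then have "\<bar>\<rho> (cmod z)\<bar> * \<bar>h (x + e t * z)\<bar> \<le> M * \<bar>B\<bar>"
      using B \<rho>(1)[of "cmod z"] by (intro mult_mono) force+
    then show ?thesis using True by (auto simp: H_def abs_mult split: split_indicator)
  next
    case False
    then show ?thesis using \<rho>(2)[of "cmod z"] by (simp add: H_def)
  qed
  have int: "integrable (lborel \<Otimes>\<^sub>M lborel) (case_prod H)"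
  proof (rule Bochner_Integration.integrable_bound)
    show "integrable (lborel \<Otimes>\<^sub>M lborel) (\<lambda>p. indicator ({0..1::real} \<times> cball (0::complex) R) p *\<^sub>R (M * \<bar>B\<bar>))"
      unfolding lborel_prod by (rule borel_integrable_compact) (auto intro: compact_Times)
    show "AE p in lborel \<Otimes>\<^sub>M lborel. norm (case_prod H p) \<le> norm (indicator ({0..1} \<times> cball 0 R) p *\<^sub>R (M * \<bar>B\<bar>) :: real)"
      using bd by (auto simp: split_beta' indicator_times mult.assoc simp del: mem_cball intro: order_trans[OF _ abs_ge_self])
  qed measurable
  have "(\<integral>t. (\<integral>z. H t z \<partial>lborel) \<partial>lborel) = (\<integral>t. indicator {0..1::real} t * (\<integral>z. \<rho> (cmod z) * h (x + z) \<partial>lborel) \<partial>lborel)"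
  proof (rule Bochner_Integration.integral_cong[OF refl])
    fix t
    have "(\<integral>z. \<rho> (cmod (e t * z)) * h (x + e t * z) \<partial>lborel) = (\<integral>z. \<rho> (cmod z) * h (x + z) \<partial>lborel)"
      by (rule integral_rotate[OF e1, of "\<lambda>z. \<rho> (cmod z) * h (x + z)"]) measurable
    then show "(\<integral>z. H t z \<partial>lborel) = indicator {0..1::real} t * (\<integral>z. \<rho> (cmod z) * h (x + z) \<partial>lborel)"
      unfolding H_def by (simp add: norm_mult e1)
  qed
  also have "\<dots> = (\<integral>z. \<rho> (cmod z) * h (x + z) \<partial>lborel)" by simp
  finally have 1: "(\<integral>t. (\<integral>z. H t z \<partial>lborel) \<partial>lborel) = (\<integral>z. \<rho> (cmod z) * h (x + z) \<partial>lborel)" .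
  have "(\<integral>z. (\<integral>t. H t z \<partial>lborel) \<partial>lborel) = (\<integral>z. \<rho> (cmod z) * h x \<partial>lborel)"
  proof (rule Bochner_Integration.integral_cong[OF refl])
    fix z
    have c: "continuous_on {0..1} (\<lambda>t. k (x + e t * z))"
      unfolding e_def by (intro continuous_on_compose2[OF kc] continuous_intros) auto
    have "(\<integral>t. H t z \<partial>lborel) = (\<integral>t. \<rho> (cmod z) * (indicator {0..1} t *\<^sub>R h (x + e t * z)) \<partial>lborel)"
      by (intro Bochner_Integration.integral_cong) (auto simp: H_def)
    also have "\<dots> = \<rho> (cmod z) * (LINT t:{0..1}|lborel. h (x + e t * z))"
      unfolding set_lebesgue_integral_def by (rule integral_mult_right_zero)
    also have "(LINT t:{0..1}|lborel. h (x + e t * z)) = integral {0..1} (\<lambda>t. h (x + e t * z))"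
      unfolding h by (intro set_borel_integral_eq_integral borel_integrable_atLeastAtMost' continuous_intros c)
    also have "\<dots> = Re (integral {0..1} (\<lambda>t. k (x + e t * z)))"
      unfolding h by (rule integral_linear[OF integrable_continuous_interval[OF c] bounded_linear_Re, unfolded o_def])
    also have "\<dots> = h x"
      using entire_circle_mean[OF k, of x z] by (simp add: h e_def mult.commute[of z])
    finally show "(\<integral>t. H t z \<partial>lborel) = \<rho> (cmod z) * h x" .
  qed
  with 1 show ?thesis
    using lborel_pair.Fubini_integral[OF int] by (simp add: mult.commute)
qed


text \<open>On the disc of radius R/2 the tent is at least R/2, which already gives the order
  R^3.\<close>

lemma nn_integral_tent:
  assumes "0 < R"
  shows "pi * R ^ 3 / 8 \<le> (\<integral>z. max 0 (R - cmod z) \<partial>lborel)"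
proof -
  have i: "integrable lborel (\<lambda>z. max 0 (R - cmod z))"
    using integrable_cball_continuous[of "\<lambda>_. 1" "\<lambda>z. max 0 (R - cmod z)" R R] assms by (auto simp: max_def)
  have "pi * R ^ 3 / 8 = (\<integral>z. indicator (cball 0 (R/2)) z * (R/2) \<partial>(lborel :: complex measure))"
    using assms content_cball[of "R/2" "0::complex"] by (simp add: unit_ball_vol_2 power2_eq_square power3_eq_cube)
  also have "\<dots> \<le> (\<integral>z. max 0 (R - cmod z) \<partial>lborel)"
    by (intro integral_mono i integrable_mult_left integrable_real_indicator)
       (auto simp: emeasure_lborel_cball_finite[unfolded infinity_ennreal_def] max_def split: split_indicator)
  finally show ?thesis .
qed

text \<open>The mean value property upgrades the one-sided hypothesis to a bound for the integral of
  |h|. Tents centred at \<open>x\<close> and at \<open>0\<close> differ by at most |x|, so h x - h 0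
  is of order R^2 ln R divided by the tent mass R^3. Discs in place of tents would give the divisor
  R^2 only, which is not enough.\<close>

lemma entire_Re_const:
  assumes k: "k holomorphic_on UNIV"
    and h: "\<And>z. h z = Re (k z)"
    and C: "\<And>R. 1 \<le> R \<Longrightarrow> (\<integral>z. indicator (cball 0 R) z * max 0 (h z) \<partial>lborel) \<le> C * R\<^sup>2 * (1 + ln R)"
  shows "h x = h 0"
proof -
  have kc: "continuous_on UNIV k" using k by (rule holomorphic_on_imp_continuous_on)
  have hc: "continuous_on UNIV h" unfolding h by (intro continuous_intros kc)
  have [measurable]: "h \<in> borel_measurable borel" by (rule borel_measurable_continuous_onI[OF hc])
  have ind: "integrable lborel (\<lambda>z. indicator (cball 0 R) z * g z)" if "continuous_on UNIV g" for R and g :: "complex \<Rightarrow> real"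
    by (rule integrable_cball_continuous[OF that borel_measurable_indicator, of _ 1 R]) (auto split: split_indicator)
  have hcs: "continuous_on UNIV (\<lambda>z. max 0 (h z))" "continuous_on UNIV (\<lambda>z. \<bar>h z\<bar>)"
    by (intro continuous_intros hc)+
  \<comment> \<open>|h| is twice the positive part minus h, and the integral of h over the disc is
    known from the mean value property.\<close>
  have abs_le: "(\<integral>z. indicator (cball 0 R) z * \<bar>h z\<bar> \<partial>lborel) \<le> 2 * (C * R\<^sup>2 * (1 + ln R)) + pi * R\<^sup>2 * \<bar>h 0\<bar>" if R: "1 \<le> R" for R
  proof -
    have "(\<integral>z. indicator (cball 0 R) z * h z \<partial>lborel) = (\<integral>z. indicator {..R} (cmod z) * h (0 + z) \<partial>lborel)"
      by (intro Bochner_Integration.integral_cong) (auto split: split_indicator)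
    also have "\<dots> = h 0 * (\<integral>z. indicator {..R} (cmod z) \<partial>lborel)"
      by (rule entire_radial_mean[OF k h, of _ 1 R]) (auto split: split_indicator)
    also have "(\<integral>z. indicator {..R} (cmod z) \<partial>lborel) = (\<integral>z. indicator (cball 0 R) z \<partial>(lborel :: complex measure))"
      by (intro Bochner_Integration.integral_cong) (auto split: split_indicator)
    also have "\<dots> = pi * R\<^sup>2" using R content_cball[of R "0::complex"] by (simp add: unit_ball_vol_2)
    finally have m: "(\<integral>z. indicator (cball 0 R) z * h z \<partial>lborel) = pi * R\<^sup>2 * h 0" by simp
    have "(\<integral>z. indicator (cball 0 R) z * \<bar>h z\<bar> \<partial>lborel) = (\<integral>z. 2 * (indicator (cball 0 R) z * max 0 (h z)) - indicator (cball 0 R) z * h z \<partial>lborel)"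
      by (intro Bochner_Integration.integral_cong) (auto split: split_indicator)
    also have "\<dots> = 2 * (\<integral>z. indicator (cball 0 R) z * max 0 (h z) \<partial>lborel) - (\<integral>z. indicator (cball 0 R) z * h z \<partial>lborel)"
      by (subst Bochner_Integration.integral_diff) (auto intro!: integrable_mult_right ind hcs hc)
    also have "\<dots> \<le> 2 * (C * R\<^sup>2 * (1 + ln R)) - pi * R\<^sup>2 * h 0" using C[OF R] m by simp
    finally have 1: "(\<integral>z. indicator (cball 0 R) z * \<bar>h z\<bar> \<partial>lborel) \<le> 2 * (C * R\<^sup>2 * (1 + ln R)) - pi * R\<^sup>2 * h 0" .
    have "pi * R\<^sup>2 * (- h 0) \<le> pi * R\<^sup>2 * \<bar>h 0\<bar>" by (intro mult_left_mono) auto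
    with 1 show ?thesis by simp
  qed
  have bound: "\<bar>h x - h 0\<bar> * (pi * R ^ 3 / 8) \<le> cmod x * (2 * (C * (R + cmod x)\<^sup>2 * (1 + ln (R + cmod x))) + pi * (R + cmod x)\<^sup>2 * \<bar>h 0\<bar>)"
    if R: "1 \<le> R" for R
  proof -
    let ?\<rho> = "\<lambda>r. indicator {0..} r * max 0 (R - r) :: real"
    let ?T = "(\<integral>z. max 0 (R - cmod z) \<partial>lborel)"
    have \<rho>: "?\<rho> \<in> borel_measurable borel" "\<And>r. \<bar>?\<rho> r\<bar> \<le> R" "\<And>r. R < r \<Longrightarrow> ?\<rho> r = 0"
      using R by (auto split: split_indicator)
    have m: "(\<integral>z. max 0 (R - cmod z) * h (y + z) \<partial>lborel) = h y * ?T" for y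
      using entire_radial_mean[OF k h \<rho>, where x=y] by simp
    have tent_cont: "continuous_on UNIV (\<lambda>z. max 0 (R - cmod (z - y)))" for y by (intro continuous_intros)
    have sh: "(\<integral>z. max 0 (R - cmod z) * h (y + z) \<partial>lborel) = (\<integral>z. max 0 (R - cmod (z - y)) * h z \<partial>lborel)" for y
    proof -
      have "(\<integral>z. max 0 (R - cmod (z - y)) * h z \<partial>lborel) = (\<integral>z. max 0 (R - cmod (z - y)) * h z \<partial>distr lborel borel (\<lambda>z. y + z))"
        by (simp add: distr_plus_complex)
      also have "\<dots> = (\<integral>z. max 0 (R - cmod z) * h (y + z) \<partial>lborel)" by (subst integral_distr) auto
      finally show ?thesis by simp
    qed
    have i: "integrable lborel (\<lambda>z. max 0 (R - cmod (z - y)) * h z)" for y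
    proof (rule integrable_cball_continuous[OF hc, where M=R and R="R + cmod y"])
      fix z assume "R + cmod y < cmod z"
      then show "max 0 (R - cmod (z - y)) = 0" using norm_triangle_ineq2[of z y] by auto
    qed (use R in auto)
    have "(h x - h 0) * ?T = (\<integral>z. max 0 (R - cmod (z - x)) * h z \<partial>lborel) - (\<integral>z. max 0 (R - cmod (z - 0)) * h z \<partial>lborel)"
      using m[of x] m[of 0] sh[of x] sh[of 0] by (simp add: left_diff_distrib)
    also have "\<dots> = (\<integral>z. max 0 (R - cmod (z - x)) * h z - max 0 (R - cmod (z - 0)) * h z \<partial>lborel)"
      by (rule Bochner_Integration.integral_diff[symmetric, OF i i])
    finally have "\<bar>h x - h 0\<bar> * \<bar>?T\<bar> = \<bar>(\<integral>z. max 0 (R - cmod (z - x)) * h z - max 0 (R - cmod (z - 0)) * h z \<partial>lborel)\<bar>"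
      by (simp only: abs_mult[symmetric])
    also have "\<dots> \<le> (\<integral>z. cmod x * (indicator (cball 0 (R + cmod x)) z * \<bar>h z\<bar>) \<partial>lborel)"
      unfolding real_norm_def[symmetric]
    proof (rule Bochner_Integration.integral_norm_bound_integral)
      fix z
      have "\<bar>max 0 (R - cmod (z - x)) - max 0 (R - cmod (z - 0))\<bar> \<le> cmod x * indicator (cball 0 (R + cmod x)) z"
      proof (cases "cmod z \<le> R + cmod x")
        case True
        have "\<bar>cmod (z - x) - cmod z\<bar> \<le> cmod x"
          using norm_triangle_ineq3[of "z - x" z] by simp
        then show ?thesis using True by auto
      next
        case False
        then have "R \<le> cmod z" "R \<le> cmod (z - x)"
            using norm_triangle_ineq2[of z x] norm_ge_zero[of x] unfolding not_le by linarith+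
          then show ?thesis using False by auto
      qed
      then have "\<bar>max 0 (R - cmod (z - x)) - max 0 (R - cmod (z - 0))\<bar> * \<bar>h z\<bar> \<le> cmod x * indicator (cball 0 (R + cmod x)) z * \<bar>h z\<bar>"
        by (rule mult_right_mono) simp
      then show "norm (max 0 (R - cmod (z - x)) * h z - max 0 (R - cmod (z - 0)) * h z) \<le> cmod x * (indicator (cball 0 (R + cmod x)) z * norm (h z))"
        by (simp add: left_diff_distrib[symmetric] abs_mult mult.assoc)
    qed (use i[of x] i[of 0] ind[OF hcs(2), of "R + cmod x"] in \<open>auto intro!: Bochner_Integration.integrable_diff\<close>)
    also have "\<dots> = cmod x * (\<integral>z. indicator (cball 0 (R + cmod x)) z * \<bar>h z\<bar> \<partial>lborel)"
      by (rule integral_mult_right_zero)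
    also have "\<dots> \<le> cmod x * (2 * (C * (R + cmod x)\<^sup>2 * (1 + ln (R + cmod x))) + pi * (R + cmod x)\<^sup>2 * \<bar>h 0\<bar>)"
      using R by (intro mult_left_mono abs_le) (auto simp: add_increasing2)
    finally have 1: "\<bar>h x - h 0\<bar> * \<bar>?T\<bar> \<le> \<dots>" .
    have "\<bar>h x - h 0\<bar> * (pi * R ^ 3 / 8) \<le> \<bar>h x - h 0\<bar> * \<bar>?T\<bar>"
      using nn_integral_tent[of R] R by (intro mult_left_mono) auto
    with 1 show ?thesis by linarith
  qed
  let ?B = "\<lambda>R. cmod x * (2 * (C * (R + cmod x)\<^sup>2 * (1 + ln (R + cmod x))) + pi * (R + cmod x)\<^sup>2 * \<bar>h 0\<bar>) / (pi * R ^ 3 / 8)"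
  have lim: "(?B \<longlongrightarrow> 0) at_top"
    by real_asymp
  have "\<forall>\<^sub>F R in at_top. \<bar>h x - h 0\<bar> \<le> ?B R"
    using eventually_ge_at_top[of 1]
  proof eventually_elim
    case (elim R)
    then show ?case using bound[of R] by (simp add: pos_le_divide_eq)
  qed
  from tendsto_lowerbound[OF lim this] show ?thesis by simp
qed

thm_deps entire_Re_const

section \<open>Mean growth of the logarithmic potential\<close>

lemma ball_borel [measurable]: "ball x r \<in> sets borel" "cball x r \<in> sets borel"
  by simp_all

lemma integrable_indicator_cball:
  fixes g :: "complex \<Rightarrow> real"
  assumes "continuous_on UNIV g"
  shows "integrable lborel (\<lambda>z. indicator (cball x R) z * g z)"
  using borel_integrable_compact[OF compact_cball continuous_on_subset[OF assms], of x R] by simp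

context planar_density begin

lemma abs_log_pot_le: "\<bar>log_pot f z\<bar> \<le> ln (1 + cmod z) * L1 + (\<integral>w. \<bar>f w\<bar> / cmod (z - w) \<partial>lborel)"
proof -
  have "\<bar>log_pot f z\<bar> \<le> (\<integral>w. \<bar>(ln (cmod (z - w)) - ln (1 + cmod w)) * f w\<bar> \<partial>lborel)"
    unfolding log_pot_def by (rule integral_abs_bound)
  also have "\<dots> \<le> (\<integral>w. ln (1 + cmod z) * \<bar>f w\<bar> + \<bar>f w\<bar> / cmod (z - w) \<partial>lborel)"
  proof (rule integral_mono_AE)
    show "integrable lborel (\<lambda>w. \<bar>(ln (cmod (z - w)) - ln (1 + cmod w)) * f w\<bar>)"
      by (intro integrable_abs integrable_log_kernel)
    show "integrable lborel (\<lambda>w. ln (1 + cmod z) * \<bar>f w\<bar> + \<bar>f w\<bar> / cmod (z - w))"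
      by (intro Bochner_Integration.integrable_add integrable_mult_right int_abs integrable_inverse_dist_density)
    have "AE w in lborel. w \<noteq> z" by (rule AE_lborel_singleton)
    then show "AE w in lborel. \<bar>(ln (cmod (z - w)) - ln (1 + cmod w)) * f w\<bar> \<le> ln (1 + cmod z) * \<bar>f w\<bar> + \<bar>f w\<bar> / cmod (z - w)"
    proof eventually_elim
      case (elim w)
      have "\<bar>(ln (cmod (z - w)) - ln (1 + cmod w)) * f w\<bar> \<le> (ln (1 + cmod z) + 1 / cmod (z - w)) * \<bar>f w\<bar>"
        using abs_log_kernel_le[OF elim] by (auto simp: abs_mult intro!: mult_right_mono)
      then show ?case by (simp add: algebra_simps)
    qed
  qed
  also have "\<dots> = ln (1 + cmod z) * L1 + (\<integral>w. \<bar>f w\<bar> / cmod (z - w) \<partial>lborel)"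
    unfolding L1_def
    by (subst Bochner_Integration.integral_add) (auto intro!: integrable_mult_right int_abs integrable_inverse_dist_density)
  finally show ?thesis .
qed

lemma log_pot_continuous: "continuous_on UNIV (log_pot f)"
  using log_pot_has_derivative
  by (auto simp: continuous_on_eq_continuous_at intro: has_derivative_continuous)

text \<open>Tonelli puts the integral over the disc inside, where 1/|z - w| contributes at most 2 pi
  from the unit disc about \<open>w\<close> and the area of the given disc from elsewhere, whatever
  \<open>w\<close> is. The centre is left free because discs moving to infinity occur later.\<close>

lemma integral_cball_inverse_dist_le:
  assumes R: "0 \<le> R"
  shows "(\<integral>\<^sup>+z. indicator (cball x R) z * ennreal (\<integral>w. \<bar>f w\<bar> / cmod (z - w) \<partial>lborel) \<partial>lborel)
      \<le> ennreal (L1 * (2 * pi + pi * R\<^sup>2))"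
proof -
  have inner: "(\<integral>\<^sup>+z. indicator (cball x R) z * ennreal (1 / cmod (z - w)) \<partial>lborel) \<le> ennreal (2 * pi + pi * R\<^sup>2)" for w
  proof -
    have "(\<integral>\<^sup>+z. indicator (cball x R) z * ennreal (1 / cmod (z - w)) \<partial>lborel)
       \<le> (\<integral>\<^sup>+z. ennreal (indicator (ball w 1) z / cmod (w - z)) + indicator (cball x R) z \<partial>lborel)"
    proof (rule nn_integral_mono)
      fix z
      have "ennreal (1 / cmod (z - w)) \<le> ennreal (indicator (ball w 1) z / cmod (w - z)) + 1"
      proof (cases "z \<in> ball w 1")
        case True
        then show ?thesis by (simp add: norm_minus_commute del: mem_ball)
      next
        case False
        then have "1 / cmod (z - w) \<le> 1" by (auto simp: dist_norm norm_minus_commute divide_le_eq)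
        then have "ennreal (1 / cmod (z - w)) \<le> 1" using ennreal_leI by fastforce
        then show ?thesis by (rule order_trans) simp
      qed
      then show "indicator (cball x R) z * ennreal (1 / cmod (z - w)) \<le> ennreal (indicator (ball w 1) z / cmod (w - z)) + indicator (cball x R) z"
        by (cases "z \<in> cball x R") (simp_all del: mem_cball mem_ball)
    qed
    also have "\<dots> = ennreal (2 * pi * 1) + emeasure lborel (cball (x::complex) R)"
      by (subst nn_integral_add) (auto simp: nn_integral_inverse_dist[of 1 w, simplified] intro: inverse_dist_measurable)
    also have "\<dots> = ennreal (2 * pi + pi * R\<^sup>2)"
      using R by (simp add: emeasure_cball unit_ball_vol_2 ennreal_plus[symmetric] del: ennreal_plus)
    finally show ?thesis .
  qed
  have "(\<integral>\<^sup>+z. indicator (cball x R) z * ennreal (\<integral>w. \<bar>f w\<bar> / cmod (z - w) \<partial>lborel) \<partial>lborel)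
     = (\<integral>\<^sup>+z. (\<integral>\<^sup>+w. indicator (cball x R) z * (ennreal \<bar>f w\<bar> * ennreal (1 / cmod (z - w))) \<partial>lborel) \<partial>lborel)"
    by (intro nn_integral_cong)
       (simp add: nn_integral_eq_integral[OF integrable_inverse_dist_density] nn_integral_cmult flip: ennreal_mult')
  also have "\<dots> = (\<integral>\<^sup>+w. (\<integral>\<^sup>+z. indicator (cball x R) z * (ennreal \<bar>f w\<bar> * ennreal (1 / cmod (z - w))) \<partial>lborel) \<partial>lborel)"
    by (rule lborel_pair.Fubini') measurable
  also have "\<dots> = (\<integral>\<^sup>+w. ennreal \<bar>f w\<bar> * (\<integral>\<^sup>+z. indicator (cball x R) z * ennreal (1 / cmod (z - w)) \<partial>lborel) \<partial>lborel)"
    by (intro nn_integral_cong) (subst nn_integral_cmult[symmetric], auto simp: mult_ac)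
  also have "\<dots> \<le> (\<integral>\<^sup>+w. ennreal \<bar>f w\<bar> * ennreal (2 * pi + pi * R\<^sup>2) \<partial>lborel)"
    by (intro nn_integral_mono mult_left_mono inner) auto
  also have "\<dots> = ennreal (L1 * (2 * pi + pi * R\<^sup>2))"
    by (subst nn_integral_multc)
       (auto simp: nn_integral_eq_integral[OF int_abs] L1_def ennreal_mult' integral_nonneg_AE)
  finally show ?thesis .
qed

text \<open>Growth of order R^2 ln R in the mean is what \<open>entire_Re_const\<close> admits. A
  pointwise estimate of this kind would require a bound on \<open>f\<close>, which is not yet
  available.\<close>

lemma integral_cball_log_pot_le:
  assumes R: "0 \<le> R"
  shows "(\<integral>z. indicator (cball 0 R) z * \<bar>log_pot f z\<bar> \<partial>lborel) \<le> L1 * (ln (1 + R) * (pi * R\<^sup>2) + (2 * pi + pi * R\<^sup>2))"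
proof -
  let ?g = "\<lambda>z. \<integral>w. \<bar>f w\<bar> / cmod (z - w) \<partial>lborel"
  have i: "integrable lborel (\<lambda>z. indicator (cball 0 R) z * \<bar>log_pot f z\<bar>)"
    by (intro integrable_indicator_cball continuous_intros log_pot_continuous)
  have "ennreal (\<integral>z. indicator (cball 0 R) z * \<bar>log_pot f z\<bar> \<partial>lborel) = (\<integral>\<^sup>+z. ennreal (indicator (cball 0 R) z * \<bar>log_pot f z\<bar>) \<partial>lborel)"
    by (rule nn_integral_eq_integral[symmetric, OF i]) auto
  also have "\<dots> \<le> (\<integral>\<^sup>+z. ennreal (ln (1 + R) * L1) * indicator (cball 0 R) z + indicator (cball 0 R) z * ennreal (?g z) \<partial>lborel)"
  proof (rule nn_integral_mono)
    fix z
    show "ennreal (indicator (cball 0 R) z * \<bar>log_pot f z\<bar>) \<le> ennreal (ln (1 + R) * L1) * indicator (cball 0 R) z + indicator (cball 0 R) z * ennreal (?g z)"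
    proof (cases "z \<in> cball 0 R")
      case True
      then have "ln (1 + cmod z) \<le> ln (1 + R)" by (intro ln_mono) (auto simp: add_pos_nonneg)
      then have "ln (1 + cmod z) * L1 \<le> ln (1 + R) * L1" by (rule mult_right_mono) (rule L1_nonneg)
      then have "\<bar>log_pot f z\<bar> \<le> ln (1 + R) * L1 + ?g z" using abs_log_pot_le[of z] by linarith
      moreover have "0 \<le> ?g z" by (intro integral_nonneg_AE) auto
      ultimately show ?thesis using True R L1_nonneg by (simp add: ennreal_leI flip: ennreal_plus)
    qed auto
  qed
  also have "\<dots> = ennreal (ln (1 + R) * L1) * emeasure lborel (cball (0::complex) R) + (\<integral>\<^sup>+z. indicator (cball 0 R) z * ennreal (?g z) \<partial>lborel)"
    by (subst nn_integral_add) (auto simp: nn_integral_cmult_indicator)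
  also have "\<dots> \<le> ennreal (ln (1 + R) * L1) * emeasure lborel (cball (0::complex) R) + ennreal (L1 * (2 * pi + pi * R\<^sup>2))"
    by (intro add_left_mono integral_cball_inverse_dist_le R)
  also have "\<dots> = ennreal (L1 * (ln (1 + R) * (pi * R\<^sup>2) + (2 * pi + pi * R\<^sup>2)))"
    using R L1_nonneg
    by (simp add: emeasure_cball unit_ball_vol_2 ennreal_mult'[symmetric] ennreal_plus[symmetric] algebra_simps del: ennreal_plus)
  finally show ?thesis
    using R L1_nonneg by (subst (asm) ennreal_le_iff) (auto intro!: mult_nonneg_nonneg add_nonneg_nonneg)
qed

end

section \<open>Holomorphic structure of a single vortex component\<close>

text \<open>One component of the system, moved to \<open>complex\<close> with its zero at the
  origin. The field equation for the curvature is absent: the representation uses only that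
  \<open>f\<close> is integrable, so both components are instances.\<close>

locale planar_vortex =
  fixes \<phi> \<phi>x \<phi>y :: "complex \<Rightarrow> complex" and a1 a2 a1y a2x f :: "complex \<Rightarrow> real" and N :: nat
  assumes d\<phi>: "\<And>z. (\<phi> has_derivative (\<lambda>h. of_real (Re h) * \<phi>x z + of_real (Im h) * \<phi>y z)) (at z)"
    and da1: "\<And>x y. ((\<lambda>y. a1 (Complex x y)) has_real_derivative a1y (Complex x y)) (at y)"
    and da2: "\<And>x y. ((\<lambda>x. a2 (Complex x y)) has_real_derivative a2x (Complex x y)) (at x)"
    and a_cont: "continuous_on UNIV a1" "continuous_on UNIV a2" "continuous_on UNIV a1y" "continuous_on UNIV a2x"
    and self_dual: "\<And>z. \<phi>x z + \<i> * a1 z * \<phi> z - \<i> * (\<phi>y z + \<i> * a2 z * \<phi> z) = 0"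
    and f_def: "f = (\<lambda>z. a2x z - a1y z)"
    and f_int: "integrable lborel f"
    and zero: "\<phi> 0 = 0" "\<And>z. \<phi> z = 0 \<Longrightarrow> z = 0" "1 \<le> N"
    and mult: "\<exists>r>0. \<exists>g. continuous_on (ball 0 r) g \<and> (\<forall>z\<in>ball 0 r. (0::real) < g z) \<and> (\<forall>z\<in>ball 0 r - {0}. cmod (\<phi> z) / cmod z ^ N = g z)"
    and L2: "integrable lborel (\<lambda>z. (cmod (\<phi> z))\<^sup>2)"
begin

sublocale planar_density f
  using f_int a_cont by unfold_locales (auto simp: f_def intro!: continuous_intros)

lemma circulation:
  assumes "x0 < x1" "y0 < y1"
  shows "integral {x0..x1} (\<lambda>x. a1 (Complex x y0)) - integral {x0..x1} (\<lambda>x. a1 (Complex x y1))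
      + integral {y0..y1} (\<lambda>y. a2 (Complex x1 y)) - integral {y0..y1} (\<lambda>y. a2 (Complex x0 y))
    = (\<integral>w. indicator (box (Complex x0 y0) (Complex x1 y1)) w * f w \<partial>lborel)"
proof -
  note c = continuous_on_compose2[OF a_cont(1)] continuous_on_compose2[OF a_cont(2)]
    continuous_on_compose2[OF a_cont(3)] continuous_on_compose2[OF a_cont(4)]
  have i: "integral {y0..y1} (\<lambda>y. a1y (Complex x y)) = a1 (Complex x y1) - a1 (Complex x y0)" for x
    by (intro integral_unique fundamental_theorem_of_calculus)
       (use assms da1 in \<open>auto simp: has_real_derivative_iff_has_vector_derivative intro: has_vector_derivative_at_within\<close>)
  have j: "integral {x0..x1} (\<lambda>x. a2x (Complex x y)) = a2 (Complex x1 y) - a2 (Complex x0 y)" for y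
    by (intro integral_unique fundamental_theorem_of_calculus)
       (use assms da2 in \<open>auto simp: has_real_derivative_iff_has_vector_derivative intro: has_vector_derivative_at_within\<close>)
  have "(\<integral>w. indicator (box (Complex x0 y0) (Complex x1 y1)) w * f w \<partial>lborel)
      = integral {x0..x1} (\<lambda>x. integral {y0..y1} (\<lambda>y. a2x (Complex x y) - a1y (Complex x y)))"
    by (subst integral_box_complex[OF cont]) (simp add: f_def)
  also have "\<dots> = integral {x0..x1} (\<lambda>x. integral {y0..y1} (\<lambda>y. a2x (Complex x y)) - integral {y0..y1} (\<lambda>y. a1y (Complex x y)))"
    by (intro integral_cong Henstock_Kurzweil_Integration.integral_diff integrable_continuous_interval c continuous_intros) auto
  also have "\<dots> = integral {x0..x1} (\<lambda>x. integral {y0..y1} (\<lambda>y. a2x (Complex x y))) - integral {x0..x1} (\<lambda>x. integral {y0..y1} (\<lambda>y. a1y (Complex x y)))"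
    unfolding i
    by (intro Henstock_Kurzweil_Integration.integral_diff integrable_continuous_interval c continuous_intros
        integral_continuous_on_param[where 'b=real, unfolded cbox_interval])
       (auto simp: split_beta' intro!: c continuous_intros)
  also have "integral {x0..x1} (\<lambda>x. integral {y0..y1} (\<lambda>y. a2x (Complex x y))) = integral {y0..y1} (\<lambda>y. integral {x0..x1} (\<lambda>x. a2x (Complex x y)))"
  proof (rule integral_swap_continuous[of x0 y0 x1 y1 "\<lambda>x y. a2x (Complex x y)", unfolded cbox_interval])
    show "continuous_on {(x0, y0)..(x1, y1)} (\<lambda>(x, y). a2x (Complex x y))"
      by (auto simp: split_beta' intro!: c continuous_intros)
  qed
  also have "\<dots> = integral {y0..y1} (\<lambda>y. a2 (Complex x1 y)) - integral {y0..y1} (\<lambda>y. a2 (Complex x0 y))"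
    unfolding j by (intro Henstock_Kurzweil_Integration.integral_diff integrable_continuous_interval c continuous_intros) auto
  also have "integral {x0..x1} (\<lambda>x. integral {y0..y1} (\<lambda>y. a1y (Complex x y))) = integral {x0..x1} (\<lambda>x. a1 (Complex x y1)) - integral {x0..x1} (\<lambda>x. a1 (Complex x y0))"
    unfolding i by (intro Henstock_Kurzweil_Integration.integral_diff integrable_continuous_interval c continuous_intros) auto
  finally show ?thesis by simp
qed

text \<open>The imaginary part of \<open>cauchy_pot_rectpath\<close>: the form with coefficients Im
  C and Re C has curl 2 pi \<open>f\<close>. Comparison with \<open>circulation\<close> shows that
  the gauge field minus this form over 2 pi is closed.\<close>

lemma cauchy_pot_circulation:
  assumes "x0 < x1" "y0 < y1"
  shows "integral {x0..x1} (\<lambda>x. Im (cauchy_pot f (Complex x y0))) - integral {x0..x1} (\<lambda>x. Im (cauchy_pot f (Complex x y1)))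
      + integral {y0..y1} (\<lambda>y. Re (cauchy_pot f (Complex x1 y))) - integral {y0..y1} (\<lambda>y. Re (cauchy_pot f (Complex x0 y)))
    = 2 * pi * (\<integral>w. indicator (box (Complex x0 y0) (Complex x1 y1)) w * f w \<partial>lborel)"
proof -
  let ?C = "cauchy_pot f"
  note c = continuous_on_compose2[OF cauchy_pot_continuous]
  have h: "integral {x0..x1} (\<lambda>x. Im (?C (Complex x y))) = Im (integral {x0..x1} (\<lambda>x. ?C (Complex x y)))" for y
    by (rule integral_linear[OF _ bounded_linear_Im, unfolded o_def])
       (auto intro!: integrable_continuous_interval c continuous_intros)
  have v: "integral {y0..y1} (\<lambda>y. Re (?C (Complex x y))) = Re (integral {y0..y1} (\<lambda>y. ?C (Complex x y)))" for x
    by (rule integral_linear[OF _ bounded_linear_Re, unfolded o_def])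
       (auto intro!: integrable_continuous_interval c continuous_intros)
  have "contour_integral (rectpath (Complex x0 y0) (Complex x1 y1)) ?C
    = contour_integral (linepath (Complex x0 y0) (Complex x1 y0)) ?C + contour_integral (linepath (Complex x1 y0) (Complex x1 y1)) ?C
      - contour_integral (linepath (Complex x0 y1) (Complex x1 y1)) ?C - contour_integral (linepath (Complex x0 y0) (Complex x0 y1)) ?C"
    by (subst contour_integral_rectpath_join)
       (auto intro: continuous_on_subset[OF cauchy_pot_continuous]
         simp: contour_integral_reverse_linepath[of "Complex x1 y1" "Complex x0 y1"] contour_integral_reverse_linepath[of "Complex x0 y1" "Complex x0 y0"]
           continuous_on_subset[OF cauchy_pot_continuous])
  also have "\<dots> = integral {x0..x1} (\<lambda>x. ?C (Complex x y0)) + \<i> * integral {y0..y1} (\<lambda>y. ?C (Complex x1 y))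
      - integral {x0..x1} (\<lambda>x. ?C (Complex x y1)) - \<i> * integral {y0..y1} (\<lambda>y. ?C (Complex x0 y))"
    using assms by (simp add: contour_integral_linepath_horizontal contour_integral_linepath_same_Re)
  finally have "Im (contour_integral (rectpath (Complex x0 y0) (Complex x1 y1)) ?C)
     = Im (integral {x0..x1} (\<lambda>x. ?C (Complex x y0)) + \<i> * integral {y0..y1} (\<lambda>y. ?C (Complex x1 y))
      - integral {x0..x1} (\<lambda>x. ?C (Complex x y1)) - \<i> * integral {y0..y1} (\<lambda>y. ?C (Complex x0 y)))"
    by simp
  then show ?thesis
    using cauchy_pot_rectpath[of "Complex x0 y0" "Complex x1 y1"] assms by (simp add: h v)
qed

text \<open>A complex gauge transformation. Its phase \<open>\<theta>\<close> removes the closed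
  part of the gauge field, its modulus the part generated by the curvature. What is left of the
  self-dual equation says that \<open>\<phi> z * e z\<close> is antiholomorphic, so its conjugate
  \<open>F\<close> is entire.\<close>

lemma holomorphic_factor:
  obtains F where "F holomorphic_on UNIV" "\<And>z. cmod (F z) = cmod (\<phi> z) * exp (log_pot f z / (2 * pi))"
proof -
  let ?C = "cauchy_pot f"
  define b1 b2 where "b1 z = a1 z - Im (?C z) / (2 * pi)" and "b2 z = a2 z - Re (?C z) / (2 * pi)" for z
  have bc: "continuous_on UNIV b1" "continuous_on UNIV b2"
    unfolding b1_def b2_def by (intro continuous_intros a_cont cauchy_pot_continuous; simp)+
  note c = continuous_on_compose2[OF a_cont(1)] continuous_on_compose2[OF a_cont(2)] continuous_on_compose2[OF cauchy_pot_continuous]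
  have i1: "integral {u..v} (\<lambda>x. b1 (Complex x y)) = integral {u..v} (\<lambda>x. a1 (Complex x y)) - integral {u..v} (\<lambda>x. Im (?C (Complex x y))) / (2 * pi)" for u v y
    unfolding b1_def
    by (subst Henstock_Kurzweil_Integration.integral_diff) (auto intro!: integrable_continuous_interval c continuous_intros)
  have i2: "integral {u..v} (\<lambda>y. b2 (Complex x y)) = integral {u..v} (\<lambda>y. a2 (Complex x y)) - integral {u..v} (\<lambda>y. Re (?C (Complex x y))) / (2 * pi)" for u v x
    unfolding b2_def
    by (subst Henstock_Kurzweil_Integration.integral_diff) (auto intro!: integrable_continuous_interval c continuous_intros)
  obtain \<theta> where \<theta>: "\<And>z. (\<theta> has_derivative (\<lambda>h. Re h * b1 z + Im h * b2 z)) (at z)"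
  proof (rule closed_planar_form_exact[OF bc])
    fix x0 x1 y0 y1 :: real assume *: "x0 < x1" "y0 < y1"
    show "integral {x0..x1} (\<lambda>x. b1 (Complex x y0)) - integral {x0..x1} (\<lambda>x. b1 (Complex x y1))
      + integral {y0..y1} (\<lambda>y. b2 (Complex x1 y)) - integral {y0..y1} (\<lambda>y. b2 (Complex x0 y)) = 0"
    proof -
      let ?I = "\<integral>w. indicator (box (Complex x0 y0) (Complex x1 y1)) w * f w \<partial>lborel"
      have "(integral {x0..x1} (\<lambda>x. Im (?C (Complex x y0))) - integral {x0..x1} (\<lambda>x. Im (?C (Complex x y1)))
        + integral {y0..y1} (\<lambda>y. Re (?C (Complex x1 y))) - integral {y0..y1} (\<lambda>y. Re (?C (Complex x0 y)))) / (2 * pi) = ?I"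
        using cauchy_pot_circulation[OF *] by simp
      then show ?thesis
        unfolding i1 i2 using circulation[OF *] by (simp only: add_divide_distrib diff_divide_distrib)
    qed
  qed (use that in blast)
  define e where "e z = exp (of_real (log_pot f z / (2 * pi)) + \<i> * of_real (\<theta> z))" for z
  define F where "F z = cnj (\<phi> z * e z)" for z
  have "(F has_field_derivative cnj (e z * (\<phi>x z + \<phi> z * (of_real (Re (?C z) / (2 * pi)) + \<i> * of_real (b1 z))))) (at z)" for z
  proof -
    let ?p = "\<phi>x z + \<phi> z * (of_real (Re (?C z) / (2 * pi)) + \<i> * of_real (b1 z))"
    let ?q = "\<phi>y z + \<phi> z * (- of_real (Im (?C z) / (2 * pi)) + \<i> * of_real (b2 z))"
    \<comment> \<open>The potential contributes cnj C \<phi> / (2 pi) to \<open>?p\<close> and -i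
      times that to \<open>?q\<close>. These contributions cancel in \<open>?p - \<i> * ?q\<close>,
      which leaves the self-dual equation.\<close>
    have pq: "?q = - \<i> * ?p"
    proof -
      have "?p - \<i> * ?q = \<phi>x z + \<i> * a1 z * \<phi> z - \<i> * (\<phi>y z + \<i> * a2 z * \<phi> z)"
        by (simp add: b1_def b2_def algebra_simps)
      then have "?p = \<i> * ?q" using self_dual[of z] by simp
      then have "- \<i> * ?p = - \<i> * (\<i> * ?q)" by (rule arg_cong)
      then show ?thesis by (simp add: algebra_simps)
    qed
    have dl: "((\<lambda>z. log_pot f z / (2 * pi)) has_derivative (\<lambda>h. Re (?C z * h) / (2 * pi))) (at z)"
      using has_derivative_mult_right[OF log_pot_has_derivative, of "1 / (2 * pi)"] by simp
    have de: "((\<lambda>z. of_real (log_pot f z / (2 * pi)) + \<i> * of_real (\<theta> z)) has_derivative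
        (\<lambda>h. of_real (Re (?C z * h) / (2 * pi)) + \<i> * of_real (Re h * b1 z + Im h * b2 z))) (at z)"
      by (intro derivative_intros dl \<theta>)
    let ?dw = "\<lambda>h. of_real (Re (?C z * h) / (2 * pi)) + \<i> * of_real (Re h * b1 z + Im h * b2 z)"
    have "(exp has_derivative (*) (e z)) (at (of_real (log_pot f z / (2 * pi)) + \<i> * of_real (\<theta> z)))"
      unfolding e_def has_field_derivative_def[symmetric] by (rule DERIV_exp)
    from has_derivative_compose[OF de this]
    have "(e has_derivative (\<lambda>h. e z * ?dw h)) (at z)"
      by (simp add: e_def[abs_def])
    then have "((\<lambda>z. \<phi> z * e z) has_derivative (\<lambda>h. \<phi> z * (e z * ?dw h)
        + (of_real (Re h) * \<phi>x z + of_real (Im h) * \<phi>y z) * e z)) (at z)"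
      by (rule has_derivative_mult[OF d\<phi>])
    then have "(F has_derivative (\<lambda>h. cnj (\<phi> z * (e z * ?dw h)
        + (of_real (Re h) * \<phi>x z + of_real (Im h) * \<phi>y z) * e z))) (at z)"
      unfolding F_def by (rule has_derivative_cnj)
    note D = this
    have alg: "e z * (u * p + v * (- \<i> * p)) = e z * p * (u - \<i> * v)" for u v p
      by (simp add: algebra_simps)
    have E: "\<phi> z * (e z * ?dw h)
        + (of_real (Re h) * \<phi>x z + of_real (Im h) * \<phi>y z) * e z = e z * ?p * cnj h" for h
    proof -
      have "\<phi> z * (e z * ?dw h)
        + (of_real (Re h) * \<phi>x z + of_real (Im h) * \<phi>y z) * e z = e z * (of_real (Re h) * ?p + of_real (Im h) * ?q)"
        by (simp add: algebra_simps diff_divide_distrib)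
      also have "\<dots> = e z * ?p * (of_real (Re h) - \<i> * of_real (Im h))"
        unfolding pq by (rule alg)
      also have "of_real (Re h) - \<i> * of_real (Im h) = cnj h" by (simp add: complex_eq_iff)
      finally show ?thesis .
    qed
    have "(\<lambda>h. cnj (e z * ?p * cnj h)) = (*) (cnj (e z * ?p))"
      by (simp only: complex_cnj_mult complex_cnj_cnj)
    with D show ?thesis unfolding has_field_derivative_def E by simp
  qed
  then have "F holomorphic_on UNIV"
    by (auto simp: holomorphic_on_def field_differentiable_def intro: has_field_derivative_at_within)
  moreover have "cmod (F z) = cmod (\<phi> z) * exp (log_pot f z / (2 * pi))" for z
    by (simp add: F_def e_def norm_mult)
  ultimately show ?thesis by (rule that)
qed

text \<open>The multiplicity hypothesis bounds F / z^N near the origin, so the quotient extends to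
  an entire function. The positive limit of its modulus makes the extension nonzero at the origin
  too, and an entire function without zeros has a logarithm.\<close>

lemma holomorphic_log_factor:
  obtains k where "k holomorphic_on UNIV" "\<And>z. z \<noteq> 0 \<Longrightarrow> Re (k z) = ln (cmod (\<phi> z)) - N * ln (cmod z) + log_pot f z / (2 * pi)"
proof -
  obtain F where F: "F holomorphic_on UNIV" "\<And>z. cmod (F z) = cmod (\<phi> z) * exp (log_pot f z / (2 * pi))"
    using holomorphic_factor by blast
  obtain r g where r: "0 < r" and g: "continuous_on (ball 0 r) g" "\<And>z. z \<in> ball 0 r \<Longrightarrow> (0::real) < g z"
      "\<And>z. z \<in> ball 0 r - {0} \<Longrightarrow> cmod (\<phi> z) / cmod z ^ N = g z"
    using mult by metis
  define G where "G z = g z * exp (log_pot f z / (2 * pi))" for z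
  have Gc: "isCont G 0"
    unfolding G_def using g(1) r log_pot_continuous
    by (intro continuous_intros) (auto simp: continuous_on_eq_continuous_at)
  have near: "\<forall>\<^sub>F z in at 0. cmod (F z / z ^ N) = G z"
    unfolding eventually_at using r g(3)
    by (intro exI[of _ r]) (auto simp: F(2) norm_divide norm_power G_def dist_norm field_simps)
  have lim: "((\<lambda>z. cmod (F z / z ^ N)) \<longlongrightarrow> G 0) (at 0)"
    using Gc near by (auto simp: isCont_def intro: tendsto_cong[THEN iffD2])
  have "\<forall>\<^sub>F z in at 0. cmod (F z / z ^ N) < G 0 + 1"
    using lim by (rule order_tendstoD) simp
  then have "\<exists>B. \<forall>\<^sub>F z in at 0. cmod (F z / z ^ N) \<le> B"
    by (intro exI[of _ "G 0 + 1"]) (auto elim: eventually_mono)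
  moreover have "(\<lambda>z. F z / z ^ N) holomorphic_on (UNIV - {0})"
    using F(1) by (intro holomorphic_intros) (auto intro: holomorphic_on_subset)
  ultimately obtain K where K: "K holomorphic_on UNIV" "\<And>z. z \<noteq> 0 \<Longrightarrow> K z = F z / z ^ N"
    using holomorphic_on_extend_bounded[of "\<lambda>z. F z / z ^ N" UNIV 0] by auto
  have "((\<lambda>z. cmod (K z)) \<longlongrightarrow> G 0) (at 0)"
    by (rule Lim_transform_eventually[OF lim]) (auto simp: eventually_at K(2) intro!: exI[of _ 1])
  moreover have "((\<lambda>z. cmod (K z)) \<longlongrightarrow> cmod (K 0)) (at 0)"
    using holomorphic_on_imp_continuous_on[OF K(1)]
    by (auto simp: continuous_on_eq_continuous_at isCont_def intro: tendsto_norm)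
  ultimately have "cmod (K 0) = G 0" using tendsto_unique[OF at_neq_bot] by blast
  moreover have "0 < G 0" using g(2)[of 0] r by (simp add: G_def)
  ultimately have "K 0 \<noteq> 0" by auto
  moreover have "K z \<noteq> 0" if "z \<noteq> 0" for z
  proof -
    have "F z \<noteq> 0" using F(2)[of z] zero(2)[of z] that by auto
    then show ?thesis using K(2)[OF that] that by simp
  qed
  ultimately have nz: "K z \<noteq> 0" for z by (cases "z = 0") auto
  obtain k where k: "k holomorphic_on UNIV" "\<And>z. exp (k z) = K z"
    using holomorphic_logarithm_exists[OF convex_UNIV open_UNIV K(1) nz, of 0] by auto
  have "Re (k z) = ln (cmod (\<phi> z)) - N * ln (cmod z) + log_pot f z / (2 * pi)" if z: "z \<noteq> 0" for z
  proof -
    have "exp (Re (k z)) = cmod (K z)" using k(2)[of z] by (metis norm_exp_eq_Re)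
    also have "\<dots> = cmod (\<phi> z) * exp (log_pot f z / (2 * pi)) / cmod z ^ N"
      using K(2)[OF z] F(2)[of z] by (simp add: norm_divide norm_power)
    finally have "Re (k z) = ln (cmod (\<phi> z) * exp (log_pot f z / (2 * pi)) / cmod z ^ N)" by (metis ln_exp)
    then show ?thesis using z zero(2)[of z] by (auto simp: ln_div ln_mult_pos ln_realpow)
  qed
  with k(1) show ?thesis by (rule that)
qed

text \<open>The entire logarithm has constant real part. Integrability of |\<phi>|^2 bounds ln
  |\<phi>| from above only, through ln t \<le> t^2; hence the one-sided form of
  \<open>entire_Re_const\<close>.\<close>

theorem modulus_representation:
  obtains C where "0 < C" "\<And>z. cmod (\<phi> z) = C * cmod z ^ N * exp (- log_pot f z / (2 * pi))"
proof -
  obtain k where k: "k holomorphic_on UNIV"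
    "\<And>z. z \<noteq> 0 \<Longrightarrow> Re (k z) = ln (cmod (\<phi> z)) - N * ln (cmod z) + log_pot f z / (2 * pi)"
    using holomorphic_log_factor by blast
  define h where "h z = Re (k z)" for z
  have hc: "continuous_on UNIV h" unfolding h_def using k(1) by (intro continuous_intros holomorphic_on_imp_continuous_on)
  define I where "I = (\<integral>z. (cmod (\<phi> z))\<^sup>2 \<partial>lborel)"
  have I0: "0 \<le> I" by (simp add: I_def)
  \<comment> \<open>The summands collect the energy, the pole of -N ln |z| and the potential, each
    compared with R^2 (1 + ln R) for R at least one.\<close>
  define C where "C = I + 4 * pi * N + L1 * 4"
  have bound: "(\<integral>z. indicator (cball 0 R) z * max 0 (h z) \<partial>lborel) \<le> C * R\<^sup>2 * (1 + ln R)" if R: "1 \<le> R" for R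
  proof -
    let ?B = "ball (0::complex) (R + 1)"
    have ih: "integrable lborel (\<lambda>z. indicator (cball 0 R) z * max 0 (h z))"
      by (intro integrable_indicator_cball continuous_intros hc)
    have iL: "integrable lborel (\<lambda>z. indicator (cball 0 R) z * \<bar>log_pot f z\<bar>)"
      by (intro integrable_indicator_cball continuous_intros log_pot_continuous)
    have iB: "integrable lborel (\<lambda>z. indicator ?B z / cmod (0 - z))"
      by (rule integrable_inverse_dist) (use R in simp)
    have "(\<integral>z. indicator (cball 0 R) z * max 0 (h z) \<partial>lborel) \<le>
      (\<integral>z. (cmod (\<phi> z))\<^sup>2 + N * (indicator ?B z / cmod (0 - z)) + indicator (cball 0 R) z * \<bar>log_pot f z\<bar> / (2 * pi) \<partial>lborel)"
    proof (rule integral_mono_AE)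
      show "integrable lborel (\<lambda>z. (cmod (\<phi> z))\<^sup>2 + N * (indicator ?B z / cmod (0 - z)) + indicator (cball 0 R) z * \<bar>log_pot f z\<bar> / (2 * pi))"
        by (intro Bochner_Integration.integrable_add L2 integrable_mult_right iB integrable_divide iL)
      have "AE z in lborel. z \<noteq> (0::complex)" by (rule AE_lborel_singleton)
      then show "AE z in lborel. indicator (cball 0 R) z * max 0 (h z) \<le> (cmod (\<phi> z))\<^sup>2 + N * (indicator ?B z / cmod (0 - z)) + indicator (cball 0 R) z * \<bar>log_pot f z\<bar> / (2 * pi)"
      proof eventually_elim
        case (elim z)
        have "\<phi> z \<noteq> 0" using zero(2) elim by auto
        then have "ln (cmod (\<phi> z)) \<le> cmod (\<phi> z) - 1" by (intro ln_le_minus_one) auto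
        also have "\<dots> \<le> (cmod (\<phi> z))\<^sup>2" using zero_le_power2[of "cmod (\<phi> z) - 1/2"] by (simp add: power2_eq_square algebra_simps)
        finally have 1: "ln (cmod (\<phi> z)) \<le> (cmod (\<phi> z))\<^sup>2" .
        have "ln (1 / cmod z) \<le> 1 / cmod z - 1" by (intro ln_le_minus_one) (use elim in auto)
        then have "- ln (cmod z) \<le> 1 / cmod z" using elim by (simp add: ln_div)
        then have "N * (- ln (cmod z)) \<le> N * (1 / cmod z)" by (intro mult_left_mono) auto
        then have 2: "- (N * ln (cmod z)) \<le> N * (1 / cmod z)" by simp
        have 3: "log_pot f z / (2 * pi) \<le> \<bar>log_pot f z\<bar> / (2 * pi)" by (intro divide_right_mono) auto
        have "h z \<le> (cmod (\<phi> z))\<^sup>2 + N * (1 / cmod z) + \<bar>log_pot f z\<bar> / (2 * pi)"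
          using 1 2 3 unfolding h_def k(2)[OF elim] by linarith
        moreover have "0 \<le> (cmod (\<phi> z))\<^sup>2 + N * (1 / cmod z) + \<bar>log_pot f z\<bar> / (2 * pi)"
          by (intro add_nonneg_nonneg) auto
        ultimately have "max 0 (h z) \<le> (cmod (\<phi> z))\<^sup>2 + N * (1 / cmod z) + \<bar>log_pot f z\<bar> / (2 * pi)" by simp
        then show ?case by (cases "z \<in> cball 0 R") (auto split: split_indicator)
      qed
    qed (rule ih)
    also have "\<dots> = I + N * (2 * pi * (R + 1)) + (\<integral>z. indicator (cball 0 R) z * \<bar>log_pot f z\<bar> \<partial>lborel) / (2 * pi)"
    proof -
      have "(\<integral>z. indicator ?B z / cmod (0 - z) \<partial>lborel) = 2 * pi * (R + 1)"
        by (rule integral_inverse_dist) (use R in simp)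
      then show ?thesis
        unfolding I_def
        by (simp only: Bochner_Integration.integral_add Bochner_Integration.integrable_add L2
            integrable_mult_right[OF iB] integrable_divide[OF iL] integral_mult_right_zero integral_divide_zero)
    qed
    also have "\<dots> \<le> I + N * (2 * pi * (R + 1)) + L1 * (ln (1 + R) * (pi * R\<^sup>2) + (2 * pi + pi * R\<^sup>2)) / (2 * pi)"
      using R by (intro add_left_mono divide_right_mono integral_cball_log_pot_le) auto
    also have "\<dots> \<le> C * R\<^sup>2 * (1 + ln R)"
    proof -
      have lnR: "0 \<le> ln R" using R by simp
      have l: "ln (1 + R) \<le> 1 + ln R"
      proof -
        have "ln (1 + R) \<le> ln (2 * R)" using R by (intro ln_mono) auto
        also have "\<dots> = ln 2 + ln R" using R by (intro ln_mult_pos) auto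
        also have "ln (2::real) \<le> 1" using ln_le_minus_one[of 2] by simp
        finally show ?thesis by simp
      qed
      define T where "T = R\<^sup>2 * (1 + ln R)"
      have R2: "1 \<le> R\<^sup>2" "R \<le> R\<^sup>2" using R self_le_power[of R 2] one_le_power[of R 2] by auto
      have R2T: "R\<^sup>2 \<le> T" unfolding T_def using lnR mult_left_mono[of 1 "1 + ln R" "R\<^sup>2"] by simp
      have T1: "1 \<le> T" using R2 R2T by linarith
      have "R + 1 \<le> 2 * T" using R2 R2T by linarith
      then have "N * (2 * pi * (R + 1)) \<le> N * (2 * pi * (2 * T))" by (intro mult_left_mono) auto
      moreover have "I * 1 \<le> I * T" using T1 I0 by (rule mult_left_mono)
      moreover have "L1 * (ln (1 + R) * (pi * R\<^sup>2) + (2 * pi + pi * R\<^sup>2)) / (2 * pi) = L1 * (ln (1 + R) * R\<^sup>2 / 2 + (1 + R\<^sup>2 / 2))"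
        by (simp add: field_simps)
      moreover have "L1 * (ln (1 + R) * R\<^sup>2 / 2 + (1 + R\<^sup>2 / 2)) \<le> L1 * (4 * T)"
      proof (rule mult_left_mono[OF _ L1_nonneg])
        have "ln (1 + R) * R\<^sup>2 \<le> T" unfolding T_def using l by (subst mult.commute) (intro mult_left_mono, auto)
        then show "ln (1 + R) * R\<^sup>2 / 2 + (1 + R\<^sup>2 / 2) \<le> 4 * T" using R2T T1 by linarith
      qed
      moreover have "C * R\<^sup>2 * (1 + ln R) = I * T + N * (2 * pi * (2 * T)) + L1 * (4 * T)"
        by (simp add: C_def T_def algebra_simps)
      ultimately show ?thesis by linarith
    qed
    finally show ?thesis .
  qed
  have const: "h z = h 0" for z
    by (rule entire_Re_const[OF k(1) h_def bound])
  have "cmod (\<phi> z) = exp (h 0) * cmod z ^ N * exp (- log_pot f z / (2 * pi))" for z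
  proof (cases "z = 0")
    case True
    then show ?thesis using zero by simp
  next
    case False
    then have nz: "\<phi> z \<noteq> 0" using zero(2) by auto
    have "ln (cmod (\<phi> z)) = h 0 + N * ln (cmod z) - log_pot f z / (2 * pi)"
      using const[of z] k(2)[OF False] unfolding h_def by simp
    then have "exp (ln (cmod (\<phi> z))) = exp (h 0) * exp (ln (cmod z)) ^ N * exp (- log_pot f z / (2 * pi))"
      by (simp only: exp_add exp_diff exp_of_nat_mult) (simp add: exp_minus field_simps)
    then show ?thesis using nz False by simp
  qed
  then show ?thesis using that[of "exp (h 0)"] by simp
qed

thm_deps modulus_representation

end

section \<open>Potentials at infinity and local exponential integrability\<close>

lemma integrable_inverse_power_norm:
  assumes p: "2 < p"
  shows "integrable lborel (\<lambda>z::complex. (1 + cmod z) powr (- p))"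
proof (rule integrableI_nonneg)
  have i1: "(\<integral>\<^sup>+s. ennreal (indicator {1..} s * s powr (-p/2)) \<partial>lborel) < \<infinity>"
  proof -
    have "((\<lambda>x. x powr (-p/2)) has_integral -(1 powr (-p/2 + 1)) / (-p/2 + 1)) {1..}"
      by (rule has_integral_powr_to_inf) (use p in auto)
    then have "((\<lambda>x. if x \<in> {1..} then x powr (-p/2) else 0) has_integral -(1 powr (-p/2 + 1)) / (-p/2 + 1)) UNIV"
      by (subst has_integral_restrict_UNIV)
    also have "(\<lambda>x. if x \<in> {1..} then x powr (-p/2) else 0) = (\<lambda>x. indicator {1..} x * x powr (-p/2))" by auto
    finally have "integral\<^sup>N lborel (\<lambda>s. indicator {1..} s * s powr (-p/2)) = ennreal (-(1 powr (-p/2 + 1)) / (-p/2 + 1))"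
      by (intro nn_integral_has_integral_lborel) auto
    then show ?thesis by simp
  qed
  have "(\<integral>\<^sup>+z. ennreal ((1 + cmod z) powr (-p)) \<partial>lborel) = (\<integral>\<^sup>+z. ennreal ((1 + sqrt ((cmod z)\<^sup>2)) powr (-p)) \<partial>lborel)"
    by simp
  also have "\<dots> = ennreal pi * (\<integral>\<^sup>+s. ennreal ((1 + sqrt s) powr (-p)) * indicator {0..} s \<partial>lborel)"
    by (rule nn_integral_cmod_square[where g="\<lambda>s. ennreal ((1 + sqrt s) powr (-p))"]) measurable
  also have "\<dots> \<le> ennreal pi * (\<integral>\<^sup>+s. indicator {0..1} s + ennreal (indicator {1..} s * s powr (-p/2)) \<partial>lborel)"
  proof (intro mult_left_mono nn_integral_mono)
    fix s :: real
    have 1: "(1 + sqrt s) powr (-p) \<le> 1" if "0 \<le> s"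
      using that p powr_mono2'[of "-p" 1 "1 + sqrt s"] by simp
    have 2: "(1 + sqrt s) powr (-p) \<le> s powr (-p/2)" if "1 \<le> s"
    proof -
      have "(1 + sqrt s) powr (-p) \<le> sqrt s powr (-p)" using that p by (intro powr_mono2') auto
      also have "\<dots> = s powr (-p/2)" using that by (simp add: powr_half_sqrt[symmetric] powr_powr)
      finally show ?thesis .
    qed
    consider "s < 0" | "0 \<le> s" "s \<le> 1" | "1 < s" by linarith
    then show "ennreal ((1 + sqrt s) powr (-p)) * indicator {0..} s \<le> indicator {0..1} s + ennreal (indicator {1..} s * s powr (-p/2))"
    proof cases
      case 2
      have "ennreal ((1 + sqrt s) powr (-p)) \<le> 1" using 1[OF 2(1)] ennreal_leI by fastforce
      then have "ennreal ((1 + sqrt s) powr (-p)) \<le> 1 + ennreal (indicator {1..} s * s powr (-p/2))"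
        by (rule order_trans) simp
      then show ?thesis using 2 by simp
    next
      case 3
      then show ?thesis using \<open>1 \<le> s \<Longrightarrow> _\<close> by (auto intro!: ennreal_leI)
    qed auto
  qed auto
  also have "\<dots> < \<infinity>"
    using i1 by (subst nn_integral_add) (auto simp: ennreal_mult_less_top)
  finally show "(\<integral>\<^sup>+z. ennreal ((1 + cmod z) powr (-p)) \<partial>(lborel :: complex measure)) < \<infinity>" .
qed auto

text \<open>For \<open>\<beta> \<le> 1\<close> the lower bound dominates c / |z|^2, whose integral
  over the annulus with |z|^2 between 1 and n is pi c ln n.\<close>

lemma not_integrable_inverse_square:
  fixes X :: "complex \<Rightarrow> real"
  assumes X: "integrable lborel X" "\<And>z. 0 \<le> X z"
    and c: "0 < c" "\<And>z. 1 \<le> cmod z \<Longrightarrow> c * cmod z powr (- 2 * \<beta>) \<le> X z"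
  shows "1 < \<beta>"
proof (rule ccontr)
  assume "\<not> 1 < \<beta>"
  define I where "I = (\<integral>z. X z \<partial>lborel)"
  have b: "pi * c * ln (real n) \<le> I" if n: "1 \<le> n" for n :: nat
  proof -
    have hi: "((\<lambda>s. 1 / s) has_integral ln (real n) - ln 1) {1..real n}"
      using n by (intro fundamental_theorem_of_calculus)
        (auto simp: has_real_derivative_iff_has_vector_derivative[symmetric] intro!: derivative_eq_intros)
    then have "((\<lambda>s. if s \<in> {1..real n} then 1 / s else 0) has_integral ln (real n)) UNIV"
      by (subst has_integral_restrict_UNIV) simp
    also have "(\<lambda>s. if s \<in> {1..real n} then 1 / s else 0) = (\<lambda>s. indicator {1..real n} s / s)" by auto
    finally have nn: "integral\<^sup>N lborel (\<lambda>s. indicator {1..real n} s / s) = ennreal (ln (real n))"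
      by (intro nn_integral_has_integral_lborel) (auto split: split_indicator)
    have "ennreal (pi * c * ln (real n)) = ennreal pi * (\<integral>\<^sup>+s. ennreal c * ennreal (indicator {1..real n} s / s) \<partial>lborel)"
      using n c(1) by (subst nn_integral_cmult) (auto simp: nn ennreal_mult[symmetric] mult.assoc)
    also have "\<dots> = ennreal pi * (\<integral>\<^sup>+s. ennreal (c * (indicator {1..real n} s / s)) * indicator {0..} s \<partial>lborel)"
      using c(1) by (intro arg_cong[where f="(*) (ennreal pi)"] nn_integral_cong) (auto simp: ennreal_mult'[symmetric] split: split_indicator)
    also have "\<dots> = (\<integral>\<^sup>+z. ennreal (c * (indicator {1..real n} ((cmod z)\<^sup>2) / (cmod z)\<^sup>2)) \<partial>(lborel :: complex measure))"
      by (rule nn_integral_cmod_square[where g="\<lambda>s. ennreal (c * (indicator {1..real n} s / s))", symmetric]) measurable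
    also have "\<dots> \<le> (\<integral>\<^sup>+z. ennreal (X z) \<partial>lborel)"
    proof (intro nn_integral_mono ennreal_leI)
      fix z :: complex
      show "c * (indicator {1..real n} ((cmod z)\<^sup>2) / (cmod z)\<^sup>2) \<le> X z"
      proof (cases "1 \<le> (cmod z)\<^sup>2")
        case True
        then have z: "1 \<le> cmod z" by (metis one_power2 power2_le_imp_le norm_ge_zero)
        have "c * (indicator {1..real n} ((cmod z)\<^sup>2) / (cmod z)\<^sup>2) \<le> c * (1 / (cmod z)\<^sup>2)"
          using c(1) by (intro mult_left_mono divide_right_mono) (auto split: split_indicator)
        also have "\<dots> = c * cmod z powr (- 2)" using z by (simp add: powr_minus powr_numeral divide_inverse)
        also have "\<dots> \<le> c * cmod z powr (- 2 * \<beta>)"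
          using c(1) z \<open>\<not> 1 < \<beta>\<close> by (intro mult_left_mono powr_mono) auto
        finally show ?thesis using c(2)[OF z] by linarith
      qed (use X(2)[of z] in auto)
    qed
    also have "\<dots> = ennreal I" unfolding I_def by (rule nn_integral_eq_integral[OF X(1)]) (use X(2) in auto)
    finally show ?thesis using X(2) by (subst (asm) ennreal_le_iff) (auto simp: I_def)
  qed
  have "filterlim (\<lambda>n. pi * c * ln (real n)) at_top sequentially"
    using c(1) by real_asymp
  then have "\<forall>\<^sub>F n in sequentially. I + 1 \<le> pi * c * ln (real n)"
    by (simp add: filterlim_at_top)
  then obtain n where "1 \<le> n" "I + 1 \<le> pi * c * ln (real n)"
    using eventually_conj[OF _ eventually_ge_at_top[of "1::nat"]] by (metis (mono_tags, lifting) eventually_happens' sequentially_bot)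
  with b[of n] show False by simp
qed

text \<open>What remains of the kernel of \<open>log_pot\<close> after its leading term ln |z|, with
  the opposite sign. Thanks to the term \<open>ln (1 + cmod w)\<close> it is nonnegative for |z| at
  least one, so signs of densities carry over to tails.\<close>

definition tail_kernel :: "complex \<Rightarrow> complex \<Rightarrow> real" where
  "tail_kernel z w = ln (cmod z) + ln (1 + cmod w) - ln (cmod (z - w))"

definition tail_pot :: "(complex \<Rightarrow> real) \<Rightarrow> complex \<Rightarrow> real" where
  "tail_pot f z = (\<integral>w. tail_kernel z w * f w \<partial>lborel)"

lemma tail_kernel_measurable [measurable]: "tail_kernel z \<in> borel_measurable borel"
  unfolding tail_kernel_def by measurable

lemma tail_kernel_nonneg:
  assumes "1 \<le> cmod z" "w \<noteq> z"
  shows "0 \<le> tail_kernel z w"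
proof -
  have "cmod (z - w) \<le> cmod z + cmod w" by (rule norm_triangle_ineq4)
  also have "\<dots> \<le> cmod z + cmod z * cmod w"
    using mult_right_mono[OF assms(1), of "cmod w"] by simp
  finally have "ln (cmod (z - w)) \<le> ln (cmod z * (1 + cmod w))"
    using assms by (intro ln_mono) (auto simp: algebra_simps)
  also have "\<dots> = ln (cmod z) + ln (1 + cmod w)"
    using assms by (intro ln_mult_pos) (auto intro: less_le_trans add_pos_nonneg)
  finally show ?thesis by (simp add: tail_kernel_def)
qed

lemma tail_kernel_le:
  assumes "z \<noteq> 0" "w \<noteq> z"
  shows "tail_kernel z w \<le> 2 * ln (1 + cmod w) + 1 / cmod (z - w)"
proof -
  have *: "0 < cmod (z - w)" "0 < cmod z" using assms by auto
  have "cmod z \<le> cmod (z - w) + cmod w" by (metis norm_triangle_sub add.commute)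
  also have "\<dots> \<le> cmod (z - w) * ((1 + cmod w) * (1 + 1 / cmod (z - w)))"
    using * by (simp add: field_simps)
  finally have "ln (cmod z) \<le> ln (cmod (z - w) * ((1 + cmod w) * (1 + 1 / cmod (z - w))))"
    using * by (intro ln_mono) (auto intro!: mult_pos_pos add_pos_nonneg)
  also have "\<dots> = ln (cmod (z - w)) + (ln (1 + cmod w) + ln (1 + 1 / cmod (z - w)))"
    using * by (subst ln_mult_pos, simp, (auto intro!: mult_pos_pos add_pos_nonneg)[1], subst ln_mult_pos) (auto intro!: add_pos_nonneg)
  also have "ln (1 + 1 / cmod (z - w)) \<le> 1 / cmod (z - w)" by (intro ln_add_one_self_le_self) auto
  finally show ?thesis by (simp add: tail_kernel_def)
qed

lemma eventually_at_infinity_cmod_ge: "\<forall>\<^sub>F z in at_infinity. R \<le> cmod z"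
  unfolding eventually_at_infinity by auto

context planar_density begin

lemma integrable_tail_kernel: "integrable lborel (\<lambda>w. tail_kernel z w * f w)"
proof -
  have "integrable lborel (\<lambda>w. ln (cmod z) * f w - (ln (cmod (z - w)) - ln (1 + cmod w)) * f w)"
    by (intro Bochner_Integration.integrable_diff integrable_mult_right int integrable_log_kernel)
  then show ?thesis by (simp add: tail_kernel_def algebra_simps)
qed

lemma log_pot_eq_tail: "log_pot f z = ln (cmod z) * (\<integral>w. f w \<partial>lborel) - tail_pot f z"
proof -
  have "tail_pot f z = (\<integral>w. ln (cmod z) * f w - (ln (cmod (z - w)) - ln (1 + cmod w)) * f w \<partial>lborel)"
    unfolding tail_pot_def by (intro Bochner_Integration.integral_cong) (auto simp: tail_kernel_def algebra_simps)
  also have "\<dots> = ln (cmod z) * (\<integral>w. f w \<partial>lborel) - log_pot f z"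
    unfolding log_pot_def
    by (subst Bochner_Integration.integral_diff) (auto intro!: int integrable_log_kernel)
  finally show ?thesis by simp
qed

text \<open>A logarithmic moment turns the tail from o(ln |z|) into O(1). It becomes available only
  after some decay of the density has been established.\<close>

lemma tail_pot_bounded:
  assumes M: "\<And>w. \<bar>f w\<bar> \<le> M" and l: "integrable lborel (\<lambda>w. ln (1 + cmod w) * \<bar>f w\<bar>)"
  obtains B where "\<And>z. 1 \<le> cmod z \<Longrightarrow> \<bar>tail_pot f z\<bar> \<le> B"
proof -
  define B where "B = 2 * (\<integral>w. ln (1 + cmod w) * \<bar>f w\<bar> \<partial>lborel) + (2 * pi * M + L1)"
  have "\<bar>tail_pot f z\<bar> \<le> B" if z: "1 \<le> cmod z" for z
  proof -
    have "\<bar>tail_pot f z\<bar> \<le> (\<integral>w. \<bar>tail_kernel z w * f w\<bar> \<partial>lborel)"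
      unfolding tail_pot_def by (rule integral_abs_bound)
    also have "\<dots> \<le> (\<integral>w. 2 * (ln (1 + cmod w) * \<bar>f w\<bar>) + \<bar>f w\<bar> / cmod (z - w) \<partial>lborel)"
    proof (rule integral_mono_AE)
      show "integrable lborel (\<lambda>w. 2 * (ln (1 + cmod w) * \<bar>f w\<bar>) + \<bar>f w\<bar> / cmod (z - w))"
        by (intro Bochner_Integration.integrable_add integrable_mult_right l integrable_inverse_dist_density)
      have "AE w in lborel. w \<noteq> z" by (rule AE_lborel_singleton)
      then show "AE w in lborel. \<bar>tail_kernel z w * f w\<bar> \<le> 2 * (ln (1 + cmod w) * \<bar>f w\<bar>) + \<bar>f w\<bar> / cmod (z - w)"
      proof eventually_elim
        case (elim w)
        have "z \<noteq> 0" using z by auto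
        have "\<bar>tail_kernel z w * f w\<bar> \<le> (2 * ln (1 + cmod w) + 1 / cmod (z - w)) * \<bar>f w\<bar>"
          unfolding abs_mult
          using tail_kernel_nonneg[OF z elim] tail_kernel_le[OF \<open>z \<noteq> 0\<close> elim] by (intro mult_right_mono) auto
        then show ?case by (simp add: algebra_simps)
      qed
    qed (intro integrable_abs integrable_tail_kernel)
    also have "\<dots> = 2 * (\<integral>w. ln (1 + cmod w) * \<bar>f w\<bar> \<partial>lborel) + (\<integral>w. \<bar>f w\<bar> / cmod (z - w) \<partial>lborel)"
      by (simp only: Bochner_Integration.integral_add integrable_mult_right[OF l] integrable_inverse_dist_density integral_mult_right_zero)
    also have "\<dots> \<le> B"
      unfolding B_def using M by (intro add_left_mono inverse_dist_bound(2)) auto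
    finally show ?thesis .
  qed
  then show ?thesis by (rule that)
qed

text \<open>Split at distance |z|/2 from \<open>z\<close>. Within it |w| is at least |z|/2, so the
  density is at most 4 A / |z|^2 and the kernel has mass pi |z|; beyond it the kernel is at most 2 /
  |z|.\<close>

lemma cauchy_pot_decay:
  assumes A: "\<And>w. \<bar>f w\<bar> * (cmod w)\<^sup>2 \<le> A"
  shows "cmod (cauchy_pot f z) * cmod z \<le> 4 * pi * A + 2 * L1"
proof (cases "z = 0")
  case True
  have "0 \<le> A" using A[of 0] by simp
  then show ?thesis using True L1_nonneg by simp
next
  case False
  have A0: "0 \<le> A" using A[of 0] by simp
  let ?r = "cmod z / 2"
  have r: "0 < ?r" using False by simp
  have "cmod (cauchy_pot f z) \<le> (\<integral>w. \<bar>f w\<bar> / cmod (z - w) \<partial>lborel)"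
    by (rule norm_cauchy_pot_le)
  also have "\<dots> \<le> (\<integral>w. 4 * A / (cmod z)\<^sup>2 * (indicator (ball z ?r) w / cmod (z - w)) + 2 / cmod z * \<bar>f w\<bar> \<partial>lborel)"
  proof (rule integral_mono[OF integrable_inverse_dist_density])
    show "integrable lborel (\<lambda>w. 4 * A / (cmod z)\<^sup>2 * (indicator (ball z ?r) w / cmod (z - w)) + 2 / cmod z * \<bar>f w\<bar>)"
      using r by (intro Bochner_Integration.integrable_add integrable_mult_right integrable_inverse_dist int_abs) auto
    fix w
    show "\<bar>f w\<bar> / cmod (z - w) \<le> 4 * A / (cmod z)\<^sup>2 * (indicator (ball z ?r) w / cmod (z - w)) + 2 / cmod z * \<bar>f w\<bar>"
    proof (cases "w \<in> ball z ?r")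
      case True
      have "cmod z \<le> cmod (z - w) + cmod w" by (metis norm_triangle_sub add.commute)
      then have w: "cmod z \<le> 2 * cmod w" using True by (simp add: dist_norm)
      then have "(cmod z)\<^sup>2 \<le> (2 * cmod w)\<^sup>2" by (intro power_mono) auto
      then have "\<bar>f w\<bar> * (cmod z)\<^sup>2 \<le> \<bar>f w\<bar> * (4 * (cmod w)\<^sup>2)" by (intro mult_left_mono) (auto simp: power_mult_distrib)
      then have "\<bar>f w\<bar> \<le> 4 * A / (cmod z)\<^sup>2" using A[of w] False by (simp add: field_simps)
      then have "\<bar>f w\<bar> / cmod (z - w) \<le> 4 * A / (cmod z)\<^sup>2 * (1 / cmod (z - w))"
        unfolding times_divide_eq_right mult_1_right by (intro divide_right_mono) auto
      moreover have "0 \<le> 2 / cmod z * \<bar>f w\<bar>" by simp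
      ultimately have "\<bar>f w\<bar> / cmod (z - w) \<le> 4 * A / (cmod z)\<^sup>2 * (1 / cmod (z - w)) + 2 / cmod z * \<bar>f w\<bar>"
        by linarith
      then show ?thesis using True by (simp del: mem_ball)
    next
      case F: False
      then have "?r \<le> cmod (z - w)" by (simp add: dist_norm)
      moreover from this r have "0 < cmod (z - w)" by linarith
      ultimately have "\<bar>f w\<bar> / cmod (z - w) \<le> \<bar>f w\<bar> / ?r" using r by (intro divide_left_mono mult_pos_pos) auto
      then show ?thesis using F by (simp add: mult.commute del: mem_ball)
    qed
  qed
  also have "\<dots> = 4 * A / (cmod z)\<^sup>2 * (2 * pi * ?r) + 2 / cmod z * L1"
    unfolding L1_def using r
    by (subst Bochner_Integration.integral_add)
       (auto intro!: integrable_mult_right integrable_inverse_dist int_abs simp only: integral_mult_right_zero integral_inverse_dist less_imp_le)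
  also have "\<dots> = (4 * pi * A + 2 * L1) / cmod z"
    using False by (simp add: field_simps power2_eq_square)
  finally show ?thesis using False by (simp add: pos_le_divide_eq)
qed

end

locale planar_density_nonneg = planar_density +
  assumes nonneg: "\<And>w. 0 \<le> f w"
begin

lemma mass_eq: "(\<integral>w. f w \<partial>lborel) = L1"
  unfolding L1_def using nonneg by simp

lemma small_mass_near_infinity:
  assumes "0 < e"
  obtains \<rho> where "0 \<le> \<rho>" "(\<integral>w. indicator (- cball 0 \<rho>) w * f w \<partial>lborel) < e"
proof -
  have "(\<lambda>n. \<integral>w. indicator (- cball 0 (real n)) w * f w \<partial>lborel) \<longlonglongrightarrow> (\<integral>w. 0 \<partial>(lborel :: complex measure))"
  proof (rule integral_dominated_convergence[where w=f])
    show "AE w in lborel. (\<lambda>n. indicator (- cball 0 (real n)) w * f w) \<longlonglongrightarrow> 0"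
    proof (rule AE_I2)
      fix w :: complex
      have "\<forall>\<^sub>F n in sequentially. cmod w \<le> real n"
        using filterlim_real_sequentially by (simp add: filterlim_at_top)
      then have "\<forall>\<^sub>F n in sequentially. indicator (- cball 0 (real n)) w * f w = 0"
        by eventually_elim simp
      then show "(\<lambda>n. indicator (- cball 0 (real n)) w * f w) \<longlonglongrightarrow> 0" by (rule tendsto_eventually)
    qed
    show "AE w in lborel. norm (indicator (- cball 0 (real n)) w * f w) \<le> f w" for n
      using nonneg by (auto split: split_indicator)
  qed (use int in auto)
  then have "\<forall>\<^sub>F n in sequentially. (\<integral>w. indicator (- cball 0 (real n)) w * f w \<partial>lborel) < e"
    using assms by (intro order_tendstoD) auto
  then obtain n where "(\<integral>w. indicator (- cball 0 (real n)) w * f w \<partial>lborel) < e"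
    by (metis (mono_tags, lifting) eventually_happens' sequentially_bot)
  then show ?thesis by (intro that[of "real n"]) auto
qed

text \<open>The tangent line of the exponential at the mean replaces Jensen's inequality for the
  measure \<open>c f\<close>, whose total mass may be less than one.\<close>

lemma exp_integral_le:
  assumes g: "g \<in> borel_measurable borel" and gb: "\<And>w. 0 \<le> g w" "\<And>w. w \<noteq> z \<Longrightarrow> g w \<le> ln (1 + 1 / cmod (z - w))"
    and supp: "\<And>w. w \<notin> S \<Longrightarrow> g w = 0"
    and c: "0 \<le> c" "c * (\<integral>w. indicator S w * f w \<partial>lborel) \<le> 1" and S: "S \<in> sets borel"
  shows "exp (c * (\<integral>w. g w * f w \<partial>lborel)) \<le> 1 + c * (\<integral>w. \<bar>f w\<bar> / cmod (z - w) \<partial>lborel)"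
proof -
  define \<mu> where "\<mu> = c * (\<integral>w. indicator S w * f w \<partial>lborel)"
  define G where "G = c * (\<integral>w. g w * f w \<partial>lborel)"
  have i1: "integrable lborel (\<lambda>w. indicator S w * f w)"
    using integrable_mult_indicator[OF _ int, of S] S by simp
  have gle: "g w \<le> 1 / cmod (z - w)" if "w \<noteq> z" for w
    using gb(2)[OF that] ln_add_one_self_le_self[of "1 / cmod (z - w)"] by simp
  have i2: "integrable lborel (\<lambda>w. g w * f w)"
  proof (rule Bochner_Integration.integrable_bound[OF integrable_inverse_dist_density[of z]])
    show "(\<lambda>w. g w * f w) \<in> borel_measurable lborel" using g by measurable
    have "AE w in lborel. w \<noteq> z" by (rule AE_lborel_singleton)
    then show "AE w in lborel. norm (g w * f w) \<le> norm (\<bar>f w\<bar> / cmod (z - w))"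
    proof eventually_elim
      case (elim w)
      have "g w * f w \<le> 1 / cmod (z - w) * f w" using gle[OF elim] nonneg by (intro mult_right_mono) auto
      then show ?case using gb(1)[of w] nonneg[of w] by (simp add: abs_mult)
    qed
  qed
  \<comment> \<open>\<open>\<mu>\<close> is the mass of c f on \<open>S\<close> and \<open>G\<close>
    the exponent. The tangent inequality exp (g w) \<ge> exp G (1 + g w - G) is integrated against c
    f over \<open>S\<close>; since only \<open>\<mu> \<le> 1\<close> is known, the linear terms do
    not cancel as they would for a probability measure.\<close>
  have "exp G * (\<mu> + G - G * \<mu>) = (\<integral>w. exp G * (c * (indicator S w * f w) + c * (g w * f w) - G * (c * (indicator S w * f w))) \<partial>lborel)"
    unfolding \<mu>_def G_def
    by (subst integral_mult_right_zero, subst Bochner_Integration.integral_diff, intro Bochner_Integration.integrable_add integrable_mult_right i1 i2,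
        intro integrable_mult_right i1, subst Bochner_Integration.integral_add)
       (auto intro!: integrable_mult_right i1 i2)
  also have "\<dots> \<le> (\<integral>w. c * (indicator S w * f w) + c * (\<bar>f w\<bar> / cmod (z - w)) \<partial>lborel)"
  proof (rule integral_mono_AE)
    have "AE w in lborel. w \<noteq> z" by (rule AE_lborel_singleton)
    then show "AE w in lborel. exp G * (c * (indicator S w * f w) + c * (g w * f w) - G * (c * (indicator S w * f w))) \<le> c * (indicator S w * f w) + c * (\<bar>f w\<bar> / cmod (z - w))"
    proof eventually_elim
      case (elim w)
      show ?case
      proof (cases "w \<in> S")
        case True
        have "exp G * (1 + g w - G) \<le> exp G * exp (g w - G)"
          using exp_ge_add_one_self[of "g w - G"] by (intro mult_left_mono) (auto simp: add_diff_eq)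
        also have "\<dots> = exp (g w)" by (simp add: exp_diff)
        also have "\<dots> \<le> exp (ln (1 + 1 / cmod (z - w)))" using gb(2)[OF elim] by simp
        also have "\<dots> = 1 + 1 / cmod (z - w)" by (rule exp_ln) (auto intro: add_pos_nonneg)
        finally have "c * f w * (exp G * (1 + g w - G)) \<le> c * f w * (1 + 1 / cmod (z - w))"
          using c(1) nonneg by (intro mult_left_mono) auto
        then show ?thesis using True nonneg[of w] by (simp add: algebra_simps)
      next
        case False
        then show ?thesis using supp[OF False] c(1) by simp
      qed
    qed
  qed (intro integrable_mult_right Bochner_Integration.integrable_diff Bochner_Integration.integrable_add i1 i2 integrable_inverse_dist_density)+
  also have "\<dots> = \<mu> + c * (\<integral>w. \<bar>f w\<bar> / cmod (z - w) \<partial>lborel)"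
    unfolding \<mu>_def
    by (simp only: Bochner_Integration.integral_add integrable_mult_right i1 integrable_inverse_dist_density integral_mult_right_zero)
  finally have 1: "exp G * (\<mu> + G - G * \<mu>) \<le> \<mu> + c * (\<integral>w. \<bar>f w\<bar> / cmod (z - w) \<partial>lborel)" .
  \<comment> \<open>The missing mass \<open>1 - \<mu>\<close> is filled up with the value of the
    tangent line at 0, which lies below exp 0 = 1.\<close>
  have "exp G * (1 - G) \<le> exp G * exp (- G)"
    using exp_ge_add_one_self[of "- G"] by (intro mult_left_mono) auto
  then have "exp G * (1 - G) \<le> 1" by (simp add: exp_minus)
  then have "(1 - \<mu>) * (exp G * (1 - G)) \<le> (1 - \<mu>) * 1"
    using c(2) by (intro mult_left_mono) (auto simp: \<mu>_def)
  then have "exp G \<le> exp G * (\<mu> + G - G * \<mu>) + (1 - \<mu>)" by (simp add: algebra_simps)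
  with 1 show ?thesis unfolding G_def by linarith
qed

thm_deps exp_integral_le

end

lemma exp_real_mult_add: "exp (real M * (a + b) + c) = exp a ^ M * exp b ^ M * exp (c::real)"
proof -
  have 1: "exp (real M * (a + b) + c) = exp (real M * a) * exp (real M * b) * exp c"
    unfolding distrib_left exp_add by (rule refl)
  have 2: "exp (real M * d) = exp d ^ M" for d :: real by (rule exp_of_nat_mult)
  show ?thesis unfolding 1 2 by (rule refl)
qed

context planar_density_nonneg begin

text \<open>Four regions. For \<open>w\<close> in the fixed disc of radius \<open>\<rho>\<close> the
  kernel is bounded. Farther out it is O(ln |z|) as long as |z - w| is at least one, or at least
  |z|^(-m); there the small mass beyond \<open>\<rho>\<close> pays. Only in the tiny disc about
  \<open>z\<close> does the singularity count, and there the square of the density takes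
  over.\<close>

lemma tail_kernel_density_le:
  assumes z: "2 \<le> cmod z" "2 * \<rho> \<le> cmod z" and w: "w \<noteq> z" and \<rho>: "0 \<le> \<rho>"
  shows "tail_kernel z w * f w \<le> (ln (1 + \<rho>) + ln 2) * f w
    + (4 + real m) * ln (cmod z) * (indicator (- cball 0 \<rho>) w * f w)
    + (indicator (cball z 1) w * (f w)\<^sup>2) / (2 * cmod z ^ m)
    + cmod z ^ m * (indicator (ball z (1 / cmod z ^ m)) w / cmod (z - w))" (is "_ \<le> ?a + ?b + ?c + ?d")
proof -
  have zw: "0 < cmod (z - w)" using w by simp
  have z0: "0 < cmod z" using z by linarith
  have lnz: "0 \<le> ln (cmod z)" "ln 2 \<le> ln (cmod z)" using z by (auto intro: ln_ge_zero ln_mono)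
  have nn: "0 \<le> ?a" "0 \<le> ?b" "0 \<le> ?c" "0 \<le> ?d"
    using nonneg[of w] \<rho> lnz by (auto intro!: mult_nonneg_nonneg)
  show ?thesis
  proof (cases "cmod w \<le> \<rho>")
    case True
    have "cmod z \<le> 2 * cmod (z - w)" using norm_triangle_ineq2[of z w] True z by linarith
    then have "ln (cmod z) \<le> ln (2 * cmod (z - w))" using z0 by (intro ln_mono) auto
    also have "\<dots> = ln 2 + ln (cmod (z - w))" using zw by (intro ln_mult_pos) auto
    finally have 1: "ln (cmod z) \<le> ln 2 + ln (cmod (z - w))" .
    have "ln (1 + cmod w) \<le> ln (1 + \<rho>)" using True by (intro ln_mono) (auto simp: add_pos_nonneg)
    with 1 have "tail_kernel z w \<le> ln (1 + \<rho>) + ln 2" unfolding tail_kernel_def by linarith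
    then have "tail_kernel z w * f w \<le> ?a" using nonneg by (rule mult_right_mono)
    then show ?thesis using nn by linarith
  next
    case F: False
    then have b: "?b = (4 + real m) * ln (cmod z) * f w" by simp
    show ?thesis
    proof (cases "1 \<le> cmod (z - w)")
      case True
      have "tail_kernel z w \<le> 4 * ln (cmod z)"
      proof (cases "cmod w \<le> 2 * cmod z")
        case True
        have "1 + cmod w \<le> 1 + 2 * cmod z" using True by simp
        also have "\<dots> \<le> cmod z ^ 3"
        proof -
          have "4 * cmod z \<le> cmod z * cmod z * cmod z"
            using z by (intro mult_right_mono) (auto intro: mult_mono[of 2 "cmod z" 2 "cmod z", simplified])
          then show ?thesis using z unfolding power3_eq_cube by linarith
        qed
        finally have "ln (1 + cmod w) \<le> ln (cmod z ^ 3)" by (intro ln_mono) (auto simp: add_pos_nonneg)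
        also have "\<dots> = 3 * ln (cmod z)" using z0 by (simp add: ln_realpow)
        finally show ?thesis using ln_ge_zero[OF \<open>1 \<le> cmod (z - w)\<close>] by (simp add: tail_kernel_def)
      next
        case False
        have "cmod w \<le> 2 * cmod (z - w)" using norm_triangle_ineq2[of w z] False by (simp add: norm_minus_commute)
        then have "1 + cmod w \<le> cmod z * (2 * cmod (z - w))"
          using z \<open>1 \<le> cmod (z - w)\<close> mult_right_mono[of 2 "cmod z" "2 * cmod (z - w)"] by linarith
        then have "ln (1 + cmod w) \<le> ln (cmod z * (2 * cmod (z - w)))"
          by (intro ln_mono) (auto simp: add_pos_nonneg)
        also have "\<dots> = ln (cmod z) + (ln 2 + ln (cmod (z - w)))"
          using z0 zw by (simp add: ln_mult_pos)
        finally show ?thesis using lnz by (simp add: tail_kernel_def)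
      qed
      also have "\<dots> \<le> (4 + real m) * ln (cmod z)" using lnz by (intro mult_right_mono) auto
      finally have "tail_kernel z w * f w \<le> ?b" unfolding b using nonneg by (rule mult_right_mono)
      then show ?thesis using nn by linarith
    next
      case False
      define b where "b = - ln (cmod (z - w))"
      have b0: "0 \<le> b" using False zw by (simp add: b_def ln_le_zero_iff)
      have "1 + cmod w \<le> 2 + cmod z" using False norm_triangle_ineq2[of w z] by (simp add: norm_minus_commute)
      also have "\<dots> \<le> (cmod z)\<^sup>2"
        using mult_mono[of 2 "cmod z" "cmod z" "cmod z"] z unfolding power2_eq_square by linarith
      finally have "ln (1 + cmod w) \<le> ln ((cmod z)\<^sup>2)" by (intro ln_mono) (auto simp: add_pos_nonneg)
      also have "\<dots> = 2 * ln (cmod z)" using z0 by (simp add: ln_realpow)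
      finally have k: "tail_kernel z w \<le> 3 * ln (cmod z) + b" by (simp add: tail_kernel_def b_def)
      show ?thesis
      proof (cases "b \<le> real m * ln (cmod z)")
        case True
        then have "tail_kernel z w \<le> (4 + real m) * ln (cmod z)" using k lnz by (simp add: algebra_simps)
        then have "tail_kernel z w * f w \<le> ?b" unfolding b using nonneg by (rule mult_right_mono)
        then show ?thesis using nn by linarith
      next
        case B: False
        \<comment> \<open>In the disc of radius |z|^(-m) Young's inequality splits b f into f^2 / (2
          |z|^m) and b^2 |z|^m / 2. The first is controlled by a polynomial bound for local square
          integrals, the second by the kernel mass 2 pi |z|^(-m).\<close>
        let ?s = "cmod z ^ m"
        have s0: "0 < ?s" using z0 by simp
        have "ln (cmod (z - w)) < ln (1 / ?s)"
          using B z0 by (simp add: b_def ln_div ln_realpow)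
        then have ws: "w \<in> ball z (1 / ?s)" using zw s0 by (simp add: dist_norm)
        \<comment> \<open>\<open>b\<close> is minus the logarithm of the distance, so the quadratic
          Taylor bound of exp trades b^2 for the integrable 2 / |z - w|.\<close>
        have "b\<^sup>2 \<le> 2 * exp b" using exp_lower_Taylor_quadratic[OF b0] b0 by simp
        also have "exp b = 1 / cmod (z - w)" using zw by (simp add: b_def exp_minus inverse_eq_divide)
        finally have b2: "b\<^sup>2 \<le> 2 / cmod (z - w)" by simp
        have "0 \<le> (f w - b * ?s)\<^sup>2" by simp
        then have "2 * (b * f w) * ?s \<le> (f w)\<^sup>2 + b\<^sup>2 * ?s\<^sup>2" by (simp add: power2_eq_square algebra_simps)
        then have "b * f w \<le> ((f w)\<^sup>2 + b\<^sup>2 * ?s\<^sup>2) / (2 * ?s)" using s0 by (simp add: field_simps)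
        also have "\<dots> = (f w)\<^sup>2 / (2 * ?s) + b\<^sup>2 * ?s / 2"
          using z0 by (simp add: field_simps power2_eq_square)
        also have "b\<^sup>2 * ?s / 2 \<le> (2 / cmod (z - w)) * ?s / 2" using b2 s0 by (intro divide_right_mono mult_right_mono) auto
        finally have bf: "b * f w \<le> ?c + ?d" using ws False by (simp add: dist_norm mult.commute)
        have "tail_kernel z w * f w \<le> (3 * ln (cmod z) + b) * f w" using k nonneg by (rule mult_right_mono)
        also have "\<dots> = 3 * ln (cmod z) * f w + b * f w" by (simp add: algebra_simps)
        also have "3 * ln (cmod z) * f w \<le> ?b" unfolding b using lnz nonneg[of w] by (intro mult_right_mono) auto
        finally show ?thesis using bf nn by linarith
      qed
    qed
  qed
qed

text \<open>Any polynomial growth of the local square integrals is harmless: it only enlarges the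
  factor \<open>4 + real m\<close> in front of ln |z|, and that factor multiplies the mass outside a
  large disc, which can be made as small as desired.\<close>

lemma tail_pot_small:
  assumes sq: "\<forall>\<^sub>F z in at_infinity. (\<integral>w. indicator (cball z 1) w * (f w)\<^sup>2 \<partial>lborel) \<le> A * cmod z ^ m"
    and e: "0 < e"
  shows "\<forall>\<^sub>F z in at_infinity. tail_pot f z \<le> e * ln (cmod z)"
proof -
  obtain \<rho> where \<rho>: "0 \<le> \<rho>" "(\<integral>w. indicator (- cball 0 \<rho>) w * f w \<partial>lborel) < e / (2 * (4 + real m))"
    using small_mass_near_infinity[of "e / (2 * (4 + real m))"] e by auto
  define \<mu> where "\<mu> = (\<integral>w. indicator (- cball 0 \<rho>) w * f w \<partial>lborel)"
  define c where "c = (ln (1 + \<rho>) + ln 2) * L1 + A / 2 + 2 * pi"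
  have sq': "continuous_on UNIV (\<lambda>w. (f w)\<^sup>2)" by (intro continuous_intros cont)
  have "\<forall>\<^sub>F z in at_infinity. c \<le> e / 2 * ln (cmod z)"
  proof -
    have "filterlim (\<lambda>x. e / 2 * ln x) at_top at_top" using e by real_asymp
    then have "filterlim (\<lambda>z::complex. e / 2 * ln (cmod z)) at_top at_infinity"
      by (rule filterlim_compose) (rule filterlim_norm_at_top)
    then show ?thesis by (simp add: filterlim_at_top)
  qed
  then show ?thesis
    using sq eventually_at_infinity_cmod_ge[of "max 2 (2 * \<rho>)"]
  proof eventually_elim
    case (elim z)
    then have z: "2 \<le> cmod z" "2 * \<rho> \<le> cmod z" by auto
    let ?s = "cmod z ^ m"
    have "0 < cmod z" using z by linarith
    then have zn: "z \<noteq> 0" and s0: "0 < ?s" by auto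
    have lnz: "0 \<le> ln (cmod z)" using z by auto
    let ?a = "\<lambda>w. (ln (1 + \<rho>) + ln 2) * f w"
    let ?b = "\<lambda>w. (4 + real m) * ln (cmod z) * (indicator (- cball 0 \<rho>) w * f w)"
    let ?c = "\<lambda>w. (indicator (cball z 1) w * (f w)\<^sup>2) / (2 * ?s)"
    let ?d = "\<lambda>w. ?s * (indicator (ball z (1 / ?s)) w / cmod (z - w))"
    have ia: "integrable lborel ?a" by (intro integrable_mult_right int)
    have ib: "integrable lborel ?b"
      using integrable_mult_indicator[OF _ int, of "- cball 0 \<rho>"] by (intro integrable_mult_right) auto
    have ic: "integrable lborel ?c" by (intro integrable_divide integrable_indicator_cball sq')
    have id: "integrable lborel ?d" using s0 by (intro integrable_mult_right integrable_inverse_dist) auto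
    have "tail_pot f z \<le> (\<integral>w. ?a w + ?b w + ?c w + ?d w \<partial>lborel)"
      unfolding tail_pot_def
    proof (rule integral_mono_AE)
      have "AE w in lborel. w \<noteq> z" by (rule AE_lborel_singleton)
      then show "AE w in lborel. tail_kernel z w * f w \<le> ?a w + ?b w + ?c w + ?d w"
        by eventually_elim (rule tail_kernel_density_le[OF z _ \<rho>(1)])
    qed (intro integrable_tail_kernel Bochner_Integration.integrable_add ia ib ic id)+
    also have "\<dots> = (\<integral>w. ?a w \<partial>lborel) + (\<integral>w. ?b w \<partial>lborel) + (\<integral>w. ?c w \<partial>lborel) + (\<integral>w. ?d w \<partial>lborel)"
      by (simp only: Bochner_Integration.integral_add Bochner_Integration.integrable_add ia ib ic id)
    also have "(\<integral>w. ?a w \<partial>lborel) = (ln (1 + \<rho>) + ln 2) * L1" by (simp only: integral_mult_right_zero mass_eq)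
    also have "(\<integral>w. ?b w \<partial>lborel) = (4 + real m) * ln (cmod z) * \<mu>" by (simp only: integral_mult_right_zero \<mu>_def)
    also have "(\<integral>w. ?d w \<partial>lborel) = ?s * (2 * pi * (1 / ?s))" using s0 by (simp only: integral_mult_right_zero integral_inverse_dist less_imp_le zero_le_divide_1_iff)
    also have "\<dots> = 2 * pi" using zn by simp
    also have "(\<integral>w. ?c w \<partial>lborel) \<le> A * ?s / (2 * ?s)"
      unfolding integral_divide_zero using elim s0 by (intro divide_right_mono) auto
    also have "A * ?s / (2 * ?s) = A / 2" by (rule mult_divide_mult_cancel_right[OF less_imp_neq[OF s0, symmetric]])
    also have "(4 + real m) * ln (cmod z) * \<mu> \<le> (4 + real m) * ln (cmod z) * (e / (2 * (4 + real m)))"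
      using \<rho>(2) lnz by (intro mult_left_mono) (auto simp: \<mu>_def)
    also have "\<dots> = e / 2 * ln (cmod z)" by (simp add: field_simps)
    finally show "tail_pot f z \<le> e * ln (cmod z)" using elim unfolding c_def by linarith
  qed
qed

end

context planar_density begin

text \<open>The fourth power of \<open>X\<close> is a power of |z| times exp (-4 log_pot / pi). In a
  unit disc far out the singular part of this exponent comes from the positive part of
  \<open>f\<close> within distance 2, and exponential integrability applies to it. All other
  contributions are logarithmic in |x| and exponentiate to powers of |x|.\<close>

lemma fourth_power_average:
  fixes C :: real and N :: nat
  assumes C: "0 \<le> C" and X: "\<And>z. X z = C * cmod z ^ (2 * N) * exp (- log_pot f z / pi)"
  obtains A m where "\<forall>\<^sub>F x in at_infinity. (\<integral>z. indicator (cball x 1) z * X z ^ 4 \<partial>lborel) \<le> A * cmod x ^ m"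
proof -
  define fp where "fp w = max 0 (f w)" for w
  interpret p: planar_density_nonneg fp
  proof
    show "continuous_on UNIV fp" unfolding fp_def by (intro continuous_intros cont)
    show "integrable lborel fp" unfolding fp_def using int by (auto simp: max.commute)
    show "0 \<le> fp w" for w by (simp add: fp_def)
  qed
  \<comment> \<open>The exponent carries the factor 4/pi, and \<open>exp_integral_le\<close> asks
    for weighted mass at most one; hence the threshold pi/4.\<close>
  obtain \<rho> where \<rho>: "0 \<le> \<rho>" "(\<integral>w. indicator (- cball 0 \<rho>) w * fp w \<partial>lborel) < pi / 4"
    using p.small_mass_near_infinity[of "pi / 4"] by auto
  \<comment> \<open>Rounding up makes the growth caused by the total mass an integer power of
    |x|.\<close>
  obtain M :: nat where M: "4 * L1 / pi \<le> real M" using real_arch_simple by blast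
  have Xc: "continuous_on UNIV (\<lambda>z. X z ^ 4)"
    unfolding X by (intro continuous_intros log_pot_continuous) auto
  let ?m = "8 * N + M"
  define A where "A = C ^ 4 * 2 ^ M * 2 ^ ?m * (pi + 4 / pi * (p.L1 * (2 * pi + pi)))"
  have "\<forall>\<^sub>F x in at_infinity. (\<integral>z. indicator (cball x 1) z * X z ^ 4 \<partial>lborel) \<le> A * cmod x ^ ?m"
    using eventually_at_infinity_cmod_ge[of "\<rho> + 2"]
  proof eventually_elim
    case (elim x)
    have x2: "2 \<le> cmod x" using elim \<rho>(1) by linarith
    define P where "P = C ^ 4 * 2 ^ M * (2 * cmod x) ^ ?m"
    have P0: "0 \<le> P" using C by (simp add: P_def)
    have sub: "ball x 2 \<subseteq> - cball 0 \<rho>"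
    proof
      fix w assume "w \<in> ball x 2"
      then have "cmod x - cmod w < 2" using norm_triangle_ineq2[of x w] by (simp add: dist_norm)
      then show "w \<in> - cball 0 \<rho>" using elim by simp
    qed
    have mass: "4 / pi * (\<integral>w. indicator (ball x 2) w * fp w \<partial>lborel) \<le> 1"
    proof -
      have ii: "integrable lborel (\<lambda>w. indicator S w * fp w)" if "S \<in> sets borel" for S
        using integrable_mult_indicator[OF _ p.int, of S] that by simp
      have "(\<integral>w. indicator (ball x 2) w * fp w \<partial>lborel) \<le> (\<integral>w. indicator (- cball 0 \<rho>) w * fp w \<partial>lborel)"
        using sub p.nonneg by (intro integral_mono ii) (auto split: split_indicator)
      then have "(\<integral>w. indicator (ball x 2) w * fp w \<partial>lborel) \<le> pi / 4" using \<rho>(2) by linarith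
      then show ?thesis using mult_left_mono[of _ "pi / 4" "4 / pi"] by fastforce
    qed
    have ptw: "X z ^ 4 \<le> P * (1 + 4 / pi * (\<integral>w. \<bar>fp w\<bar> / cmod (z - w) \<partial>lborel))" if z: "z \<in> cball x 1" for z
    proof -
      \<comment> \<open>The radius 2 about \<open>x\<close> keeps every \<open>w\<close> outside at
        distance at least one from every \<open>z\<close> in the unit disc about \<open>x\<close>;
        there the logarithm is at most ln 2.\<close>
      define g where "g w = indicator (ball x 2) w * ln (1 + 1 / cmod (z - w))" for w
      have gm [measurable]: "g \<in> borel_measurable borel" unfolding g_def by measurable
      have gb: "0 \<le> g w" for w by (auto simp: g_def split: split_indicator intro!: ln_ge_zero)
      have gb2: "w \<noteq> z \<Longrightarrow> g w \<le> ln (1 + 1 / cmod (z - w))" for w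
        by (auto simp: g_def split: split_indicator intro!: ln_ge_zero)
      have E: "exp (4 / pi * (\<integral>w. g w * fp w \<partial>lborel)) \<le> 1 + 4 / pi * (\<integral>w. \<bar>fp w\<bar> / cmod (z - w) \<partial>lborel)"
        by (rule p.exp_integral_le[OF gm gb gb2 _ _ mass]) (auto simp: g_def)
      have ig: "integrable lborel (\<lambda>w. g w * fp w)"
      proof (rule Bochner_Integration.integrable_bound[OF p.integrable_inverse_dist_density[of z]])
        have "AE w in lborel. w \<noteq> z" by (rule AE_lborel_singleton)
        then show "AE w in lborel. norm (g w * fp w) \<le> norm (\<bar>fp w\<bar> / cmod (z - w))"
        proof eventually_elim
          case (elim w)
          have "g w \<le> 1 / cmod (z - w)"
            using gb2[OF elim] ln_add_one_self_le_self[of "1 / cmod (z - w)"] by simp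
          then have "g w * fp w \<le> 1 / cmod (z - w) * fp w" using p.nonneg by (intro mult_right_mono) auto
          then show ?case using gb[of w] p.nonneg[of w] by (simp add: abs_mult)
        qed
      qed measurable
      have "- log_pot f z = (\<integral>w. - ((ln (cmod (z - w)) - ln (1 + cmod w)) * f w) \<partial>lborel)"
        by (simp add: log_pot_def)
      also have "\<dots> \<le> (\<integral>w. (ln (1 + cmod z) + ln 2) * \<bar>f w\<bar> + g w * fp w \<partial>lborel)"
      proof (rule integral_mono_AE)
        have "AE w in lborel. w \<noteq> z" by (rule AE_lborel_singleton)
        then show "AE w in lborel. - ((ln (cmod (z - w)) - ln (1 + cmod w)) * f w) \<le> (ln (1 + cmod z) + ln 2) * \<bar>f w\<bar> + g w * fp w"
        proof eventually_elim
          case (elim w)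
          show ?case
          proof (cases "0 \<le> f w")
            case True
            have "ln (1 + 1 / cmod (z - w)) \<le> ln 2 + g w"
            proof (cases "w \<in> ball x 2")
              case False
              have "1 \<le> cmod (z - w)"
                using False z norm_triangle_ineq[of "x - z" "z - w"] by (simp add: dist_norm)
              then have "1 + 1 / cmod (z - w) \<le> 2" by (simp add: divide_le_eq)
              then have "ln (1 + 1 / cmod (z - w)) \<le> ln 2" by (intro ln_mono) (auto intro: add_pos_nonneg)
              then show ?thesis using False by (simp add: g_def)
            qed (simp add: g_def)
            then have "- (ln (cmod (z - w)) - ln (1 + cmod w)) \<le> ln (1 + cmod z) + ln 2 + g w"
              using log_kernel_ge[OF elim] by linarith
            then have "- (ln (cmod (z - w)) - ln (1 + cmod w)) * f w \<le> (ln (1 + cmod z) + ln 2 + g w) * f w"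
              using True by (rule mult_right_mono)
            then show ?thesis using True by (simp add: fp_def algebra_simps)
          next
            case False
            have "(ln (cmod (z - w)) - ln (1 + cmod w)) * (- f w) \<le> (ln (1 + cmod z) + ln 2) * (- f w)"
            proof (rule mult_right_mono)
              show "ln (cmod (z - w)) - ln (1 + cmod w) \<le> ln (1 + cmod z) + ln 2"
                using log_kernel_le[OF elim] ln_gt_zero[of "2::real"] by linarith
            qed (use False in simp)
            then show ?thesis using False by (simp add: fp_def)
          qed
        qed
      qed (intro integrable_minus integrable_log_kernel Bochner_Integration.integrable_add integrable_mult_right int_abs ig)+
      also have "\<dots> = (ln (1 + cmod z) + ln 2) * L1 + (\<integral>w. g w * fp w \<partial>lborel)"
        unfolding L1_def
        by (simp only: Bochner_Integration.integral_add integrable_mult_right int_abs ig integral_mult_right_zero)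
      finally have L: "- log_pot f z \<le> (ln (1 + cmod z) + ln 2) * L1 + (\<integral>w. g w * fp w \<partial>lborel)" .
      have zx: "cmod z \<le> 2 * cmod x" "1 + cmod z \<le> 2 * cmod x"
        using z x2 norm_triangle_ineq2[of z x] by (auto simp: dist_norm norm_minus_commute)
      have "4 * (- log_pot f z / pi) \<le> 4 * (((ln (1 + cmod z) + ln 2) * L1 + (\<integral>w. g w * fp w \<partial>lborel)) / pi)"
        using L by (intro mult_left_mono divide_right_mono) auto
      also have "\<dots> = (4 * L1 / pi) * (ln (1 + cmod z) + ln 2) + 4 / pi * (\<integral>w. g w * fp w \<partial>lborel)"
        by (simp add: field_simps)
      also have "(4 * L1 / pi) * (ln (1 + cmod z) + ln 2) \<le> real M * (ln (2 * cmod x) + ln 2)"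
        using M zx L1_nonneg x2 by (intro mult_mono add_mono ln_mono) (auto intro!: add_nonneg_nonneg ln_ge_zero add_pos_nonneg)
      finally have "exp (4 * (- log_pot f z / pi)) \<le> exp (real M * (ln (2 * cmod x) + ln 2) + 4 / pi * (\<integral>w. g w * fp w \<partial>lborel))"
        by simp
      also have "\<dots> = (2 * cmod x) ^ M * 2 ^ M * exp (4 / pi * (\<integral>w. g w * fp w \<partial>lborel))"
      proof -
        have 1: "exp (ln (2 * cmod x)) = 2 * cmod x" using x2 by (intro exp_ln) linarith
        have 2: "exp (ln (2::real)) = 2" by (rule exp_ln) simp
        show ?thesis unfolding exp_real_mult_add 1 2 by (rule refl)
      qed
      also have "\<dots> \<le> (2 * cmod x) ^ M * 2 ^ M * (1 + 4 / pi * (\<integral>w. \<bar>fp w\<bar> / cmod (z - w) \<partial>lborel))"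
        using E by (intro mult_left_mono) auto
      finally have e4: "exp (4 * (- log_pot f z / pi)) \<le> (2 * cmod x) ^ M * 2 ^ M * (1 + 4 / pi * (\<integral>w. \<bar>fp w\<bar> / cmod (z - w) \<partial>lborel))" .
      have "X z ^ 4 = C ^ 4 * cmod z ^ (8 * N) * exp (4 * (- log_pot f z / pi))"
      proof -
        have "exp (- log_pot f z / pi) ^ 4 = exp (4 * (- log_pot f z / pi))" by (simp add: exp_of_nat_mult[of 4, simplified, symmetric])
        then show ?thesis unfolding X power_mult_distrib by (simp add: power_mult[symmetric] mult.commute)
      qed
      also have "\<dots> \<le> C ^ 4 * (2 * cmod x) ^ (8 * N) * ((2 * cmod x) ^ M * 2 ^ M * (1 + 4 / pi * (\<integral>w. \<bar>fp w\<bar> / cmod (z - w) \<partial>lborel)))"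
        using e4 zx C by (intro mult_mono power_mono) auto
      also have "\<dots> = P * (1 + 4 / pi * (\<integral>w. \<bar>fp w\<bar> / cmod (z - w) \<partial>lborel))"
        by (simp add: P_def power_add)
      finally show ?thesis .
    qed
    have i: "integrable lborel (\<lambda>z. indicator (cball x 1) z * X z ^ 4)"
      by (rule integrable_indicator_cball[OF Xc])
    let ?J = "\<lambda>z. \<integral>w. \<bar>fp w\<bar> / cmod (z - w) \<partial>lborel"
    have "ennreal (\<integral>z. indicator (cball x 1) z * X z ^ 4 \<partial>lborel) = (\<integral>\<^sup>+z. ennreal (indicator (cball x 1) z * X z ^ 4) \<partial>lborel)"
      by (rule nn_integral_eq_integral[symmetric, OF i]) auto
    also have "\<dots> \<le> (\<integral>\<^sup>+z. ennreal P * (indicator (cball x 1) z + ennreal (4 / pi) * (indicator (cball x 1) z * ennreal (?J z))) \<partial>lborel)"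
    proof (rule nn_integral_mono)
      fix z
      have J0: "0 \<le> ?J z" by (intro integral_nonneg_AE) auto
      show "ennreal (indicator (cball x 1) z * X z ^ 4) \<le> ennreal P * (indicator (cball x 1) z + ennreal (4 / pi) * (indicator (cball x 1) z * ennreal (?J z)))"
      proof (cases "z \<in> cball x 1")
        case True
        have "ennreal (X z ^ 4) \<le> ennreal (P * (1 + 4 / pi * ?J z))" by (rule ennreal_leI[OF ptw[OF True]])
        also have "\<dots> = ennreal P * (1 + ennreal (4 / pi) * ennreal (?J z))"
          using P0 J0 by (simp add: ennreal_mult ennreal_plus del: ennreal_plus[symmetric] times_divide_eq_left flip: ennreal_1)
        finally show ?thesis using True by (simp del: mem_cball)
      qed simp
    qed
    also have "\<dots> = ennreal P * (emeasure lborel (cball x 1) + ennreal (4 / pi) * (\<integral>\<^sup>+z. indicator (cball x 1) z * ennreal (?J z) \<partial>lborel))"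
    proof -
      have m1: "(\<lambda>z. indicator (cball x 1) z * ennreal (?J z)) \<in> borel_measurable lborel" by measurable
      have m2: "(\<lambda>z. indicator (cball x 1) z :: ennreal) \<in> borel_measurable lborel" by measurable
      have m3: "(\<lambda>z. ennreal (4 / pi) * (indicator (cball x 1) z * ennreal (?J z))) \<in> borel_measurable lborel"
        by (rule borel_measurable_times_ennreal[OF borel_measurable_const m1])
      have m4: "(\<lambda>z. indicator (cball x 1) z + ennreal (4 / pi) * (indicator (cball x 1) z * ennreal (?J z))) \<in> borel_measurable lborel"
        by (rule borel_measurable_add[OF m2 m3])
      have "(\<integral>\<^sup>+z. indicator (cball x 1) z \<partial>lborel) = emeasure lborel (cball x 1)" by simp
      then show ?thesis by (simp only: nn_integral_cmult[OF m4] nn_integral_add[OF m2 m3] nn_integral_cmult[OF m1])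
    qed
    also have "\<dots> \<le> ennreal P * (emeasure lborel (cball x 1) + ennreal (4 / pi) * ennreal (p.L1 * (2 * pi + pi * 1\<^sup>2)))"
      by (intro mult_left_mono add_left_mono p.integral_cball_inverse_dist_le) auto
    also have "\<dots> = ennreal (P * (pi + 4 / pi * (p.L1 * (2 * pi + pi))))"
      using P0 p.L1_nonneg
      by (simp add: emeasure_cball unit_ball_vol_2 ennreal_mult[symmetric] ennreal_plus[symmetric] add_nonneg_nonneg del: ennreal_plus)
    also have "P * (pi + 4 / pi * (p.L1 * (2 * pi + pi))) = A * cmod x ^ ?m"
      by (simp add: P_def A_def power_mult_distrib)
    finally show ?case
      using C p.L1_nonneg
      by (subst (asm) ennreal_le_iff) (auto simp: A_def intro!: mult_nonneg_nonneg add_nonneg_nonneg)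
  qed
  then show ?thesis by (rule that)
qed

thm_deps fourth_power_average

end

section \<open>Decay of the moduli in the coupled system\<close>

lemma powr_decay_global:
  fixes X :: "complex \<Rightarrow> real"
  assumes c: "continuous_on UNIV X" and ev: "\<forall>\<^sub>F z in at_infinity. \<bar>X z\<bar> \<le> cmod z powr (- p)" and p: "0 \<le> p"
  obtains A where "\<And>z. \<bar>X z\<bar> \<le> A * (1 + cmod z) powr (- p)"
proof -
  obtain b where b: "\<And>z. b \<le> cmod z \<Longrightarrow> \<bar>X z\<bar> \<le> cmod z powr (- p)"
    using ev unfolding eventually_at_infinity by auto
  define \<rho> where "\<rho> = max b 1"
  have "bounded (X ` cball 0 \<rho>)"
    by (intro compact_imp_bounded compact_continuous_image continuous_on_subset[OF c]) auto
  then obtain M where M: "\<And>z. z \<in> cball 0 \<rho> \<Longrightarrow> \<bar>X z\<bar> \<le> M"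
    unfolding bounded_iff by (metis imageI real_norm_def)
  define A where "A = max (2 powr p) (\<bar>M\<bar> * (1 + \<rho>) powr p)"
  have A0: "0 \<le> A" by (simp add: A_def le_max_iff_disj)
  have "\<bar>X z\<bar> \<le> A * (1 + cmod z) powr (- p)" for z
  proof (cases "cmod z \<le> \<rho>")
    case True
    have "\<bar>X z\<bar> \<le> \<bar>M\<bar>" using M[of z] True by simp
    also have "\<bar>M\<bar> = (\<bar>M\<bar> * (1 + \<rho>) powr p) * (1 + \<rho>) powr (- p)"
      by (simp add: powr_minus \<rho>_def field_simps)
    also have "\<dots> \<le> A * (1 + cmod z) powr (- p)"
      using True p A0 by (intro mult_mono powr_mono2') (auto simp: A_def add_pos_nonneg)
    finally show ?thesis .
  next
    case False
    then have z: "b \<le> cmod z" "1 \<le> cmod z" by (auto simp: \<rho>_def)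
    have "\<bar>X z\<bar> \<le> cmod z powr (- p)" by (rule b[OF z(1)])
    also have "\<dots> = 2 powr p * (2 * cmod z) powr (- p)"
      using z by (simp add: powr_mult powr_minus field_simps)
    also have "\<dots> \<le> A * (1 + cmod z) powr (- p)"
      using z p A0 by (intro mult_mono powr_mono2') (auto simp: A_def)
    finally show ?thesis .
  qed
  then show ?thesis by (rule that)
qed

text \<open>Half of the excess \<open>p - 2\<close> pays for the logarithm, the other half keeps the
  power integrable.\<close>

lemma log_integrable_of_decay:
  fixes f :: "complex \<Rightarrow> real"
  assumes [measurable]: "f \<in> borel_measurable borel" and p: "2 < p"
    and A: "\<And>w. \<bar>f w\<bar> \<le> A * (1 + cmod w) powr (- p)"
  shows "integrable lborel (\<lambda>w. ln (1 + cmod w) * \<bar>f w\<bar>)"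
proof -
  define e where "e = (p - 2) / 2"
  have e: "0 < e" using p by (simp add: e_def)
  have A0: "0 \<le> A" using A[of 0] by simp
  show ?thesis
  proof (rule Bochner_Integration.integrable_bound)
    show "integrable lborel (\<lambda>w::complex. (A / e) * (1 + cmod w) powr (- (p - e)))"
      using p by (intro integrable_mult_right integrable_inverse_power_norm) (auto simp: e_def field_simps)
    show "AE w in lborel. norm (ln (1 + cmod w) * \<bar>f w\<bar>) \<le> norm ((A / e) * (1 + cmod w) powr (- (p - e)))"
    proof (rule AE_I2)
      fix w :: complex
      have l: "ln (1 + cmod w) \<le> (1 + cmod w) powr e / e"
        using ln_powr_bound[of "1 + cmod w" e] e by simp
      have "ln (1 + cmod w) * \<bar>f w\<bar> \<le> ((1 + cmod w) powr e / e) * (A * (1 + cmod w) powr (- p))"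
        using l A[of w] e by (intro mult_mono) auto
      also have "\<dots> = (A / e) * (1 + cmod w) powr (e + - p)" unfolding powr_add by (simp add: mult_ac)
      also have "e + - p = - (p - e)" by simp
      finally show "norm (ln (1 + cmod w) * \<bar>f w\<bar>) \<le> norm ((A / e) * (1 + cmod w) powr (- (p - e)))"
        using A0 e by (simp add: abs_mult)
    qed
  qed measurable
qed

text \<open>\<open>X1\<close> and \<open>X2\<close> are the squared moduli, \<open>f1\<close> and
  \<open>f2\<close> the curvatures, K stands for 8 pi^2 / k^2 and c for \<sigma> k / (2 pi). The
  representation of the moduli by potentials is taken as an assumption, so the gauge fields no
  longer occur.\<close>

locale skew_system =
  fixes X1 X2 f1 f2 :: "complex \<Rightarrow> real" and N1 N2 :: nat and K c C1 C2 :: real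
  assumes K: "0 < K" and c: "0 < c" and C: "0 < C1" "0 < C2" and N: "1 \<le> N1" "1 \<le> N2"
    and f1: "\<And>z. f1 z = K * X2 z * (X1 z + c)" and f2: "\<And>z. f2 z = K * X1 z * (X2 z - c)"
    and X_cont: "continuous_on UNIV X1" "continuous_on UNIV X2"
    and X1_int: "integrable lborel X1" and X2_int: "integrable lborel X2" and X12_int: "integrable lborel (\<lambda>z. X1 z * X2 z)"
    and X1: "\<And>z. X1 z = C1 * cmod z ^ (2 * N1) * exp (- log_pot f1 z / pi)"
    and X2: "\<And>z. X2 z = C2 * cmod z ^ (2 * N2) * exp (- log_pot f2 z / pi)"
begin

lemma X_nonneg: "0 \<le> X1 z" "0 \<le> X2 z"
  using C by (simp_all add: X1 X2)

lemma f1_eq: "f1 = (\<lambda>z. K * (X1 z * X2 z) + K * c * X2 z)"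
  by (simp add: f1 fun_eq_iff algebra_simps)

lemma f2_eq: "f2 = (\<lambda>z. K * (X1 z * X2 z) - K * c * X1 z)"
  by (simp add: f2 fun_eq_iff algebra_simps)

sublocale d1: planar_density_nonneg f1
proof
  show "continuous_on UNIV f1" unfolding f1_eq by (intro continuous_intros X_cont)
  show "integrable lborel f1" unfolding f1_eq
    by (intro Bochner_Integration.integrable_add integrable_mult_right X2_int X12_int)
  show "0 \<le> f1 w" for w using X_nonneg[of w] K c by (simp add: f1)
qed

sublocale d2: planar_density f2
proof
  show "continuous_on UNIV f2" unfolding f2_eq by (intro continuous_intros X_cont)
  show "integrable lborel f2" unfolding f2_eq
    by (intro Bochner_Integration.integrable_diff integrable_mult_right X1_int X12_int)
qed

definition "\<Phi>1 = (\<integral>z. f1 z \<partial>lborel)"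
definition "\<Phi>2 = (\<integral>z. f2 z \<partial>lborel)"
definition "\<beta>1 = \<Phi>1 / (2 * pi) - N1"
definition "\<beta>2 = \<Phi>2 / (2 * pi) - N2"

lemma power_form:
  assumes X: "\<And>z. X z = C * cmod z ^ (2 * N) * exp (- log_pot f z / pi)"
    and L: "log_pot f z = ln (cmod z) * \<Phi> - tail_pot f z" and z: "z \<noteq> 0"
  shows "X z = C * cmod z powr (- 2 * (\<Phi> / (2 * pi) - real N)) * exp (tail_pot f z / pi)"
proof -
  have "cmod z ^ (2 * N) = cmod z powr (2 * real N)" using z by (simp add: powr_realpow[symmetric])
  moreover have "exp (- log_pot f z / pi) = cmod z powr (- \<Phi> / pi) * exp (tail_pot f z / pi)"
    using z by (simp add: L powr_def exp_add[symmetric] diff_divide_distrib mult.commute)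
  ultimately have "X z = C * (cmod z powr (2 * real N) * cmod z powr (- \<Phi> / pi)) * exp (tail_pot f z / pi)"
    by (simp add: X)
  also have "cmod z powr (2 * real N) * cmod z powr (- \<Phi> / pi) = cmod z powr (- 2 * (\<Phi> / (2 * pi) - real N))"
  proof -
    have "2 * real N + - \<Phi> / pi = - 2 * (\<Phi> / (2 * pi) - real N)" by (simp add: field_simps)
    then show ?thesis by (simp only: powr_add[symmetric])
  qed
  finally show ?thesis .
qed

lemma X1_form: "z \<noteq> 0 \<Longrightarrow> X1 z = C1 * cmod z powr (- 2 * \<beta>1) * exp (tail_pot f1 z / pi)"
  unfolding \<beta>1_def \<Phi>1_def by (rule power_form[OF X1 d1.log_pot_eq_tail])

lemma X2_form: "z \<noteq> 0 \<Longrightarrow> X2 z = C2 * cmod z powr (- 2 * \<beta>2) * exp (tail_pot f2 z / pi)"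
  unfolding \<beta>2_def \<Phi>2_def by (rule power_form[OF X2 d2.log_pot_eq_tail])

text \<open>\<open>f1\<close> is nonnegative, hence so is its tail, and \<open>X1\<close> dominates
  a multiple of a pure power. Integrability of that power decides the exponent.\<close>

lemma \<beta>1_gt: "1 < \<beta>1"
proof (rule not_integrable_inverse_square[OF X1_int X_nonneg(1) C(1)])
  fix z :: complex assume z: "1 \<le> cmod z"
  have "0 \<le> tail_pot f1 z"
    unfolding tail_pot_def
  proof (rule integral_nonneg_AE)
    have "AE w in lborel. w \<noteq> z" by (rule AE_lborel_singleton)
    then show "AE w in lborel. 0 \<le> tail_kernel z w * f1 w"
      by eventually_elim (intro mult_nonneg_nonneg tail_kernel_nonneg z d1.nonneg)
  qed
  then have "C1 * cmod z powr (- 2 * \<beta>1) * 1 \<le> C1 * cmod z powr (- 2 * \<beta>1) * exp (tail_pot f1 z / pi)"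
    using C(1) by (intro mult_left_mono) auto
  moreover have "z \<noteq> 0" using z by auto
  ultimately show "C1 * cmod z powr (- 2 * \<beta>1) \<le> X1 z" by (simp add: X1_form)
qed

lemma almost_decay:
  assumes C: "0 < C" and e: "0 < e" and z0: "\<And>z. z \<noteq> 0 \<Longrightarrow> X z = C * cmod z powr (- 2 * \<beta>) * exp (T z / pi)"
    and T: "\<And>e. 0 < e \<Longrightarrow> \<forall>\<^sub>F z in at_infinity. T z \<le> e * ln (cmod z)"
  shows "\<forall>\<^sub>F z in at_infinity. X z \<le> cmod z powr (- 2 * \<beta> + e)"
proof -
  have "filterlim (\<lambda>x. (e / 2) * ln x) at_top at_top" using e by real_asymp
  then have "filterlim (\<lambda>z::complex. (e / 2) * ln (cmod z)) at_top at_infinity"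
    by (rule filterlim_compose) (rule filterlim_norm_at_top)
  then have 1: "\<forall>\<^sub>F z::complex in at_infinity. ln C \<le> (e / 2) * ln (cmod z)" by (simp add: filterlim_at_top)
  have 2: "\<forall>\<^sub>F z in at_infinity. T z \<le> pi * e / 2 * ln (cmod z)" by (rule T) (use e in simp)
  show ?thesis
    using 1 2 eventually_at_infinity_cmod_ge[of 1]
  proof eventually_elim
    case (elim z)
    then have z: "z \<noteq> 0" by auto
    have "T z / pi \<le> (pi * e / 2 * ln (cmod z)) / pi" using elim e by (intro divide_right_mono) auto
    also have "\<dots> = e / 2 * ln (cmod z)" by simp
    finally have t: "T z / pi \<le> e / 2 * ln (cmod z)" .
    have "X z = exp (ln C) * exp (- 2 * \<beta> * ln (cmod z)) * exp (T z / pi)"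
      using z C by (simp add: z0 powr_def)
    also have "\<dots> = exp (ln C + - 2 * \<beta> * ln (cmod z) + T z / pi)" by (simp only: exp_add)
    also have "\<dots> \<le> exp ((- 2 * \<beta> + e) * ln (cmod z))"
      unfolding exp_le_cancel_iff distrib_right using elim t by linarith
    finally show ?case using z by (simp add: powr_def)
  qed
qed

lemma square_average:
  assumes g: "continuous_on UNIV g" and G: "\<And>z. (g z)\<^sup>2 \<le> B * (1 + X1 z ^ 4 + X2 z ^ 4)" and B: "0 \<le> B"
  obtains A m where "\<forall>\<^sub>F z in at_infinity. (\<integral>w. indicator (cball z 1) w * (g w)\<^sup>2 \<partial>lborel) \<le> A * cmod z ^ m"
proof -
  obtain A1 m1 where 1: "\<forall>\<^sub>F x in at_infinity. (\<integral>z. indicator (cball x 1) z * X1 z ^ 4 \<partial>lborel) \<le> A1 * cmod x ^ m1"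
    using d1.fourth_power_average[OF less_imp_le[OF C(1)] X1] by blast
  obtain A2 m2 where 2: "\<forall>\<^sub>F x in at_infinity. (\<integral>z. indicator (cball x 1) z * X2 z ^ 4 \<partial>lborel) \<le> A2 * cmod x ^ m2"
    using d2.fourth_power_average[OF less_imp_le[OF C(2)] X2] by blast
  define m where "m = max m1 m2"
  define A where "A = B * (pi + \<bar>A1\<bar> + \<bar>A2\<bar>)"
  have "\<forall>\<^sub>F z in at_infinity. (\<integral>w. indicator (cball z 1) w * (g w)\<^sup>2 \<partial>lborel) \<le> A * cmod z ^ m"
    using 1 2 eventually_at_infinity_cmod_ge[of 1]
  proof eventually_elim
    case (elim x)
    have i1: "integrable lborel (\<lambda>w. indicator (cball x 1) w * X1 w ^ 4)" "integrable lborel (\<lambda>w. indicator (cball x 1) w * X2 w ^ 4)"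
      by (intro integrable_indicator_cball continuous_intros X_cont)+
    have i2: "integrable lborel (\<lambda>w. indicator (cball x 1) w :: real)"
      using integrable_indicator_cball[of "\<lambda>_. 1" x 1] by simp
    have i3: "integrable lborel (\<lambda>w. indicator (cball x 1) w * (g w)\<^sup>2)"
      by (intro integrable_indicator_cball continuous_intros g)
    have "(\<integral>w. indicator (cball x 1) w * (g w)\<^sup>2 \<partial>lborel) \<le>
       (\<integral>w. B * (indicator (cball x 1) w + indicator (cball x 1) w * X1 w ^ 4 + indicator (cball x 1) w * X2 w ^ 4) \<partial>lborel)"
    proof (rule integral_mono[OF i3])
      show "integrable lborel (\<lambda>w. B * (indicator (cball x 1) w + indicator (cball x 1) w * X1 w ^ 4 + indicator (cball x 1) w * X2 w ^ 4))"
        by (intro integrable_mult_right Bochner_Integration.integrable_add i1 i2)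
      show "indicator (cball x 1) w * (g w)\<^sup>2 \<le> B * (indicator (cball x 1) w + indicator (cball x 1) w * X1 w ^ 4 + indicator (cball x 1) w * X2 w ^ 4)" for w
        using G[of w] by (auto split: split_indicator)
    qed
    also have "\<dots> = B * (pi + (\<integral>w. indicator (cball x 1) w * X1 w ^ 4 \<partial>lborel) + (\<integral>w. indicator (cball x 1) w * X2 w ^ 4 \<partial>lborel))"
    proof -
      have "(\<integral>w. indicator (cball x 1) w \<partial>lborel) = pi"
        using content_cball[of 1 x] by (simp add: unit_ball_vol_2)
      then show ?thesis
        by (simp only: integral_mult_right_zero Bochner_Integration.integral_add Bochner_Integration.integrable_add i1 i2)
    qed
    also have "\<dots> \<le> B * (pi * cmod x ^ m + \<bar>A1\<bar> * cmod x ^ m + \<bar>A2\<bar> * cmod x ^ m)"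
    proof (intro mult_left_mono add_mono B)
      show "pi \<le> pi * cmod x ^ m" using elim one_le_power[of "cmod x" m] by simp
      have "A1 * cmod x ^ m1 \<le> \<bar>A1\<bar> * cmod x ^ m" "A2 * cmod x ^ m2 \<le> \<bar>A2\<bar> * cmod x ^ m"
        using elim by (auto intro!: mult_mono power_increasing simp: m_def)
      with elim show "(\<integral>w. indicator (cball x 1) w * X1 w ^ 4 \<partial>lborel) \<le> \<bar>A1\<bar> * cmod x ^ m"
        "(\<integral>w. indicator (cball x 1) w * X2 w ^ 4 \<partial>lborel) \<le> \<bar>A2\<bar> * cmod x ^ m" by linarith+
    qed
    also have "\<dots> = A * cmod x ^ m" by (simp add: A_def algebra_simps)
    finally show ?case .
  qed
  then show ?thesis by (rule that)
qed

lemma X2_sq_le: "X2 z ^ 2 \<le> 1 + X2 z ^ 4" and X12_sq_le: "(X1 z * X2 z)\<^sup>2 \<le> X1 z ^ 4 + X2 z ^ 4"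
proof -
  have "2 * X2 z ^ 2 \<le> 1 + (X2 z ^ 2)\<^sup>2" using zero_le_power2[of "X2 z ^ 2 - 1"] by (simp add: power2_diff)
  moreover have "0 \<le> X2 z ^ 2" "(X2 z ^ 2)\<^sup>2 = X2 z ^ 4" by (simp_all flip: power_mult)
  ultimately show "X2 z ^ 2 \<le> 1 + X2 z ^ 4" by linarith
  have "2 * (X1 z ^ 2 * X2 z ^ 2) \<le> (X1 z ^ 2)\<^sup>2 + (X2 z ^ 2)\<^sup>2" using zero_le_power2[of "X1 z ^ 2 - X2 z ^ 2"] by (simp add: power2_diff)
  moreover have "0 \<le> X1 z ^ 2 * X2 z ^ 2" "(X1 z ^ 2)\<^sup>2 = X1 z ^ 4" "(X2 z ^ 2)\<^sup>2 = X2 z ^ 4" by (simp_all flip: power_mult)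
  ultimately show "(X1 z * X2 z)\<^sup>2 \<le> X1 z ^ 4 + X2 z ^ 4" unfolding power_mult_distrib by linarith
qed

text \<open>The density is quadratic in \<open>X1\<close> and \<open>X2\<close>, so its square is
  bounded by their fourth powers; this is what \<open>fourth_power_average\<close> was made
  for.\<close>

lemma X1_almost_decay: "0 < e \<Longrightarrow> \<forall>\<^sub>F z in at_infinity. X1 z \<le> cmod z powr (- 2 * \<beta>1 + e)"
proof (rule almost_decay[OF C(1) _ X1_form])
  have "(f1 z)\<^sup>2 \<le> (2 * K\<^sup>2 * (1 + c\<^sup>2)) * (1 + X1 z ^ 4 + X2 z ^ 4)" for z
  proof -
    have "(X1 z * X2 z + c * X2 z)\<^sup>2 \<le> 2 * (X1 z * X2 z)\<^sup>2 + 2 * (c * X2 z)\<^sup>2"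
      using zero_le_power2[of "X1 z * X2 z - c * X2 z"] by (simp add: power2_eq_square algebra_simps)
    also have "\<dots> \<le> 2 * (X1 z ^ 4 + X2 z ^ 4) + 2 * (c\<^sup>2 * (1 + X2 z ^ 4))"
      unfolding power_mult_distrib[of c] using X12_sq_le[of z] X2_sq_le[of z] by (intro add_mono mult_left_mono) auto
    also have "\<dots> \<le> 2 * (1 + c\<^sup>2) * (1 + X1 z ^ 4 + X2 z ^ 4)"
      by (simp add: algebra_simps)
    finally have "K\<^sup>2 * (X1 z * X2 z + c * X2 z)\<^sup>2 \<le> K\<^sup>2 * (2 * (1 + c\<^sup>2) * (1 + X1 z ^ 4 + X2 z ^ 4))"
      by (intro mult_left_mono) auto
    moreover have "(f1 z)\<^sup>2 = K\<^sup>2 * (X1 z * X2 z + c * X2 z)\<^sup>2" by (simp add: f1 power2_eq_square algebra_simps)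
    ultimately show ?thesis by (simp only: mult_ac)
  qed
  then obtain A m where "\<forall>\<^sub>F z in at_infinity. (\<integral>w. indicator (cball z 1) w * (f1 w)\<^sup>2 \<partial>lborel) \<le> A * cmod z ^ m"
    by (rule square_average[OF d1.cont]) (auto)
  from d1.tail_pot_small[OF this]
  show "\<And>e. 0 < e \<Longrightarrow> \<forall>\<^sub>F z in at_infinity. tail_pot f1 z \<le> e * ln (cmod z)" .
qed

text \<open>\<open>f2\<close> has no fixed sign, but the tail kernel is nonnegative, so an upper
  bound for the tail involves only the positive part, and that is at most K X1 X2.\<close>

lemma X2_almost_decay: "0 < e \<Longrightarrow> \<forall>\<^sub>F z in at_infinity. X2 z \<le> cmod z powr (- 2 * \<beta>2 + e)"
proof (rule almost_decay[OF C(2) _ X2_form])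
  define fp where "fp w = max 0 (f2 w)" for w
  interpret p: planar_density_nonneg fp
  proof
    show "continuous_on UNIV fp" unfolding fp_def by (intro continuous_intros d2.cont)
    show "integrable lborel fp" unfolding fp_def using d2.int by (auto simp: max.commute)
    show "0 \<le> fp w" for w by (simp add: fp_def)
  qed
  have "(fp z)\<^sup>2 \<le> K\<^sup>2 * (1 + X1 z ^ 4 + X2 z ^ 4)" for z
  proof -
    have "fp z \<le> K * (X1 z * X2 z)"
      using X_nonneg[of z] K c by (auto simp: fp_def f2_eq)
    then have "(fp z)\<^sup>2 \<le> (K * (X1 z * X2 z))\<^sup>2" by (intro power_mono) (simp_all add: fp_def)
    also have "\<dots> = K\<^sup>2 * (X1 z * X2 z)\<^sup>2" by (rule power_mult_distrib)
    also have "\<dots> \<le> K\<^sup>2 * (1 + X1 z ^ 4 + X2 z ^ 4)"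
      using X12_sq_le[of z] by (intro mult_left_mono) auto
    finally show ?thesis .
  qed
  then obtain A m where "\<forall>\<^sub>F z in at_infinity. (\<integral>w. indicator (cball z 1) w * (fp w)\<^sup>2 \<partial>lborel) \<le> A * cmod z ^ m"
    by (rule square_average[OF p.cont]) auto
  note small = p.tail_pot_small[OF this]
  fix e :: real assume e: "0 < e"
  show "\<forall>\<^sub>F z in at_infinity. tail_pot f2 z \<le> e * ln (cmod z)"
    using small[OF e] eventually_at_infinity_cmod_ge[of 1]
  proof eventually_elim
    case (elim z)
    have "tail_pot f2 z \<le> tail_pot fp z"
      unfolding tail_pot_def
    proof (rule integral_mono_AE[OF d2.integrable_tail_kernel p.integrable_tail_kernel])
      have "AE w in lborel. w \<noteq> z" by (rule AE_lborel_singleton)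
      then show "AE w in lborel. tail_kernel z w * f2 w \<le> tail_kernel z w * fp w"
        by eventually_elim (use elim in \<open>auto intro!: mult_left_mono tail_kernel_nonneg simp: fp_def\<close>)
    qed
    then show ?case using elim by linarith
  qed
qed

text \<open>The admissible loss is chosen as \<open>\<beta>1 - 1\<close>, positive by
  \<open>\<beta>1_gt\<close>. The remaining exponent \<open>\<beta>1 + 1\<close> still exceeds 2,
  enough for a logarithmic moment of \<open>X1\<close>.\<close>

lemma X1_decay:
  obtains A where "\<And>z. X1 z \<le> A * (1 + cmod z) powr (- (\<beta>1 + 1))"
proof -
  have "\<forall>\<^sub>F z in at_infinity. \<bar>X1 z\<bar> \<le> cmod z powr (- (\<beta>1 + 1))"
    using X1_almost_decay[of "\<beta>1 - 1"] \<beta>1_gt X_nonneg by (simp add: algebra_simps)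
  then obtain A where "\<And>z. \<bar>X1 z\<bar> \<le> A * (1 + cmod z) powr (- (\<beta>1 + 1))"
    by (rule powr_decay_global[OF X_cont(1)]) (use \<beta>1_gt in auto)
  then show ?thesis using that X_nonneg(1) by auto
qed

lemma one_plus_powr_le_1: "0 \<le> p \<Longrightarrow> (1 + cmod z) powr (- p) \<le> 1"
  using powr_mono2'[of "- p" 1 "1 + cmod z"] by simp

text \<open>The sign of \<open>f2\<close> blocks the argument used for \<open>\<beta>1\<close>. Its
  negative part is at most K c X1, which by now decays and has a logarithmic moment, so it lowers
  the tail by a bounded amount only. This is why the decay of \<open>X1\<close> has to come
  first.\<close>

lemma \<beta>2_gt: "1 < \<beta>2"
proof -
  obtain A where A: "\<And>z. X1 z \<le> A * (1 + cmod z) powr (- (\<beta>1 + 1))" using X1_decay by blast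
  define fm where "fm w = max 0 (- f2 w)" for w
  interpret m: planar_density_nonneg fm
  proof
    show "continuous_on UNIV fm" unfolding fm_def by (intro continuous_intros d2.cont)
    show "integrable lborel fm" unfolding fm_def using d2.int by (auto simp: max.commute)
    show "0 \<le> fm w" for w by (simp add: fm_def)
  qed
  have A0: "0 \<le> A" using A[of 0] X_nonneg(1)[of 0] by simp
  have fm: "\<bar>fm w\<bar> \<le> (K * c * A) * (1 + cmod w) powr (- (\<beta>1 + 1))" for w
  proof -
    have "\<bar>fm w\<bar> \<le> K * c * X1 w" using X_nonneg[of w] K c by (auto simp: fm_def f2_eq)
    also have "\<dots> \<le> K * c * (A * (1 + cmod w) powr (- (\<beta>1 + 1)))" using K c by (intro mult_left_mono A) auto
    finally show ?thesis by (simp add: mult.assoc)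
  qed
  have M: "\<bar>fm w\<bar> \<le> K * c * A" for w
  proof -
    have "(K * c * A) * (1 + cmod w) powr (- (\<beta>1 + 1)) \<le> (K * c * A) * 1"
      using K c A0 \<beta>1_gt by (intro mult_left_mono one_plus_powr_le_1) auto
    then show ?thesis using fm[of w] by linarith
  qed
  obtain B where B: "\<And>z. 1 \<le> cmod z \<Longrightarrow> \<bar>tail_pot fm z\<bar> \<le> B"
    using m.tail_pot_bounded[OF M log_integrable_of_decay[OF m.meas _ fm]] \<beta>1_gt by auto
  show ?thesis
  proof (rule not_integrable_inverse_square[OF X2_int X_nonneg(2), of "C2 * exp (- B / pi)"])
    fix z :: complex assume z: "1 \<le> cmod z"
    have "- tail_pot fm z \<le> tail_pot f2 z"
    proof -
      have "(\<integral>w. - (tail_kernel z w * fm w) \<partial>lborel) \<le> (\<integral>w. tail_kernel z w * f2 w \<partial>lborel)"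
      proof (rule integral_mono_AE[OF integrable_minus[OF m.integrable_tail_kernel] d2.integrable_tail_kernel])
        have "AE w in lborel. w \<noteq> z" by (rule AE_lborel_singleton)
        then show "AE w in lborel. - (tail_kernel z w * fm w) \<le> tail_kernel z w * f2 w"
        proof eventually_elim
          case (elim w)
          have "tail_kernel z w * (- fm w) \<le> tail_kernel z w * f2 w"
            by (intro mult_left_mono tail_kernel_nonneg z elim) (simp add: fm_def)
          then show ?case by simp
        qed
      qed
      then show ?thesis by (simp add: tail_pot_def)
    qed
    then have "- B / pi \<le> tail_pot f2 z / pi" using B[OF z] by (intro divide_right_mono) auto
    then have "C2 * cmod z powr (- 2 * \<beta>2) * exp (- B / pi) \<le> C2 * cmod z powr (- 2 * \<beta>2) * exp (tail_pot f2 z / pi)"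
      using C(2) by (intro mult_left_mono) auto
    moreover have "z \<noteq> 0" using z by auto
    ultimately show "C2 * exp (- B / pi) * cmod z powr (- 2 * \<beta>2) \<le> X2 z" by (simp add: X2_form mult_ac)
  qed (use C in simp)
qed

lemma X2_decay:
  obtains A where "\<And>z. X2 z \<le> A * (1 + cmod z) powr (- (\<beta>2 + 1))"
proof -
  have "\<forall>\<^sub>F z in at_infinity. \<bar>X2 z\<bar> \<le> cmod z powr (- (\<beta>2 + 1))"
    using X2_almost_decay[of "\<beta>2 - 1"] \<beta>2_gt X_nonneg by (simp add: algebra_simps)
  then obtain A where "\<And>z. \<bar>X2 z\<bar> \<le> A * (1 + cmod z) powr (- (\<beta>2 + 1))"
    by (rule powr_decay_global[OF X_cont(2)]) (use \<beta>2_gt in auto)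
  then show ?thesis using that X_nonneg(2) by auto
qed

lemma f_decay:
  obtains A p where "2 < p" "\<And>z. \<bar>f1 z\<bar> \<le> A * (1 + cmod z) powr (- p)" "\<And>z. \<bar>f2 z\<bar> \<le> A * (1 + cmod z) powr (- p)"
proof -
  obtain A1 where A1: "\<And>z. X1 z \<le> A1 * (1 + cmod z) powr (- (\<beta>1 + 1))" using X1_decay by blast
  obtain A2 where A2: "\<And>z. X2 z \<le> A2 * (1 + cmod z) powr (- (\<beta>2 + 1))" using X2_decay by blast
  have A0: "0 \<le> A1" "0 \<le> A2" using A1[of 0] A2[of 0] X_nonneg[of 0] by auto
  define p where "p = min (\<beta>1 + 1) (\<beta>2 + 1)"
  have p: "2 < p" using \<beta>1_gt \<beta>2_gt by (simp add: p_def)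
  let ?w = "\<lambda>z. (1 + cmod z) powr (- p)"
  have "(1 + cmod z) powr (- (\<beta>1 + 1)) \<le> ?w z" "(1 + cmod z) powr (- (\<beta>2 + 1)) \<le> ?w z" for z
    by (auto intro!: powr_mono simp: p_def)
  then have X: "X1 z \<le> A1 * ?w z" "X2 z \<le> A2 * ?w z" for z
    using A1[of z] A2[of z] A0 by (meson mult_left_mono order_trans)+
  have Xb: "X1 z \<le> A1" "X2 z \<le> A2" for z
    using X[of z] mult_left_mono[OF one_plus_powr_le_1[of p z] A0(1)] mult_left_mono[OF one_plus_powr_le_1[of p z] A0(2)] p by auto
  define A where "A = K * A2 * (A1 + c) + K * A1 * (A2 + c)"
  have w0: "0 \<le> ?w z" for z by simp
  have 1: "\<bar>f1 z\<bar> \<le> A * ?w z" for z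
  proof -
    have "\<bar>f1 z\<bar> = K * (X2 z * (X1 z + c))" using d1.nonneg[of z] by (simp add: f1)
    also have "\<dots> \<le> K * ((A2 * ?w z) * (A1 + c))" using X[of z] Xb[of z] K c X_nonneg[of z] A0
      by (intro mult_left_mono mult_mono) auto
    also have "\<dots> = (K * A2 * (A1 + c)) * ?w z" by simp
    also have "\<dots> \<le> A * ?w z" unfolding A_def using K c A0 by (intro mult_right_mono) auto
    finally show ?thesis .
  qed
  have 2: "\<bar>f2 z\<bar> \<le> A * ?w z" for z
  proof -
    have "\<bar>f2 z\<bar> = K * (X1 z * \<bar>X2 z - c\<bar>)" using X_nonneg[of z] K by (simp add: f2 abs_mult)
    also have "\<dots> \<le> K * ((A1 * ?w z) * (A2 + c))" using X[of z] Xb[of z] K c X_nonneg[of z] A0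
      by (intro mult_left_mono mult_mono) auto
    also have "\<dots> = (K * A1 * (A2 + c)) * ?w z" by simp
    also have "\<dots> \<le> A * ?w z" unfolding A_def using K c A0 by (intro mult_right_mono) auto
    finally show ?thesis .
  qed
  from that[OF p 1 2] show ?thesis .
qed

text \<open>Both densities decay faster than |z|^(-2) with room to spare, so the tails are bounded
  and not merely o(ln |z|). This yields the sharp powers, together with O(1/|z|) for both Cauchy
  potentials.\<close>

lemma tail_bound:
  obtains B where "\<And>z. 1 \<le> cmod z \<Longrightarrow> X1 z \<le> B * cmod z powr (- 2 * \<beta>1)" "\<And>z. 1 \<le> cmod z \<Longrightarrow> X2 z \<le> B * cmod z powr (- 2 * \<beta>2)"
    "\<And>z. cmod (cauchy_pot f1 z) * cmod z \<le> B" "\<And>z. cmod (cauchy_pot f2 z) * cmod z \<le> B"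
    "\<And>z. \<bar>f1 z\<bar> \<le> B" "\<And>z. \<bar>f2 z\<bar> \<le> B" "\<And>z. X1 z \<le> B" "\<And>z. X2 z \<le> B" "0 \<le> B"
proof -
  obtain A p where p: "2 < p" and A: "\<And>z. \<bar>f1 z\<bar> \<le> A * (1 + cmod z) powr (- p)" "\<And>z. \<bar>f2 z\<bar> \<le> A * (1 + cmod z) powr (- p)"
    by (rule f_decay) blast
  obtain D1 where D1: "\<And>z. X1 z \<le> D1 * (1 + cmod z) powr (- (\<beta>1 + 1))" using X1_decay by blast
  obtain D2 where D2: "\<And>z. X2 z \<le> D2 * (1 + cmod z) powr (- (\<beta>2 + 1))" using X2_decay by blast
  have D0: "0 \<le> D1" "0 \<le> D2" using D1[of 0] D2[of 0] X_nonneg[of 0] by auto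
  have A0: "0 \<le> A" using A(1)[of 0] by simp
  have w1: "A * (1 + cmod z) powr (- p) \<le> A" for z
    using mult_left_mono[OF one_plus_powr_le_1[of p z] A0] p by simp
  have M: "\<bar>f1 z\<bar> \<le> A" "\<bar>f2 z\<bar> \<le> A" for z using A[of z] w1[of z] by linarith+
  obtain B1 where B1: "\<And>z. 1 \<le> cmod z \<Longrightarrow> \<bar>tail_pot f1 z\<bar> \<le> B1"
    using d1.tail_pot_bounded[OF M(1) log_integrable_of_decay[OF d1.meas p A(1)]] by auto
  obtain B2 where B2: "\<And>z. 1 \<le> cmod z \<Longrightarrow> \<bar>tail_pot f2 z\<bar> \<le> B2"
    using d2.tail_pot_bounded[OF M(2) log_integrable_of_decay[OF d2.meas p A(2)]] by auto
  have sq: "A * (1 + cmod z) powr (- p) * (cmod z)\<^sup>2 \<le> A" for z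
  proof -
    have "(1 + cmod z) powr (- p) * (cmod z)\<^sup>2 \<le> (1 + cmod z) powr (- 2) * (1 + cmod z)\<^sup>2"
      using p by (intro mult_mono powr_mono power_mono) auto
    also have "\<dots> = 1" by (simp add: powr_minus powr_numeral add_pos_nonneg) (metis add_pos_nonneg less_irrefl norm_ge_zero right_inverse zero_less_one power_eq_0_iff left_inverse)
    finally show ?thesis using A0 mult_left_mono[of _ 1 A] by (fastforce simp: mult.assoc)
  qed
  have sq': "\<bar>f1 z\<bar> * (cmod z)\<^sup>2 \<le> A" "\<bar>f2 z\<bar> * (cmod z)\<^sup>2 \<le> A" for z
    using sq[of z] mult_right_mono[OF A(1)[of z], of "(cmod z)\<^sup>2"] mult_right_mono[OF A(2)[of z], of "(cmod z)\<^sup>2"] by auto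
  have X: "x \<le> C * exp (b / pi) * y" if "x = C * y * exp (t / pi)" "\<bar>t\<bar> \<le> b" "0 < C" "0 \<le> y" for x C y t b :: real
  proof -
    have "exp (t / pi) \<le> exp (b / pi)" using that(2) by (auto intro: divide_right_mono)
    then have "C * y * exp (t / pi) \<le> C * y * exp (b / pi)"
      using that(3,4) by (intro mult_left_mono) auto
    then show ?thesis using that(1) by (simp add: mult_ac)
  qed
  define B where "B = Max {C1 * exp (B1 / pi), C2 * exp (B2 / pi), 4 * pi * A + 2 * d1.L1, 4 * pi * A + 2 * d2.L1, A, D1, D2}"
  have B: "C1 * exp (B1 / pi) \<le> B" "C2 * exp (B2 / pi) \<le> B" "4 * pi * A + 2 * d1.L1 \<le> B" "4 * pi * A + 2 * d2.L1 \<le> B" "A \<le> B" "D1 \<le> B" "D2 \<le> B"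
    unfolding B_def by (intro Max_ge; simp)+
  show ?thesis
  proof (rule that[of B])
    fix z :: complex
    show "X1 z \<le> B * cmod z powr (- 2 * \<beta>1)" if z: "1 \<le> cmod z"
    proof -
      have "z \<noteq> 0" using z by auto
      from X[OF X1_form[OF this] B1[OF z] C(1) powr_ge_zero] mult_right_mono[OF B(1), of "cmod z powr (- 2 * \<beta>1)"]
      show ?thesis by simp
    qed
    show "X2 z \<le> B * cmod z powr (- 2 * \<beta>2)" if z: "1 \<le> cmod z"
    proof -
      have "z \<noteq> 0" using z by auto
      from X[OF X2_form[OF this] B2[OF z] C(2) powr_ge_zero] mult_right_mono[OF B(2), of "cmod z powr (- 2 * \<beta>2)"]
      show ?thesis by simp
    qed
    show "cmod (cauchy_pot f1 z) * cmod z \<le> B" using d1.cauchy_pot_decay[OF sq'(1), of z] B(3) by linarith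
    show "cmod (cauchy_pot f2 z) * cmod z \<le> B" using d2.cauchy_pot_decay[OF sq'(2), of z] B(4) by linarith
    show "\<bar>f1 z\<bar> \<le> B" "\<bar>f2 z\<bar> \<le> B" using M[of z] B(5) by linarith+
    have "D1 * (1 + cmod z) powr (- (\<beta>1 + 1)) \<le> D1 * 1" "D2 * (1 + cmod z) powr (- (\<beta>2 + 1)) \<le> D2 * 1"
      using \<beta>1_gt \<beta>2_gt by (intro mult_left_mono one_plus_powr_le_1 D0; simp)+
    then show "X1 z \<le> B" "X2 z \<le> B" using D1[of z] D2[of z] B(6,7) by linarith+
    show "0 \<le> B" using A0 B(5) by linarith
  qed
qed

thm_deps tail_bound

end

section \<open>The Pohozaev identity and the inequalities for the exponents\<close>

lemma integral_divergence_zero: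
  fixes P Q Px Qy :: "complex \<Rightarrow> real"
  assumes dP: "\<And>x y. ((\<lambda>x. P (Complex x y)) has_real_derivative Px (Complex x y)) (at x)"
    and dQ: "\<And>x y. ((\<lambda>y. Q (Complex x y)) has_real_derivative Qy (Complex x y)) (at y)"
    and c: "continuous_on UNIV Px" "continuous_on UNIV Qy"
    and supp: "\<And>z. R \<le> cmod z \<Longrightarrow> P z = 0 \<and> Q z = 0 \<and> Px z = 0 \<and> Qy z = 0"
  shows "(\<integral>z. Px z + Qy z \<partial>lborel) = 0"
proof -
  define r where "r = \<bar>R\<bar> + 1"
  let ?a = "Complex (-r) (-r)" and ?b = "Complex r r"
  have out: "R \<le> cmod z" if "r \<le> \<bar>Re z\<bar> \<or> r \<le> \<bar>Im z\<bar>" for z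
    using that abs_Re_le_cmod[of z] abs_Im_le_cmod[of z] by (auto simp: r_def)
  have ind: "indicator (box ?a ?b) z * g z = g z" if "\<And>z. R \<le> cmod z \<Longrightarrow> g z = 0" for g :: "complex \<Rightarrow> real" and z
  proof (cases "z \<in> box ?a ?b")
    case False
    then have "R \<le> cmod z" by (intro out) (auto simp: in_box_complex_iff abs_if)
    then show ?thesis using that by simp
  qed simp
  have int: "integrable lborel g" if "continuous_on UNIV g" "\<And>z. R \<le> cmod z \<Longrightarrow> g z = 0" for g :: "complex \<Rightarrow> real"
  proof -
    have "(\<lambda>z. indicator (cball 0 R) z * g z) = g" using that(2) by (auto simp: fun_eq_iff split: split_indicator)
    then show ?thesis using integrable_indicator_cball[OF that(1), of 0 R] by simp
  qed
  have "(\<integral>z. Px z \<partial>lborel) = (\<integral>z. indicator (box ?a ?b) z * Px z \<partial>lborel)"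
    by (intro Bochner_Integration.integral_cong refl ind[symmetric]) (use supp in blast)
  also have "\<dots> = integral {-r..r} (\<lambda>x. integral {-r..r} (\<lambda>y. Px (Complex x y)))"
    by (subst integral_box_complex[OF c(1)]) simp
  also have "\<dots> = integral {-r..r} (\<lambda>y. integral {-r..r} (\<lambda>x. Px (Complex x y)))"
    by (rule integral_swap_continuous[of "-r" "-r" r r "\<lambda>x y. Px (Complex x y)", unfolded cbox_interval])
       (auto simp: split_beta' intro!: continuous_on_compose2[OF c(1)] continuous_intros)
  also have "\<dots> = integral {-r..r} (\<lambda>y. 0)"
  proof (rule integral_cong)
    fix y
    have "((\<lambda>x. Px (Complex x y)) has_integral P (Complex r y) - P (Complex (-r) y)) {-r..r}"
      by (intro fundamental_theorem_of_calculus)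
         (auto simp: r_def has_real_derivative_iff_has_vector_derivative[symmetric] intro: has_field_derivative_at_within dP)
    moreover have "P (Complex r y) = 0" "P (Complex (-r) y) = 0"
      by (rule supp[THEN conjunct1]; rule out; simp add: r_def)+
    ultimately show "integral {-r..r} (\<lambda>x. Px (Complex x y)) = 0" by (simp add: integral_unique)
  qed
  finally have 1: "(\<integral>z. Px z \<partial>lborel) = 0" by simp
  have "(\<integral>z. Qy z \<partial>lborel) = (\<integral>z. indicator (box ?a ?b) z * Qy z \<partial>lborel)"
    by (intro Bochner_Integration.integral_cong refl ind[symmetric]) (use supp in blast)
  also have "\<dots> = integral {-r..r} (\<lambda>x. integral {-r..r} (\<lambda>y. Qy (Complex x y)))"
    by (subst integral_box_complex[OF c(2)]) simp
  also have "\<dots> = integral {-r..r} (\<lambda>x. 0)"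
  proof (rule integral_cong)
    fix x
    have "((\<lambda>y. Qy (Complex x y)) has_integral Q (Complex x r) - Q (Complex x (-r))) {-r..r}"
      by (intro fundamental_theorem_of_calculus)
         (auto simp: r_def has_real_derivative_iff_has_vector_derivative[symmetric] intro: has_field_derivative_at_within dQ)
    moreover have "Q (Complex x r) = 0" "Q (Complex x (-r)) = 0"
      by (rule supp[THEN conjunct2, THEN conjunct1]; rule out; simp add: r_def)+
    ultimately show "integral {-r..r} (\<lambda>y. Qy (Complex x y)) = 0" by (simp add: integral_unique)
  qed
  finally have 2: "(\<integral>z. Qy z \<partial>lborel) = 0" by simp
  show ?thesis using 1 2 int[OF c(1)] int[OF c(2)] supp by simp
qed

lemma has_derivative_lines:
  assumes "(P has_derivative D) (at (Complex x y))"
  shows "((\<lambda>x. P (Complex x y)) has_real_derivative D 1) (at x)"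
    and "((\<lambda>y. P (Complex x y)) has_real_derivative D \<i>) (at y)"
proof -
  have lin: "linear D" using assms by (rule has_derivative_linear)
  have 1: "((\<lambda>x. Complex x y) has_derivative (\<lambda>h. of_real h)) (at x)"
    unfolding Complex_eq by (auto intro!: derivative_eq_intros)
  have "((\<lambda>x. P (Complex x y)) has_derivative (\<lambda>h. D (of_real h))) (at x)"
    by (rule has_derivative_compose[OF 1 assms])
  moreover have "D (of_real h) = D 1 * h" for h
    using linear_scale[OF lin, of h 1] by (simp add: scaleR_conv_of_real)
  ultimately show "((\<lambda>x. P (Complex x y)) has_real_derivative D 1) (at x)"
    by (simp add: has_field_derivative_def)
  have 2: "((\<lambda>y. Complex x y) has_derivative (\<lambda>h. \<i> * of_real h)) (at y)"
    unfolding Complex_eq by (auto intro!: derivative_eq_intros)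
  have "((\<lambda>y. P (Complex x y)) has_derivative (\<lambda>h. D (\<i> * of_real h))) (at y)"
    by (rule has_derivative_compose[OF 2 assms])
  moreover have "D (\<i> * of_real h) = D \<i> * h" for h
    using linear_scale[OF lin, of h \<i>] by (simp add: scaleR_conv_of_real mult.commute)
  ultimately show "((\<lambda>y. P (Complex x y)) has_real_derivative D \<i>) (at y)"
    by (simp add: has_field_derivative_def)
qed

lemma has_real_derivative_max_square:
  "((\<lambda>t::real. (max 0 t)\<^sup>2) has_real_derivative 2 * max 0 t) (at t)"
proof (cases t "0::real" rule: linorder_cases)
  case less
  have "((\<lambda>t::real. 0) has_real_derivative 2 * max 0 t) (at t)" using less by simp
  then show ?thesis
    by (rule DERIV_cong_ev[THEN iffD1, rotated -1]) (use less in \<open>auto simp: eventually_nhds intro!: exI[of _ "{..<0}"]\<close>)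
next
  case greater
  have "((\<lambda>t::real. t\<^sup>2) has_real_derivative 2 * max 0 t) (at t)" using greater by (auto intro!: derivative_eq_intros)
  then show ?thesis
    by (rule DERIV_cong_ev[THEN iffD1, rotated -1]) (use greater in \<open>auto simp: eventually_nhds intro!: exI[of _ "{0<..}"]\<close>)
next
  case equal
  have "((\<lambda>h::real. (max 0 h)\<^sup>2 / h) \<longlongrightarrow> 0) (at 0)"
  proof (rule tendsto_0_le[where f="\<lambda>h::real. h" and K=1])
    have "norm ((max 0 h)\<^sup>2 / h) \<le> norm h * 1" for h :: real
      by (cases "h = 0") (auto simp: max_def power2_eq_square)
    then show "\<forall>\<^sub>F h::real in at 0. norm ((max 0 h)\<^sup>2 / h) \<le> norm h * 1"
      by (intro always_eventually allI)
  qed (rule tendsto_ident_at)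
  then show ?thesis using equal by (simp add: has_field_derivative_iff)
qed

text \<open>Its square is the cut-off in use: the corner at |z| = R disappears on squaring, so the
  first derivatives are continuous and vanish, with the value, outside the disc.\<close>

definition cutoff :: "real \<Rightarrow> complex \<Rightarrow> real" where
  "cutoff R z = max 0 (1 - (cmod z)\<^sup>2 / R\<^sup>2)"

lemma cutoff_bounds: "0 \<le> cutoff R z" "cutoff R z \<le> 1"
  by (auto simp: cutoff_def)

lemma cutoff_eq_0: "0 < R \<Longrightarrow> R \<le> cmod z \<Longrightarrow> cutoff R z = 0"
  by (auto simp: cutoff_def max_def divide_le_eq le_divide_eq power_mono)

lemma cutoff_sq_le: "0 < R \<Longrightarrow> cutoff R z * ((cmod z)\<^sup>2 / R\<^sup>2) \<le> 1"
proof -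
  assume "0 < R"
  have "cutoff R z * ((cmod z)\<^sup>2 / R\<^sup>2) \<le> 1" if "(cmod z)\<^sup>2 / R\<^sup>2 \<le> 1"
    using mult_mono[OF cutoff_bounds(2)[of R z] that] by simp
  moreover have "cutoff R z = 0" if "\<not> (cmod z)\<^sup>2 / R\<^sup>2 \<le> 1" using that by (simp add: cutoff_def)
  ultimately show ?thesis by (cases "(cmod z)\<^sup>2 / R\<^sup>2 \<le> 1") auto
qed

lemma cutoff_continuous: "0 < R \<Longrightarrow> continuous_on UNIV (cutoff R)"
  unfolding cutoff_def by (intro continuous_intros) auto

lemma cutoff_tendsto: "(\<lambda>n. cutoff (real (Suc n)) z) \<longlonglongrightarrow> 1"
proof -
  have "(\<lambda>n. max 0 (1 - (cmod z)\<^sup>2 / (real (Suc n))\<^sup>2)) \<longlonglongrightarrow> max 0 (1 - 0)"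
    by (intro tendsto_intros) real_asymp
  then show ?thesis by (simp add: cutoff_def)
qed

lemma cutoff_square_has_derivative:
  "((\<lambda>z. (cutoff R z)\<^sup>2) has_derivative (\<lambda>h. - 4 * cutoff R z / R\<^sup>2 * (z \<bullet> h))) (at z)"
proof -
  have 1: "((\<lambda>z::complex. 1 - (cmod z)\<^sup>2 / R\<^sup>2) has_derivative (\<lambda>h. - (2 * (z \<bullet> h)) / R\<^sup>2)) (at z)"
    unfolding power2_norm_eq_inner divide_inverse by (auto intro!: derivative_eq_intros simp: inner_commute)
  have 2: "((\<lambda>t::real. (max 0 t)\<^sup>2) has_derivative (*) (2 * max 0 (1 - (cmod z)\<^sup>2 / R\<^sup>2))) (at (1 - (cmod z)\<^sup>2 / R\<^sup>2))"
    using has_real_derivative_max_square unfolding has_field_derivative_def .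
  show ?thesis
    using has_derivative_compose[OF 1 2] by (simp add: cutoff_def mult_ac)
qed

text \<open>The constant is independent of R: the cut-off varies at rate O(1/R), and it multiplies a
  vector of length at most R. With |z| \<le> |w|, the variation of the squared cut-off accounts for
  4 and the difference z - w for 1.\<close>

lemma cutoff_field_lipschitz:
  assumes R: "0 < R"
  shows "cmod (of_real ((cutoff R z)\<^sup>2) * z - of_real ((cutoff R w)\<^sup>2) * w) \<le> 5 * cmod (z - w)"
proof -
  have main: "cmod (of_real ((cutoff R z)\<^sup>2) * z - of_real ((cutoff R w)\<^sup>2) * w) \<le> 5 * cmod (z - w)"
    if zw: "cmod z \<le> cmod w" for z w
  proof (cases "R \<le> cmod z")
    case True
    then show ?thesis using cutoff_eq_0[OF R] zw by (auto simp: cutoff_eq_0[OF R])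
  next
    case False
    \<comment> \<open>Replacing |w| by its truncation at R lets one formula for the cut-off cover
      points inside and outside the disc.\<close>
    define t where "t = min (cmod w) R"
    have cw: "cutoff R w = 1 - t\<^sup>2 / R\<^sup>2"
    proof (cases "cmod w \<le> R")
      case True
      then have "(cmod w)\<^sup>2 / R\<^sup>2 \<le> 1" using R by (simp add: divide_le_eq power_mono)
      then show ?thesis using True by (simp add: cutoff_def t_def)
    qed (use R cutoff_eq_0[OF R, of w] in \<open>simp add: t_def\<close>)
    have "(cmod z)\<^sup>2 / R\<^sup>2 \<le> 1" using R False by (simp add: divide_le_eq power_mono)
    then have cz: "cutoff R z = 1 - (cmod z)\<^sup>2 / R\<^sup>2" by (simp add: cutoff_def)
    have t: "cmod z \<le> t" "t \<le> R" "t \<le> cmod w" using zw False by (auto simp: t_def)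
    have d: "cutoff R z - cutoff R w = (t - cmod z) * (t + cmod z) / R\<^sup>2"
      by (simp add: cz cw power2_eq_square algebra_simps diff_divide_distrib)
    have t0: "0 \<le> t" using t(1) norm_ge_zero[of z] by linarith
    have d0: "0 \<le> cutoff R z - cutoff R w" unfolding d using t t0 R by (intro divide_nonneg_nonneg mult_nonneg_nonneg add_nonneg_nonneg) auto
    have d1: "(cutoff R z - cutoff R w) * R \<le> 2 * (t - cmod z)"
    proof -
      have "(cutoff R z - cutoff R w) * R = (t - cmod z) * ((t + cmod z) / R)"
        unfolding d using R by (simp add: power2_eq_square)
      also have "\<dots> \<le> (t - cmod z) * 2" using t R by (intro mult_left_mono) (auto simp: divide_le_eq)
      finally show ?thesis by simp
    qed
    have "\<bar>(cutoff R z)\<^sup>2 - (cutoff R w)\<^sup>2\<bar> * cmod z = (cutoff R z - cutoff R w) * cmod z * (cutoff R z + cutoff R w)"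
      using d0 cutoff_bounds[of R z] cutoff_bounds[of R w] by (simp add: power2_eq_square square_diff_square_factored abs_mult)
    also have "\<dots> \<le> (cutoff R z - cutoff R w) * R * 2"
      using d0 cutoff_bounds[of R z] cutoff_bounds[of R w] R False by (intro mult_mono mult_left_mono) auto
    also have "\<dots> \<le> 4 * (t - cmod z)" using d1 by simp
    also have "\<dots> \<le> 4 * cmod (z - w)" using t norm_triangle_ineq2[of w z] by (simp add: norm_minus_commute)
    finally have 1: "\<bar>(cutoff R z)\<^sup>2 - (cutoff R w)\<^sup>2\<bar> * cmod z \<le> 4 * cmod (z - w)" .
    have "of_real ((cutoff R z)\<^sup>2) * z - of_real ((cutoff R w)\<^sup>2) * w = of_real ((cutoff R z)\<^sup>2 - (cutoff R w)\<^sup>2) * z + of_real ((cutoff R w)\<^sup>2) * (z - w)"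
      by (simp add: algebra_simps)
    also have "cmod \<dots> \<le> \<bar>(cutoff R z)\<^sup>2 - (cutoff R w)\<^sup>2\<bar> * cmod z + (cutoff R w)\<^sup>2 * cmod (z - w)"
      by (rule order_trans[OF norm_triangle_ineq]) (simp only: norm_mult norm_of_real abs_power2 order_refl)
    also have "\<dots> \<le> 4 * cmod (z - w) + 1 * cmod (z - w)"
      using 1 cutoff_bounds[of R w] by (intro add_mono mult_right_mono) (auto simp: power_le_one)
    finally show ?thesis by simp
  qed
  show ?thesis
  proof (cases "cmod z \<le> cmod w")
    case False
    then show ?thesis using main[of w z] by (simp add: norm_minus_commute)
  qed (rule main)
qed

lemma integrable_pair_mult:
  fixes f g :: "complex \<Rightarrow> real"
  assumes f: "integrable lborel f" and g: "integrable lborel g"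
  shows "integrable (lborel \<Otimes>\<^sub>M lborel) (\<lambda>(z, w). f z * g w)"
proof (rule lborel_pair.Fubini_integrable)
  have [measurable]: "f \<in> borel_measurable borel" "g \<in> borel_measurable borel" using f g by auto
  show "(\<lambda>(z, w). f z * g w) \<in> borel_measurable (lborel \<Otimes>\<^sub>M lborel)" by measurable
  show "integrable lborel (\<lambda>z. \<integral>w. norm (case (z, w) of (z, w) \<Rightarrow> f z * g w) \<partial>lborel)"
    using integrable_abs[OF f] by (simp add: abs_mult)
  show "AE z in lborel. integrable lborel (\<lambda>w. case (z, w) of (z, w) \<Rightarrow> f z * g w)"
    using g by simp
qed

text \<open>\<open>g\<close> is bounded, so the singular kernel integrates in \<open>w\<close> to a
  bounded function of \<open>z\<close>; the double integral converges absolutely and may be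
  symmetrised afterwards.\<close>

lemma vector_field_cauchy_pot:
  fixes f g :: "complex \<Rightarrow> real" and V :: "complex \<Rightarrow> complex"
  assumes f: "planar_density f" and g: "planar_density g" and B: "\<And>w. \<bar>g w\<bar> \<le> B"
    and V: "continuous_on UNIV V" "\<And>z. cmod (V z) \<le> M"
  shows "integrable (lborel \<Otimes>\<^sub>M lborel) (\<lambda>(z, w). Re (V z / (z - w)) * (f z * g w))"
    and "(\<integral>p. (case p of (z, w) \<Rightarrow> Re (V z / (z - w)) * (f z * g w)) \<partial>(lborel \<Otimes>\<^sub>M lborel))
           = (\<integral>z. f z * Re (V z * cauchy_pot g z) \<partial>lborel)"
proof -
  interpret f: planar_density f by (rule f)
  interpret g: planar_density g by (rule g)
  have [measurable]: "V \<in> borel_measurable borel" by (rule borel_measurable_continuous_onI[OF V(1)])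
  have M0: "0 \<le> M" using V(2)[of 0] norm_ge_zero order_trans by blast
  have iw: "integrable lborel (\<lambda>w. Re (V z / (z - w)) * (f z * g w))" for z
  proof -
    have "integrable lborel (\<lambda>w. f z * Re (V z * (of_real (g w) / (z - w))))"
      by (intro integrable_mult_right integrable_Re g.integrable_cauchy)
    moreover have "(\<lambda>w. f z * Re (V z * (of_real (g w) / (z - w)))) = (\<lambda>w. Re (V z / (z - w)) * (f z * g w))"
      by (intro ext) (simp add: Re_divide field_simps)
    ultimately show ?thesis by (simp only:)
  qed
  show i: "integrable (lborel \<Otimes>\<^sub>M lborel) (\<lambda>(z, w). Re (V z / (z - w)) * (f z * g w))"
  proof (rule lborel_pair.Fubini_integrable)
    show "(\<lambda>(z, w). Re (V z / (z - w)) * (f z * g w)) \<in> borel_measurable (lborel \<Otimes>\<^sub>M lborel)" by measurable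
    show "integrable lborel (\<lambda>z. \<integral>w. norm (case (z, w) of (z, w) \<Rightarrow> Re (V z / (z - w)) * (f z * g w)) \<partial>lborel)"
    proof (rule Bochner_Integration.integrable_bound)
      show "integrable lborel (\<lambda>z. (M * (2 * pi * B + g.L1)) * \<bar>f z\<bar>)" by (intro integrable_mult_right f.int_abs)
      show "AE z in lborel. norm (\<integral>w. norm (case (z, w) of (z, w) \<Rightarrow> Re (V z / (z - w)) * (f z * g w)) \<partial>lborel) \<le> norm ((M * (2 * pi * B + g.L1)) * \<bar>f z\<bar>)"
      proof (rule AE_I2)
        fix z
        have "(\<integral>w. norm (Re (V z / (z - w)) * (f z * g w)) \<partial>lborel) \<le> (\<integral>w. (M * \<bar>f z\<bar>) * (\<bar>g w\<bar> / cmod (z - w)) \<partial>lborel)"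
        proof (rule integral_mono)
          fix w
          have "\<bar>Re (V z / (z - w))\<bar> \<le> M / cmod (z - w)"
            using abs_Re_le_cmod[of "V z / (z - w)"] divide_right_mono[OF V(2)[of z] norm_ge_zero[of "z - w"]]
            unfolding norm_divide by linarith
          then have "\<bar>Re (V z / (z - w))\<bar> * \<bar>f z * g w\<bar> \<le> M / cmod (z - w) * \<bar>f z * g w\<bar>" by (rule mult_right_mono) simp
          then show "norm (Re (V z / (z - w)) * (f z * g w)) \<le> (M * \<bar>f z\<bar>) * (\<bar>g w\<bar> / cmod (z - w))"
            by (simp add: abs_mult)
        qed (intro integrable_norm iw integrable_mult_right g.integrable_inverse_dist_density)+
        also have "\<dots> = (M * \<bar>f z\<bar>) * (\<integral>w. \<bar>g w\<bar> / cmod (z - w) \<partial>lborel)" by (rule integral_mult_right_zero)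
        also have "\<dots> \<le> (M * \<bar>f z\<bar>) * (2 * pi * B + g.L1)"
          using B M0 by (intro mult_left_mono g.inverse_dist_bound(2)) auto
        finally show "norm (\<integral>w. norm (case (z, w) of (z, w) \<Rightarrow> Re (V z / (z - w)) * (f z * g w)) \<partial>lborel) \<le> norm ((M * (2 * pi * B + g.L1)) * \<bar>f z\<bar>)"
          by (simp add: mult_ac)
      qed
    qed measurable
    show "AE z in lborel. integrable lborel (\<lambda>w. case (z, w) of (z, w) \<Rightarrow> Re (V z / (z - w)) * (f z * g w))"
      using iw by simp
  qed
  have "(\<integral>p. (case p of (z, w) \<Rightarrow> Re (V z / (z - w)) * (f z * g w)) \<partial>(lborel \<Otimes>\<^sub>M lborel))
      = (\<integral>z. (\<integral>w. Re (V z / (z - w)) * (f z * g w) \<partial>lborel) \<partial>lborel)"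
    using lborel_pair.integral_fst'[OF i] by simp
  also have "\<dots> = (\<integral>z. f z * Re (V z * cauchy_pot g z) \<partial>lborel)"
  proof (rule Bochner_Integration.integral_cong[OF refl])
    fix z
    have "(\<integral>w. Re (V z / (z - w)) * (f z * g w) \<partial>lborel) = (\<integral>w. f z * Re (V z * (of_real (g w) / (z - w))) \<partial>lborel)"
      by (intro Bochner_Integration.integral_cong refl) (simp add: Re_divide field_simps)
    also have "\<dots> = f z * (\<integral>w. Re (V z * (of_real (g w) / (z - w))) \<partial>lborel)" by (rule integral_mult_right_zero)
    also have "(\<integral>w. Re (V z * (of_real (g w) / (z - w))) \<partial>lborel) = Re (\<integral>w. V z * (of_real (g w) / (z - w)) \<partial>lborel)"
      by (intro integral_Re integrable_mult_right g.integrable_cauchy)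
    also have "(\<integral>w. V z * (of_real (g w) / (z - w)) \<partial>lborel) = V z * cauchy_pot g z"
      unfolding cauchy_pot_def by (rule integral_mult_right_zero)
    finally show "(\<integral>w. Re (V z / (z - w)) * (f z * g w) \<partial>lborel) = f z * Re (V z * cauchy_pot g z)" .
  qed
  finally show "(\<integral>p. (case p of (z, w) \<Rightarrow> Re (V z / (z - w)) * (f z * g w)) \<partial>(lborel \<Otimes>\<^sub>M lborel))
           = (\<integral>z. f z * Re (V z * cauchy_pot g z) \<partial>lborel)" .
qed

text \<open>Symmetrising the double integral replaces the singular kernel by the difference quotient of
  the vector field, which stays bounded.\<close>

lemma cutoff_virial_tendsto:
  fixes f g :: "complex \<Rightarrow> real"
  assumes f: "planar_density f" and g: "planar_density g" and B: "\<And>w. \<bar>f w\<bar> \<le> B" "\<And>w. \<bar>g w\<bar> \<le> B"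
  shows "(\<lambda>n. (\<integral>z. f z * Re (of_real ((cutoff (real (Suc n)) z)\<^sup>2) * z * cauchy_pot g z) \<partial>lborel)
            + (\<integral>z. g z * Re (of_real ((cutoff (real (Suc n)) z)\<^sup>2) * z * cauchy_pot f z) \<partial>lborel))
         \<longlonglongrightarrow> (\<integral>z. f z \<partial>lborel) * (\<integral>z. g z \<partial>lborel)"
proof -
  interpret f: planar_density f by (rule f)
  interpret g: planar_density g by (rule g)
  define V where "V n z = of_real ((cutoff (real (Suc n)) z)\<^sup>2) * z" for n z
  have Vc: "continuous_on UNIV (V n)" for n
    unfolding V_def by (intro continuous_intros cutoff_continuous) auto
  have [measurable]: "V n \<in> borel_measurable borel" for n by (rule borel_measurable_continuous_onI[OF Vc])
  have VM: "cmod (V n z) \<le> real (Suc n)" for n z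
  proof (cases "real (Suc n) \<le> cmod z")
    case True
    then show ?thesis using cutoff_eq_0[of "real (Suc n)" z] by (simp add: V_def)
  next
    case False
    have "cmod (V n z) = (cutoff (real (Suc n)) z)\<^sup>2 * cmod z" by (simp add: V_def norm_mult norm_power cutoff_bounds)
    also have "\<dots> \<le> 1 * cmod z" using cutoff_bounds[of "real (Suc n)" z] by (intro mult_right_mono) (auto simp: power_le_one)
    finally show ?thesis using False by simp
  qed
  let ?M = "lborel \<Otimes>\<^sub>M (lborel :: complex measure)"
  \<comment> \<open>The symmetrised integrand. On the diagonal the quotient is 0 by the convention
    for division; off it the quotient is at most 5 in modulus, for all \<open>n\<close>.\<close>
  define S where "S n = (\<lambda>(z, w). Re ((V n z - V n w) / (z - w)) * (f z * g w))" for n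
  note fg = vector_field_cauchy_pot[OF f g B(2) Vc VM]
  note gf = vector_field_cauchy_pot[OF g f B(1) Vc VM]
  have eq: "(\<integral>z. f z * Re (V n z * cauchy_pot g z) \<partial>lborel) + (\<integral>z. g z * Re (V n z * cauchy_pot f z) \<partial>lborel) = (\<integral>p. S n p \<partial>?M)" for n
  proof -
    let ?A = "\<lambda>(z, w). Re (V n z / (z - w)) * (f z * g w)"
    let ?A' = "\<lambda>(z, w). Re (V n z / (z - w)) * (g z * f w)"
    let ?B = "\<lambda>(z, w). Re (V n w / (w - z)) * (g w * f z)"
    have iB: "integrable ?M ?B"
      using lborel_pair.integrable_product_swap[OF gf(1)[of n]] by simp
    have "(\<integral>p. ?B p \<partial>?M) = (\<integral>p. ?A' p \<partial>?M)"
      using lborel_pair.integral_product_swap[of ?A'] borel_measurable_integrable[OF gf(1)[of n]] by simp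
    then have "(\<integral>z. f z * Re (V n z * cauchy_pot g z) \<partial>lborel) + (\<integral>z. g z * Re (V n z * cauchy_pot f z) \<partial>lborel)
       = (\<integral>p. ?A p \<partial>?M) + (\<integral>p. ?B p \<partial>?M)"
      by (simp only: fg(2) gf(2))
    also have "\<dots> = (\<integral>p. ?A p + ?B p \<partial>?M)"
      by (rule Bochner_Integration.integral_add[symmetric, OF fg(1) iB])
    also have "\<dots> = (\<integral>p. S n p \<partial>?M)"
    proof (intro Bochner_Integration.integral_cong refl)
      fix p :: "complex \<times> complex"
      obtain z w where p: "p = (z, w)" by (cases p)
      have "V n w / (w - z) = - (V n w / (z - w))" by (metis minus_diff_eq minus_divide_right)
      then show "?A p + ?B p = S n p"
        unfolding p S_def by (simp add: diff_divide_distrib left_diff_distrib mult.commute[of "g w"])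
    qed
    finally show ?thesis .
  qed
  \<comment> \<open>Off the diagonal the cut-off fields tend to the identity field, whose difference
    quotient is 1. Hence the limit of the integrals is the product of the two masses.\<close>
  define L where "L = (\<lambda>(z, w). if z = w then 0 else f z * g w)"
  have "(\<lambda>n. \<integral>p. S n p \<partial>?M) \<longlonglongrightarrow> (\<integral>p. L p \<partial>?M)"
  proof (rule integral_dominated_convergence[where w="\<lambda>(z, w). 5 * (\<bar>f z\<bar> * \<bar>g w\<bar>)"])
    show "integrable ?M (\<lambda>(z, w). 5 * (\<bar>f z\<bar> * \<bar>g w\<bar>))"
      using integrable_mult_right[OF integrable_pair_mult[OF f.int_abs g.int_abs], of 5] by (simp add: split_beta')
    show "L \<in> borel_measurable ?M" unfolding L_def by measurable
    show "S n \<in> borel_measurable ?M" for n unfolding S_def by measurable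
    show "AE p in ?M. norm (S n p) \<le> (case p of (z, w) \<Rightarrow> 5 * (\<bar>f z\<bar> * \<bar>g w\<bar>))" for n
    proof (rule AE_I2)
      fix p :: "complex \<times> complex"
      obtain z w where p: "p = (z, w)" by (cases p)
      have "\<bar>Re ((V n z - V n w) / (z - w))\<bar> \<le> 5"
      proof (cases "z = w")
        case False
        have "\<bar>Re ((V n z - V n w) / (z - w))\<bar> \<le> cmod (V n z - V n w) / cmod (z - w)"
          using abs_Re_le_cmod[of "(V n z - V n w) / (z - w)"] by (simp add: norm_divide)
        also have "\<dots> \<le> 5" using cutoff_field_lipschitz[of "real (Suc n)" z w] False by (simp add: V_def divide_le_eq)
        finally show ?thesis .
      qed simp
      then have "\<bar>Re ((V n z - V n w) / (z - w))\<bar> * \<bar>f z * g w\<bar> \<le> 5 * \<bar>f z * g w\<bar>" by (rule mult_right_mono) simp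
      then show "norm (S n p) \<le> (case p of (z, w) \<Rightarrow> 5 * (\<bar>f z\<bar> * \<bar>g w\<bar>))"
        by (simp add: p S_def abs_mult)
    qed
    show "AE p in ?M. (\<lambda>n. S n p) \<longlonglongrightarrow> L p"
    proof (rule AE_I2)
      fix p :: "complex \<times> complex"
      obtain z w where p: "p = (z, w)" by (cases p)
      show "(\<lambda>n. S n p) \<longlonglongrightarrow> L p"
      proof (cases "z = w")
        case False
        have V: "(\<lambda>n. V n z) \<longlonglongrightarrow> z" for z
        proof -
          have "(\<lambda>n. of_real ((cutoff (real (Suc n)) z)\<^sup>2) * z) \<longlonglongrightarrow> of_real (1\<^sup>2) * z"
            by (intro tendsto_intros cutoff_tendsto)
          then show ?thesis by (simp add: V_def)
        qed
        have "(\<lambda>n. Re ((V n z - V n w) / (z - w)) * (f z * g w)) \<longlonglongrightarrow> Re ((z - w) / (z - w)) * (f z * g w)"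
          using False by (intro tendsto_intros V) auto
        then show ?thesis using False by (simp add: p S_def L_def)
      qed (simp add: p S_def L_def)
    qed
  qed
  also have "(\<integral>p. L p \<partial>?M) = (\<integral>z. (\<integral>w. L (z, w) \<partial>lborel) \<partial>lborel)"
  proof (rule lborel_pair.integral_fst'[symmetric])
    show "integrable ?M L"
      by (rule Bochner_Integration.integrable_bound[OF integrable_pair_mult[OF f.int g.int]]) (auto simp: L_def split_beta')
  qed
  also have "\<dots> = (\<integral>z. f z * (\<integral>w. g w \<partial>lborel) \<partial>lborel)"
  proof (rule Bochner_Integration.integral_cong[OF refl])
    fix z
    have "(\<integral>w. L (z, w) \<partial>lborel) = (\<integral>w. f z * g w \<partial>lborel)"
    proof (rule integral_cong_AE)
      have "AE w in lborel. w \<noteq> z" by (rule AE_lborel_singleton)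
      then show "AE w in lborel. L (z, w) = f z * g w" by eventually_elim (simp add: L_def)
    qed (auto simp: L_def)
    then show "(\<integral>w. L (z, w) \<partial>lborel) = f z * (\<integral>w. g w \<partial>lborel)" by simp
  qed
  also have "\<dots> = (\<integral>z. f z \<partial>lborel) * (\<integral>w. g w \<partial>lborel)" by (rule integral_mult_left_zero)
  finally show ?thesis unfolding eq[symmetric] V_def by simp
qed

lemma Re_of_real_mult: "Re (of_real x * z) = x * Re z"
  by simp

text \<open>\<open>G\<close> is the conjugate of the gradient of \<open>X\<close>. Writing |z|^(2N)
  as a power of the inner product makes the derivative at the origin explicit. In the direction of
  the Euler field the power gives the factor 2 N and the potential the term with
  \<open>cauchy_pot f\<close>.\<close>

lemma potential_power_has_derivative:
  assumes f: "planar_density f" and N: "1 \<le> N"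
    and X: "\<And>z. X z = C * cmod z ^ (2 * N) * exp (- log_pot f z / pi)"
  obtains G where "continuous_on UNIV G" "\<And>z. (X has_derivative (\<lambda>h. Re (G z * h))) (at z)"
    "\<And>z. Re (G z * z) = X z * (2 * real N - Re (z * cauchy_pot f z) / pi)"
    "\<And>z. z \<noteq> 0 \<Longrightarrow> cmod (G z) * cmod z \<le> \<bar>X z\<bar> * (2 * real N + cmod (cauchy_pot f z) * cmod z / pi)"
proof -
  interpret f: planar_density f by (rule f)
  define E where "E z = exp (- log_pot f z / pi)" for z
  define a b where "a z = C * E z * (2 * real N * (z \<bullet> z) ^ (N - 1))" and "b z = C * E z * (z \<bullet> z) ^ N / pi" for z :: complex
  define G where "G z = of_real (a z) * cnj z - of_real (b z) * cauchy_pot f z" for z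
  have Ec: "continuous_on UNIV E" unfolding E_def by (intro continuous_intros f.log_pot_continuous) auto
  have Gc: "continuous_on UNIV G" unfolding G_def a_def b_def
    by (intro continuous_intros Ec f.cauchy_pot_continuous) auto
  have d: "(X has_derivative (\<lambda>h. Re (G z * h))) (at z)" for z
  proof -
    have dl: "((\<lambda>z. - log_pot f z / pi) has_derivative (\<lambda>h. - Re (cauchy_pot f z * h) / pi)) (at z)"
    proof -
      have 0: "- u / pi = - (1 / pi) * u" for u :: real by simp
      have 1: "(\<lambda>z. - log_pot f z / pi) = (\<lambda>z. - (1 / pi) * log_pot f z)"
        "(\<lambda>h. - Re (cauchy_pot f z * h) / pi) = (\<lambda>h. - (1 / pi) * Re (cauchy_pot f z * h))"
        by (rule ext, rule 0)+
      show ?thesis unfolding 1 by (rule has_derivative_mult_right[OF f.log_pot_has_derivative])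
    qed
    have "(exp has_derivative (*) (E z)) (at (- log_pot f z / pi))"
      unfolding E_def has_field_derivative_def[symmetric] by (rule DERIV_exp)
    from has_derivative_compose[OF dl this]
    have dE: "(E has_derivative (\<lambda>h. E z * (- Re (cauchy_pot f z * h) / pi))) (at z)"
      by (simp add: E_def[abs_def])
    have dq: "((\<lambda>z::complex. (z \<bullet> z) ^ N) has_derivative (\<lambda>h. of_nat N * (2 * (z \<bullet> h)) * (z \<bullet> z) ^ (N - 1))) (at z)"
      by (auto intro!: derivative_eq_intros simp: inner_commute)
    have "(X has_derivative (\<lambda>h. C * ((z \<bullet> z) ^ N * (E z * (- Re (cauchy_pot f z * h) / pi)) + of_nat N * (2 * (z \<bullet> h)) * (z \<bullet> z) ^ (N - 1) * E z))) (at z)"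
    proof -
      have "X = (\<lambda>z. C * ((z \<bullet> z) ^ N * E z))"
        by (auto simp: X E_def power_mult power2_norm_eq_inner fun_eq_iff)
      then show ?thesis using has_derivative_mult_right[OF has_derivative_mult[OF dq dE], of C] by simp
    qed
    moreover have "C * ((z \<bullet> z) ^ N * (E z * (- Re (cauchy_pot f z * h) / pi)) + of_nat N * (2 * (z \<bullet> h)) * (z \<bullet> z) ^ (N - 1) * E z) = Re (G z * h)" for h
    proof -
      have "Re (G z * h) = Re (of_real (a z) * (cnj z * h) - of_real (b z) * (cauchy_pot f z * h))"
        by (simp only: G_def left_diff_distrib mult.assoc)
      also have "\<dots> = a z * Re (cnj z * h) - b z * Re (cauchy_pot f z * h)"
        by (simp only: minus_complex.sel Re_of_real_mult)
      also have "Re (cnj z * h) = z \<bullet> h" by (simp add: inner_complex_def)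
      finally show ?thesis by (simp only: a_def b_def) (simp add: field_simps del: times_complex.sel)
    qed
    ultimately show ?thesis by simp
  qed
  have Gz: "G z * z = of_real (X z) * (2 * of_nat N - z * cauchy_pot f z / pi)" for z
  proof -
    have q: "of_real (z \<bullet> z) = cnj z * z"
      by (metis complex_norm_square power2_norm_eq_inner mult.commute of_real_power)
    have "(z \<bullet> z) ^ N = (z \<bullet> z) ^ (N - 1) * (z \<bullet> z)" using N power_minus_mult[of N "z \<bullet> z"] by linarith
    then have "of_real (a z) * (cnj z * z) = of_real (X z) * (2 * of_nat N)"
      by (simp add: a_def X E_def power_mult power2_norm_eq_inner flip: q)
    moreover have "of_real (b z) = of_real (X z) / (of_real pi :: complex)"
      by (simp add: b_def X E_def power_mult power2_norm_eq_inner)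
    moreover have "G z * z = of_real (a z) * (cnj z * z) - of_real (b z) * (z * cauchy_pot f z)"
      by (simp add: G_def algebra_simps)
    ultimately show ?thesis by (simp add: algebra_simps)
  qed
  have r: "Re (G z * z) = X z * (2 * real N - Re (z * cauchy_pot f z) / pi)" for z
    unfolding Gz by simp
  have n: "cmod (G z) * cmod z \<le> \<bar>X z\<bar> * (2 * real N + cmod (cauchy_pot f z) * cmod z / pi)" for z
  proof -
    have "cmod (G z) * cmod z = \<bar>X z\<bar> * cmod (2 * of_nat N - z * cauchy_pot f z / pi)"
      unfolding norm_mult[symmetric] Gz by (simp add: norm_mult)
    also have "\<dots> \<le> \<bar>X z\<bar> * (cmod (2 * of_nat N) + cmod (z * cauchy_pot f z / pi))"
      by (intro mult_left_mono norm_triangle_ineq4) auto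
    finally show ?thesis by (simp add: norm_mult norm_divide mult.commute)
  qed
  from that[OF Gc d r n] show ?thesis .
qed


context skew_system begin

text \<open>Put u_i = ln X_i and H = X1 X2 + c X2 - c X1. Then K \<partial>H/\<partial>u_1 = f2 and
  K \<partial>H/\<partial>u_2 = f1, crosswise; this is the skew structure. The Euler field applied
  to u_i gives 2 N_i - Re (z C_i) / pi, where C_i is the Cauchy potential of f_i. Integrating K z .
  grad H therefore produces 2 N1 \<Phi>2 + 2 N2 \<Phi>1 and, after symmetrisation, -\<Phi>1 \<Phi>2
  / pi, while the divergence theorem turns the same integral into -2 K times the integral of
  H.\<close>

lemma pohozaev:
  "2 * real N1 * \<Phi>2 + 2 * real N2 * \<Phi>1 - \<Phi>1 * \<Phi>2 / pi = - 2 * K * (\<integral>z. X1 z * X2 z + c * X2 z - c * X1 z \<partial>lborel)"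
proof -
  obtain B where B: "\<And>z. \<bar>f1 z\<bar> \<le> B" "\<And>z. \<bar>f2 z\<bar> \<le> B" by (rule tail_bound) blast
  note pd = d1.planar_density_axioms d2.planar_density_axioms
  obtain G1 where G1: "continuous_on UNIV G1" "\<And>z. (X1 has_derivative (\<lambda>h. Re (G1 z * h))) (at z)"
    "\<And>z. Re (G1 z * z) = X1 z * (2 * real N1 - Re (z * cauchy_pot f1 z) / pi)"
    by (rule potential_power_has_derivative[OF pd(1) N(1) X1]) blast
  obtain G2 where G2: "continuous_on UNIV G2" "\<And>z. (X2 has_derivative (\<lambda>h. Re (G2 z * h))) (at z)"
    "\<And>z. Re (G2 z * z) = X2 z * (2 * real N2 - Re (z * cauchy_pot f2 z) / pi)"
    by (rule potential_power_has_derivative[OF pd(2) N(2) X2]) blast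
  define H where "H z = X1 z * X2 z + c * X2 z - c * X1 z" for z
  define GH where "GH z = of_real (X1 z + c) * G2 z + of_real (X2 z - c) * G1 z" for z
  have Hc: "continuous_on UNIV H" unfolding H_def by (intro continuous_intros X_cont)
  have GHc: "continuous_on UNIV GH" unfolding GH_def by (intro continuous_intros X_cont G1 G2)
  have Hi: "integrable lborel H" unfolding H_def
    by (intro Bochner_Integration.integrable_add Bochner_Integration.integrable_diff integrable_mult_right X1_int X2_int X12_int)
  have dH: "(H has_derivative (\<lambda>h. Re (GH z * h))) (at z)" for z
  proof -
    have "(H has_derivative (\<lambda>h. (X1 z * Re (G2 z * h) + Re (G1 z * h) * X2 z) + c * Re (G2 z * h) - c * Re (G1 z * h))) (at z)"
      unfolding H_def
      by (intro has_derivative_add has_derivative_diff has_derivative_mult has_derivative_mult_right G1(2) G2(2))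
    moreover have "(X1 z * Re (G2 z * h) + Re (G1 z * h) * X2 z) + c * Re (G2 z * h) - c * Re (G1 z * h) = Re (GH z * h)" for h
      by (simp add: GH_def algebra_simps)
    ultimately show ?thesis by (simp only:)
  qed
  have GHz: "K * Re (GH z * z) = f2 z * (2 * real N1 - Re (z * cauchy_pot f1 z) / pi) + f1 z * (2 * real N2 - Re (z * cauchy_pot f2 z) / pi)" for z
  proof -
    have "Re (GH z * z) = (X1 z + c) * Re (G2 z * z) + (X2 z - c) * Re (G1 z * z)"
      by (simp add: GH_def algebra_simps)
    moreover have "K * ((X1 z + c) * (X2 z * u) + (X2 z - c) * (X1 z * v)) = f2 z * v + f1 z * u" for u v
      unfolding f1[of z] f2[of z] by (simp add: algebra_simps)
    ultimately show ?thesis by (simp only: G1(3) G2(3))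
  qed
  let ?\<mu> = "\<lambda>n. cutoff (real (Suc n))"
  let ?R = "\<lambda>n. real (Suc n)"
  \<comment> \<open>\<open>T n + W n\<close> is the divergence of H times the cut-off Euler field;
    \<open>W n\<close> collects the divergence 2 of the Euler field and the derivative of the
    squared cut-off.\<close>
  define T where "T n z = (?\<mu> n z)\<^sup>2 * Re (GH z * z)" for n z
  define W where "W n z = (2 * (?\<mu> n z)\<^sup>2 - 4 * (?\<mu> n z * ((cmod z)\<^sup>2 / (?R n)\<^sup>2))) * H z" for n z
  have mc: "continuous_on UNIV (?\<mu> n)" for n by (rule cutoff_continuous) simp
  have div: "(\<integral>z. T n z + W n z \<partial>lborel) = 0" for n
  proof -
    let ?m' = "\<lambda>z h. - 4 * ?\<mu> n z / (?R n)\<^sup>2 * (z \<bullet> h)"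
    define P where "P z = (?\<mu> n z)\<^sup>2 * (Re z * H z)" for z
    define Q where "Q z = (?\<mu> n z)\<^sup>2 * (Im z * H z)" for z
    define DP where "DP z h = (?\<mu> n z)\<^sup>2 * (Re z * Re (GH z * h) + Re h * H z) + ?m' z h * (Re z * H z)" for z h
    define DQ where "DQ z h = (?\<mu> n z)\<^sup>2 * (Im z * Re (GH z * h) + Im h * H z) + ?m' z h * (Im z * H z)" for z h
    have dP: "(P has_derivative DP z) (at z)" for z
      unfolding P_def DP_def
      by (intro has_derivative_mult cutoff_square_has_derivative dH bounded_linear_imp_has_derivative bounded_linear_Re)
    have dQ: "(Q has_derivative DQ z) (at z)" for z
      unfolding Q_def DQ_def
      by (intro has_derivative_mult cutoff_square_has_derivative dH bounded_linear_imp_has_derivative bounded_linear_Im)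
    have "(\<integral>z. DP z 1 + DQ z \<i> \<partial>lborel) = 0"
    proof (rule integral_divergence_zero[where P=P and Q=Q and R="?R n"])
      show "((\<lambda>x. P (Complex x y)) has_real_derivative DP (Complex x y) 1) (at x)" for x y
        by (rule has_derivative_lines(1)[OF dP])
      show "((\<lambda>y. Q (Complex x y)) has_real_derivative DQ (Complex x y) \<i>) (at y)" for x y
        by (rule has_derivative_lines(2)[OF dQ])
      show "continuous_on UNIV (\<lambda>z. DP z 1)" "continuous_on UNIV (\<lambda>z. DQ z \<i>)"
        unfolding DP_def DQ_def by (intro continuous_intros mc Hc GHc; simp)+
      show "P z = 0 \<and> Q z = 0 \<and> DP z 1 = 0 \<and> DQ z \<i> = 0" if "?R n \<le> cmod z" for z
        using cutoff_eq_0[OF _ that] by (simp add: P_def Q_def DP_def DQ_def)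
    qed
    moreover have "DP z 1 + DQ z \<i> = T n z + W n z" for z
    proof -
      have "z \<bullet> 1 = Re z" "z \<bullet> \<i> = Im z" by (simp_all add: inner_complex_def)
      then show ?thesis
        unfolding DP_def DQ_def T_def W_def cmod_power2
        by (simp add: power2_eq_square algebra_simps add_divide_distrib del: of_nat_Suc)
    qed
    ultimately show ?thesis by simp
  qed
  have Wi: "integrable lborel (W n)" and Wb: "\<bar>W n z\<bar> \<le> 6 * \<bar>H z\<bar>" for n z
  proof -
    have b: "\<bar>W n z\<bar> \<le> 6 * \<bar>H z\<bar>" for z
    proof -
      have "(?\<mu> n z)\<^sup>2 \<le> 1" using cutoff_bounds by (simp add: power_le_one)
      moreover have "?\<mu> n z * ((cmod z)\<^sup>2 / (?R n)\<^sup>2) \<le> 1" by (rule cutoff_sq_le) simp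
      moreover have "0 \<le> ?\<mu> n z * ((cmod z)\<^sup>2 / (?R n)\<^sup>2)" "0 \<le> (?\<mu> n z)\<^sup>2" using cutoff_bounds by simp_all
      ultimately have "\<bar>2 * (?\<mu> n z)\<^sup>2 - 4 * (?\<mu> n z * ((cmod z)\<^sup>2 / (?R n)\<^sup>2))\<bar> \<le> 6" by linarith
      then show ?thesis unfolding W_def abs_mult by (rule mult_right_mono) simp
    qed
    then show "\<bar>W n z\<bar> \<le> 6 * \<bar>H z\<bar>" .
    have "continuous_on UNIV (W n)" unfolding W_def by (intro continuous_intros mc Hc) auto
    then have [measurable]: "W n \<in> borel_measurable borel" by (rule borel_measurable_continuous_onI)
    show "integrable lborel (W n)"
      by (rule Bochner_Integration.integrable_bound[OF integrable_mult_right[OF integrable_abs[OF Hi], of 6]]) (use b in auto)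
  qed
  \<comment> \<open>The term with the derivative of the cut-off is not uniformly small. It tends to
    0 pointwise, which together with the majorant 6 |H| is enough.\<close>
  have Wlim: "(\<lambda>n. \<integral>z. W n z \<partial>lborel) \<longlonglongrightarrow> (\<integral>z. 2 * H z \<partial>lborel)"
  proof (rule integral_dominated_convergence[where w="\<lambda>z. 6 * \<bar>H z\<bar>"])
    show "AE z in lborel. (\<lambda>n. W n z) \<longlonglongrightarrow> 2 * H z"
    proof (rule AE_I2)
      fix z
      have "(\<lambda>n. (cmod z)\<^sup>2 / (?R n)\<^sup>2) \<longlonglongrightarrow> 0" by real_asymp
      then have "(\<lambda>n. (2 * (?\<mu> n z)\<^sup>2 - 4 * (?\<mu> n z * ((cmod z)\<^sup>2 / (?R n)\<^sup>2))) * H z) \<longlonglongrightarrow> (2 * 1\<^sup>2 - 4 * (1 * 0)) * H z"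
        by (intro tendsto_intros cutoff_tendsto)
      then show "(\<lambda>n. W n z) \<longlonglongrightarrow> 2 * H z" by (simp add: W_def)
    qed
  qed (use Wi Wb Hi in auto)
  have KT: "K * (\<integral>z. T n z \<partial>lborel) = 2 * real N1 * (\<integral>z. (?\<mu> n z)\<^sup>2 * f2 z \<partial>lborel) + 2 * real N2 * (\<integral>z. (?\<mu> n z)\<^sup>2 * f1 z \<partial>lborel)
     - ((\<integral>z. f2 z * Re (of_real ((?\<mu> n z)\<^sup>2) * z * cauchy_pot f1 z) \<partial>lborel)
      + (\<integral>z. f1 z * Re (of_real ((?\<mu> n z)\<^sup>2) * z * cauchy_pot f2 z) \<partial>lborel)) / pi"
    and Ti: "integrable lborel (T n)" for n
  proof -
    have ci: "integrable lborel g" if "continuous_on UNIV g" "\<And>z. ?R n \<le> cmod z \<Longrightarrow> g z = 0" for g :: "complex \<Rightarrow> real"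
    proof -
      have "(\<lambda>z. indicator (cball 0 (?R n)) z * g z) = g" using that(2) by (auto simp: fun_eq_iff split: split_indicator)
      then show ?thesis using integrable_indicator_cball[OF that(1), of 0 "?R n"] by simp
    qed
    have z0: "?R n \<le> cmod z \<Longrightarrow> ?\<mu> n z = 0" for z by (rule cutoff_eq_0) simp
    have i1: "integrable lborel (\<lambda>z. (?\<mu> n z)\<^sup>2 * f2 z)" "integrable lborel (\<lambda>z. (?\<mu> n z)\<^sup>2 * f1 z)"
      by (intro ci continuous_intros mc d1.cont d2.cont; simp add: z0 del: of_nat_Suc)+
    have i2: "integrable lborel (\<lambda>z. f2 z * Re (of_real ((?\<mu> n z)\<^sup>2) * z * cauchy_pot f1 z))"
      "integrable lborel (\<lambda>z. f1 z * Re (of_real ((?\<mu> n z)\<^sup>2) * z * cauchy_pot f2 z))"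
      by (intro ci continuous_intros mc d1.cont d2.cont d1.cauchy_pot_continuous d2.cauchy_pot_continuous; simp add: z0 del: of_nat_Suc)+
    show "integrable lborel (T n)"
      unfolding T_def by (intro ci continuous_intros mc GHc; simp add: z0 del: of_nat_Suc)+
    have "K * T n z = 2 * real N1 * ((?\<mu> n z)\<^sup>2 * f2 z) + 2 * real N2 * ((?\<mu> n z)\<^sup>2 * f1 z)
      - (f2 z * Re (of_real ((?\<mu> n z)\<^sup>2) * z * cauchy_pot f1 z) + f1 z * Re (of_real ((?\<mu> n z)\<^sup>2) * z * cauchy_pot f2 z)) / pi" for z
    proof -
      have "K * T n z = (?\<mu> n z)\<^sup>2 * (K * Re (GH z * z))" by (simp add: T_def)
      moreover have "Re (of_real ((?\<mu> n z)\<^sup>2) * z * u) = (?\<mu> n z)\<^sup>2 * Re (z * u)" for u by (simp add: algebra_simps flip: of_real_power)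
      moreover have "u * (v2 * (x - r1 / pi) + v1 * (y - r2 / pi)) = x * (u * v2) + y * (u * v1) - (v2 * (u * r1) + v1 * (u * r2)) / pi" for u v1 v2 x y r1 r2 :: real
        by (simp add: algebra_simps add_divide_distrib)
      ultimately show ?thesis by (simp only: GHz)
    qed
    then have "K * (\<integral>z. T n z \<partial>lborel) = (\<integral>z. 2 * real N1 * ((?\<mu> n z)\<^sup>2 * f2 z) + 2 * real N2 * ((?\<mu> n z)\<^sup>2 * f1 z)
      - (f2 z * Re (of_real ((?\<mu> n z)\<^sup>2) * z * cauchy_pot f1 z) + f1 z * Re (of_real ((?\<mu> n z)\<^sup>2) * z * cauchy_pot f2 z)) / pi \<partial>lborel)"
      by (simp only: integral_mult_right_zero[symmetric])
    then show "K * (\<integral>z. T n z \<partial>lborel) = 2 * real N1 * (\<integral>z. (?\<mu> n z)\<^sup>2 * f2 z \<partial>lborel) + 2 * real N2 * (\<integral>z. (?\<mu> n z)\<^sup>2 * f1 z \<partial>lborel)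
     - ((\<integral>z. f2 z * Re (of_real ((?\<mu> n z)\<^sup>2) * z * cauchy_pot f1 z) \<partial>lborel)
      + (\<integral>z. f1 z * Re (of_real ((?\<mu> n z)\<^sup>2) * z * cauchy_pot f2 z) \<partial>lborel)) / pi"
      by (simp only: Bochner_Integration.integral_add Bochner_Integration.integral_diff Bochner_Integration.integrable_add
          i1 i2 integrable_mult_right integrable_divide integral_mult_right_zero integral_divide_zero)
  qed
  have flim: "(\<lambda>n. \<integral>z. (?\<mu> n z)\<^sup>2 * g z \<partial>lborel) \<longlonglongrightarrow> (\<integral>z. g z \<partial>lborel)" if g: "planar_density g" for g
  proof (rule integral_dominated_convergence[where w="\<lambda>z. \<bar>g z\<bar>"])
    interpret g: planar_density g by (rule g)
    have [measurable]: "?\<mu> n \<in> borel_measurable borel" for n by (rule borel_measurable_continuous_onI[OF mc])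
    show "g \<in> borel_measurable lborel" "(\<lambda>z. (?\<mu> n z)\<^sup>2 * g z) \<in> borel_measurable lborel" for n by measurable
    show "integrable lborel (\<lambda>z. \<bar>g z\<bar>)" by (rule g.int_abs)
    show "AE z in lborel. (\<lambda>n. (?\<mu> n z)\<^sup>2 * g z) \<longlonglongrightarrow> g z"
    proof (rule AE_I2)
      fix z
      have "(\<lambda>n. (?\<mu> n z)\<^sup>2 * g z) \<longlonglongrightarrow> 1\<^sup>2 * g z" by (intro tendsto_intros cutoff_tendsto)
      then show "(\<lambda>n. (?\<mu> n z)\<^sup>2 * g z) \<longlonglongrightarrow> g z" by simp
    qed
    show "AE z in lborel. norm ((?\<mu> n z)\<^sup>2 * g z) \<le> \<bar>g z\<bar>" for n
    proof (rule AE_I2)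
      fix z
      have "(?\<mu> n z)\<^sup>2 * \<bar>g z\<bar> \<le> 1 * \<bar>g z\<bar>" using cutoff_bounds by (intro mult_right_mono) (auto simp: power_le_one)
      then show "norm ((?\<mu> n z)\<^sup>2 * g z) \<le> \<bar>g z\<bar>" by (simp add: abs_mult)
    qed
  qed
  have "(\<lambda>n. K * (\<integral>z. T n z \<partial>lborel)) \<longlonglongrightarrow> 2 * real N1 * \<Phi>2 + 2 * real N2 * \<Phi>1 - (\<Phi>2 * \<Phi>1) / pi"
    unfolding KT \<Phi>1_def \<Phi>2_def
    by (intro tendsto_intros flim pd cutoff_virial_tendsto[OF pd(2) pd(1) B(2) B(1)]) auto
  moreover have "(\<integral>z. T n z \<partial>lborel) = - (\<integral>z. W n z \<partial>lborel)" for n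
    using div[of n] Bochner_Integration.integral_add[OF Ti[of n] Wi[of n]] by linarith
  moreover have "(\<lambda>n. K * - (\<integral>z. W n z \<partial>lborel)) \<longlonglongrightarrow> K * - (\<integral>z. 2 * H z \<partial>lborel)"
    by (intro tendsto_intros Wlim)
  ultimately have "2 * real N1 * \<Phi>2 + 2 * real N2 * \<Phi>1 - (\<Phi>2 * \<Phi>1) / pi = K * - (\<integral>z. 2 * H z \<partial>lborel)"
    using LIMSEQ_unique by fastforce
  moreover define I where "I = (\<integral>z. H z \<partial>lborel)"
  moreover have "(\<integral>z. 2 * H z \<partial>lborel) = 2 * I" unfolding I_def by (rule integral_mult_right_zero)
  ultimately have "2 * real N1 * \<Phi>2 + 2 * real N2 * \<Phi>1 - \<Phi>1 * \<Phi>2 / pi = - 2 * K * I" by (simp add: mult.commute)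
  then show ?thesis by (simp only: I_def H_def)
qed

lemma integral_X_pos: "0 < (\<integral>z. X1 z \<partial>lborel)" "0 < (\<integral>z. X2 z \<partial>lborel)" "0 < (\<integral>z. X1 z * X2 z \<partial>lborel)"
proof -
  have pos: "0 < (\<integral>z. X z \<partial>lborel)" if i: "integrable lborel X" and p: "\<And>z. 0 \<le> X z" "\<And>z. z \<noteq> 0 \<Longrightarrow> 0 < X z" for X :: "complex \<Rightarrow> real"
  proof -
    have "(\<integral>z. X z \<partial>lborel) \<noteq> 0"
    proof
      assume "(\<integral>z. X z \<partial>lborel) = 0"
      then have "AE z in lborel. X z = 0" using integral_nonneg_eq_0_iff_AE[OF i] p(1) by auto
      moreover have "AE z in lborel. z \<noteq> (0::complex)" by (rule AE_lborel_singleton)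
      ultimately have "AE z in (lborel :: complex measure). False"
        by eventually_elim (use p(2) in force)
      then show False by (simp add: eventually_False ae_filter_eq_bot_iff emeasure_lborel_UNIV)
    qed
    moreover have "0 \<le> (\<integral>z. X z \<partial>lborel)" by (intro integral_nonneg_AE) (use p in auto)
    ultimately show ?thesis by linarith
  qed
  have X: "0 < X1 z" "0 < X2 z" if "z \<noteq> 0" for z using that C by (simp_all add: X1 X2)
  show "0 < (\<integral>z. X1 z \<partial>lborel)" "0 < (\<integral>z. X2 z \<partial>lborel)" "0 < (\<integral>z. X1 z * X2 z \<partial>lborel)"
    using X X_nonneg by (auto intro!: pos X1_int X2_int X12_int)
qed

text \<open>In terms of the positive numbers P, A, B the fluxes over 2 pi are P + B and P - A, and
  the Pohozaev identity says that the three products of exponents equal (N1 + 1)(N2 + 1) - P, N2 (N1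
  + 1) + B and N1 (N2 + 1) - A. Strictness is the positivity of P, A and B; the lower bounds 0 hold
  because both exponents exceed 1.\<close>

theorem exponent_inequalities:
  "0 < (\<beta>1 - 1) * (\<beta>2 - 1)" "(\<beta>1 - 1) * (\<beta>2 - 1) < (real N1 + 1) * (real N2 + 1)"
  "\<beta>2 * (\<beta>1 - 1) > real N2 * (real N1 + 1)" "0 < \<beta>1 * (\<beta>2 - 1)" "\<beta>1 * (\<beta>2 - 1) < real N1 * (real N2 + 1)"
proof -
  define P A B where "P = K * (\<integral>z. X1 z * X2 z \<partial>lborel) / (2 * pi)"
    and "A = K * c * (\<integral>z. X1 z \<partial>lborel) / (2 * pi)" and "B = K * c * (\<integral>z. X2 z \<partial>lborel) / (2 * pi)"
  have pos: "0 < P" "0 < A" "0 < B" using integral_X_pos K c by (auto simp: P_def A_def B_def)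
  have "\<Phi>1 = (\<integral>z. K * (X1 z * X2 z) + K * c * X2 z \<partial>lborel)"
    unfolding \<Phi>1_def by (rule arg_cong[OF f1_eq])
  moreover have "\<Phi>2 = (\<integral>z. K * (X1 z * X2 z) - K * c * X1 z \<partial>lborel)"
    unfolding \<Phi>2_def by (rule arg_cong[OF f2_eq])
  moreover have e: "2 * pi * P = K * (\<integral>z. X1 z * X2 z \<partial>lborel)" "2 * pi * A = K * c * (\<integral>z. X1 z \<partial>lborel)" "2 * pi * B = K * c * (\<integral>z. X2 z \<partial>lborel)"
    by (simp_all add: P_def A_def B_def)
  ultimately have \<Phi>: "\<Phi>1 = 2 * pi * (P + B)" "\<Phi>2 = 2 * pi * (P - A)"
    unfolding distrib_left right_diff_distrib e using X1_int X2_int X12_int by simp_all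
  have H: "K * (\<integral>z. X1 z * X2 z + c * X2 z - c * X1 z \<partial>lborel) = 2 * pi * (P + B - A)"
    unfolding distrib_left right_diff_distrib e using X1_int X2_int X12_int by (simp add: algebra_simps)
  have "2 * real N1 * (2 * pi * (P - A)) + 2 * real N2 * (2 * pi * (P + B)) - (2 * pi * (P + B)) * (2 * pi * (P - A)) / pi = - 2 * (2 * pi * (P + B - A))"
    using pohozaev unfolding \<Phi> H[symmetric] by simp
  moreover have q: "(2 * pi * (P + B)) * (2 * pi * (P - A)) / pi = 4 * pi * ((P + B) * (P - A))" by simp
  ultimately have "4 * pi * (real N1 * (P - A) + real N2 * (P + B) - (P + B) * (P - A) + (P + B - A)) = 0"
    unfolding q by (simp add: algebra_simps)
  then have E: "real N1 * (P - A) + real N2 * (P + B) - (P + B) * (P - A) + (P + B - A) = 0" by simp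
  have b: "\<beta>1 = P + B - N1" "\<beta>2 = P - A - N2" by (simp_all add: \<beta>1_def \<beta>2_def \<Phi>)
  have "(\<beta>1 - 1) * (\<beta>2 - 1) = (real N1 + 1) * (real N2 + 1) - P"
    "\<beta>2 * (\<beta>1 - 1) = real N2 * (real N1 + 1) + B" "\<beta>1 * (\<beta>2 - 1) = real N1 * (real N2 + 1) - A"
    using E unfolding b by algebra+
  moreover have "0 < (\<beta>1 - 1) * (\<beta>2 - 1)" "0 < \<beta>1 * (\<beta>2 - 1)"
    using \<beta>1_gt \<beta>2_gt by (auto intro!: mult_pos_pos)
  ultimately show "0 < (\<beta>1 - 1) * (\<beta>2 - 1)" "(\<beta>1 - 1) * (\<beta>2 - 1) < (real N1 + 1) * (real N2 + 1)"
    "\<beta>2 * (\<beta>1 - 1) > real N2 * (real N1 + 1)" "0 < \<beta>1 * (\<beta>2 - 1)" "\<beta>1 * (\<beta>2 - 1) < real N1 * (real N2 + 1)"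
    using pos by linarith+
qed

thm_deps exponent_inequalities

end

section \<open>Asymptotics of vortex solutions on the plane of the problem\<close>

lemma distr_plane_shift: "distr lborel borel (\<lambda>z. p + of_plane z) = (lborel :: (real^2) measure)"
proof -
  have "distr lborel borel (\<lambda>z. p + of_plane z) = distr (distr lborel borel of_plane) borel (\<lambda>x. p + x)"
    by (subst distr_distr) (auto simp: o_def)
  also have "\<dots> = distr lborel borel (\<lambda>x. p + x)" by (simp add: distr_of_plane)
  also have "\<dots> = lborel" using lborel_affine[of 1 p] by (simp add: density_1)
  finally show ?thesis .
qed

lemma plane_shift_measurable [measurable]: "(\<lambda>z. p + of_plane z) \<in> borel_measurable borel"
  by measurable

lemma integral_plane:
  fixes g :: "real^2 \<Rightarrow> real"
  assumes "g \<in> borel_measurable borel"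
  shows "(\<integral>x. g x \<partial>lborel) = (\<integral>z. g (p + of_plane z) \<partial>lborel)"
  using integral_distr[of "\<lambda>z. p + of_plane z" lborel borel g] assms by (simp add: distr_plane_shift)

lemma integrable_plane_iff:
  fixes g :: "real^2 \<Rightarrow> real"
  assumes "g \<in> borel_measurable borel"
  shows "integrable lborel g \<longleftrightarrow> integrable lborel (\<lambda>z. g (p + of_plane z))"
  using integrable_distr_eq[of "\<lambda>z. p + of_plane z" lborel borel g] assms by (simp add: distr_plane_shift)

lemma of_plane_eq: "of_plane h = Re h *\<^sub>R axis 1 1 + Im h *\<^sub>R axis 2 1"
  by (auto simp: vec_eq_iff forall_2 axis_def)

lemma of_plane_eq_0_iff [simp]: "of_plane z = 0 \<longleftrightarrow> z = 0"
  by (metis norm_eq_zero norm_of_plane)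

lemma has_derivative_plane_shift: "((\<lambda>z. p + of_plane z) has_derivative of_plane) (at z)"
  using has_derivative_add[OF has_derivative_const bounded_linear_imp_has_derivative[OF bounded_linear_of_plane]] by simp

lemma plane_shift_continuous: "continuous_on S (\<lambda>z. p + of_plane z)"
  by (intro continuous_on_add continuous_on_const linear_continuous_on bounded_linear_of_plane)

lemma plane_continuous:
  assumes "continuous_on UNIV f"
  shows "continuous_on UNIV (\<lambda>z. f (p + of_plane z))"
  by (rule continuous_on_compose2[OF assms plane_shift_continuous]) simp

lemma has_derivative_plane:
  assumes "f differentiable (at (p + of_plane z))"
  shows "((\<lambda>z. f (p + of_plane z)) has_derivative
     (\<lambda>h. Re h *\<^sub>R partial_deriv 1 f (p + of_plane z) + Im h *\<^sub>R partial_deriv 2 f (p + of_plane z))) (at z)"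
proof -
  let ?D = "frechet_derivative f (at (p + of_plane z))"
  have D: "(f has_derivative ?D) (at (p + of_plane z))" using assms by (simp add: frechet_derivative_works)
  have lin: "linear ?D" using D by (rule has_derivative_linear)
  have "((\<lambda>z. f (p + of_plane z)) has_derivative (\<lambda>h. ?D (of_plane h))) (at z)"
    by (rule has_derivative_compose[OF has_derivative_plane_shift D])
  moreover have "?D (of_plane h) = Re h *\<^sub>R partial_deriv 1 f (p + of_plane z) + Im h *\<^sub>R partial_deriv 2 f (p + of_plane z)" for h
    by (simp add: of_plane_eq[of h] linear_add[OF lin] linear_scale[OF lin] partial_deriv_def)
  ultimately show ?thesis by simp
qed

lemma
  fixes A :: "real^2 \<Rightarrow> real^2"
  assumes "A differentiable (at x)"
  shows differentiable_nth: "(\<lambda>y. A y $ i) differentiable (at x)"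
    and partial_deriv_nth: "partial_deriv j (\<lambda>y. A y $ i) x = partial_deriv j A x $ i"
proof -
  let ?D = "frechet_derivative A (at x)"
  have "(A has_derivative ?D) (at x)" using assms by (simp add: frechet_derivative_works)
  then have D: "((\<lambda>y. A y $ i) has_derivative (\<lambda>h. ?D h $ i)) (at x)"
    by (rule bounded_linear.has_derivative[OF bounded_linear_vec_nth])
  then show "(\<lambda>y. A y $ i) differentiable (at x)" by (auto simp: differentiable_def)
  have "frechet_derivative (\<lambda>y. A y $ i) (at x) = (\<lambda>h. ?D h $ i)"
    by (rule frechet_derivative_at[OF D, symmetric])
  then show "partial_deriv j (\<lambda>y. A y $ i) x = partial_deriv j A x $ i"
    by (simp add: partial_deriv_def)
qed

lemma C1_plane_continuous: "C1_plane f \<Longrightarrow> continuous_on UNIV f"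
  by (auto simp: C1_plane_def continuous_on_eq_continuous_at intro: differentiable_imp_continuous_within)

lemma continuous_curvature: "C1_plane A \<Longrightarrow> continuous_on UNIV (curvature A)"
  unfolding curvature_def
  by (simp add: C1_plane_def partial_deriv_nth) (intro continuous_intros; simp)

text \<open>Translation by \<open>p\<close> followed by \<open>of_plane\<close> moves the zero to
  the origin; the derivatives along coordinate lines are read off from the total derivative.\<close>

lemma vortex_component:
  assumes A: "C1_plane A" and \<phi>: "C1_plane \<phi>"
    and sd: "\<And>x. cov_deriv A 1 \<phi> x - \<i> * cov_deriv A 2 \<phi> x = 0"
    and z: "zero_of_multiplicity \<phi> p N" "\<And>x. \<phi> x = 0 \<Longrightarrow> x = p" "1 \<le> N"
    and L2: "integrable lborel (\<lambda>x. (norm (\<phi> x))\<^sup>2)" and int: "integrable lborel (curvature A)"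
  shows "planar_vortex (\<lambda>z. \<phi> (p + of_plane z))
     (\<lambda>z. partial_deriv 1 \<phi> (p + of_plane z)) (\<lambda>z. partial_deriv 2 \<phi> (p + of_plane z))
     (\<lambda>z. A (p + of_plane z) $ 1) (\<lambda>z. A (p + of_plane z) $ 2)
     (\<lambda>z. partial_deriv 2 A (p + of_plane z) $ 1) (\<lambda>z. partial_deriv 1 A (p + of_plane z) $ 2)
     (\<lambda>z. curvature A (p + of_plane z)) N"
proof
  have Ad: "A differentiable (at x)" and \<phi>d: "\<phi> differentiable (at x)" for x
    using A \<phi> by (auto simp: C1_plane_def)
  have Ac: "continuous_on UNIV (partial_deriv j A)" for j using A by (auto simp: C1_plane_def)
  show "((\<lambda>z. \<phi> (p + of_plane z)) has_derivative
      (\<lambda>h. of_real (Re h) * partial_deriv 1 \<phi> (p + of_plane z) + of_real (Im h) * partial_deriv 2 \<phi> (p + of_plane z))) (at z)" for z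
    using has_derivative_plane[OF \<phi>d, of p z] by (simp add: scaleR_conv_of_real)
  have d: "((\<lambda>z. A (p + of_plane z) $ i) has_derivative
     (\<lambda>h. Re h *\<^sub>R partial_deriv 1 A (p + of_plane z) $ i + Im h *\<^sub>R partial_deriv 2 A (p + of_plane z) $ i)) (at z)" for z i
    using has_derivative_plane[where f="\<lambda>x. A x $ i" and p=p and z=z, OF differentiable_nth[OF Ad]] by (simp add: partial_deriv_nth[OF Ad])
  show "((\<lambda>y. A (p + of_plane (Complex x y)) $ 1) has_real_derivative partial_deriv 2 A (p + of_plane (Complex x y)) $ 1) (at y)" for x y
    using has_derivative_lines(2)[OF d[of 1 "Complex x y"]] by simp
  show "((\<lambda>x. A (p + of_plane (Complex x y)) $ 2) has_real_derivative partial_deriv 1 A (p + of_plane (Complex x y)) $ 2) (at x)" for x y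
    using has_derivative_lines(1)[OF d[of 2 "Complex x y"]] by simp
  show "continuous_on UNIV (\<lambda>z. A (p + of_plane z) $ 1)" "continuous_on UNIV (\<lambda>z. A (p + of_plane z) $ 2)"
    "continuous_on UNIV (\<lambda>z. partial_deriv 2 A (p + of_plane z) $ 1)" "continuous_on UNIV (\<lambda>z. partial_deriv 1 A (p + of_plane z) $ 2)"
    by (intro continuous_intros plane_continuous C1_plane_continuous[OF A] Ac)+
  show "partial_deriv 1 \<phi> (p + of_plane z) + \<i> * complex_of_real (A (p + of_plane z) $ 1) * \<phi> (p + of_plane z) -
      \<i> * (partial_deriv 2 \<phi> (p + of_plane z) + \<i> * complex_of_real (A (p + of_plane z) $ 2) * \<phi> (p + of_plane z)) = 0" for z
    using sd[of "p + of_plane z"] by (simp add: cov_deriv_def)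
  show "(\<lambda>z. curvature A (p + of_plane z)) = (\<lambda>z. partial_deriv 1 A (p + of_plane z) $ 2 - partial_deriv 2 A (p + of_plane z) $ 1)"
    by (simp add: curvature_def partial_deriv_nth[OF Ad])
  show "integrable lborel (\<lambda>z. curvature A (p + of_plane z))"
    using int integrable_plane_iff[of "curvature A" p] borel_measurable_continuous_onI[OF continuous_curvature[OF A]] by simp
  have "\<phi> p = 0" using z(1) by (simp add: zero_of_multiplicity_def)
  then show "\<phi> (p + of_plane 0) = 0" by (simp add: of_plane_eq)
  show "z = 0" if "\<phi> (p + of_plane z) = 0" for z
    using z(2)[OF that] norm_of_plane[of z] by simp
  show "1 \<le> N" by (rule z(3))
  obtain r g where r: "0 < r" "continuous_on (ball p r) g" "\<And>x. x \<in> ball p r \<Longrightarrow> (0::real) < g x"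
    "\<And>x. x \<in> ball p r - {p} \<Longrightarrow> norm (\<phi> x) / norm (x - p) ^ N = g x"
    using z(1) unfolding zero_of_multiplicity_def by metis
  have b: "p + of_plane z \<in> ball p r \<longleftrightarrow> z \<in> ball 0 r" for z by (simp add: dist_norm)
  show "\<exists>r>0. \<exists>g. continuous_on (ball 0 r) g \<and> (\<forall>z\<in>ball 0 r. (0::real) < g z) \<and> (\<forall>z\<in>ball 0 r - {0}. cmod (\<phi> (p + of_plane z)) / cmod z ^ N = g z)"
  proof (intro exI conjI ballI)
    show "0 < r" by (rule r(1))
    show "continuous_on (ball 0 r) (\<lambda>z. g (p + of_plane z))"
      by (rule continuous_on_compose2[OF r(2) plane_shift_continuous]) (use b in blast)
    show "0 < g (p + of_plane z)" if "z \<in> ball 0 r" for z using r(3) b that by blast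
    show "cmod (\<phi> (p + of_plane z)) / cmod z ^ N = g (p + of_plane z)" if "z \<in> ball 0 r - {0}" for z
    proof -
      have "p + of_plane z \<noteq> p" using that norm_of_plane[of z] by auto
      then have "p + of_plane z \<in> ball p r - {p}" using b that by blast
      from r(4)[OF this] show ?thesis by simp
    qed
  qed
  have "(\<lambda>x. (norm (\<phi> x))\<^sup>2) \<in> borel_measurable borel"
    by (intro borel_measurable_continuous_onI continuous_intros C1_plane_continuous[OF \<phi>])
  then show "integrable lborel (\<lambda>z. (cmod (\<phi> (p + of_plane z)))\<^sup>2)"
    using L2 integrable_plane_iff[of "\<lambda>x. (norm (\<phi> x))\<^sup>2" p] by simp
qed

text \<open>Self-duality makes \<open>D\<^sub>1\<phi>\<close> and \<open>D\<^sub>2\<phi>\<close> proportional, so that both are controlled by the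
  gradient of \<open>|\<phi>|\<^sup>2\<close>.\<close>

lemma self_dual_cov_deriv_norm:
  fixes \<phi> \<phi>x \<phi>y :: complex
  assumes sd: "\<phi>x + \<i> * of_real a1 * \<phi> - \<i> * (\<phi>y + \<i> * of_real a2 * \<phi>) = 0"
    and G: "2 * Re (cnj \<phi> * \<phi>x) = Re G" "2 * Re (cnj \<phi> * \<phi>y) = - Im G"
  shows "2 * (cmod \<phi> * cmod (\<phi>x + \<i> * of_real a1 * \<phi>)) = cmod G" "2 * (cmod \<phi> * cmod (\<phi>y + \<i> * of_real a2 * \<phi>)) = cmod G"
proof -
  define D1 D2 where "D1 = \<phi>x + \<i> * of_real a1 * \<phi>" and "D2 = \<phi>y + \<i> * of_real a2 * \<phi>"
  have D: "D1 = \<i> * D2" using sd by (simp add: D1_def D2_def)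
  have "2 * Re (cnj \<phi> * D1) = Re G" "2 * Re (cnj \<phi> * D2) = - Im G"
    using G by (simp_all add: D1_def D2_def algebra_simps)
  moreover have "Im (cnj \<phi> * D1) = Re (cnj \<phi> * D2)" unfolding D by simp
  ultimately have "2 * (cnj \<phi> * D1) = cnj G" by (simp add: complex_eq_iff)
  then have "cmod (2 * (cnj \<phi> * D1)) = cmod (cnj G)" by simp
  then have 1: "2 * (cmod \<phi> * cmod D1) = cmod G" by (simp add: norm_mult)
  have "cmod D1 = cmod D2" unfolding D by (simp add: norm_mult)
  with 1 show "2 * (cmod \<phi> * cmod (\<phi>x + \<i> * of_real a1 * \<phi>)) = cmod G" "2 * (cmod \<phi> * cmod (\<phi>y + \<i> * of_real a2 * \<phi>)) = cmod G"
    by (simp_all add: D1_def D2_def)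
qed

text \<open>By self-duality the gradient of |\<phi>|^2 has modulus 2 |\<phi>| |D_j \<phi>|, and by
  the representation it is at most |\<phi>|^2 times O(1/|z|). Dividing by |\<phi>|, positive off the
  origin, bounds D_j \<phi> without any bound on the gauge field.\<close>

lemma (in planar_vortex) cov_deriv_decay:
  assumes C: "0 < C" "\<And>z. (cmod (\<phi> z))\<^sup>2 = C * cmod z ^ (2 * N) * exp (- log_pot f z / pi)"
    and B: "\<And>z. cmod (cauchy_pot f z) * cmod z \<le> B" and z: "z \<noteq> 0"
  shows "(cmod (\<phi>x z + \<i> * of_real (a1 z) * \<phi> z))\<^sup>2 \<le> (cmod (\<phi> z))\<^sup>2 * (2 * real N + B / pi)\<^sup>2 / (cmod z)\<^sup>2"
    and "(cmod (\<phi>y z + \<i> * of_real (a2 z) * \<phi> z))\<^sup>2 \<le> (cmod (\<phi> z))\<^sup>2 * (2 * real N + B / pi)\<^sup>2 / (cmod z)\<^sup>2"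
proof -
  define X where "X z = (cmod (\<phi> z))\<^sup>2" for z
  obtain G where G: "\<And>z. (X has_derivative (\<lambda>h. Re (G z * h))) (at z)"
    "\<And>z. z \<noteq> 0 \<Longrightarrow> cmod (G z) * cmod z \<le> \<bar>X z\<bar> * (2 * real N + cmod (cauchy_pot f z) * cmod z / pi)"
    by (rule potential_power_has_derivative[OF planar_density_axioms zero(3), of X C]) (use C in \<open>auto simp: X_def\<close>)
  have "(X has_derivative (\<lambda>h. 2 * (\<phi> z \<bullet> (of_real (Re h) * \<phi>x z + of_real (Im h) * \<phi>y z)))) (at z)"
    unfolding X_def power2_norm_eq_inner
    using has_derivative_inner[OF d\<phi>[of z] d\<phi>[of z]] by (simp add: inner_commute)
  from has_derivative_unique[OF this G(1)]
  have e: "2 * (\<phi> z \<bullet> (of_real (Re h) * \<phi>x z + of_real (Im h) * \<phi>y z)) = Re (G z * h)" for h by metis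
  have r: "2 * Re (cnj (\<phi> z) * \<phi>x z) = Re (G z)" "2 * Re (cnj (\<phi> z) * \<phi>y z) = - Im (G z)"
    using e[of 1] e[of \<i>] by (simp_all add: inner_complex_def)
  note n = self_dual_cov_deriv_norm[OF self_dual[of z] r]
  have nz: "0 < cmod (\<phi> z)" using zero(2) z by auto
  have "cmod (G z) * cmod z \<le> X z * (2 * real N + B / pi)"
  proof -
    have "\<bar>X z\<bar> * (2 * real N + cmod (cauchy_pot f z) * cmod z / pi) \<le> \<bar>X z\<bar> * (2 * real N + B / pi)"
      using B[of z] by (intro mult_left_mono add_left_mono divide_right_mono) auto
    then show ?thesis using G(2)[OF z] by (simp add: X_def)
  qed
  then have GB: "cmod (G z) * cmod z \<le> cmod (\<phi> z) * (cmod (\<phi> z) * (2 * real N + B / pi))"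
    by (simp add: X_def power2_eq_square mult.assoc)
  have "d\<^sup>2 \<le> (cmod (\<phi> z))\<^sup>2 * (2 * real N + B / pi)\<^sup>2 / (cmod z)\<^sup>2" if "2 * (cmod (\<phi> z) * d) = cmod (G z)" "0 \<le> d" for d
  proof -
    have "cmod (\<phi> z) * (2 * (d * cmod z)) \<le> cmod (\<phi> z) * (cmod (\<phi> z) * (2 * real N + B / pi))"
      using GB that(1)[symmetric] by (simp add: mult_ac)
    then have "2 * (d * cmod z) \<le> cmod (\<phi> z) * (2 * real N + B / pi)" using nz by simp
    moreover have "0 \<le> d * cmod z" using that(2) by simp
    ultimately have "d * cmod z \<le> cmod (\<phi> z) * (2 * real N + B / pi)" by linarith
    then have "(d * cmod z)\<^sup>2 \<le> (cmod (\<phi> z) * (2 * real N + B / pi))\<^sup>2"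
      using that(2) by (intro power_mono) auto
    then show ?thesis using z by (simp add: power_mult_distrib pos_le_divide_eq)
  qed
  then show "(cmod (\<phi>x z + \<i> * of_real (a1 z) * \<phi> z))\<^sup>2 \<le> (cmod (\<phi> z))\<^sup>2 * (2 * real N + B / pi)\<^sup>2 / (cmod z)\<^sup>2"
    "(cmod (\<phi>y z + \<i> * of_real (a2 z) * \<phi> z))\<^sup>2 \<le> (cmod (\<phi> z))\<^sup>2 * (2 * real N + B / pi)\<^sup>2 / (cmod z)\<^sup>2"
    using n by auto
qed

text \<open>Bounds in |x - p| are converted to |x|: for |x| at least 2 |p| + 2 the distance to
  \<open>p\<close> is at least |x|/2 and at least 1, at the price of the factor 2^b.\<close>

lemma bigo_plane:
  fixes g :: "real^2 \<Rightarrow> real"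
  assumes b: "0 \<le> b" and g: "\<And>z. 1 \<le> cmod z \<Longrightarrow> \<bar>g (p + of_plane z)\<bar> \<le> B * cmod z powr (- b)"
  shows "g \<in> O[at_infinity](\<lambda>x. norm x powr (- b))"
proof (rule bigoI[where c="\<bar>B\<bar> * 2 powr b"])
  have "\<forall>\<^sub>F x in at_infinity. 2 * norm p + 2 \<le> norm (x :: real^2)"
    unfolding eventually_at_infinity by auto
  then show "\<forall>\<^sub>F x in at_infinity. norm (g x) \<le> \<bar>B\<bar> * 2 powr b * norm (norm x powr (- b))"
  proof eventually_elim
    case (elim x)
    obtain z where "x - p = of_plane z" using ex_of_plane by blast
    then have x: "x = p + of_plane z" and nz: "cmod z = norm (x - p)"
      by (auto simp: algebra_simps simp flip: norm_of_plane)
    have half: "norm x / 2 \<le> cmod z" unfolding nz using norm_triangle_ineq2[of x p] elim by linarith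
    have one: "1 \<le> cmod z" using half elim norm_ge_zero[of p] by linarith
    have "\<bar>g x\<bar> \<le> B * cmod z powr (- b)" unfolding x by (rule g[OF one])
    also have "\<dots> \<le> \<bar>B\<bar> * cmod z powr (- b)" by (intro mult_right_mono) auto
    also have "cmod z powr (- b) \<le> (norm x / 2) powr (- b)"
    proof (rule powr_mono2')
      show "0 < norm x / 2" using elim norm_ge_zero[of p] by linarith
    qed (use b half in auto)
    also have "(norm x / 2) powr (- b) = 2 powr b * norm x powr (- b)"
      by (simp add: powr_divide powr_minus field_simps)
    finally show ?case by (simp add: mult.assoc mult_left_mono)
  qed
qed

text \<open>The conclusions \<open>1 < \<beta>1\<close> and \<open>1 < \<beta>2\<close> are listed
  separately because products alone leave the signs of the factors open; the existence argument
  relies on both bounds.\<close>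

theorem vortex_solution_asymptotics:
  assumes S: "vortex_solution k \<sigma> p N1 N2 S" and k: "0 < k" "0 < \<sigma>" and N: "1 \<le> N1" "1 \<le> N2"
    and \<beta>: "\<beta>1 = 1 / (2 * pi) * flux (A1 S) - real N1" "\<beta>2 = 1 / (2 * pi) * flux (A2 S) - real N2"
  shows "(\<lambda>x. (norm (phi1 S x))^2) \<in> O[at_infinity](\<lambda>x. norm x powr (- 2 * \<beta>1))"
    "(\<lambda>x. (norm (phi2 S x))^2) \<in> O[at_infinity](\<lambda>x. norm x powr (- 2 * \<beta>2))"
    "(\<lambda>x. (norm (cov_deriv (A1 S) j (phi1 S) x))^2) \<in> O[at_infinity](\<lambda>x. norm x powr (- 2 * (\<beta>1 + 1)))"
    "(\<lambda>x. (norm (cov_deriv (A2 S) j (phi2 S) x))^2) \<in> O[at_infinity](\<lambda>x. norm x powr (- 2 * (\<beta>2 + 1)))"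
    "curvature (A1 S) \<in> O[at_infinity](\<lambda>x. norm x powr (- 2 * \<beta>2))"
    "curvature (A2 S) \<in> O[at_infinity](\<lambda>x. norm x powr (- 2 * \<beta>1))"
    "0 < (\<beta>1 - 1) * (\<beta>2 - 1)" "(\<beta>1 - 1) * (\<beta>2 - 1) < (real N1 + 1) * (real N2 + 1)"
    "\<beta>2 * (\<beta>1 - 1) > real N2 * (real N1 + 1)" "0 < \<beta>1 * (\<beta>2 - 1)" "\<beta>1 * (\<beta>2 - 1) < real N1 * (real N2 + 1)"
    "1 < \<beta>1" "1 < \<beta>2"
proof -
  define K where "K = 8 * pi\<^sup>2 / k\<^sup>2"
  define c where "c = \<sigma> * k / (2 * pi)"
  have Kc: "0 < K" "0 < c" using k by (auto simp: K_def c_def)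
  have C1: "C1_plane (A1 S)" "C1_plane (A2 S)" "C1_plane (phi1 S)" "C1_plane (phi2 S)"
    and sd: "\<And>x. cov_deriv (A1 S) 1 (phi1 S) x - \<i> * cov_deriv (A1 S) 2 (phi1 S) x = 0"
      "\<And>x. cov_deriv (A2 S) 1 (phi2 S) x - \<i> * cov_deriv (A2 S) 2 (phi2 S) x = 0"
    and cv: "\<And>x. curvature (A1 S) x = K * (norm (phi2 S x))\<^sup>2 * ((norm (phi1 S x))\<^sup>2 + c)"
      "\<And>x. curvature (A2 S) x = K * (norm (phi1 S x))\<^sup>2 * ((norm (phi2 S x))\<^sup>2 - c)"
    using S by (auto simp: vortex_solution_def SD_solution_def Let_def K_def c_def)
  have fe: "integrable lborel (\<lambda>x. (norm (phi1 S x))\<^sup>2)" "integrable lborel (\<lambda>x. (norm (phi2 S x))\<^sup>2)"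
    "integrable lborel (\<lambda>x. (norm (phi1 S x))\<^sup>2 * (norm (phi2 S x))\<^sup>2)"
    using S by (auto simp: vortex_solution_def finite_energy_def)
  have z: "zero_of_multiplicity (phi1 S) p N1" "zero_of_multiplicity (phi2 S) p N2"
    "\<And>x. phi1 S x = 0 \<Longrightarrow> x = p" "\<And>x. phi2 S x = 0 \<Longrightarrow> x = p"
    using S by (auto simp: vortex_solution_def)
  have cv': "curvature (A1 S) = (\<lambda>x. K * ((norm (phi1 S x))\<^sup>2 * (norm (phi2 S x))\<^sup>2) + K * c * (norm (phi2 S x))\<^sup>2)"
    "curvature (A2 S) = (\<lambda>x. K * ((norm (phi1 S x))\<^sup>2 * (norm (phi2 S x))\<^sup>2) - K * c * (norm (phi1 S x))\<^sup>2)"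
    by (simp_all add: cv fun_eq_iff algebra_simps)
  have ci: "integrable lborel (curvature (A1 S))" "integrable lborel (curvature (A2 S))"
    unfolding cv' by (intro Bochner_Integration.integrable_add Bochner_Integration.integrable_diff integrable_mult_right fe)+
  interpret v1: planar_vortex "\<lambda>z. phi1 S (p + of_plane z)"
     "\<lambda>z. partial_deriv 1 (phi1 S) (p + of_plane z)" "\<lambda>z. partial_deriv 2 (phi1 S) (p + of_plane z)"
     "\<lambda>z. A1 S (p + of_plane z) $ 1" "\<lambda>z. A1 S (p + of_plane z) $ 2"
     "\<lambda>z. partial_deriv 2 (A1 S) (p + of_plane z) $ 1" "\<lambda>z. partial_deriv 1 (A1 S) (p + of_plane z) $ 2"
     "\<lambda>z. curvature (A1 S) (p + of_plane z)" N1
    by (rule vortex_component[OF C1(1,3) sd(1) z(1,3) N(1) fe(1) ci(1)])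
  interpret v2: planar_vortex "\<lambda>z. phi2 S (p + of_plane z)"
     "\<lambda>z. partial_deriv 1 (phi2 S) (p + of_plane z)" "\<lambda>z. partial_deriv 2 (phi2 S) (p + of_plane z)"
     "\<lambda>z. A2 S (p + of_plane z) $ 1" "\<lambda>z. A2 S (p + of_plane z) $ 2"
     "\<lambda>z. partial_deriv 2 (A2 S) (p + of_plane z) $ 1" "\<lambda>z. partial_deriv 1 (A2 S) (p + of_plane z) $ 2"
     "\<lambda>z. curvature (A2 S) (p + of_plane z)" N2
    by (rule vortex_component[OF C1(2,4) sd(2) z(2,4) N(2) fe(2) ci(2)])
  define X1 X2 f1 f2 where "X1 z = (cmod (phi1 S (p + of_plane z)))\<^sup>2" and "X2 z = (cmod (phi2 S (p + of_plane z)))\<^sup>2"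
    and "f1 z = curvature (A1 S) (p + of_plane z)" and "f2 z = curvature (A2 S) (p + of_plane z)" for z
  have sq: "(C * t ^ N * exp (- l / (2 * pi)))\<^sup>2 = C\<^sup>2 * t ^ (2 * N) * exp (- l / pi)" for C t l N
  proof -
    have "(exp (- l / (2 * pi)))\<^sup>2 = exp (- l / pi)" by (simp add: exp_double[symmetric])
    then show ?thesis by (simp only: power_mult_distrib power_mult[symmetric] mult.commute[of N])
  qed
  obtain D1 where D1: "0 < D1" "\<And>z. cmod (phi1 S (p + of_plane z)) = D1 * cmod z ^ N1 * exp (- log_pot (\<lambda>z. curvature (A1 S) (p + of_plane z)) z / (2 * pi))"
    by (rule v1.modulus_representation) blast
  obtain D2 where D2: "0 < D2" "\<And>z. cmod (phi2 S (p + of_plane z)) = D2 * cmod z ^ N2 * exp (- log_pot (\<lambda>z. curvature (A2 S) (p + of_plane z)) z / (2 * pi))"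
    by (rule v2.modulus_representation) blast
  have X1: "X1 z = D1\<^sup>2 * cmod z ^ (2 * N1) * exp (- log_pot f1 z / pi)" for z
    unfolding X1_def D1(2) sq f1_def[abs_def] ..
  have X2: "X2 z = D2\<^sup>2 * cmod z ^ (2 * N2) * exp (- log_pot f2 z / pi)" for z
    unfolding X2_def D2(2) sq f2_def[abs_def] ..
  have pc: "continuous_on UNIV (phi1 S)" "continuous_on UNIV (phi2 S)" using C1 by (auto intro: C1_plane_continuous)
  have m: "(\<lambda>x. (norm (phi1 S x))\<^sup>2) \<in> borel_measurable borel" "(\<lambda>x. (norm (phi2 S x))\<^sup>2) \<in> borel_measurable borel"
    "(\<lambda>x. (norm (phi1 S x))\<^sup>2 * (norm (phi2 S x))\<^sup>2) \<in> borel_measurable borel"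
    by (intro borel_measurable_continuous_onI continuous_intros pc)+
  interpret s: skew_system X1 X2 f1 f2 N1 N2 K c "D1\<^sup>2" "D2\<^sup>2"
  proof
    show "continuous_on UNIV X1" "continuous_on UNIV X2"
      unfolding X1_def X2_def by (intro continuous_intros plane_continuous pc)+
    show "integrable lborel X1" "integrable lborel X2" "integrable lborel (\<lambda>z. X1 z * X2 z)"
      using fe integrable_plane_iff[OF m(1), of p] integrable_plane_iff[OF m(2), of p] integrable_plane_iff[OF m(3), of p]
      by (simp_all add: X1_def[abs_def] X2_def[abs_def])
  qed (use Kc D1(1) D2(1) N X1 X2 cv in \<open>simp_all add: X1_def X2_def f1_def f2_def\<close>)
  have fl: "flux (A1 S) = s.\<Phi>1" "flux (A2 S) = s.\<Phi>2"
    unfolding flux_def s.\<Phi>1_def s.\<Phi>2_def f1_def f2_def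
    by (intro integral_plane borel_measurable_continuous_onI continuous_curvature C1)+
  have b: "\<beta>1 = s.\<beta>1" "\<beta>2 = s.\<beta>2" by (simp_all add: \<beta> s.\<beta>1_def s.\<beta>2_def fl)
  show gt: "1 < \<beta>1" "1 < \<beta>2" using s.\<beta>1_gt s.\<beta>2_gt by (simp_all add: b)
  show "0 < (\<beta>1 - 1) * (\<beta>2 - 1)" "(\<beta>1 - 1) * (\<beta>2 - 1) < (real N1 + 1) * (real N2 + 1)"
    "\<beta>2 * (\<beta>1 - 1) > real N2 * (real N1 + 1)" "0 < \<beta>1 * (\<beta>2 - 1)" "\<beta>1 * (\<beta>2 - 1) < real N1 * (real N2 + 1)"
    using s.exponent_inequalities by (simp_all add: b)
  obtain B where B: "\<And>z. 1 \<le> cmod z \<Longrightarrow> X1 z \<le> B * cmod z powr (- 2 * s.\<beta>1)" "\<And>z. 1 \<le> cmod z \<Longrightarrow> X2 z \<le> B * cmod z powr (- 2 * s.\<beta>2)"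
    "\<And>z. cmod (cauchy_pot f1 z) * cmod z \<le> B" "\<And>z. cmod (cauchy_pot f2 z) * cmod z \<le> B"
    "\<And>z. X1 z \<le> B" "\<And>z. X2 z \<le> B" "0 \<le> B"
    by (rule s.tail_bound) blast
  have mon: "\<bar>g\<bar> \<le> (D * B) * r" if "\<bar>g\<bar> \<le> D * x" "x \<le> B * r" "0 \<le> D" for g D x r :: real
    using that(1) mult_left_mono[OF that(2,3)] by (simp add: mult.assoc)
  show "(\<lambda>x. (norm (phi1 S x))^2) \<in> O[at_infinity](\<lambda>x. norm x powr (- 2 * \<beta>1))"
    using bigo_plane[of "2 * \<beta>1" "\<lambda>x. (norm (phi1 S x))\<^sup>2" p B] B(1) gt by (simp add: X1_def b)
  show "(\<lambda>x. (norm (phi2 S x))^2) \<in> O[at_infinity](\<lambda>x. norm x powr (- 2 * \<beta>2))"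
    using bigo_plane[of "2 * \<beta>2" "\<lambda>x. (norm (phi2 S x))\<^sup>2" p B] B(2) gt by (simp add: X2_def b)
  have "\<bar>f1 z\<bar> \<le> (K * (B + c)) * X2 z" for z
  proof -
    have "\<bar>f1 z\<bar> = K * X2 z * (X1 z + c)" using s.d1.nonneg[of z] s.f1[of z] by simp
    also have "\<dots> \<le> K * X2 z * (B + c)" using B(5)[of z] s.X_nonneg[of z] Kc by (intro mult_left_mono) auto
    finally show ?thesis by (simp add: mult_ac)
  qed
  from mon[OF this B(2)] have "1 \<le> cmod z \<Longrightarrow> \<bar>f1 z\<bar> \<le> (K * (B + c) * B) * cmod z powr (- (2 * \<beta>2))" for z
    using Kc B(7) by (simp add: b)
  then show "curvature (A1 S) \<in> O[at_infinity](\<lambda>x. norm x powr (- 2 * \<beta>2))"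
    using bigo_plane[of "2 * \<beta>2" "curvature (A1 S)" p "K * (B + c) * B"] gt by (simp add: f1_def)
  have "\<bar>f2 z\<bar> \<le> (K * (B + c)) * X1 z" for z
  proof -
    have "\<bar>f2 z\<bar> = K * X1 z * \<bar>X2 z - c\<bar>" using s.f2[of z] s.X_nonneg[of z] Kc by (simp add: abs_mult)
    also have "\<dots> \<le> K * X1 z * (B + c)" using B(6)[of z] s.X_nonneg[of z] Kc by (intro mult_left_mono) auto
    finally show ?thesis by (simp add: mult_ac)
  qed
  from mon[OF this B(1)] have "1 \<le> cmod z \<Longrightarrow> \<bar>f2 z\<bar> \<le> (K * (B + c) * B) * cmod z powr (- (2 * \<beta>1))" for z
    using Kc B(7) by (simp add: b)
  then show "curvature (A2 S) \<in> O[at_infinity](\<lambda>x. norm x powr (- 2 * \<beta>1))"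
    using bigo_plane[of "2 * \<beta>1" "curvature (A2 S)" p "K * (B + c) * B"] gt by (simp add: f2_def)
  have gr: "x * E / (cmod z)\<^sup>2 \<le> (E * B) * cmod z powr (- (2 * (\<beta> + 1)))"
    if "x \<le> B * cmod z powr (- 2 * \<beta>)" "1 \<le> cmod z" "0 \<le> E" for x E z \<beta>
  proof -
    have "x * E / (cmod z)\<^sup>2 \<le> B * cmod z powr (- 2 * \<beta>) * E / (cmod z)\<^sup>2"
      using that by (intro divide_right_mono mult_right_mono) auto
    also have "\<dots> = (E * B) * (cmod z powr (- 2 * \<beta>) * cmod z powr (- 2))"
      using that(2) by (simp add: powr_minus powr_numeral divide_inverse)
    also have "\<dots> = (E * B) * cmod z powr (- 2 * \<beta> + - 2)" by (simp only: powr_add)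
    also have "- 2 * \<beta> + - 2 = - (2 * (\<beta> + 1))" by simp
    finally show ?thesis .
  qed
  have cd1: "(norm (cov_deriv (A1 S) j (phi1 S) (p + of_plane z)))\<^sup>2 \<le> X1 z * (2 * real N1 + B / pi)\<^sup>2 / (cmod z)\<^sup>2" if "1 \<le> cmod z" for z j
  proof -
    have z: "z \<noteq> 0" using that by auto
    note d = v1.cov_deriv_decay[OF _ X1[unfolded X1_def f1_def[abs_def]] B(3)[unfolded f1_def[abs_def]] z]
    show ?thesis using d D1(1) exhaust_2[of j] by (auto simp: cov_deriv_def X1_def)
  qed
  have cd2: "(norm (cov_deriv (A2 S) j (phi2 S) (p + of_plane z)))\<^sup>2 \<le> X2 z * (2 * real N2 + B / pi)\<^sup>2 / (cmod z)\<^sup>2" if "1 \<le> cmod z" for z j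
  proof -
    have z: "z \<noteq> 0" using that by auto
    note d = v2.cov_deriv_decay[OF _ X2[unfolded X2_def f2_def[abs_def]] B(4)[unfolded f2_def[abs_def]] z]
    show ?thesis using d D2(1) exhaust_2[of j] by (auto simp: cov_deriv_def X2_def)
  qed
  have "(norm (cov_deriv (A1 S) j (phi1 S) (p + of_plane z)))\<^sup>2 \<le> ((2 * real N1 + B / pi)\<^sup>2 * B) * cmod z powr (- (2 * (\<beta>1 + 1)))" if "1 \<le> cmod z" for z j
    using cd1[OF that, of j] gr[OF B(1)[OF that] that, of "(2 * real N1 + B / pi)\<^sup>2"] by (simp add: b)
  then show "(\<lambda>x. (norm (cov_deriv (A1 S) j (phi1 S) x))^2) \<in> O[at_infinity](\<lambda>x. norm x powr (- 2 * (\<beta>1 + 1)))"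
    using bigo_plane[of "2 * (\<beta>1 + 1)" "\<lambda>x. (norm (cov_deriv (A1 S) j (phi1 S) x))\<^sup>2" p "(2 * real N1 + B / pi)\<^sup>2 * B"] gt by simp
  have "(norm (cov_deriv (A2 S) j (phi2 S) (p + of_plane z)))\<^sup>2 \<le> ((2 * real N2 + B / pi)\<^sup>2 * B) * cmod z powr (- (2 * (\<beta>2 + 1)))" if "1 \<le> cmod z" for z j
    using cd2[OF that, of j] gr[OF B(2)[OF that] that, of "(2 * real N2 + B / pi)\<^sup>2"] by (simp add: b)
  then show "(\<lambda>x. (norm (cov_deriv (A2 S) j (phi2 S) x))^2) \<in> O[at_infinity](\<lambda>x. norm x powr (- 2 * (\<beta>2 + 1)))"
    using bigo_plane[of "2 * (\<beta>2 + 1)" "\<lambda>x. (norm (cov_deriv (A2 S) j (phi2 S) x))\<^sup>2" p "(2 * real N2 + B / pi)\<^sup>2 * B"] gt by simp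
qed

thm_deps vortex_solution_asymptotics

section \<open>Picard iteration for the singular radial equation\<close>

text \<open>The 2 in the exponent comes back as 1/2 in the integral; this is the contraction
  constant of the weighted iteration.\<close>

lemma integral_double_exp:
  "c * integral {0..1} (\<lambda>t. exp (2 * c * t)) = (exp (2 * c) - 1) / (2::real)"
proof -
  have "((\<lambda>t. c * exp (2 * c * t)) has_integral exp (2 * c * 1) / 2 - exp (2 * c * 0) / 2) {0..1}"
    by (intro fundamental_theorem_of_calculus)
       (auto simp: has_real_derivative_iff_has_vector_derivative[symmetric] intro!: derivative_eq_intros)
  then show ?thesis by (simp add: integral_unique diff_divide_distrib flip: integral_mult_right)
qed

text \<open>A Picard iteration for \<open>s Z'' + Z' = - G(s, Z)\<close>, \<open>Z(0) = 0\<close>, in integrated form. Iterating on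
  functions of \<open>s\<close> and of the parameter jointly gives continuous dependence on the parameter; the
  weight absorbs the growth of the Lipschitz constant \<open>L\<close>.\<close>

lemma continuous_on_compose_UNIV:
  "continuous_on UNIV f \<Longrightarrow> continuous_on S g \<Longrightarrow> continuous_on S (\<lambda>x. f (g x))"
  by (rule continuous_on_compose2) auto

lemma averaged_fixpoint:
  fixes G :: "real \<Rightarrow> 'p::metric_space \<Rightarrow> 'z::euclidean_space \<Rightarrow> 'z" and L :: "real \<Rightarrow> 'p \<Rightarrow> real"
  assumes Gc: "continuous_on UNIV (\<lambda>(s, p, z). G s p z)" and Lc: "continuous_on UNIV (\<lambda>(s, p). L s p)"
    and L0: "\<And>s p. 0 \<le> L s p" and Lm: "\<And>s t p. 0 \<le> s \<Longrightarrow> s \<le> t \<Longrightarrow> L s p \<le> L t p"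
    and Gb: "\<And>s p z. 0 \<le> s \<Longrightarrow> norm (G s p z) \<le> L s p"
    and Gl: "\<And>s p z z'. 0 \<le> s \<Longrightarrow> norm (G s p z - G s p z') \<le> L s p * norm (z - z')"
  obtains Z where "continuous_on UNIV (\<lambda>(s, p). Z s p)"
    "\<And>s p. 0 \<le> s \<Longrightarrow> Z s p = - s *\<^sub>R integral {0..1} (\<lambda>\<tau>. integral {0..1} (\<lambda>\<sigma>. G (s * \<tau> * \<sigma>) p (Z (s * \<tau> * \<sigma>) p)))"
proof -
  \<comment> \<open>The unknown of the iteration is Z / W, which stays bounded by 1. Using
    \<open>max 0 s\<close> extends everything to the whole line, so the iteration runs in the
    complete space of bounded continuous functions of \<open>s\<close> and the parameter.\<close>
  define W where "W s p = exp (2 * (max 0 s * L (max 0 s) p))" for s p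
  have W0: "0 < W s p" for s p by (simp add: W_def)
  have Wc: "continuous_on UNIV (\<lambda>x. W (fst x) (snd x))"
  proof -
    have "continuous_on UNIV (\<lambda>x. L (max 0 (fst x)) (snd x))"
      using continuous_on_compose_UNIV[OF Lc, of UNIV "\<lambda>x. (max 0 (fst x), snd x)"]
      by (simp add: split_beta' continuous_intros)
    then show ?thesis unfolding W_def by (intro continuous_intros)
  qed
  \<comment> \<open>Substituting t = s \<tau> in the integral of (1/t) times the integral of G over
    [0, t] turns the singular quotient into a double average over unit intervals, which is
    continuous at s = 0.\<close>
  define D where "D b s p = integral {0..1} (\<lambda>\<tau>. integral {0..1} (\<lambda>\<sigma>. G (max 0 s * \<tau> * \<sigma>) p (W (max 0 s * \<tau> * \<sigma>) p *\<^sub>R b (max 0 s * \<tau> * \<sigma>, p))))"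
    for b :: "real \<times> 'p \<Rightarrow> 'z" and s p
  have Ic: "continuous_on UNIV (\<lambda>(x, \<tau>, \<sigma>). G (max 0 (fst x) * \<tau> * \<sigma>) (snd x) (W (max 0 (fst x) * \<tau> * \<sigma>) (snd x) *\<^sub>R b (max 0 (fst x) * \<tau> * \<sigma>, snd x)))"
    if b: "continuous_on UNIV b" for b
  proof -
    let ?s = "\<lambda>y. max 0 (fst (fst y)) * fst (snd y) * snd (snd y)"
    have s: "continuous_on UNIV (\<lambda>y :: (real \<times> 'p) \<times> real \<times> real. ?s y)" by (intro continuous_intros)
    have 1: "continuous_on UNIV (\<lambda>y :: (real \<times> 'p) \<times> real \<times> real. W (?s y) (snd (fst y)))"
      using continuous_on_compose_UNIV[OF Wc, of UNIV "\<lambda>y. (?s y, snd (fst y))"] by (simp add: continuous_on_Pair continuous_on_snd continuous_on_fst s)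
    have 2: "continuous_on UNIV (\<lambda>y :: (real \<times> 'p) \<times> real \<times> real. b (?s y, snd (fst y)))"
      by (rule continuous_on_compose2[OF b]) (auto intro!: continuous_intros)
    have "continuous_on UNIV (\<lambda>y :: (real \<times> 'p) \<times> real \<times> real. (\<lambda>(s, p, z). G s p z) (?s y, snd (fst y), W (?s y) (snd (fst y)) *\<^sub>R b (?s y, snd (fst y))))"
      by (rule continuous_on_compose2[OF Gc]) (auto intro!: continuous_intros 1 2)
    then show ?thesis by (simp add: split_beta')
  qed
  have I2: "continuous_on UNIV (\<lambda>y. integral {0..1} (\<lambda>\<sigma>. G (max 0 (fst (fst y)) * snd y * \<sigma>) (snd (fst y)) (W (max 0 (fst (fst y)) * snd y * \<sigma>) (snd (fst y)) *\<^sub>R b (max 0 (fst (fst y)) * snd y * \<sigma>, snd (fst y)))))"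
    if b: "continuous_on UNIV b" for b
  proof (rule integral_continuous_on_param[where 'b=real, unfolded cbox_interval])
    show "continuous_on (UNIV \<times> {0..1}) (\<lambda>(y, \<sigma>). G (max 0 (fst (fst y)) * snd y * \<sigma>) (snd (fst y)) (W (max 0 (fst (fst y)) * snd y * \<sigma>) (snd (fst y)) *\<^sub>R b (max 0 (fst (fst y)) * snd y * \<sigma>, snd (fst y))))"
      using continuous_on_compose_UNIV[OF Ic[OF b], of "UNIV \<times> {0..1}" "\<lambda>q. (fst (fst q), snd (fst q), snd q)"]
      by (simp add: split_beta' continuous_intros)
  qed
  have Dc: "continuous_on UNIV (\<lambda>x. D b (fst x) (snd x))" if b: "continuous_on UNIV b" for b
    unfolding D_def
  proof (rule integral_continuous_on_param[where 'b=real, unfolded cbox_interval])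
    show "continuous_on (UNIV \<times> {0..1}) (\<lambda>(x, \<tau>). integral {0..1} (\<lambda>\<sigma>. G (max 0 (fst x) * \<tau> * \<sigma>) (snd x) (W (max 0 (fst x) * \<tau> * \<sigma>) (snd x) *\<^sub>R b (max 0 (fst x) * \<tau> * \<sigma>, snd x))))"
      using continuous_on_subset[OF I2[OF b]] by (simp add: split_beta')
  qed
  have inner_i: "(\<lambda>\<sigma>. G (max 0 s * \<tau> * \<sigma>) p (W (max 0 s * \<tau> * \<sigma>) p *\<^sub>R b (max 0 s * \<tau> * \<sigma>, p))) integrable_on {0..1}"
    if b: "continuous_on UNIV b" for b s \<tau> p
    using continuous_on_compose_UNIV[OF Ic[OF b], of "{0..1}" "\<lambda>\<sigma>. ((s, p), \<tau>, \<sigma>)"]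
    by (intro integrable_continuous_interval) (simp add: split_beta' continuous_intros)
  have outer_i: "(\<lambda>\<tau>. integral {0..1} (\<lambda>\<sigma>. G (max 0 s * \<tau> * \<sigma>) p (W (max 0 s * \<tau> * \<sigma>) p *\<^sub>R b (max 0 s * \<tau> * \<sigma>, p)))) integrable_on {0..1}"
    if b: "continuous_on UNIV b" for b s p
    using continuous_on_compose_UNIV[OF I2[OF b], of "{0..1}" "\<lambda>\<tau>. ((s, p), \<tau>)"]
    by (intro integrable_continuous_interval) (simp add: split_beta' continuous_intros)
  define F where "F b x = (- (max 0 (fst x)) / W (fst x) (snd x)) *\<^sub>R D b (fst x) (snd x)" for b :: "real \<times> 'p \<Rightarrow> 'z" and x
  have Fc: "continuous_on UNIV (F b)" if "continuous_on UNIV b" for b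
    unfolding F_def using W0 by (intro continuous_intros Dc that Wc) (auto simp: less_le)
  have sW: "max 0 s * (\<tau> * \<sigma>) * L (max 0 s * \<tau> * \<sigma>) p \<le> max 0 s * L (max 0 s) p * \<tau>" "L (max 0 s * \<tau> * \<sigma>) p \<le> L (max 0 s) p"
    if "\<tau> \<in> {0..1}" "\<sigma> \<in> {0..1}" for s \<tau> \<sigma> p
  proof -
    have ts: "0 \<le> \<tau> * \<sigma>" "\<tau> * \<sigma> \<le> \<tau>" "\<tau> * \<sigma> \<le> 1" using that by (auto intro: mult_nonneg_nonneg mult_left_le mult_le_one)
    have le: "max 0 s * (\<tau> * \<sigma>) \<le> max 0 s * 1" "0 \<le> max 0 s * (\<tau> * \<sigma>)" using ts that by (auto intro!: mult_left_mono mult_nonneg_nonneg simp del: mult_1_right)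
    then show l: "L (max 0 s * \<tau> * \<sigma>) p \<le> L (max 0 s) p" by (intro Lm) (simp_all add: mult.assoc)
    have "max 0 s * (\<tau> * \<sigma>) * L (max 0 s * \<tau> * \<sigma>) p \<le> max 0 s * \<tau> * L (max 0 s) p"
      using ts that l L0 by (intro mult_mono mult_left_mono) auto
    then show "max 0 s * (\<tau> * \<sigma>) * L (max 0 s * \<tau> * \<sigma>) p \<le> max 0 s * L (max 0 s) p * \<tau>" by (simp add: mult_ac)
  qed
  have Fb: "norm (F b x) \<le> 1" if b: "continuous_on UNIV b" for b x
  proof -
    obtain s p where x: "x = (s, p)" by (cases x)
    let ?s = "max 0 s"
    have "norm (D b s p) \<le> L ?s p * (1 - 0)"
      unfolding D_def
    proof (rule integral_bound[OF _ _ ])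
      show "continuous_on {0..1} (\<lambda>\<tau>. integral {0..1} (\<lambda>\<sigma>. G (?s * \<tau> * \<sigma>) p (W (?s * \<tau> * \<sigma>) p *\<^sub>R b (?s * \<tau> * \<sigma>, p))))"
        using continuous_on_compose_UNIV[OF I2[OF b], of "{0..1}" "\<lambda>\<tau>. ((s, p), \<tau>)"] by (simp add: split_beta' continuous_intros)
      fix \<tau> :: real assume \<tau>: "\<tau> \<in> {0..1}"
      have "norm (integral {0..1} (\<lambda>\<sigma>. G (?s * \<tau> * \<sigma>) p (W (?s * \<tau> * \<sigma>) p *\<^sub>R b (?s * \<tau> * \<sigma>, p)))) \<le> L ?s p * (1 - 0)"
      proof (rule integral_bound)
        show "continuous_on {0..1} (\<lambda>\<sigma>. G (?s * \<tau> * \<sigma>) p (W (?s * \<tau> * \<sigma>) p *\<^sub>R b (?s * \<tau> * \<sigma>, p)))"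
          using continuous_on_compose_UNIV[OF Ic[OF b], of "{0..1}" "\<lambda>\<sigma>. ((s, p), \<tau>, \<sigma>)"] by (simp add: split_beta' continuous_intros)
        fix \<sigma> :: real assume \<sigma>: "\<sigma> \<in> {0..1}"
        have "norm (G (?s * \<tau> * \<sigma>) p (W (?s * \<tau> * \<sigma>) p *\<^sub>R b (?s * \<tau> * \<sigma>, p))) \<le> L (?s * \<tau> * \<sigma>) p"
          using \<tau> \<sigma> by (intro Gb mult_nonneg_nonneg) auto
        then show "norm (G (?s * \<tau> * \<sigma>) p (W (?s * \<tau> * \<sigma>) p *\<^sub>R b (?s * \<tau> * \<sigma>, p))) \<le> L ?s p"
          using sW(2)[OF \<tau> \<sigma>, of s p] by linarith
      qed simp
      then show "norm (integral {0..1} (\<lambda>\<sigma>. G (?s * \<tau> * \<sigma>) p (W (?s * \<tau> * \<sigma>) p *\<^sub>R b (?s * \<tau> * \<sigma>, p)))) \<le> L ?s p" by simp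
    qed simp
    then have "?s * norm (D b s p) \<le> ?s * L ?s p" by (intro mult_left_mono) auto
    also have "\<dots> \<le> W s p"
    proof -
      have "0 \<le> ?s * L ?s p" using L0 by simp
      then show ?thesis using exp_ge_add_one_self[of "2 * (?s * L ?s p)"] unfolding W_def by linarith
    qed
    finally show ?thesis using W0[of s p] by (simp add: F_def x divide_le_eq)
  qed
  have Fl: "norm (F b x - F b' x) \<le> 1 / 2 * d" if b: "continuous_on UNIV b" "continuous_on UNIV b'" and d: "\<And>x. norm (b x - b' x) \<le> d" for b b' d x
  proof -
    obtain s p where x: "x = (s, p)" by (cases x)
    let ?s = "max 0 s"
    have d0: "0 \<le> d" using d[of x] norm_ge_zero order_trans by blast
    \<comment> \<open>A majorant of the inner integrand that no longer depends on \<sigma>: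
      monotonicity of \<open>L\<close> and \<sigma> \<le> 1 bound the weight at s \<tau> \<sigma> by
      an exponential that is linear in \<tau> in the exponent.\<close>
    let ?E = "\<lambda>\<tau>. L ?s p * exp (2 * (?s * L ?s p) * \<tau>) * d"
    have "norm (D b s p - D b' s p) \<le> integral {0..1} ?E"
      unfolding D_def Henstock_Kurzweil_Integration.integral_diff[OF outer_i[OF b(1)] outer_i[OF b(2)], symmetric]
    proof (rule Henstock_Kurzweil_Integration.integral_norm_bound_integral)
      show "(\<lambda>\<tau>. integral {0..1} (\<lambda>\<sigma>. G (?s * \<tau> * \<sigma>) p (W (?s * \<tau> * \<sigma>) p *\<^sub>R b (?s * \<tau> * \<sigma>, p)))
           - integral {0..1} (\<lambda>\<sigma>. G (?s * \<tau> * \<sigma>) p (W (?s * \<tau> * \<sigma>) p *\<^sub>R b' (?s * \<tau> * \<sigma>, p)))) integrable_on {0..1}"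
        by (intro Henstock_Kurzweil_Integration.integrable_diff outer_i b)
      show "?E integrable_on {0..1}" by (intro integrable_continuous_interval continuous_intros)
      fix \<tau> :: real assume \<tau>: "\<tau> \<in> {0..1}"
      have "norm (integral {0..1} (\<lambda>\<sigma>. G (?s * \<tau> * \<sigma>) p (W (?s * \<tau> * \<sigma>) p *\<^sub>R b (?s * \<tau> * \<sigma>, p))
           - G (?s * \<tau> * \<sigma>) p (W (?s * \<tau> * \<sigma>) p *\<^sub>R b' (?s * \<tau> * \<sigma>, p)))) \<le> integral {0..1} (\<lambda>\<sigma>::real. ?E \<tau>)"
      proof (rule Henstock_Kurzweil_Integration.integral_norm_bound_integral)
        fix \<sigma> :: real assume \<sigma>: "\<sigma> \<in> {0..1}"
        let ?u = "?s * \<tau> * \<sigma>"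
        have u0: "0 \<le> ?u" using \<tau> \<sigma> by simp
        have "norm (G ?u p (W ?u p *\<^sub>R b (?u, p)) - G ?u p (W ?u p *\<^sub>R b' (?u, p))) \<le> L ?u p * norm (W ?u p *\<^sub>R b (?u, p) - W ?u p *\<^sub>R b' (?u, p))"
          by (rule Gl[OF u0])
        also have "\<dots> = L ?u p * (W ?u p * norm (b (?u, p) - b' (?u, p)))"
          using W0[of ?u p] by (simp add: scaleR_diff_right[symmetric])
        also have "\<dots> \<le> L ?s p * (exp (2 * (?s * L ?s p) * \<tau>) * d)"
        proof (intro mult_mono)
          show "L ?u p \<le> L ?s p" by (rule sW(2)[OF \<tau> \<sigma>])
          have "?u * L ?u p \<le> ?s * L ?s p * \<tau>" using sW(1)[OF \<tau> \<sigma>, of s p] by (simp add: mult_ac)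
          then show "W ?u p \<le> exp (2 * (?s * L ?s p) * \<tau>)" using u0 unfolding W_def by (simp add: mult.assoc)
          show "norm (b (?u, p) - b' (?u, p)) \<le> d" by (rule d)
        qed (use L0 d0 W0[of ?u p] in auto)
        finally show "norm (G ?u p (W ?u p *\<^sub>R b (?u, p)) - G ?u p (W ?u p *\<^sub>R b' (?u, p))) \<le> ?E \<tau>" by (simp add: mult.assoc)
      qed (auto intro!: Henstock_Kurzweil_Integration.integrable_diff inner_i b)
      then show "norm (integral {0..1} (\<lambda>\<sigma>. G (?s * \<tau> * \<sigma>) p (W (?s * \<tau> * \<sigma>) p *\<^sub>R b (?s * \<tau> * \<sigma>, p)))
           - integral {0..1} (\<lambda>\<sigma>. G (?s * \<tau> * \<sigma>) p (W (?s * \<tau> * \<sigma>) p *\<^sub>R b' (?s * \<tau> * \<sigma>, p)))) \<le> ?E \<tau>"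
        by (simp add: Henstock_Kurzweil_Integration.integral_diff inner_i b)
    qed
    then have "?s * norm (D b s p - D b' s p) \<le> ?s * integral {0..1} ?E" by (intro mult_left_mono) auto
    also have "\<dots> = ((?s * L ?s p) * integral {0..1} (\<lambda>\<tau>. exp (2 * (?s * L ?s p) * \<tau>))) * d"
      by (simp add: mult_ac)
    also have "\<dots> = (W s p - 1) / 2 * d" unfolding integral_double_exp W_def by simp
    also have "\<dots> \<le> W s p / 2 * d" using d0 by (intro mult_right_mono) auto
    finally have 1: "?s * norm (D b s p - D b' s p) \<le> W s p / 2 * d" .
    have "norm (F b x - F b' x) = ?s / W s p * norm (D b s p - D b' s p)"
      using W0[of s p] unfolding F_def x fst_conv snd_conv scaleR_diff_right[symmetric] by simp
    also have "\<dots> \<le> 1 / 2 * d" using 1 W0[of s p] by (simp add: field_simps)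
    finally show ?thesis .
  qed
  define \<Psi> where "\<Psi> b = Bcontfun (F (apply_bcontfun b))" for b :: "(real \<times> 'p) \<Rightarrow>\<^sub>C 'z"
  have F_in: "F (apply_bcontfun b) \<in> bcontfun" for b :: "(real \<times> 'p) \<Rightarrow>\<^sub>C 'z"
    by (rule bcontfun_normI[of _ 1]) (auto intro!: Fc Fb)
  have ap: "apply_bcontfun (\<Psi> b) = F (apply_bcontfun b)" for b
    unfolding \<Psi>_def by (rule Bcontfun_inverse[OF F_in])
  have "\<exists>!b. \<Psi> b = b"
  proof (rule banach_fix_type[of "1/2"])
    show "\<forall>b b'. dist (\<Psi> b) (\<Psi> b') \<le> 1 / 2 * dist b b'"
    proof (intro allI dist_bound)
      fix b b' x
      have "norm (F (apply_bcontfun b) x - F (apply_bcontfun b') x) \<le> 1 / 2 * dist b b'"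
        by (rule Fl) (auto simp: dist_norm[symmetric] intro: dist_bounded)
      then show "dist (apply_bcontfun (\<Psi> b) x) (apply_bcontfun (\<Psi> b') x) \<le> 1 / 2 * dist b b'"
        by (simp add: ap dist_norm)
    qed
  qed auto
  then obtain b where b: "F (apply_bcontfun b) = apply_bcontfun b" using ap by metis
  define Z where "Z s p = W s p *\<^sub>R apply_bcontfun b (s, p)" for s p
  have Zc: "continuous_on UNIV (\<lambda>(s, p). Z s p)"
    unfolding Z_def split_beta' by (intro continuous_intros Wc) auto
  have Zeq: "Z s p = - s *\<^sub>R integral {0..1} (\<lambda>\<tau>. integral {0..1} (\<lambda>\<sigma>. G (s * \<tau> * \<sigma>) p (Z (s * \<tau> * \<sigma>) p)))" if s: "0 \<le> s" for s p
  proof -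
    have "Z s p = W s p *\<^sub>R F (apply_bcontfun b) (s, p)" unfolding Z_def b ..
    also have "\<dots> = - s *\<^sub>R D (apply_bcontfun b) s p" using W0[of s p] s by (simp add: F_def)
    finally show ?thesis using s by (simp add: D_def Z_def)
  qed
  from that[OF Zc Zeq] show ?thesis .
qed

lemma average_eq:
  fixes g :: "real \<Rightarrow> 'a::euclidean_space"
  assumes "0 < s"
  shows "s *\<^sub>R integral {0..1} (\<lambda>\<sigma>. g (s * \<sigma>)) = integral {0..s} g"
proof -
  have e: "{0..1} = (\<lambda>x. x / s) ` {0..s}" using assms by simp
  have "integral {0..1} (\<lambda>\<sigma>. g (s * \<sigma>)) = integral {0..s} g /\<^sub>R s"
    unfolding e using assms by (subst integral_stretch_real) (auto simp: divide_inverse_commute)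
  then show ?thesis using assms by simp
qed

lemma average_continuous:
  fixes g :: "real \<Rightarrow> 'a::euclidean_space"
  assumes "continuous_on {0..} g"
  shows "continuous_on {0..} (\<lambda>s. integral {0..1} (\<lambda>\<sigma>. g (s * \<sigma>)))"
proof (rule integral_continuous_on_param[where 'b=real, unfolded cbox_interval])
  show "continuous_on ({0..} \<times> {0..1}) (\<lambda>(s, \<sigma>). g (s * \<sigma>))"
    unfolding split_beta' by (rule continuous_on_compose2[OF assms]) (auto intro!: continuous_intros)
qed

lemma integral_has_derivative_within:
  fixes g :: "real \<Rightarrow> real"
  assumes g: "continuous_on {0..} g" and s: "0 \<le> s"
  shows "((\<lambda>s. integral {0..s} g) has_real_derivative g s) (at s within {0..})"
proof -
  have "((\<lambda>u. integral {0..u} g) has_real_derivative g s) (at s within {0..s + 1})"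
    using integral_has_real_derivative[OF continuous_on_subset[OF g], of 0 "s + 1" s] s by auto
  moreover have "at s within {0..} = at s within {0..s + 1}"
    by (rule at_within_nhd[of s "{..<s + 1}"]) auto
  ultimately show ?thesis by simp
qed

thm_deps integral_has_derivative_within

lemma has_real_derivative_cong_on:
  fixes f :: "real \<Rightarrow> real"
  assumes "(f has_real_derivative D) (at s within S)" "\<And>u. u \<in> S \<Longrightarrow> g u = f u" "s \<in> S"
  shows "(g has_real_derivative D) (at s within S)"
  using assms has_derivative_transform[of s S g f] by (simp add: has_field_derivative_def)

text \<open>\<open>q\<close> is -Z', and s q is the integral of g: the equation s Z'' + Z' = -g in
  divergence form, with no division by s at the origin.\<close>

lemma averaged_second_order:
  fixes g Z :: "real \<Rightarrow> real"
  assumes g: "continuous_on {0..} g"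
    and Z: "\<And>s. 0 \<le> s \<Longrightarrow> Z s = - (s * integral {0..1} (\<lambda>\<tau>. integral {0..1} (\<lambda>\<sigma>. g (s * \<tau> * \<sigma>))))"
  defines "q \<equiv> \<lambda>s. integral {0..1} (\<lambda>\<sigma>. g (s * \<sigma>))"
  shows "continuous_on {0..} q" and "0 \<le> s \<Longrightarrow> (Z has_real_derivative - q s) (at s within {0..})"
    and "0 \<le> s \<Longrightarrow> s * q s = integral {0..s} g"
proof -
  show q: "continuous_on {0..} q" unfolding q_def by (rule average_continuous[OF g])
  show "s * q s = integral {0..s} g" if "0 \<le> s" for s
    using average_eq[of s g] that by (cases "s = 0") (auto simp: q_def)
  have Zq: "Z u = - integral {0..u} q" if "u \<in> {0..}" for u
    using average_eq[of u q] Z[of u] that by (cases "u = 0") (auto simp: q_def)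
  show "(Z has_real_derivative - q s) (at s within {0..})" if "0 \<le> s"
  proof (rule has_real_derivative_cong_on)
    show "((\<lambda>u. - integral {0..u} q) has_real_derivative - q s) (at s within {0..})"
      by (intro DERIV_minus integral_has_derivative_within q that)
  qed (use that Zq in auto)
qed

text \<open>Differentiating under the average works up to s = 0. The relation q + s q' = g, the
  derivative of s q, is what gives the radial ansatz its prescribed curvature.\<close>

lemma average_has_derivative:
  fixes g g' :: "real \<Rightarrow> real"
  assumes g: "\<And>s. 0 \<le> s \<Longrightarrow> (g has_real_derivative g' s) (at s within {0..})" and g': "continuous_on {0..} g'"
  defines "q \<equiv> \<lambda>s. integral {0..1} (\<lambda>\<sigma>. g (s * \<sigma>))"
  obtains q' where "continuous_on {0..} q'" "\<And>s. 0 \<le> s \<Longrightarrow> (q has_real_derivative q' s) (at s within {0..})"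
    "\<And>s. 0 \<le> s \<Longrightarrow> q s + s * q' s = g s"
proof -
  define q' where "q' s = integral {0..1} (\<lambda>\<sigma>. \<sigma> * g' (s * \<sigma>))" for s
  have cg: "continuous_on {0..} g"
    using g by (auto simp: continuous_on_eq_continuous_within intro: DERIV_continuous)
  have c: "continuous_on ({0..} \<times> {0..1}) (\<lambda>(s, \<sigma>). \<sigma> * g' (s * \<sigma>))"
    unfolding split_beta' by (intro continuous_intros continuous_on_compose2[OF g']) auto
  have c': "continuous_on {0..} q'"
    unfolding q'_def using integral_continuous_on_param[where 'b=real, unfolded cbox_interval, OF c] .
  have d: "(q has_real_derivative q' s) (at s within {0..})" if "0 \<le> s" for s
    unfolding q_def q'_def
  proof (rule leibniz_rule_field_derivative[where 'b=real, unfolded cbox_interval])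
    fix x \<sigma> :: real assume x: "x \<in> {0..}" and \<sigma>: "\<sigma> \<in> {0..1}"
    have "((g \<circ> (\<lambda>x. x * \<sigma>)) has_real_derivative g' (x * \<sigma>) * \<sigma>) (at x within {0..})"
    proof (rule DERIV_image_chain)
      show "(g has_real_derivative g' (x * \<sigma>)) (at (x * \<sigma>) within (\<lambda>x. x * \<sigma>) ` {0..})"
        using x \<sigma> by (intro DERIV_subset[OF g]) auto
      show "((\<lambda>x. x * \<sigma>) has_real_derivative \<sigma>) (at x within {0..})" by (auto intro!: derivative_eq_intros)
    qed
    then show "((\<lambda>x. g (x * \<sigma>)) has_real_derivative \<sigma> * g' (x * \<sigma>)) (at x within {0..})" by (simp add: o_def mult.commute)
  next
    fix x :: real assume x: "x \<in> {0..}"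
    show "(\<lambda>\<sigma>. g (x * \<sigma>)) integrable_on {0..1}"
      using x by (intro integrable_continuous_interval continuous_on_compose2[OF cg] continuous_intros) auto
  qed (use c that in auto)
  have "q s + s * q' s = g s" if s: "0 \<le> s" for s
  proof (cases "s = 0")
    case False
    have "((\<lambda>s. s * q s) has_real_derivative q s + s * q' s) (at s within {0..})"
      by (rule derivative_eq_intros d s refl)+ simp
    moreover have "s * q s = integral {0..s} g" if "s \<in> {0..}" for s
      using average_eq[of s g] that by (cases "s = 0") (auto simp: q_def)
    ultimately have "((\<lambda>s. integral {0..s} g) has_real_derivative q s + s * q' s) (at s within {0..})"
      using s by (elim has_real_derivative_cong_on) auto
    moreover have "((\<lambda>s. integral {0..s} g) has_real_derivative g s) (at s within {0..})"
      by (rule integral_has_derivative_within[OF cg s])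
    moreover have "at s within {0..} = at s" using s False by (intro at_within_interior) auto
    ultimately show ?thesis by (metis DERIV_unique)
  qed (simp add: q_def)
  with c' d show ?thesis by (rule that)
qed

text \<open>Truncating the exponent at \<open>H\<close> supplies the global Lipschitz constant that
  the iteration asks for.\<close>

lemma exp_min_lipschitz: "\<bar>exp (min x H) - exp (min y H)\<bar> \<le> exp H * \<bar>x - y\<bar>" for x y H :: real
proof -
  have *: "exp u - exp v \<le> exp H * (u - v)" if "v \<le> u" "u \<le> H" for u v :: real
  proof -
    have "exp u - exp v = exp u * (1 - exp (v - u))" by (simp add: algebra_simps flip: exp_add)
    also have "\<dots> \<le> exp H * (u - v)"
    proof (rule mult_mono)
      show "1 - exp (v - u) \<le> u - v" using exp_ge_add_one_self[of "v - u"] by linarith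
    qed (use that in auto)
    finally show ?thesis .
  qed
  show ?thesis
  proof (cases "x \<le> y")
    case True
    have "exp (min y H) - exp (min x H) \<le> exp H * (min y H - min x H)" using True by (intro *) auto
    also have "\<dots> \<le> exp H * \<bar>x - y\<bar>" using True by (intro mult_left_mono) auto
    finally show ?thesis using True by (simp add: abs_if min_def)
  next
    case False
    have "exp (min x H) - exp (min y H) \<le> exp H * (min x H - min y H)" using False by (intro *) auto
    also have "\<dots> \<le> exp H * \<bar>x - y\<bar>" using False by (intro mult_left_mono) auto
    finally show ?thesis using False by (simp add: abs_if min_def)
  qed
qed

locale radial_system =
  fixes N1 N2 :: nat and h1 h2 :: real and Z1 Z2 X1 X2 G1 G2 :: "real \<Rightarrow> real"
  assumes h_nonneg: "0 \<le> h1" "0 \<le> h2"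
    and X: "\<And>s. X1 s = s ^ N1 * exp (Z1 s)" "\<And>s. X2 s = s ^ N2 * exp (Z2 s)"
    and G: "\<And>s. G1 s = X2 s * (X1 s + h1)" "\<And>s. G2 s = X1 s * (X2 s - h2)"
    and Z_cont: "continuous_on {0..} Z1" "continuous_on {0..} Z2"
    and Z_eq: "\<And>s. 0 \<le> s \<Longrightarrow> Z1 s = - (s * integral {0..1} (\<lambda>\<tau>. integral {0..1} (\<lambda>\<sigma>. G1 (s * \<tau> * \<sigma>))))"
      "\<And>s. 0 \<le> s \<Longrightarrow> Z2 s = - (s * integral {0..1} (\<lambda>\<tau>. integral {0..1} (\<lambda>\<sigma>. G2 (s * \<tau> * \<sigma>))))"

text \<open>To have data that are Lipschitz in Z, the exponents are truncated from above and the
  masses replaced by their positive parts. Afterwards the signs show that the truncations are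
  inactive: \<open>G1\<close> is nonnegative, hence Z1 \<le> 0, and \<open>G2\<close> is at least
  -h2 s^N1, which limits the growth of Z2.\<close>

lemma radial_system_exists:
  obtains Z1 Z2 :: "real \<Rightarrow> real \<times> real \<Rightarrow> real" where
    "continuous_on UNIV (\<lambda>(s, h). Z1 s h)" "continuous_on UNIV (\<lambda>(s, h). Z2 s h)"
    "\<And>h1 h2. 0 \<le> h1 \<Longrightarrow> 0 \<le> h2 \<Longrightarrow> radial_system N1 N2 h1 h2 (\<lambda>s. Z1 s (h1, h2)) (\<lambda>s. Z2 s (h1, h2))
       (\<lambda>s. s ^ N1 * exp (Z1 s (h1, h2))) (\<lambda>s. s ^ N2 * exp (Z2 s (h1, h2)))
       (\<lambda>s. s ^ N2 * exp (Z2 s (h1, h2)) * (s ^ N1 * exp (Z1 s (h1, h2)) + h1))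
       (\<lambda>s. s ^ N1 * exp (Z1 s (h1, h2)) * (s ^ N2 * exp (Z2 s (h1, h2)) - h2))"
    "\<And>s h1 h2. 0 \<le> s \<Longrightarrow> 0 \<le> h1 \<Longrightarrow> 0 \<le> h2 \<Longrightarrow> Z1 s (h1, h2) \<le> 0"
    "\<And>s h1 h2. 0 \<le> s \<Longrightarrow> 0 \<le> h1 \<Longrightarrow> 0 \<le> h2 \<Longrightarrow> Z2 s (h1, h2) \<le> h2 * s ^ (N1 + 1)"
proof -
  let ?a = "\<lambda>s::real. max 0 s ^ N1" and ?b = "\<lambda>s::real. max 0 s ^ N2"
  \<comment> \<open>The bound that Z2 will turn out to satisfy: s times the double average of h2
    s^N1 is at most h2 s^(N1+1).\<close>
  define H where "H s h = max 0 (snd h) * max 0 s ^ (N1 + 1)" for s :: real and h :: "real \<times> real"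
  define x1 where "x1 s h z = ?a s * exp (min (fst z) 0)" for s :: real and h z :: "real \<times> real"
  define x2 where "x2 s h z = ?b s * exp (min (snd z) (H s h))" for s :: real and h z :: "real \<times> real"
  define G where "G s h z = (x2 s h z * (x1 s h z + max 0 (fst h)), x1 s h z * (x2 s h z - max 0 (snd h)))" for s h z
  define L where "L s h = ?b s * exp (H s h) * (2 * ?a s + max 0 (fst h)) + ?a s * (2 * (?b s * exp (H s h)) + max 0 (snd h))"
    for s :: real and h :: "real \<times> real"
  have Gc: "continuous_on UNIV (\<lambda>(s, p, z). G s p z)"
    unfolding G_def x1_def x2_def H_def split_beta' by (intro continuous_intros)
  have Lc: "continuous_on UNIV (\<lambda>(s, p). L s p)"
    unfolding L_def H_def split_beta' by (intro continuous_intros)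
  have x1: "0 \<le> x1 s h z" "x1 s h z \<le> ?a s" for s h z by (auto simp: x1_def mult_left_le)
  have x2: "0 \<le> x2 s h z" "x2 s h z \<le> ?b s * exp (H s h)" for s h z
    by (auto simp: x2_def intro!: mult_left_mono)
  have d1: "\<bar>x1 s h z - x1 s h z'\<bar> \<le> ?a s * norm (z - z')" for s h z z'
  proof -
    have "\<bar>x1 s h z - x1 s h z'\<bar> = ?a s * \<bar>exp (min (fst z) 0) - exp (min (fst z') 0)\<bar>"
      by (simp add: x1_def abs_mult flip: right_diff_distrib)
    also have "\<dots> \<le> ?a s * \<bar>fst (z - z')\<bar>" using exp_min_lipschitz[of "fst z" 0 "fst z'"] by (intro mult_left_mono) auto
    also have "\<dots> \<le> ?a s * norm (z - z')" using norm_fst_le[of "fst (z - z')" "snd (z - z')"] by (intro mult_left_mono) (auto simp del: fst_diff snd_diff)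
    finally show ?thesis .
  qed
  have d2: "\<bar>x2 s h z - x2 s h z'\<bar> \<le> ?b s * exp (H s h) * norm (z - z')" for s h z z'
  proof -
    have "\<bar>x2 s h z - x2 s h z'\<bar> = ?b s * \<bar>exp (min (snd z) (H s h)) - exp (min (snd z') (H s h))\<bar>"
      by (simp add: x2_def abs_mult flip: right_diff_distrib)
    also have "\<dots> \<le> ?b s * (exp (H s h) * \<bar>snd (z - z')\<bar>)" using exp_min_lipschitz[of "snd z" "H s h" "snd z'"] by (intro mult_left_mono) auto
    also have "\<dots> \<le> ?b s * (exp (H s h) * norm (z - z'))" using norm_snd_le[of "snd (z - z')" "fst (z - z')"] by (intro mult_left_mono) (auto simp del: fst_diff snd_diff)
    finally show ?thesis by (simp add: mult.assoc)
  qed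
  have pair: "norm ((x, y) :: real \<times> real) \<le> \<bar>x\<bar> + \<bar>y\<bar>" for x y
    using norm_Pair_le[of x y] by simp
  have L0: "0 \<le> L s p" for s p unfolding L_def by (intro add_nonneg_nonneg mult_nonneg_nonneg) auto
  have Lm: "L s p \<le> L t p" if "0 \<le> s" "s \<le> t" for s t p
  proof -
    have "H s p \<le> H t p" unfolding H_def using that by (intro mult_left_mono power_mono) auto
    moreover have "?a s \<le> ?a t" "?b s \<le> ?b t" using that by (auto intro!: power_mono)
    ultimately show ?thesis unfolding L_def by (intro add_mono mult_mono) auto
  qed
  have Gb: "norm (G s p z) \<le> L s p" for s p z
  proof -
    have "\<bar>x2 s p z * (x1 s p z + max 0 (fst p))\<bar> = x2 s p z * (x1 s p z + max 0 (fst p))"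
      using x1[of s p z] x2[of s p z] by (simp add: abs_mult)
    also have "\<dots> \<le> ?b s * exp (H s p) * (2 * ?a s + max 0 (fst p))"
      using x1[of s p z] x2[of s p z] by (intro mult_mono) auto
    finally have 1: "\<bar>x2 s p z * (x1 s p z + max 0 (fst p))\<bar> \<le> ?b s * exp (H s p) * (2 * ?a s + max 0 (fst p))" .
    have "\<bar>x1 s p z * (x2 s p z - max 0 (snd p))\<bar> = x1 s p z * \<bar>x2 s p z - max 0 (snd p)\<bar>"
      using x1[of s p z] by (simp add: abs_mult)
    also have "\<dots> \<le> ?a s * (2 * (?b s * exp (H s p)) + max 0 (snd p))"
      using x1[of s p z] x2[of s p z] by (intro mult_mono) auto
    finally show ?thesis using 1 pair[of "x2 s p z * (x1 s p z + max 0 (fst p))" "x1 s p z * (x2 s p z - max 0 (snd p))"]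
      unfolding G_def L_def by linarith
  qed
  have Gl: "norm (G s p z - G s p z') \<le> L s p * norm (z - z')" for s p z z'
  proof -
    let ?M = "?b s * exp (H s p)" and ?d = "norm (z - z')"
    have M0: "0 \<le> ?M" by simp
    have prod: "\<bar>x2 s p z * x1 s p z - x2 s p z' * x1 s p z'\<bar> \<le> 2 * ?M * ?a s * ?d"
    proof -
      have "x2 s p z * x1 s p z - x2 s p z' * x1 s p z' = x2 s p z * (x1 s p z - x1 s p z') + x1 s p z' * (x2 s p z - x2 s p z')"
        by (simp add: algebra_simps)
      also have "\<bar>\<dots>\<bar> \<le> x2 s p z * \<bar>x1 s p z - x1 s p z'\<bar> + x1 s p z' * \<bar>x2 s p z - x2 s p z'\<bar>"
        using x1(1)[of s p z'] x2(1)[of s p z] by (intro order_trans[OF abs_triangle_ineq]) (simp add: abs_mult)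
      also have "\<dots> \<le> ?M * (?a s * ?d) + ?a s * (?M * ?d)"
        using x1[of s p z'] x2[of s p z] by (intro add_mono mult_mono d1 d2) auto
      finally show ?thesis by (simp add: algebra_simps)
    qed
    have "\<bar>max 0 (fst p) * (x2 s p z - x2 s p z')\<bar> \<le> max 0 (fst p) * (?M * ?d)"
      unfolding abs_mult using d2[of s p z z'] by (intro mult_mono) auto
    moreover have "\<bar>max 0 (snd p) * (x1 s p z - x1 s p z')\<bar> \<le> max 0 (snd p) * (?a s * ?d)"
      unfolding abs_mult using d1[of s p z z'] by (intro mult_mono) auto
    moreover have "fst (G s p z - G s p z') = (x2 s p z * x1 s p z - x2 s p z' * x1 s p z') + max 0 (fst p) * (x2 s p z - x2 s p z')"
      "snd (G s p z - G s p z') = (x2 s p z * x1 s p z - x2 s p z' * x1 s p z') - max 0 (snd p) * (x1 s p z - x1 s p z')"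
      by (simp_all add: G_def algebra_simps)
    ultimately have "\<bar>fst (G s p z - G s p z')\<bar> + \<bar>snd (G s p z - G s p z')\<bar>
        \<le> (2 * ?M * ?a s * ?d + max 0 (fst p) * (?M * ?d)) + (2 * ?M * ?a s * ?d + max 0 (snd p) * (?a s * ?d))"
      using prod by linarith
    also have "\<dots> = L s p * ?d" by (simp add: L_def algebra_simps)
    finally show ?thesis using pair[of "fst (G s p z - G s p z')" "snd (G s p z - G s p z')"] unfolding prod.collapse by linarith
  qed
  obtain Z where Zc: "continuous_on UNIV (\<lambda>(s, p). Z s p)"
    and Zeq: "\<And>s p. 0 \<le> s \<Longrightarrow> Z s p = - s *\<^sub>R integral {0..1} (\<lambda>\<tau>. integral {0..1} (\<lambda>\<sigma>. G (s * \<tau> * \<sigma>) p (Z (s * \<tau> * \<sigma>) p)))"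
    using averaged_fixpoint[OF Gc Lc L0 Lm Gb Gl] by blast
  define Z1 where "Z1 s p = fst (Z s p)" for s p
  define Z2 where "Z2 s p = snd (Z s p)" for s p
  have Z1c: "continuous_on UNIV (\<lambda>(s, p). Z1 s p)" and Z2c: "continuous_on UNIV (\<lambda>(s, p). Z2 s p)"
    using continuous_on_fst[OF Zc] continuous_on_snd[OF Zc] by (simp_all add: Z1_def Z2_def split_beta')
  have gc: "continuous_on UNIV (\<lambda>(x, \<sigma>). G (fst x * snd x * \<sigma>) p (Z (fst x * snd x * \<sigma>) p))" for p
  proof -
    have 1: "continuous_on UNIV (\<lambda>y :: (real \<times> real) \<times> real. Z (fst (fst y) * snd (fst y) * snd y) p)"
      using continuous_on_compose_UNIV[OF Zc, of UNIV "\<lambda>y. (fst (fst y) * snd (fst y) * snd y, p)"] by (simp add: continuous_intros)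
    show ?thesis
      using continuous_on_compose_UNIV[OF Gc, of UNIV "\<lambda>y. (fst (fst y) * snd (fst y) * snd y, p, Z (fst (fst y) * snd (fst y) * snd y) p)"] 1
      by (simp add: continuous_intros split_beta')
  qed
  have i: "(\<lambda>\<sigma>. G (s * \<tau> * \<sigma>) p (Z (s * \<tau> * \<sigma>) p)) integrable_on {0..1}" for s \<tau> p
    using continuous_on_compose_UNIV[OF gc[of p], of "{0..1}" "\<lambda>\<sigma>. ((s, \<tau>), \<sigma>)"]
    by (intro integrable_continuous_interval) (simp add: continuous_intros)
  have o: "(\<lambda>\<tau>. integral {0..1} (\<lambda>\<sigma>. G (s * \<tau> * \<sigma>) p (Z (s * \<tau> * \<sigma>) p))) integrable_on {0..1}" for s p
  proof -
    have "continuous_on UNIV (\<lambda>x. integral {0..1} (\<lambda>\<sigma>. G (fst x * snd x * \<sigma>) p (Z (fst x * snd x * \<sigma>) p)))"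
      by (rule integral_continuous_on_param[where 'b=real, unfolded cbox_interval], rule continuous_on_subset[OF gc]) auto
    from continuous_on_compose_UNIV[OF this, of "{0..1}" "\<lambda>\<tau>. (s, \<tau>)"] show ?thesis
      by (intro integrable_continuous_interval) (simp add: continuous_intros)
  qed
  have comp: "T (integral {0..1} (\<lambda>\<tau>. integral {0..1} (\<lambda>\<sigma>. G (s * \<tau> * \<sigma>) p (Z (s * \<tau> * \<sigma>) p))))
      = integral {0..1} (\<lambda>\<tau>. integral {0..1} (\<lambda>\<sigma>. T (G (s * \<tau> * \<sigma>) p (Z (s * \<tau> * \<sigma>) p))))"
    "(\<lambda>\<sigma>. T (G (s * \<tau> * \<sigma>) p (Z (s * \<tau> * \<sigma>) p))) integrable_on {0..1}"
    "(\<lambda>\<tau>. integral {0..1} (\<lambda>\<sigma>. T (G (s * \<tau> * \<sigma>) p (Z (s * \<tau> * \<sigma>) p)))) integrable_on {0..1}"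
    if T: "bounded_linear T" for T :: "real \<times> real \<Rightarrow> real" and s p \<tau>
    using integral_linear[OF o T, of s p] integral_linear[OF i T, of s _ p] integrable_linear[OF i T, of s \<tau> p]
      integrable_linear[OF o T, of s p] by (simp_all add: o_def)
  let ?g1 = "\<lambda>s p. x2 s p (Z s p) * (x1 s p (Z s p) + max 0 (fst p))" and ?g2 = "\<lambda>s p. x1 s p (Z s p) * (x2 s p (Z s p) - max 0 (snd p))"
  have e1: "Z1 s p = - (s * integral {0..1} (\<lambda>\<tau>. integral {0..1} (\<lambda>\<sigma>. ?g1 (s * \<tau> * \<sigma>) p)))" if "0 \<le> s" for s p
    unfolding Z1_def Zeq[OF that] fst_scaleR comp(1)[OF bounded_linear_fst] by (simp add: G_def)
  have e2: "Z2 s p = - (s * integral {0..1} (\<lambda>\<tau>. integral {0..1} (\<lambda>\<sigma>. ?g2 (s * \<tau> * \<sigma>) p)))" if "0 \<le> s" for s p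
    unfolding Z2_def Zeq[OF that] snd_scaleR comp(1)[OF bounded_linear_snd] by (simp add: G_def)
  have Z1_le: "Z1 s p \<le> 0" if "0 \<le> s" for s p
  proof -
    have "0 \<le> integral {0..1} (\<lambda>\<tau>. integral {0..1} (\<lambda>\<sigma>. ?g1 (s * \<tau> * \<sigma>) p))"
      using comp(2)[OF bounded_linear_fst, of s _ p] comp(3)[OF bounded_linear_fst, of s p]
      by (intro integral_nonneg) (auto simp: G_def intro!: integral_nonneg mult_nonneg_nonneg add_nonneg_nonneg x1 x2)
    with that show ?thesis unfolding e1[OF that] by simp
  qed
  have Z2_le: "Z2 s p \<le> max 0 (snd p) * s ^ (N1 + 1)" if s: "0 \<le> s" for s p
  proof -
    let ?c = "max 0 (snd p) * s ^ N1"
    have le: "- ?c \<le> ?g2 (s * \<tau> * \<sigma>) p" if "\<tau> \<in> {0..1}" "\<sigma> \<in> {0..1}" for \<tau> \<sigma>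
    proof -
      let ?u = "s * \<tau> * \<sigma>"
      have "?u \<le> s" using that s mult_left_mono[of "\<tau> * \<sigma>" 1 s] mult_le_one[of \<tau> \<sigma>] by (simp add: mult.assoc)
      then have "max 0 ?u ^ N1 \<le> s ^ N1" using s by (intro power_mono) auto
      then have "x1 ?u p (Z ?u p) \<le> s ^ N1" using x1(2)[of ?u p "Z ?u p"] by linarith
      then have "max 0 (snd p) * x1 ?u p (Z ?u p) \<le> ?c" by (intro mult_left_mono) auto
      moreover have "0 \<le> x1 ?u p (Z ?u p) * x2 ?u p (Z ?u p)" by (intro mult_nonneg_nonneg x1 x2)
      ultimately show ?thesis by (simp add: algebra_simps)
    qed
    have "- ?c \<le> integral {0..1} (\<lambda>\<sigma>. ?g2 (s * \<tau> * \<sigma>) p)" if "\<tau> \<in> {0..1}" for \<tau>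
      using integral_le[of "\<lambda>_. - ?c" "{0..1::real}" "\<lambda>\<sigma>. ?g2 (s * \<tau> * \<sigma>) p"] comp(2)[OF bounded_linear_snd, of s \<tau> p] le[OF that]
      by (simp add: G_def integrable_const_ivl)
    then have "- ?c \<le> integral {0..1} (\<lambda>\<tau>. integral {0..1} (\<lambda>\<sigma>. ?g2 (s * \<tau> * \<sigma>) p))"
      using integral_le[of "\<lambda>_. - ?c" "{0..1::real}" "\<lambda>\<tau>. integral {0..1} (\<lambda>\<sigma>. ?g2 (s * \<tau> * \<sigma>) p)"] comp(3)[OF bounded_linear_snd, of s p]
      by (simp add: G_def integrable_const_ivl)
    from mult_left_mono[OF this s] show ?thesis unfolding e2[OF s] by (simp add: algebra_simps)
  qed
  have xx: "x1 u p (Z u p) = u ^ N1 * exp (Z1 u p)" "x2 u p (Z u p) = u ^ N2 * exp (Z2 u p)" if "0 \<le> u" for u p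
    using Z1_le[OF that, of p] Z2_le[OF that, of p] that by (simp_all add: x1_def x2_def H_def Z1_def[symmetric] Z2_def[symmetric] min_absorb1)
  have sys: "radial_system N1 N2 h1 h2 (\<lambda>s. Z1 s (h1, h2)) (\<lambda>s. Z2 s (h1, h2))
       (\<lambda>s. s ^ N1 * exp (Z1 s (h1, h2))) (\<lambda>s. s ^ N2 * exp (Z2 s (h1, h2)))
       (\<lambda>s. s ^ N2 * exp (Z2 s (h1, h2)) * (s ^ N1 * exp (Z1 s (h1, h2)) + h1))
       (\<lambda>s. s ^ N1 * exp (Z1 s (h1, h2)) * (s ^ N2 * exp (Z2 s (h1, h2)) - h2))"
    if h: "0 \<le> h1" "0 \<le> h2" for h1 h2
    proof (rule radial_system.intro)
      show "continuous_on {0..} (\<lambda>s. Z1 s (h1, h2))" "continuous_on {0..} (\<lambda>s. Z2 s (h1, h2))"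
        using continuous_on_compose_UNIV[OF Z1c, of "{0..}" "\<lambda>s. (s, h1, h2)"] continuous_on_compose_UNIV[OF Z2c, of "{0..}" "\<lambda>s. (s, h1, h2)"]
        by (simp_all add: continuous_intros)
      fix s :: real assume s: "0 \<le> s"
      show "Z1 s (h1, h2) = - (s * integral {0..1} (\<lambda>\<tau>. integral {0..1} (\<lambda>\<sigma>. (s * \<tau> * \<sigma>) ^ N2 * exp (Z2 (s * \<tau> * \<sigma>) (h1, h2)) * ((s * \<tau> * \<sigma>) ^ N1 * exp (Z1 (s * \<tau> * \<sigma>) (h1, h2)) + h1))))"
        unfolding e1[OF s] using h s
        by (intro arg_cong[where f="\<lambda>x. - (s * x)"] Henstock_Kurzweil_Integration.integral_cong) (simp add: xx)
      show "Z2 s (h1, h2) = - (s * integral {0..1} (\<lambda>\<tau>. integral {0..1} (\<lambda>\<sigma>. (s * \<tau> * \<sigma>) ^ N1 * exp (Z1 (s * \<tau> * \<sigma>) (h1, h2)) * ((s * \<tau> * \<sigma>) ^ N2 * exp (Z2 (s * \<tau> * \<sigma>) (h1, h2)) - h2))))"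
        unfolding e2[OF s] using h s
        by (intro arg_cong[where f="\<lambda>x. - (s * x)"] Henstock_Kurzweil_Integration.integral_cong) (simp add: xx)
    qed (rule h refl)+
  have "Z2 s (h1, h2) \<le> h2 * s ^ (N1 + 1)" if "0 \<le> s" "0 \<le> h1" "0 \<le> h2" for s h1 h2
    using Z2_le[of s "(h1, h2)"] that by simp
  from that[OF Z1c Z2c sys Z1_le this] show ?thesis .
qed

thm_deps radial_system_exists

section \<open>From radial profiles to vortex solutions\<close>

lemma C1_planeI:
  assumes D: "\<And>x. (f has_derivative f' x) (at x)" and c: "\<And>j. continuous_on UNIV (\<lambda>x. f' x (axis j 1))"
  shows "C1_plane f" and "partial_deriv j f x = f' x (axis j 1)"
proof -
  have *: "partial_deriv j f x = f' x (axis j 1)" for j x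
    using frechet_derivative_at[OF D[of x]] by (simp add: partial_deriv_def)
  then show "partial_deriv j f x = f' x (axis j 1)" .
  show "C1_plane f"
    unfolding C1_plane_def * using D c by (auto simp: differentiable_def)
qed

text \<open>At 0 the profile has only a one-sided derivative, but l |x - p|^2 takes values in the
  half-line, so the chain rule within the range applies even at x = p.\<close>

lemma radial_has_derivative:
  fixes p :: "real^2"
  assumes "\<And>s. 0 \<le> s \<Longrightarrow> (f has_real_derivative f' s) (at s within {0..})" and "0 \<le> l"
  shows "((\<lambda>x. f (l * (norm (x - p))\<^sup>2)) has_derivative (\<lambda>h. f' (l * (norm (x - p))\<^sup>2) * (l * (2 * ((x - p) \<bullet> h))))) (at x)"
proof -
  let ?s = "\<lambda>x. l * (norm (x - p))\<^sup>2"
  have 1: "(?s has_derivative (\<lambda>h. l * (2 * ((x - p) \<bullet> h)))) (at x)"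
    unfolding power2_norm_eq_inner
    by (rule has_derivative_eq_rhs, (rule derivative_intros)+) (auto simp: fun_eq_iff inner_commute algebra_simps)
  have "(f has_derivative (*) (f' (?s x))) (at (?s x) within {0..})"
    using assms by (simp flip: has_field_derivative_def)
  then have 2: "(f has_derivative (*) (f' (?s x))) (at (?s x) within range ?s)"
    using assms(2) by (elim has_derivative_subset) auto
  from has_derivative_in_compose[OF 1 2] show ?thesis .
qed

lemma radial_continuous:
  fixes p :: "real^2"
  assumes "continuous_on {0..} f" "0 \<le> l"
  shows "continuous_on UNIV (\<lambda>x. f (l * (norm (x - p))\<^sup>2) :: real)"
  using assms by (intro continuous_on_compose2[OF assms(1)] continuous_intros) auto

lemma norm_to_complex [simp]: "norm (to_complex v) = norm v"
  using norm_of_plane[of "to_complex v"] by simp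

lemma bounded_linear_to_complex: "bounded_linear to_complex"
  using linear_to_complex by (simp add: linear_conv_bounded_linear)

lemma plane_axis [simp]:
  "to_complex (axis 1 1) = 1" "to_complex (axis 2 1) = \<i>" "v \<bullet> axis j 1 = (v :: real^2) $ j"
  by (simp_all add: to_complex_def complex_eq_iff inner_axis) (simp_all add: axis_def)

text \<open>The conjugate in the ansatz is dictated by the operator D_1 - i D_2, which without gauge
  field annihilates antiholomorphic functions. \<open>A\<close> is the gradient of Z(s)/2 turned
  clockwise by a right angle, so it compensates the radial factor exp (Z/2).\<close>

lemma radial_component:
  fixes Z q q' :: "real \<Rightarrow> real" and p :: "real^2" and D l :: real and n :: nat
  assumes Z: "\<And>s. 0 \<le> s \<Longrightarrow> (Z has_real_derivative - q s) (at s within {0..})"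
    and q: "\<And>s. 0 \<le> s \<Longrightarrow> (q has_real_derivative q' s) (at s within {0..})" "continuous_on {0..} q'"
    and pos: "0 < D" "0 < l" "1 \<le> n"
  defines "s \<equiv> \<lambda>x. l * (norm (x - p))\<^sup>2"
  defines "\<phi> \<equiv> \<lambda>x. of_real (D * exp (Z (s x) / 2)) * cnj (to_complex (x - p)) ^ n"
    and "A \<equiv> \<lambda>x. (- (l * q (s x))) *\<^sub>R (vector [(x - p) $ 2, - ((x - p) $ 1)] :: real^2)"
  shows "C1_plane \<phi>" "C1_plane A" "cov_deriv A 1 \<phi> x - \<i> * cov_deriv A 2 \<phi> x = 0"
    "curvature A x = 2 * l * (q (s x) + s x * q' (s x))"
    "(norm (\<phi> x))\<^sup>2 = D\<^sup>2 * ((norm (x - p))\<^sup>2) ^ n * exp (Z (s x))"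
    "\<phi> x = 0 \<Longrightarrow> x = p" "zero_of_multiplicity \<phi> p n"
proof -
  define W where "W x = cnj (to_complex (x - p))" for x
  define e where "e x = D * exp (Z (s x) / 2)" for x
  have \<phi>_eW: "\<phi> = (\<lambda>x. of_real (e x) * W x ^ n)" by (simp add: \<phi>_def e_def W_def)
  have Zc: "continuous_on {0..} Z" and qc: "continuous_on {0..} q"
    using Z q(1) by (auto simp: continuous_on_eq_continuous_within intro: DERIV_continuous)
  have sc: "continuous_on UNIV (\<lambda>x. Z (s x))" "continuous_on UNIV (\<lambda>x. q (s x))" "continuous_on UNIV (\<lambda>x. q' (s x))"
    unfolding s_def using pos by (intro radial_continuous Zc qc q(2); simp)+
  have dZ: "((\<lambda>x. Z (s x)) has_derivative (\<lambda>h. - q (s x) * (l * (2 * ((x - p) \<bullet> h))))) (at x)" for x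
    unfolding s_def using Z pos by (intro radial_has_derivative) auto
  have dq: "((\<lambda>x. q (s x)) has_derivative (\<lambda>h. q' (s x) * (l * (2 * ((x - p) \<bullet> h))))) (at x)" for x
    unfolding s_def using q pos by (intro radial_has_derivative) auto
  have blW: "bounded_linear (\<lambda>v. cnj (to_complex v))"
    by (rule bounded_linear_compose[OF bounded_linear_cnj bounded_linear_to_complex])
  have dW: "(W has_derivative (\<lambda>h. cnj (to_complex h))) (at x)" for x
    unfolding W_def[abs_def] by (rule bounded_linear.has_derivative[OF blW]) (auto intro!: derivative_eq_intros)
  have Wc: "continuous_on UNIV W"
    unfolding W_def[abs_def] by (rule bounded_linear.continuous_on[OF blW]) (intro continuous_intros)
  have dE: "(e has_derivative (\<lambda>h. e x * (- q (s x) * (l * ((x - p) \<bullet> h))))) (at x)" for x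
    unfolding e_def[abs_def] by (rule derivative_eq_intros dZ refl)+ (auto simp: fun_eq_iff)
  have ec: "continuous_on UNIV e"
    unfolding e_def[abs_def] by (intro continuous_intros sc(1)) simp
  have dP: "((\<lambda>x. W x ^ n) has_derivative (\<lambda>h. of_nat n * cnj (to_complex h) * W x ^ (n - 1))) (at x)" for x
    by (rule has_derivative_power[OF dW])
  define \<phi>' where "\<phi>' x h = of_real (e x) * (of_nat n * cnj (to_complex h) * W x ^ (n - 1))
      + of_real (e x * (- q (s x) * (l * ((x - p) \<bullet> h)))) * W x ^ n" for x h
  have d\<phi>: "(\<phi> has_derivative \<phi>' x) (at x)" for x
    unfolding \<phi>_eW \<phi>'_def
    by (rule has_derivative_mult[OF has_derivative_of_real[OF dE] dP])
  have c\<phi>: "continuous_on UNIV (\<lambda>x. \<phi>' x (axis j 1))" for j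
    unfolding \<phi>'_def by (intro continuous_intros sc(2) Wc ec)
  show "C1_plane \<phi>" by (rule C1_planeI(1)[OF d\<phi> c\<phi>])
  define J where "J v = (vector [v $ 2, - (v $ 1)] :: real^2)" for v :: "real^2"
  have J: "bounded_linear J"
    unfolding linear_conv_bounded_linear[symmetric] by (rule linearI) (auto simp: J_def vec_eq_iff forall_2)
  have Jn: "J v $ 1 = v $ 2" "J v $ 2 = - (v $ 1)" for v by (simp_all add: J_def)
  define A' where "A' x h = (- (l * q (s x))) *\<^sub>R J h + (- (l * (q' (s x) * (l * (2 * ((x - p) \<bullet> h)))))) *\<^sub>R J (x - p)" for x h
  have dJ: "((\<lambda>x. J (x - p)) has_derivative J) (at x)" for x
    by (rule bounded_linear.has_derivative[OF J]) (auto intro!: derivative_eq_intros)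
  have AJ: "A = (\<lambda>x. (- (l * q (s x))) *\<^sub>R J (x - p))" by (simp add: A_def J_def)
  have dA: "(A has_derivative A' x) (at x)" for x
    unfolding AJ A'_def
    by (rule has_derivative_scaleR[OF has_derivative_minus[OF has_derivative_mult_right[OF dq]] dJ])
  have cA: "continuous_on UNIV (\<lambda>x. A' x (axis j 1))" for j
    unfolding A'_def by (intro continuous_intros sc bounded_linear.continuous_on[OF J])
  show C1A: "C1_plane A" by (rule C1_planeI(1)[OF dA cA])
  note pd = C1_planeI(2)[OF d\<phi> c\<phi>] C1_planeI(2)[OF dA cA]
  have Wx: "W x = of_real ((x - p) $ 1) - \<i> * of_real ((x - p) $ 2)" for x
    by (simp add: W_def to_complex_def complex_eq_iff)
  show "cov_deriv A 1 \<phi> x - \<i> * cov_deriv A 2 \<phi> x = 0"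
    unfolding cov_deriv_def pd AJ by (simp add: \<phi>'_def \<phi>_eW Jn algebra_simps complex_eq_iff)
  have "curvature A x = A' x (axis 1 1) $ 2 - A' x (axis 2 1) $ 1"
    unfolding curvature_def using C1A by (simp add: C1_plane_def partial_deriv_nth pd)
  also have "\<dots> = 2 * l * (q (s x) + (l * (((x - p) $ 1)\<^sup>2 + ((x - p) $ 2)\<^sup>2)) * q' (s x))"
  proof -
    have ax: "axis 1 1 $ 1 = (1 :: real)" "axis 2 1 $ 2 = (1 :: real)" by (simp_all add: axis_def)
    show ?thesis unfolding A'_def vector_add_component vector_scaleR_component Jn plane_axis(3) ax by (simp add: algebra_simps power2_eq_square)
  qed
  also have "((x - p) $ 1)\<^sup>2 + ((x - p) $ 2)\<^sup>2 = (norm (x - p))\<^sup>2"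
    unfolding power2_norm_eq_inner inner_vec_def sum_2 by (simp add: power2_eq_square)
  finally show "curvature A x = 2 * l * (q (s x) + s x * q' (s x))" by (simp add: s_def)
  have n\<phi>: "norm (\<phi> x) = e x * norm (x - p) ^ n" for x
    unfolding \<phi>_eW using pos by (simp add: e_def W_def norm_mult norm_power)
  show "(norm (\<phi> x))\<^sup>2 = D\<^sup>2 * ((norm (x - p))\<^sup>2) ^ n * exp (Z (s x))"
    unfolding n\<phi> by (simp add: e_def power_mult_distrib power2_eq_square mult_ac flip: exp_add)
  show "\<phi> x = 0 \<Longrightarrow> x = p" for x using n\<phi>[of x] pos by (simp add: e_def)
  show "zero_of_multiplicity \<phi> p n"
    unfolding zero_of_multiplicity_def
  proof (intro conjI exI)
    show "\<phi> p = 0" using n\<phi>[of p] pos(3) by (cases n) auto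
    show "continuous_on (ball p 1) e" by (rule continuous_on_subset[OF ec]) simp
    show "\<forall>x\<in>ball p 1 - {p}. norm (\<phi> x) / norm (x - p) ^ n = e x" by (simp add: n\<phi>)
  qed (use pos in \<open>auto simp: e_def\<close>)
qed

lemma bounded_integral_tendsto:
  fixes f :: "real \<Rightarrow> real"
  assumes f: "continuous_on {0..} f" "\<And>s. 0 \<le> s \<Longrightarrow> 0 \<le> f s" and B: "\<And>T. 0 \<le> T \<Longrightarrow> integral {0..T} f \<le> B"
  shows "\<exists>I. ((\<lambda>T. integral {0..T} f) \<longlongrightarrow> I) at_top"
proof -
  let ?F = "\<lambda>T. integral {0..T} f"
  have bdd: "bdd_above (?F ` {0..})" using B by (auto intro!: bdd_aboveI)
  have mono: "?F s \<le> ?F t" if "0 \<le> s" "s \<le> t" for s t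
    using that f by (intro integral_subset_le integrable_continuous_interval continuous_on_subset[OF f(1)]) auto
  have le: "?F T \<le> Sup (?F ` {0..})" if "0 \<le> T" for T using that bdd by (intro cSup_upper) auto
  have "(?F \<longlongrightarrow> Sup (?F ` {0..})) at_top"
  proof (rule increasing_tendsto)
    show "\<forall>\<^sub>F T in at_top. ?F T \<le> Sup (?F ` {0..})" using eventually_ge_at_top[of 0] by eventually_elim (rule le)
    fix x assume "x < Sup (?F ` {0..})"
    then obtain t where "0 \<le> t" "x < ?F t" using less_cSup_iff[OF _ bdd] by auto
    then show "\<forall>\<^sub>F T in at_top. x < ?F T" using mono by (auto simp: eventually_at_top_linorder intro!: exI[of _ t] intro: less_le_trans)
  qed
  then show ?thesis ..
qed

text \<open>With s = l |x - p|^2 as variable, area becomes pi / l times length on the half-line, by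
  \<open>nn_integral_cmod_square\<close>.\<close>

lemma radial_integral:
  fixes f :: "real \<Rightarrow> real" and p :: "real^2"
  assumes f: "continuous_on {0..} f" "\<And>s. 0 \<le> s \<Longrightarrow> 0 \<le> f s" and I: "((\<lambda>T. integral {0..T} f) \<longlongrightarrow> I) at_top" and l: "0 < l"
  shows "integrable lborel (\<lambda>x. f (l * (norm (x - p))\<^sup>2))" "(\<integral>x. f (l * (norm (x - p))\<^sup>2) \<partial>lborel) = pi / l * I"
proof -
  define g where "g s = f (max 0 s)" for s
  have gc: "continuous_on S g" for S
    unfolding g_def by (intro continuous_on_compose2[OF f(1)] continuous_intros) auto
  have g0: "0 \<le> g s" for s using f(2) by (simp add: g_def)
  have [measurable]: "g \<in> borel_measurable borel" using gc by (intro borel_measurable_continuous_onI)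
  have fg: "f (l * (norm v)\<^sup>2) = g (l * (norm v)\<^sup>2)" for v :: "'a::real_normed_vector" using l by (simp add: g_def)
  define F where "F s = integral {-1..s} g" for s
  have dF: "(F has_real_derivative g s) (at s)" if "0 \<le> s" for s
  proof -
    have "(F has_real_derivative g s) (at s within {-1..s + 1})"
      unfolding F_def using that by (intro integral_has_real_derivative gc) auto
    moreover have "at s within {-1..s + 1} = at s" using that by (intro at_within_interior) auto
    ultimately show ?thesis by simp
  qed
  have F_eq: "F s = F 0 + integral {0..s} f" if "0 \<le> s" for s
  proof -
    have "F s = integral {-1..0} g + integral {0..s} g"
      unfolding F_def using that by (intro Henstock_Kurzweil_Integration.integral_combine[symmetric] integrable_continuous_interval gc) auto
    also have "integral {0..s} g = integral {0..s} f" by (intro Henstock_Kurzweil_Integration.integral_cong) (auto simp: g_def)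
    finally show ?thesis by (simp add: F_def)
  qed
  have "((\<lambda>s. F 0 + integral {0..s} f) \<longlongrightarrow> F 0 + I) at_top" by (intro tendsto_intros I)
  then have Flim: "(F \<longlongrightarrow> F 0 + I) at_top"
    by (rule Lim_transform_eventually) (rule eventually_mono[OF eventually_ge_at_top[of 0]], rule F_eq[symmetric])
  have I0: "0 \<le> I"
  proof (rule tendsto_lowerbound[OF I])
    show "\<forall>\<^sub>F T in at_top. 0 \<le> integral {0..T} f"
      using f by (intro always_eventually allI integral_nonneg integrable_continuous_interval continuous_on_subset[OF f(1)]) auto
  qed simp
  have "(\<integral>\<^sup>+ s. ennreal (g (l * s)) * indicator {0..} s \<partial>lborel) = (F 0 + I) / l - F (l * 0) / l"
  proof (rule nn_integral_FTC_atLeast)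
    show "((\<lambda>s. F (l * s) / l) has_real_derivative g (l * s)) (at s)" if "0 \<le> s" for s
      using DERIV_chain2[OF dF, of "\<lambda>s. l * s" s l UNIV] that l by (auto intro!: derivative_eq_intros)
    show "((\<lambda>s. F (l * s) / l) \<longlongrightarrow> (F 0 + I) / l) at_top"
      using l by (intro tendsto_intros filterlim_compose[OF Flim] filterlim_tendsto_pos_mult_at_top[OF tendsto_const _ filterlim_ident]) auto
  qed (use g0 in auto)
  then have nn: "(\<integral>\<^sup>+ s. ennreal (g (l * s)) * indicator {0..} s \<partial>lborel) = I / l" by (simp add: diff_divide_distrib add_divide_distrib)
  have "(\<integral>\<^sup>+ z. ennreal (g (l * (cmod z)\<^sup>2)) \<partial>lborel) = ennreal pi * (I / l)"
    using nn_integral_cmod_square[of "\<lambda>s. ennreal (g (l * s))"] nn by simp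
  also have "\<dots> = ennreal (pi / l * I)" using I0 l by (simp flip: ennreal_mult)
  finally have nnz: "(\<integral>\<^sup>+ z. ennreal (g (l * (cmod z)\<^sup>2)) \<partial>lborel) = ennreal (pi / l * I)" .
  have iz: "integrable lborel (\<lambda>z. g (l * (cmod z)\<^sup>2))"
    using g0 nnz by (intro integrableI_nonneg) (auto simp: less_top)
  have ez: "(\<integral>z. g (l * (cmod z)\<^sup>2) \<partial>lborel) = pi / l * I"
    using g0 nnz I0 l by (intro integral_eq_nn_integral[THEN trans]) (auto intro!: AE_I2)
  have m: "(\<lambda>x :: real^2. g (l * (norm (x - p))\<^sup>2)) \<in> borel_measurable borel" by measurable
  show "integrable lborel (\<lambda>x. f (l * (norm (x - p))\<^sup>2))"
    using integrable_plane_iff[OF m, of p] iz by (simp add: fg norm_of_plane)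
  show "(\<integral>x. f (l * (norm (x - p))\<^sup>2) \<partial>lborel) = pi / l * I"
    using integral_plane[OF m, of p] ez by (simp add: fg norm_of_plane)
qed

context radial_system begin

definition q1 where "q1 s = integral {0..1} (\<lambda>\<sigma>. G1 (s * \<sigma>))"
definition q2 where "q2 s = integral {0..1} (\<lambda>\<sigma>. G2 (s * \<sigma>))"
definition p1 where "p1 s = integral {0..s} G1"
definition p2 where "p2 s = integral {0..s} G2"

lemma cont: "continuous_on {0..} X1" "continuous_on {0..} X2" "continuous_on {0..} G1" "continuous_on {0..} G2"
  unfolding G[abs_def] X[abs_def] using Z_cont by (auto intro!: continuous_intros)

lemma X_nonneg: "0 \<le> s \<Longrightarrow> 0 \<le> X1 s" "0 \<le> s \<Longrightarrow> 0 \<le> X2 s"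
  by (auto simp: X)

lemma X_pos: "0 < s \<Longrightarrow> 0 < X1 s" "0 < s \<Longrightarrow> 0 < X2 s"
  by (auto simp: X)

lemma Z_deriv: "0 \<le> s \<Longrightarrow> (Z1 has_real_derivative - q1 s) (at s within {0..})"
    "0 \<le> s \<Longrightarrow> (Z2 has_real_derivative - q2 s) (at s within {0..})"
  and q_cont: "continuous_on {0..} q1" "continuous_on {0..} q2"
  and q_p: "0 \<le> s \<Longrightarrow> s * q1 s = p1 s" "0 \<le> s \<Longrightarrow> s * q2 s = p2 s"
  using averaged_second_order[OF cont(3) Z_eq(1)] averaged_second_order[OF cont(4) Z_eq(2)]
  by (simp_all add: q1_def[abs_def] q2_def[abs_def] p1_def p2_def)

lemma p_deriv: "0 \<le> s \<Longrightarrow> (p1 has_real_derivative G1 s) (at s within {0..})"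
    "0 \<le> s \<Longrightarrow> (p2 has_real_derivative G2 s) (at s within {0..})"
  unfolding p1_def[abs_def] p2_def[abs_def] by (intro integral_has_derivative_within cont; simp)+

lemma X_deriv_within:
  "0 \<le> s \<Longrightarrow> (X1 has_real_derivative real N1 * s ^ (N1 - 1) * exp (Z1 s) - X1 s * q1 s) (at s within {0..})"
  "0 \<le> s \<Longrightarrow> (X2 has_real_derivative real N2 * s ^ (N2 - 1) * exp (Z2 s) - X2 s * q2 s) (at s within {0..})"
  unfolding X[abs_def] by (rule derivative_eq_intros Z_deriv refl | simp)+

lemma q_deriv:
  obtains q1' q2' where "continuous_on {0..} q1'" "continuous_on {0..} q2'"
    "\<And>s. 0 \<le> s \<Longrightarrow> (q1 has_real_derivative q1' s) (at s within {0..})"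
    "\<And>s. 0 \<le> s \<Longrightarrow> (q2 has_real_derivative q2' s) (at s within {0..})"
    "\<And>s. 0 \<le> s \<Longrightarrow> q1 s + s * q1' s = G1 s" "\<And>s. 0 \<le> s \<Longrightarrow> q2 s + s * q2' s = G2 s"
proof -
  let ?d1 = "\<lambda>s. real N1 * s ^ (N1 - 1) * exp (Z1 s) - X1 s * q1 s" and ?d2 = "\<lambda>s. real N2 * s ^ (N2 - 1) * exp (Z2 s) - X2 s * q2 s"
  have c: "continuous_on {0..} ?d1" "continuous_on {0..} ?d2"
    by (intro continuous_intros cont Z_cont q_cont)+
  have d1: "(G1 has_real_derivative ?d2 s * (X1 s + h1) + X2 s * ?d1 s) (at s within {0..})" if "0 \<le> s" for s
    using has_real_derivative_cong_on[OF DERIV_mult[OF X_deriv_within(2)[OF that] DERIV_add[OF X_deriv_within(1)[OF that] DERIV_const]] G(1)] that by (simp add: algebra_simps)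
  have d2: "(G2 has_real_derivative ?d1 s * (X2 s - h2) + X1 s * ?d2 s) (at s within {0..})" if "0 \<le> s" for s
    using has_real_derivative_cong_on[OF DERIV_mult[OF X_deriv_within(1)[OF that] DERIV_diff[OF X_deriv_within(2)[OF that] DERIV_const]] G(2)] that by (simp add: algebra_simps)
  have c1: "continuous_on {0..} (\<lambda>s. ?d2 s * (X1 s + h1) + X2 s * ?d1 s)" and c2: "continuous_on {0..} (\<lambda>s. ?d1 s * (X2 s - h2) + X1 s * ?d2 s)"
    by (intro continuous_on_add continuous_on_mult continuous_on_diff continuous_on_const c cont(1,2))+
  obtain q1' where 1: "continuous_on {0..} q1'" "\<And>s. 0 \<le> s \<Longrightarrow> (q1 has_real_derivative q1' s) (at s within {0..})"
    "\<And>s. 0 \<le> s \<Longrightarrow> q1 s + s * q1' s = G1 s"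
    using average_has_derivative[OF d1 c1, folded q1_def] by blast
  obtain q2' where 2: "continuous_on {0..} q2'" "\<And>s. 0 \<le> s \<Longrightarrow> (q2 has_real_derivative q2' s) (at s within {0..})"
    "\<And>s. 0 \<le> s \<Longrightarrow> q2 s + s * q2' s = G2 s"
    using average_has_derivative[OF d2 c2, folded q2_def] by blast
  show ?thesis by (rule that[OF 1(1) 2(1) 1(2) 2(2) 1(3) 2(3)])
qed

text \<open>Finite energy in the variable s, as a bound on all partial integrals: in this form it
  survives limits in the masses at every fixed \<open>T\<close>.\<close>

definition bounded_mass where
  "bounded_mass B \<longleftrightarrow> (\<forall>T\<ge>0. integral {0..T} X1 \<le> B \<and> integral {0..T} X2 \<le> B \<and> integral {0..T} (\<lambda>s. X1 s * X2 s) \<le> B)"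

lemma X_integrable: "0 \<le> s \<Longrightarrow> X1 integrable_on {s..t}" "0 \<le> s \<Longrightarrow> X2 integrable_on {s..t}"
    "0 \<le> s \<Longrightarrow> (\<lambda>s. X1 s * X2 s) integrable_on {s..t}"
  by (intro integrable_continuous_interval continuous_intros continuous_on_subset[OF cont(1)] continuous_on_subset[OF cont(2)]; simp)+

lemma p_eq:
  "p1 T = integral {0..T} (\<lambda>s. X1 s * X2 s) + h1 * integral {0..T} X2"
  "p2 T = integral {0..T} (\<lambda>s. X1 s * X2 s) - h2 * integral {0..T} X1"
proof -
  have "p1 T = integral {0..T} (\<lambda>s. X1 s * X2 s + h1 * X2 s)" "p2 T = integral {0..T} (\<lambda>s. X1 s * X2 s - h2 * X1 s)"
    unfolding p1_def p2_def by (auto intro!: Henstock_Kurzweil_Integration.integral_cong simp: G algebra_simps)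
  then show "p1 T = integral {0..T} (\<lambda>s. X1 s * X2 s) + h1 * integral {0..T} X2"
    "p2 T = integral {0..T} (\<lambda>s. X1 s * X2 s) - h2 * integral {0..T} X1"
    using X_integrable(3)[of 0 T]
      integrable_continuous_interval[OF continuous_on_mult[OF continuous_on_const continuous_on_subset[OF cont(1)]], of 0 T h2]
      integrable_continuous_interval[OF continuous_on_mult[OF continuous_on_const continuous_on_subset[OF cont(2)]], of 0 T h1]
    by (simp_all add: Henstock_Kurzweil_Integration.integral_add Henstock_Kurzweil_Integration.integral_diff)
qed

text \<open>The ansatz is |phi_i|^2 = (c / h_i) X_i(l |x - p|^2). The curvatures are then 2 l G_i,
  and both field equations reduce to the single condition 2 l h1 h2 = 8 pi^2 c^2 / k^2, which is the
  choice of \<open>l\<close>. Since the ansatz divides by the masses, they are positive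
  here.\<close>

lemma radial_vortex:
  fixes p :: "real^2"
  assumes pos: "0 < k" "0 < \<sigma>" "0 < h1" "0 < h2" "1 \<le> N1" "1 \<le> N2" and B: "bounded_mass B"
  defines "c \<equiv> \<sigma> * k / (2 * pi)"
  defines "l \<equiv> 8 * pi\<^sup>2 / k\<^sup>2 * c\<^sup>2 / (2 * h1 * h2)"
  obtains S where "vortex_solution k \<sigma> p N1 N2 S"
    "(p1 \<longlongrightarrow> 1 / (2 * pi) * flux (A1 S)) at_top" "(p2 \<longlongrightarrow> 1 / (2 * pi) * flux (A2 S)) at_top"
    "\<And>x. (norm (phi1 S x))\<^sup>2 = c / h1 * l ^ N1 * ((norm (x - p))\<^sup>2) ^ N1 * exp (Z1 (l * (norm (x - p))\<^sup>2))"
    "\<And>x. (norm (phi2 S x))\<^sup>2 = c / h2 * l ^ N2 * ((norm (x - p))\<^sup>2) ^ N2 * exp (Z2 (l * (norm (x - p))\<^sup>2))"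
proof -
  have c: "0 < c" using pos by (simp add: c_def)
  have l: "0 < l" unfolding l_def using pos c by simp
  obtain q1' q2' where q': "continuous_on {0..} q1'" "continuous_on {0..} q2'"
    "\<And>s. 0 \<le> s \<Longrightarrow> (q1 has_real_derivative q1' s) (at s within {0..})"
    "\<And>s. 0 \<le> s \<Longrightarrow> (q2 has_real_derivative q2' s) (at s within {0..})"
    "\<And>s. 0 \<le> s \<Longrightarrow> q1 s + s * q1' s = G1 s" "\<And>s. 0 \<le> s \<Longrightarrow> q2 s + s * q2' s = G2 s"
    using q_deriv by blast
  define D1 where "D1 = sqrt (c / h1 * l ^ N1)"
  define D2 where "D2 = sqrt (c / h2 * l ^ N2)"
  have D: "0 < D1" "0 < D2" "D1\<^sup>2 = c / h1 * l ^ N1" "D2\<^sup>2 = c / h2 * l ^ N2"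
    using pos c l by (simp_all add: D1_def D2_def)
  let ?s = "\<lambda>x. l * (norm (x - p))\<^sup>2"
  define S where "S = \<lparr>
    A1 = \<lambda>x. (- (l * q1 (?s x))) *\<^sub>R (vector [(x - p) $ 2, - ((x - p) $ 1)] :: real^2),
    A2 = \<lambda>x. (- (l * q2 (?s x))) *\<^sub>R (vector [(x - p) $ 2, - ((x - p) $ 1)] :: real^2),
    phi1 = \<lambda>x. of_real (D1 * exp (Z1 (?s x) / 2)) * cnj (to_complex (x - p)) ^ N1,
    phi2 = \<lambda>x. of_real (D2 * exp (Z2 (?s x) / 2)) * cnj (to_complex (x - p)) ^ N2\<rparr>"
  note r1 = radial_component[where p=p, OF Z_deriv(1) q'(3) q'(1) D(1) l pos(5)]
  note r2 = radial_component[where p=p, OF Z_deriv(2) q'(4) q'(2) D(2) l pos(6)]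
  have s0: "0 \<le> ?s x" for x using l by simp
  have n1: "(norm (phi1 S x))\<^sup>2 = c / h1 * l ^ N1 * ((norm (x - p))\<^sup>2) ^ N1 * exp (Z1 (?s x))"
    and n2: "(norm (phi2 S x))\<^sup>2 = c / h2 * l ^ N2 * ((norm (x - p))\<^sup>2) ^ N2 * exp (Z2 (?s x))" for x
    using r1(5)[of x] r2(5)[of x] D by (simp_all add: S_def)
  have X1s: "(norm (phi1 S x))\<^sup>2 = c / h1 * X1 (?s x)" and X2s: "(norm (phi2 S x))\<^sup>2 = c / h2 * X2 (?s x)" for x
    unfolding n1 n2 X by (simp_all add: power_mult_distrib)
  have C1: "curvature (A1 S) x = 2 * l * G1 (?s x)" and C2: "curvature (A2 S) x = 2 * l * G2 (?s x)" for x
    using r1(4)[of x] r2(4)[of x] q'(5,6)[OF s0[of x]] by (simp_all add: S_def)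
  have lK: "2 * l * (h1 * h2) = 8 * pi\<^sup>2 / k\<^sup>2 * c\<^sup>2" unfolding l_def using pos by simp
  have K1: "2 * l * (x2 * (x1 + h1)) = 8 * pi\<^sup>2 / k\<^sup>2 * (c / h2 * x2) * (c / h1 * x1 + c)" for x1 x2
  proof -
    have "8 * pi\<^sup>2 / k\<^sup>2 * (c / h2 * x2) * (c / h1 * x1 + c) = 8 * pi\<^sup>2 / k\<^sup>2 * c\<^sup>2 * (x2 * (x1 + h1)) / (h1 * h2)"
      using pos by (simp add: field_simps power2_eq_square)
    then show ?thesis unfolding lK[symmetric] using pos by simp
  qed
  have K2: "2 * l * (x1 * (x2 - h2)) = 8 * pi\<^sup>2 / k\<^sup>2 * (c / h1 * x1) * (c / h2 * x2 - c)" for x1 x2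
  proof -
    have "8 * pi\<^sup>2 / k\<^sup>2 * (c / h1 * x1) * (c / h2 * x2 - c) = 8 * pi\<^sup>2 / k\<^sup>2 * c\<^sup>2 * (x1 * (x2 - h2)) / (h1 * h2)"
      using pos by (simp add: field_simps power2_eq_square)
    then show ?thesis unfolding lK[symmetric] using pos by simp
  qed
  have SD: "SD_solution k \<sigma> S"
    unfolding SD_solution_def Let_def c_def[symmetric] X1s X2s C1 C2 G K1 K2
    using r1(1,2,3) r2(1,2,3) by (simp add: S_def)
  have XX: "continuous_on {0..} (\<lambda>s. X1 s * X2 s)" "\<And>s. 0 \<le> s \<Longrightarrow> 0 \<le> X1 s * X2 s"
    using X_nonneg by (auto intro!: continuous_intros cont)
  obtain I1 where I1: "((\<lambda>T. integral {0..T} X1) \<longlongrightarrow> I1) at_top"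
    using bounded_integral_tendsto[OF cont(1) X_nonneg(1), of B] B unfolding bounded_mass_def by blast
  obtain I2 where I2: "((\<lambda>T. integral {0..T} X2) \<longlongrightarrow> I2) at_top"
    using bounded_integral_tendsto[OF cont(2) X_nonneg(2), of B] B unfolding bounded_mass_def by blast
  obtain I where I: "((\<lambda>T. integral {0..T} (\<lambda>s. X1 s * X2 s)) \<longlongrightarrow> I) at_top"
    using bounded_integral_tendsto[OF XX, of B] B unfolding bounded_mass_def by blast
  note R1 = radial_integral[where p=p, OF cont(1) X_nonneg(1) I1 l] and R2 = radial_integral[where p=p, OF cont(2) X_nonneg(2) I2 l]
    and R = radial_integral[where p=p, OF XX I l]
  have fin: "finite_energy S"
    unfolding finite_energy_def X1s X2s using R1(1) R2(1) integrable_mult_right[OF R(1), of "c / h1 * (c / h2)"]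
    by (simp add: mult_ac)
  have vs: "vortex_solution k \<sigma> p N1 N2 S"
    unfolding vortex_solution_def using SD fin r1(6,7) r2(6,7) by (simp add: S_def)
  have f1: "flux (A1 S) = 2 * pi * (I + h1 * I2)"
  proof -
    have "flux (A1 S) = (\<integral>x. 2 * l * (X1 (?s x) * X2 (?s x)) + 2 * l * h1 * X2 (?s x) \<partial>lborel)"
      unfolding flux_def C1 G by (simp add: algebra_simps)
    also have "\<dots> = 2 * l * (pi / l * I) + 2 * l * h1 * (pi / l * I2)" using R R2 by simp
    finally show ?thesis using l by (simp add: field_simps)
  qed
  have f2: "flux (A2 S) = 2 * pi * (I - h2 * I1)"
  proof -
    have "flux (A2 S) = (\<integral>x. 2 * l * (X1 (?s x) * X2 (?s x)) - 2 * l * h2 * X1 (?s x) \<partial>lborel)"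
      unfolding flux_def C2 G by (simp add: algebra_simps)
    also have "\<dots> = 2 * l * (pi / l * I) - 2 * l * h2 * (pi / l * I1)" using R R1 by simp
    finally show ?thesis using l by (simp add: field_simps)
  qed
  have "(p1 \<longlongrightarrow> I + h1 * I2) at_top" "(p2 \<longlongrightarrow> I - h2 * I1) at_top"
    unfolding p_eq[abs_def] by (intro tendsto_intros I I1 I2)+
  then show ?thesis using that[OF vs _ _ n1 n2] by (simp add: f1 f2)
qed

thm_deps radial_vortex

end

section \<open>Finite mass and fluxes of radial solutions\<close>

text \<open>The derivative of s X is (1 + n - p) X, which is at most -\<kappa> X on the interval;
  integrating bounds the mass beyond \<open>T\<close> by the value T X(T).\<close>

lemma decay_integral:
  fixes X p :: "real \<Rightarrow> real"
  assumes T: "0 < T" "T \<le> S" and \<kappa>: "0 < \<kappa>"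
    and d: "\<And>s. T \<le> s \<Longrightarrow> (X has_real_derivative (n - p s) / s * X s) (at s)"
    and X0: "\<And>s. T \<le> s \<Longrightarrow> 0 \<le> X s" and n: "\<And>s. T \<le> s \<Longrightarrow> s \<le> S \<Longrightarrow> n - p s \<le> - 1 - \<kappa>"
  shows "\<kappa> * integral {T..S} X \<le> T * X T" "X S \<le> X T"
proof -
  have i: "((\<lambda>s. (1 + n - p s) * X s) has_integral S * X S - T * X T) {T..S}"
  proof (rule fundamental_theorem_of_calculus[OF T(2)])
    fix s assume s: "s \<in> {T..S}"
    have "((\<lambda>s. s * X s) has_real_derivative 1 * X s + (n - p s) / s * X s * s) (at s)"
      using s by (intro DERIV_mult DERIV_ident d) auto
    also have "1 * X s + (n - p s) / s * X s * s = (1 + n - p s) * X s" using s T by (simp add: field_simps)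
    finally show "((\<lambda>s. s * X s) has_vector_derivative (1 + n - p s) * X s) (at s within {T..S})"
      by (simp add: has_real_derivative_iff_has_vector_derivative has_vector_derivative_at_within)
  qed
  have "continuous_on {T..S} X"
    using d by (intro continuous_at_imp_continuous_on ballI DERIV_isCont[OF d]) auto
  then have X: "X integrable_on {T..S}" by (rule integrable_continuous_interval)
  have j: "((\<lambda>s. - \<kappa> * X s) has_integral - \<kappa> * integral {T..S} X) {T..S}"
    by (rule has_integral_mult_right[OF integrable_integral[OF X]])
  have "S * X S - T * X T \<le> - \<kappa> * integral {T..S} X"
  proof (rule has_integral_le[OF i j])
    fix s assume "s \<in> {T..S}"
    then show "(1 + n - p s) * X s \<le> - \<kappa> * X s" using n[of s] X0[of s] by (intro mult_right_mono) auto
  qed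
  moreover have "0 \<le> S * X S" using T X0[of S] by simp
  ultimately show "\<kappa> * integral {T..S} X \<le> T * X T" by linarith
  show "X S \<le> X T"
  proof (rule DERIV_nonpos_imp_nonincreasing[OF T(2)])
    fix s assume s: "T \<le> s" "s \<le> S"
    have "(n - p s) / s * X s \<le> 0" using n[OF s] X0[OF s(1)] s T \<kappa> by (intro mult_nonpos_nonneg divide_nonpos_pos) auto
    with d[OF s(1)] show "\<exists>y. (X has_real_derivative y) (at s) \<and> y \<le> 0" by blast
  qed
qed

lemma integral_bound_from_tail:
  fixes f :: "real \<Rightarrow> real"
  assumes f: "continuous_on {0..} f" "\<And>s. 0 \<le> s \<Longrightarrow> 0 \<le> f s" and T: "0 \<le> T"
    and C: "\<And>S. T \<le> S \<Longrightarrow> integral {T..S} f \<le> C" and S: "0 \<le> S"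
  shows "integral {0..S} f \<le> integral {0..T} f + C"
proof -
  have i: "f integrable_on {a..b}" if "0 \<le> a" for a b
    using that by (intro integrable_continuous_interval continuous_on_subset[OF f(1)]) auto
  have "integral {0..S} f \<le> integral {0..max S T} f" using f i S by (intro integral_subset_le) auto
  also have "\<dots> = integral {0..T} f + integral {T..max S T} f"
    using T i by (intro Henstock_Kurzweil_Integration.integral_combine[symmetric]) auto
  also have "\<dots> \<le> integral {0..T} f + C" using C[of "max S T"] by simp
  finally show ?thesis .
qed

context radial_system begin

lemma Z_0: "Z1 0 = 0" "Z2 0 = 0"
  using Z_eq[of 0] by simp_all

lemma X_deriv:
  assumes s: "0 < s"
  shows "(X1 has_real_derivative (real N1 - p1 s) / s * X1 s) (at s)" "(X2 has_real_derivative (real N2 - p2 s) / s * X2 s) (at s)"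
proof -
  have w: "at s within {0..} = at s" using s by (intro at_within_interior) auto
  have e: "real n * s ^ (n - 1) * E - s ^ n * E * q = (real n - s * q) / s * (s ^ n * E)" for n E q
    using s by (cases n) (auto simp: field_simps)
  have 1: "real N1 * s ^ (N1 - 1) * exp (Z1 s) - X1 s * q1 s = (real N1 - p1 s) / s * X1 s"
    unfolding X q_p(1)[OF less_imp_le[OF s], symmetric] by (rule e)
  have 2: "real N2 * s ^ (N2 - 1) * exp (Z2 s) - X2 s * q2 s = (real N2 - p2 s) / s * X2 s"
    unfolding X q_p(2)[OF less_imp_le[OF s], symmetric] by (rule e)
  show "(X1 has_real_derivative (real N1 - p1 s) / s * X1 s) (at s)" "(X2 has_real_derivative (real N2 - p2 s) / s * X2 s) (at s)"
    using X_deriv_within(1)[of s, unfolded w 1] X_deriv_within(2)[of s, unfolded w 2] s by simp_all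
qed

lemma X_integral_nonneg:
  "0 \<le> s \<Longrightarrow> 0 \<le> integral {s..t} X1" "0 \<le> s \<Longrightarrow> 0 \<le> integral {s..t} X2" "0 \<le> s \<Longrightarrow> 0 \<le> integral {s..t} (\<lambda>s. X1 s * X2 s)"
  using X_integrable X_nonneg by (auto intro!: integral_nonneg)

lemma p_split:
  assumes "0 \<le> s" "s \<le> t"
  shows "p1 t = p1 s + integral {s..t} (\<lambda>s. X1 s * X2 s) + h1 * integral {s..t} X2"
    "p2 t = p2 s + integral {s..t} (\<lambda>s. X1 s * X2 s) - h2 * integral {s..t} X1"
proof -
  have c: "integral {0..t} f = integral {0..s} f + integral {s..t} f" if "f integrable_on {0..t}" for f :: "real \<Rightarrow> real"
    using assms that by (intro Henstock_Kurzweil_Integration.integral_combine[symmetric])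
  show "p1 t = p1 s + integral {s..t} (\<lambda>s. X1 s * X2 s) + h1 * integral {s..t} X2"
    "p2 t = p2 s + integral {s..t} (\<lambda>s. X1 s * X2 s) - h2 * integral {s..t} X1"
    unfolding p_eq c[OF X_integrable(1)[of 0 t, simplified]] c[OF X_integrable(2)[of 0 t, simplified]] c[OF X_integrable(3)[of 0 t, simplified]]
    by (simp_all add: algebra_simps)
qed

lemma p1_mono: "0 \<le> s \<Longrightarrow> s \<le> t \<Longrightarrow> p1 s \<le> p1 t"
  using p_split(1)[of s t] X_integral_nonneg[of s t] h_nonneg by simp

context
  fixes T \<delta> :: real
  assumes T: "0 < T" and \<delta>: "0 < \<delta>"
    and T1: "real N1 + 1 + 2 * \<delta> \<le> p1 T" and T2: "real N2 + 1 + 2 * \<delta> \<le> p2 T" and T3: "h2 * (T * X1 T) \<le> 2 * \<delta>\<^sup>2"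
begin

text \<open>Everything is decided at the one time \<open>T\<close>. \<open>p1\<close> increases, so
  X1 has tail mass at most T X1(T) / (2 \<delta>). The later loss of \<open>p2\<close> is at most h2
  times that, hence at most \<delta> by \<open>T3\<close>, so \<open>p2\<close> keeps the excess
  \<delta> and X2 is controlled as well. Conditions at a single time are what survives a
  perturbation of the masses.\<close>

lemma tail:
  assumes S: "T \<le> S"
  shows "integral {T..S} X1 \<le> T * X1 T / \<delta>" "integral {T..S} X2 \<le> T * X2 T / \<delta>"
    "integral {T..S} (\<lambda>s. X1 s * X2 s) \<le> X1 T * (T * X2 T) / \<delta>"
proof -
  have n1: "real N1 - p1 s \<le> - 1 - 2 * \<delta>" if "T \<le> s" for s
    using p1_mono[of T s] T T1 that by simp
  have d: "(X1 has_real_derivative (real N1 - p1 u) / u * X1 u) (at u)" "(X2 has_real_derivative (real N2 - p2 u) / u * X2 u) (at u)"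
    and nn: "0 \<le> X1 u" "0 \<le> X2 u" if "T \<le> u" for u
    using X_deriv[of u] X_nonneg[of u] T that by simp_all
  have i1: "2 * \<delta> * integral {T..s} X1 \<le> T * X1 T" and m1: "X1 s \<le> X1 T" if "T \<le> s" for s
    by (rule decay_integral[OF T that _ d(1) nn(1) n1]; use \<delta> in simp)+
  have n2: "real N2 - p2 s \<le> - 1 - \<delta>" if "T \<le> s" for s
  proof -
    have "2 * \<delta> * (h2 * integral {T..s} X1) \<le> h2 * (T * X1 T)"
      using mult_left_mono[OF i1[OF that] h_nonneg(2)] by (simp add: mult_ac)
    also have "\<dots> \<le> 2 * \<delta> * \<delta>" using T3 by (simp add: power2_eq_square)
    finally have "h2 * integral {T..s} X1 \<le> \<delta>" using \<delta> by simp
    then show ?thesis using p_split(2)[of T s] X_integral_nonneg(3)[of T s] T T2 that by simp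
  qed
  have i2: "\<delta> * integral {T..S} X2 \<le> T * X2 T"
    by (rule decay_integral(1)[OF T S \<delta> d(2) nn(2) n2])
  have "0 \<le> \<delta> * integral {T..S} X1" using \<delta> X_integral_nonneg[of T S] T by simp
  then show "integral {T..S} X1 \<le> T * X1 T / \<delta>" using i1[OF S] \<delta> by (simp add: field_simps)
  show 2: "integral {T..S} X2 \<le> T * X2 T / \<delta>" using i2 \<delta> by (simp add: field_simps)
  have "integral {T..S} (\<lambda>s. X1 s * X2 s) \<le> integral {T..S} (\<lambda>s. X1 T * X2 s)"
  proof (rule integral_le)
    show "(\<lambda>s. X1 T * X2 s) integrable_on {T..S}"
      using T by (intro integrable_continuous_interval continuous_intros continuous_on_subset[OF cont(2)]) auto
    show "X1 s * X2 s \<le> X1 T * X2 s" if "s \<in> {T..S}" for s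
      using that m1[of s] X_nonneg(2)[of s] T by (intro mult_right_mono) auto
  qed (use X_integrable T in auto)
  also have "\<dots> = X1 T * integral {T..S} X2" by simp
  also have "\<dots> \<le> X1 T * (T * X2 T / \<delta>)" using 2 X_nonneg(1)[of T] T by (intro mult_left_mono) auto
  finally show "integral {T..S} (\<lambda>s. X1 s * X2 s) \<le> X1 T * (T * X2 T) / \<delta>" by simp
qed

lemma tail_p:
  assumes S: "T \<le> S"
  shows "\<bar>p1 S - p1 T\<bar> \<le> (X1 T + h1) * (T * X2 T) / \<delta>" "\<bar>p2 S - p2 T\<bar> \<le> (X1 T * (T * X2 T) + h2 * (T * X1 T)) / \<delta>"
proof -
  note t = tail[OF S] and n = X_integral_nonneg[of T S, OF less_imp_le[OF T]] and sp = p_split[of T S, OF less_imp_le[OF T] S]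
  have "h1 * integral {T..S} X2 \<le> h1 * (T * X2 T / \<delta>)" "h2 * integral {T..S} X1 \<le> h2 * (T * X1 T / \<delta>)"
    using t h_nonneg by (intro mult_left_mono; simp)+
  moreover have "0 \<le> h1 * integral {T..S} X2" "0 \<le> h2 * integral {T..S} X1" using n h_nonneg by simp_all
  moreover have "(X1 T + h1) * (T * X2 T) / \<delta> = X1 T * (T * X2 T) / \<delta> + h1 * (T * X2 T / \<delta>)"
    "(X1 T * (T * X2 T) + h2 * (T * X1 T)) / \<delta> = X1 T * (T * X2 T) / \<delta> + h2 * (T * X1 T / \<delta>)"
    by (simp_all add: algebra_simps add_divide_distrib)
  moreover have "0 \<le> X1 T * (T * X2 T) / \<delta>" using T \<delta> X_nonneg[of T] by simp
  ultimately show "\<bar>p1 S - p1 T\<bar> \<le> (X1 T + h1) * (T * X2 T) / \<delta>" "\<bar>p2 S - p2 T\<bar> \<le> (X1 T * (T * X2 T) + h2 * (T * X1 T)) / \<delta>"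
    using t n sp by (simp_all only: abs_le_iff) linarith+
qed

lemma tail_bounded_mass: "\<exists>B. bounded_mass B"
proof -
  note b = integral_bound_from_tail[OF _ _ less_imp_le[OF T] tail(1), OF cont(1) X_nonneg(1)]
    integral_bound_from_tail[OF _ _ less_imp_le[OF T] tail(2), OF cont(2) X_nonneg(2)]
    integral_bound_from_tail[OF _ _ less_imp_le[OF T] tail(3), OF continuous_on_mult[OF cont(1,2)] mult_nonneg_nonneg[OF X_nonneg]]
  let ?a = "integral {0..T} X1 + T * X1 T / \<delta>" and ?b = "integral {0..T} X2 + T * X2 T / \<delta>"
    and ?c = "integral {0..T} (\<lambda>s. X1 s * X2 s) + X1 T * (T * X2 T) / \<delta>"
  have "bounded_mass (max ?a (max ?b ?c))"
    unfolding bounded_mass_def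
  proof (intro allI impI)
    fix S :: real assume S: "0 \<le> S"
    show "integral {0..S} X1 \<le> max ?a (max ?b ?c) \<and> integral {0..S} X2 \<le> max ?a (max ?b ?c) \<and> integral {0..S} (\<lambda>s. X1 s * X2 s) \<le> max ?a (max ?b ?c)"
      using b(1)[OF _ _ S] b(2)[OF _ _ S] b(3)[OF _ _ _ S] by (auto simp: le_max_iff_disj)
  qed
  then show ?thesis ..
qed

end

lemma p_tendsto:
  assumes B: "bounded_mass B"
  obtains g1 g2 where "(p1 \<longlongrightarrow> g1) at_top" "(p2 \<longlongrightarrow> g2) at_top"
proof -
  have XX: "continuous_on {0..} (\<lambda>s. X1 s * X2 s)" "\<And>s. 0 \<le> s \<Longrightarrow> 0 \<le> X1 s * X2 s"
    using X_nonneg by (auto intro!: continuous_intros cont)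
  obtain I1 where I1: "((\<lambda>T. integral {0..T} X1) \<longlongrightarrow> I1) at_top"
    using bounded_integral_tendsto[OF cont(1) X_nonneg(1), of B] B unfolding bounded_mass_def by blast
  obtain I2 where I2: "((\<lambda>T. integral {0..T} X2) \<longlongrightarrow> I2) at_top"
    using bounded_integral_tendsto[OF cont(2) X_nonneg(2), of B] B unfolding bounded_mass_def by blast
  obtain I where I: "((\<lambda>T. integral {0..T} (\<lambda>s. X1 s * X2 s)) \<longlongrightarrow> I) at_top"
    using bounded_integral_tendsto[OF XX, of B] B unfolding bounded_mass_def by blast
  have "(p1 \<longlongrightarrow> I + h1 * I2) at_top" "(p2 \<longlongrightarrow> I - h2 * I1) at_top"
    unfolding p_eq[abs_def] by (intro tendsto_intros I I1 I2)+
  then show ?thesis by (rule that)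
qed

text \<open>Otherwise X1 + X2 would exceed \<epsilon>/s for all large s and have a logarithmically
  divergent mass.\<close>

lemma small_flux_time:
  assumes B: "bounded_mass B" and \<epsilon>: "0 < \<epsilon>"
  shows "\<exists>T\<ge>1. T0 \<le> T \<and> T * (X1 T + X2 T) \<le> \<epsilon>"
proof (rule ccontr)
  assume no: "\<not> ?thesis"
  define a where "a = max T0 1"
  \<comment> \<open>With this end point \<epsilon> ln (S / a) is at least 2 B + 1, more than the
    mass 2 B that both functions can have together.\<close>
  define S where "S = a * exp (max 0 ((2 * B + 1) / \<epsilon>))"
  have a: "0 < a" "1 \<le> a" "T0 \<le> a" by (auto simp: a_def)
  have aS: "a \<le> S" using a by (simp add: S_def)
  have big: "\<epsilon> * (1 / s) \<le> X1 s + X2 s" if "a \<le> s" for s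
  proof -
    have "\<epsilon> < s * (X1 s + X2 s)" using no order_trans[OF a(2) that] order_trans[OF a(3) that] by (meson not_le)
    then show ?thesis using that a by (simp add: field_simps)
  qed
  have i: "((\<lambda>s. \<epsilon> * (1 / s)) has_integral \<epsilon> * (ln S - ln a)) {a..S}"
  proof (rule has_integral_mult_right, rule fundamental_theorem_of_calculus[OF aS])
    fix s assume "s \<in> {a..S}"
    then have "(ln has_real_derivative 1 / s) (at s)" using a by (intro derivative_eq_intros) auto
    then show "(ln has_vector_derivative 1 / s) (at s within {a..S})"
      by (simp add: has_real_derivative_iff_has_vector_derivative has_vector_derivative_at_within)
  qed
  have xi: "X1 integrable_on {a..S}" "X2 integrable_on {a..S}" using X_integrable(1,2)[of a S] a by simp_all
  have "\<epsilon> * (ln S - ln a) \<le> integral {a..S} X1 + integral {a..S} X2"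
    using big by (intro has_integral_le[OF i has_integral_add[OF integrable_integral integrable_integral]] xi) auto
  also have "\<dots> \<le> integral {0..S} X1 + integral {0..S} X2"
    using a X_integrable X_nonneg by (intro add_mono integral_subset_le) auto
  also have "\<dots> \<le> 2 * B" using B[unfolded bounded_mass_def, rule_format, of S] aS a by linarith
  also have "ln S - ln a = max 0 ((2 * B + 1) / \<epsilon>)" using a by (simp add: S_def ln_mult)
  finally have "\<epsilon> * max 0 ((2 * B + 1) / \<epsilon>) \<le> 2 * B" .
  moreover have "\<epsilon> * ((2 * B + 1) / \<epsilon>) \<le> \<epsilon> * max 0 ((2 * B + 1) / \<epsilon>)" using \<epsilon> by (intro mult_left_mono) auto
  ultimately show False using \<epsilon> by simp
qed

text \<open>The limiting problem without masses: \<open>p1 = p2 = p\<close> obeys the logistic equation \<open>s p' = p (N1 + N2 + 1 - p)\<close>.\<close>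

lemma massless:
  assumes h: "h1 = 0" "h2 = 0" and N: "1 \<le> N1" "1 \<le> N2"
  shows "\<exists>B. bounded_mass B" "(p1 \<longlongrightarrow> real N1 + real N2 + 1) at_top" "(p2 \<longlongrightarrow> real N1 + real N2 + 1) at_top"
proof -
  define m where "m = real N1 + real N2 + 1"
  have GX: "G1 s = X1 s * X2 s" "G2 s = X1 s * X2 s" for s using G[of s] h by simp_all
  have "G1 = G2" by (simp add: fun_eq_iff GX)
  then have pp: "p2 = p1" unfolding p1_def[abs_def] p2_def[abs_def] by simp
  have p0: "p1 0 = 0" by (simp add: p1_def)
  have w: "at s within {0..} = at s" if "0 < s" for s :: real using that by (intro at_within_interior) auto
  have dp: "(p1 has_real_derivative X1 s * X2 s) (at s)" if "0 < s" for s
    using p_deriv(1)[of s] that by (simp add: w GX)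
  have pc: "continuous_on {0..} p1"
    using p_deriv(1) by (auto simp: continuous_on_eq_continuous_within intro: DERIV_continuous)
  \<comment> \<open>A first integral of the system without masses, zero at s = 0; its vanishing is
    the logistic equation for \<open>p1\<close>.\<close>
  define f where "f s = s * (X1 s * X2 s) - p1 s * (m - p1 s)" for s
  have df: "(f has_real_derivative 0) (at s)" if "0 < s" for s
  proof -
    show ?thesis unfolding f_def[abs_def]
      by (rule DERIV_cong[OF DERIV_diff[OF DERIV_mult[OF DERIV_ident DERIV_mult[OF X_deriv[OF that]]]
            DERIV_mult[OF dp[OF that] DERIV_diff[OF DERIV_const dp[OF that]]]]])
         (use that in \<open>simp add: pp m_def field_simps\<close>)
  qed
  have f0: "f s = 0" if "0 \<le> s" for s
  proof (cases "s = 0")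
    case False
    have "f s = f 0"
    proof (rule DERIV_isconst_end[of 0 s f])
      show "continuous_on {0..s} f" unfolding f_def[abs_def]
        by (intro continuous_intros continuous_on_subset[OF cont(1)] continuous_on_subset[OF cont(2)] continuous_on_subset[OF pc]) auto
    qed (use that False df in auto)
    then show ?thesis by (simp add: f_def p0)
  qed (simp add: f_def p0)
  have log: "s * (X1 s * X2 s) = p1 s * (m - p1 s)" if "0 \<le> s" for s using f0[OF that] by (simp add: f_def)
  have p_nn: "0 \<le> p1 s" if "0 \<le> s" for s using p1_mono[of 0 s] that p0 by simp
  have prod: "0 < p1 s * (m - p1 s)" if "0 < s" for s
    unfolding log[OF less_imp_le[OF that], symmetric] using X_pos[OF that] that by simp
  have p_pos: "0 < p1 s" "p1 s < m" if "0 < s" for s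
    using prod[OF that] p_nn[of s] that by (auto simp: zero_less_mult_iff)
  \<comment> \<open>If \<open>p1\<close> stayed below m - e, the logistic equation would make it
    grow at least like p1(1) e ln s, against the bound p1 < m.\<close>
  have ex: "\<exists>T\<ge>1. m - e < p1 T" if e: "0 < e" for e
  proof (rule ccontr)
    assume "\<not> ?thesis"
    then have le: "p1 s \<le> m - e" if "1 \<le> s" for s using that by (meson not_le)
    define c where "c = p1 1 * e"
    have c: "0 < c" using p_pos(1)[of 1] e by (simp add: c_def)
    define S where "S = exp (m / c)"
    have S: "1 \<le> S" using c by (simp add: S_def m_def)
    have "p1 1 - c * ln 1 \<le> p1 S - c * ln S"
    proof (rule DERIV_nonneg_imp_nondecreasing[OF S])
      fix s :: real assume s: "1 \<le> s" "s \<le> S"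
      have "c \<le> p1 s * (m - p1 s)" unfolding c_def
        using p1_mono[of 1 s] le[of s] s e p_pos(1)[of s] by (intro mult_mono) auto
      then have "c \<le> s * (X1 s * X2 s)" using log[of s] s by simp
      then have "0 \<le> X1 s * X2 s - c * (1 / s)" using s by (simp add: field_simps)
      moreover have "((\<lambda>s. p1 s - c * ln s) has_real_derivative X1 s * X2 s - c * (1 / s)) (at s)"
        using s dp[of s] by (auto intro!: derivative_eq_intros)
      ultimately show "\<exists>y. ((\<lambda>s. p1 s - c * ln s) has_real_derivative y) (at s) \<and> 0 \<le> y" by blast
    qed
    moreover have "c * ln S = m" using c by (simp add: S_def)
    ultimately show False using p_pos[of S] p_pos[of 1] S by simp
  qed
  have lim: "(p1 \<longlongrightarrow> m) at_top"
  proof (rule increasing_tendsto)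
    show "\<forall>\<^sub>F s in at_top. p1 s \<le> m"
      using eventually_gt_at_top[of 0] by (rule eventually_mono) (rule less_imp_le[OF p_pos(2)])
    fix x assume "x < m"
    then obtain T where T: "1 \<le> T" "x < p1 T" using ex[of "m - x"] by auto
    show "\<forall>\<^sub>F s in at_top. x < p1 s"
      using eventually_ge_at_top[of T]
      by (rule eventually_mono) (use T p1_mono[of T] in \<open>force intro: less_le_trans\<close>)
  qed
  then show "(p1 \<longlongrightarrow> real N1 + real N2 + 1) at_top" "(p2 \<longlongrightarrow> real N1 + real N2 + 1) at_top"
    by (simp_all add: pp m_def)
  show "\<exists>B. bounded_mass B"
  proof -
    \<comment> \<open>Since N1 and N2 are at least 1, the value m - 1/2 exceeds both N1 + 1 and N2 +
      1 by at least 1/2, that is 2 \<delta> with \<delta> = 1/4.\<close>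
    obtain T where T: "1 \<le> T" "m - 1 / 2 < p1 T" using ex[of "1 / 2"] by auto
    with N show ?thesis by (intro tail_bounded_mass[of T "1 / 4"]) (auto simp: m_def pp h)
  qed
qed

thm_deps massless

end

section \<open>The flux map on the two-parameter family\<close>

lemma eventually_less_nhds:
  fixes f :: "'a::topological_space \<Rightarrow> real"
  assumes "continuous_on UNIV f" "f a < c"
  shows "\<forall>\<^sub>F h in nhds a. f h < c"
  using open_Collect_less[OF assms(1) continuous_on_const[of UNIV c]] assms(2)
  by (auto simp: eventually_nhds intro!: exI[of _ "{h. f h < c}"])

locale radial_family =
  fixes N1 N2 :: nat and Z1 Z2 :: "real \<Rightarrow> real \<times> real \<Rightarrow> real"
  assumes N: "1 \<le> N1" "1 \<le> N2"
    and Z_joint: "continuous_on UNIV (\<lambda>(s, h). Z1 s h)" "continuous_on UNIV (\<lambda>(s, h). Z2 s h)"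
    and sys: "\<And>h1 h2. 0 \<le> h1 \<Longrightarrow> 0 \<le> h2 \<Longrightarrow> radial_system N1 N2 h1 h2 (\<lambda>s. Z1 s (h1, h2)) (\<lambda>s. Z2 s (h1, h2))
       (\<lambda>s. s ^ N1 * exp (Z1 s (h1, h2))) (\<lambda>s. s ^ N2 * exp (Z2 s (h1, h2)))
       (\<lambda>s. s ^ N2 * exp (Z2 s (h1, h2)) * (s ^ N1 * exp (Z1 s (h1, h2)) + h1))
       (\<lambda>s. s ^ N1 * exp (Z1 s (h1, h2)) * (s ^ N2 * exp (Z2 s (h1, h2)) - h2))"
    and Z_le: "\<And>s h1 h2. 0 \<le> s \<Longrightarrow> 0 \<le> h1 \<Longrightarrow> 0 \<le> h2 \<Longrightarrow> Z1 s (h1, h2) \<le> 0"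
      "\<And>s h1 h2. 0 \<le> s \<Longrightarrow> 0 \<le> h1 \<Longrightarrow> 0 \<le> h2 \<Longrightarrow> Z2 s (h1, h2) \<le> h2 * s ^ (N1 + 1)"
begin

definition "x1 h s = s ^ N1 * exp (Z1 s h)" for h and s :: real
definition "x2 h s = s ^ N2 * exp (Z2 s h)" for h and s :: real
definition "g1 h s = x2 h s * (x1 h s + fst h)" for h s
definition "g2 h s = x1 h s * (x2 h s - snd h)" for h s
definition "P1 h T = integral {0..T} (g1 h)" for h T
definition "P2 h T = integral {0..T} (g2 h)" for h T
definition "bdd h \<longleftrightarrow> (\<exists>B. radial_system.bounded_mass (x1 h) (x2 h) B)" for h
text \<open>A limit whose existence is known only where \<open>bdd h\<close> holds and both masses
  are nonnegative; see \<open>\<gamma>_lim\<close>.\<close>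

definition "\<gamma>1 h = Lim at_top (P1 h)" for h
definition "\<gamma>2 h = Lim at_top (P2 h)" for h

lemma rs:
  assumes "0 \<le> fst h" "0 \<le> snd h"
  shows "radial_system N1 N2 (fst h) (snd h) (\<lambda>s. Z1 s h) (\<lambda>s. Z2 s h) (x1 h) (x2 h) (g1 h) (g2 h)"
  using sys[OF assms] by (simp add: x1_def[abs_def] x2_def[abs_def] g1_def[abs_def] g2_def[abs_def])

lemma p_P:
  assumes "0 \<le> fst h" "0 \<le> snd h"
  shows "radial_system.p1 (g1 h) = P1 h" "radial_system.p2 (g2 h) = P2 h"
  by (simp_all add: fun_eq_iff radial_system.p1_def[OF rs[OF assms]] radial_system.p2_def[OF rs[OF assms]] P1_def P2_def)

lemma joint: "continuous_on UNIV (\<lambda>(h, s). x1 h s)" "continuous_on UNIV (\<lambda>(h, s). x2 h s)"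
    "continuous_on UNIV (\<lambda>(h, s). g1 h s)" "continuous_on UNIV (\<lambda>(h, s). g2 h s)"
proof -
  have Z: "continuous_on UNIV (\<lambda>y. Z1 (snd y) (fst y))" "continuous_on UNIV (\<lambda>y. Z2 (snd y) (fst y))"
    using continuous_on_compose_UNIV[OF Z_joint(1), of UNIV "\<lambda>y. (snd y, fst y)"] continuous_on_compose_UNIV[OF Z_joint(2), of UNIV "\<lambda>y. (snd y, fst y)"]
    by (simp_all add: continuous_on_Pair continuous_on_fst continuous_on_snd)
  show x: "continuous_on UNIV (\<lambda>(h, s). x1 h s)" "continuous_on UNIV (\<lambda>(h, s). x2 h s)"
    unfolding x1_def x2_def split_beta' by (intro continuous_intros Z)+
  note x' = x[unfolded split_beta']
  show "continuous_on UNIV (\<lambda>(h, s). g1 h s)"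
    unfolding g1_def split_beta' by (intro continuous_on_mult[OF x'(2)] continuous_on_add[OF x'(1)] continuous_on_fst continuous_on_id)
  show "continuous_on UNIV (\<lambda>(h, s). g2 h s)"
    unfolding g2_def split_beta' by (intro continuous_on_mult[OF x'(1)] continuous_on_diff[OF x'(2)] continuous_on_snd continuous_on_fst continuous_on_id)
qed

lemma joint_integral:
  fixes f :: "real \<times> real \<Rightarrow> real \<Rightarrow> real"
  assumes "continuous_on UNIV (\<lambda>(h, s). f h s)"
  shows "continuous_on UNIV (\<lambda>h. integral {0..T} (f h))"
  by (rule integral_continuous_on_param[where 'b=real, unfolded cbox_interval], rule continuous_on_subset[OF assms]) simp

lemma joint_at:
  fixes f :: "real \<times> real \<Rightarrow> real \<Rightarrow> real"
  assumes "continuous_on UNIV (\<lambda>(h, s). f h s)"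
  shows "continuous_on UNIV (\<lambda>h. f h T)"
  using continuous_on_compose_UNIV[OF assms, of UNIV "\<lambda>h. (h, T)"] by (simp add: continuous_on_Pair)

lemma P_cont: "continuous_on UNIV (\<lambda>h. P1 h T)" "continuous_on UNIV (\<lambda>h. P2 h T)"
  unfolding P1_def P2_def by (intro joint_integral joint)+

lemma \<gamma>_lim:
  assumes h: "0 \<le> fst h" "0 \<le> snd h" and b: "bdd h"
  shows "(P1 h \<longlongrightarrow> \<gamma>1 h) at_top" "(P2 h \<longlongrightarrow> \<gamma>2 h) at_top"
proof -
  interpret r: radial_system N1 N2 "fst h" "snd h" "\<lambda>s. Z1 s h" "\<lambda>s. Z2 s h" "x1 h" "x2 h" "g1 h" "g2 h" by (rule rs[OF h])
  obtain B where "r.bounded_mass B" using b unfolding bdd_def by blast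
  then obtain l1 l2 where "(P1 h \<longlongrightarrow> l1) at_top" "(P2 h \<longlongrightarrow> l2) at_top"
    using r.p_tendsto unfolding p_P[OF h] by blast
  then show "(P1 h \<longlongrightarrow> \<gamma>1 h) at_top" "(P2 h \<longlongrightarrow> \<gamma>2 h) at_top"
    unfolding \<gamma>1_def \<gamma>2_def by (simp_all add: tendsto_Lim[OF trivial_limit_at_top_linorder])
qed

text \<open>At a late time \<open>T\<close> the hypotheses of the tail criterion hold at
  \<open>h0\<close> as strict inequalities between functions continuous in \<open>h\<close>, so they
  persist nearby. The same \<open>T\<close> keeps the change of the fluxes beyond it at most
  \<epsilon>/4 for all these \<open>h\<close>, and continuity of \<open>P1\<close> and
  \<open>P2\<close> at fixed \<open>T\<close> does the rest.\<close>

lemma near: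
  assumes h0: "0 \<le> fst h0" "0 \<le> snd h0" "bdd h0"
    and l: "(P1 h0 \<longlongrightarrow> l1) at_top" "(P2 h0 \<longlongrightarrow> l2) at_top" "real N1 + 1 < l1" "real N2 + 1 < l2" and \<epsilon>: "0 < \<epsilon>"
  shows "\<forall>\<^sub>F h in nhds h0. 0 \<le> fst h \<longrightarrow> 0 \<le> snd h \<longrightarrow> bdd h \<and> \<bar>\<gamma>1 h - l1\<bar> < \<epsilon> \<and> \<bar>\<gamma>2 h - l2\<bar> < \<epsilon>"
proof -
  interpret r0: radial_system N1 N2 "fst h0" "snd h0" "\<lambda>s. Z1 s h0" "\<lambda>s. Z2 s h0" "x1 h0" "x2 h0" "g1 h0" "g2 h0"
    by (rule rs[OF h0(1,2)])
  obtain B where B: "r0.bounded_mass B" using h0(3) unfolding bdd_def by blast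
  \<comment> \<open>A quarter of the smaller excess: after an error \<open>e \<le> \<delta>\<close>
    at time \<open>T\<close> the excess is at least 3 \<delta>, strictly more than the 2 \<delta> of
    the tail criterion.\<close>
  define \<delta> where "\<delta> = min (l1 - real N1 - 1) (l2 - real N2 - 1) / 4"
  have \<delta>: "0 < \<delta>" "4 * \<delta> \<le> l1 - real N1 - 1" "4 * \<delta> \<le> l2 - real N2 - 1" using l by (auto simp: \<delta>_def)
  define e where "e = min (\<epsilon> / 4) \<delta>"
  have e: "0 < e" "e \<le> \<epsilon> / 4" "e \<le> \<delta>" using \<epsilon> \<delta> by (auto simp: e_def)
  obtain T1 where T1: "\<And>T. T1 \<le> T \<Longrightarrow> \<bar>P1 h0 T - l1\<bar> < e \<and> \<bar>P2 h0 T - l2\<bar> < e"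
    using eventually_conj[OF tendstoD[OF l(1) e(1)] tendstoD[OF l(2) e(1)]]
    unfolding eventually_at_top_linorder dist_real_def by blast
  define H where "H = 1 + fst h0 + snd h0"
  have H: "1 \<le> H" using h0 by (simp add: H_def)
  \<comment> \<open>H \<mu> is at most half of each of the thresholds 2 \<delta>^2 and \<epsilon>
    \<delta> / 4, which leaves the strictness that continuity in \<open>h\<close> needs.\<close>
  define \<mu> where "\<mu> = min 1 (min (\<delta>\<^sup>2) (\<epsilon> * \<delta> / 8)) / H"
  have \<mu>0: "0 < \<mu>" using \<delta> \<epsilon> H by (simp add: \<mu>_def)
  have H\<mu>: "H * \<mu> \<le> 1" "H * \<mu> \<le> \<delta>\<^sup>2" "H * \<mu> \<le> \<epsilon> * \<delta> / 8" using H by (simp_all add: \<mu>_def)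
  have \<mu>1: "\<mu> \<le> 1" using H\<mu>(1) mult_right_mono[OF H, of \<mu>] \<mu>0 by linarith
  obtain T where T: "1 \<le> T" "T1 \<le> T" "T * (x1 h0 T + x2 h0 T) \<le> \<mu>" using r0.small_flux_time[OF B \<mu>0, of T1] by blast
  let ?a = "x1 h0 T" and ?b = "x2 h0 T"
  have ab: "0 \<le> ?a" "0 \<le> ?b" using r0.X_nonneg[of T] T(1) by simp_all
  then have Tab: "0 \<le> T * ?a" "0 \<le> T * ?b" "T * ?a \<le> \<mu>" "T * ?b \<le> \<mu>" using T(1,3) by (simp_all add: distrib_left add_increasing add_increasing2 order_trans[OF _ T(3)])
  have a1: "?a \<le> 1" using Tab(3) \<mu>1 mult_right_mono[OF T(1) ab(1)] by linarith
  have c3: "snd h0 * (T * ?a) < 2 * \<delta>\<^sup>2"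
  proof -
    have "snd h0 * (T * ?a) \<le> H * \<mu>" using Tab h0 by (intro mult_mono) (auto simp: H_def)
    also have "\<dots> < 2 * \<delta>\<^sup>2" using H\<mu>(2) \<delta>(1) zero_less_power[of \<delta> 2] by linarith
    finally show ?thesis .
  qed
  have \<epsilon>\<delta>: "H * \<mu> < \<epsilon> * \<delta> / 4" using H\<mu>(3) mult_pos_pos[OF \<epsilon> \<delta>(1)] by linarith
  have c4: "(?a + fst h0) * (T * ?b) < \<epsilon> * \<delta> / 4"
  proof -
    have "(?a + fst h0) * (T * ?b) \<le> H * \<mu>" using Tab h0 a1 ab by (intro mult_mono) (auto simp: H_def)
    with \<epsilon>\<delta> show ?thesis by linarith
  qed
  have c5: "?a * (T * ?b) + snd h0 * (T * ?a) < \<epsilon> * \<delta> / 4"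
  proof -
    have "?a * (T * ?b) \<le> 1 * \<mu>" by (rule mult_mono[OF a1 Tab(4)]) (use Tab in auto)
    moreover have "snd h0 * (T * ?a) \<le> snd h0 * \<mu>" by (rule mult_left_mono[OF Tab(3) h0(2)])
    moreover have "0 \<le> fst h0 * \<mu>" using h0 \<mu>0 by simp
    ultimately have "?a * (T * ?b) + snd h0 * (T * ?a) \<le> H * \<mu>" unfolding H_def distrib_right by linarith
    with \<epsilon>\<delta> show ?thesis by linarith
  qed
  note P = T1[OF T(2)]
  have p: "- P1 h0 T < - (real N1 + 1 + 2 * \<delta>)" "- P2 h0 T < - (real N2 + 1 + 2 * \<delta>)"
    using P \<delta> e by linarith+
  have q: "\<bar>P1 h0 T - l1\<bar> < \<epsilon> / 4" "\<bar>P2 h0 T - l2\<bar> < \<epsilon> / 4" using P e by linarith+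
  note C = joint_at[OF joint(1), of T] joint_at[OF joint(2), of T] P_cont[of T] continuous_on_fst[OF continuous_on_id] continuous_on_snd[OF continuous_on_id]
  have "\<forall>\<^sub>F h in nhds h0. - P1 h T < - (real N1 + 1 + 2 * \<delta>) \<and> - P2 h T < - (real N2 + 1 + 2 * \<delta>) \<and>
      snd h * (T * x1 h T) < 2 * \<delta>\<^sup>2 \<and> (x1 h T + fst h) * (T * x2 h T) < \<epsilon> * \<delta> / 4 \<and>
      x1 h T * (T * x2 h T) + snd h * (T * x1 h T) < \<epsilon> * \<delta> / 4 \<and> \<bar>P1 h T - l1\<bar> < \<epsilon> / 4 \<and> \<bar>P2 h T - l2\<bar> < \<epsilon> / 4"
    by (intro eventually_conj eventually_less_nhds p q c3 c4 c5 continuous_on_minus continuous_on_mult continuous_on_add continuous_on_diff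
        continuous_on_const continuous_on_rabs C)
  then show ?thesis
  proof eventually_elim
    case (elim h)
    show ?case
    proof (intro impI)
      assume h: "0 \<le> fst h" "0 \<le> snd h"
      interpret r: radial_system N1 N2 "fst h" "snd h" "\<lambda>s. Z1 s h" "\<lambda>s. Z2 s h" "x1 h" "x2 h" "g1 h" "g2 h"
        by (rule rs[OF h])
      have t: "0 < T" "0 < \<delta>" "real N1 + 1 + 2 * \<delta> \<le> r.p1 T" "real N2 + 1 + 2 * \<delta> \<le> r.p2 T" "snd h * (T * x1 h T) \<le> 2 * \<delta>\<^sup>2"
        using T(1) \<delta>(1) elim unfolding p_P[OF h] by auto
      have b: "bdd h" unfolding bdd_def by (rule r.tail_bounded_mass[OF t])
      have k: "x / \<delta> \<le> \<epsilon> / 4" if "x < \<epsilon> * \<delta> / 4" for x using that \<delta>(1) by (simp add: field_simps)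
      have k1: "(x1 h T + fst h) * (T * x2 h T) / \<delta> \<le> \<epsilon> / 4" and k2: "(x1 h T * (T * x2 h T) + snd h * (T * x1 h T)) / \<delta> \<le> \<epsilon> / 4"
        using elim by (intro k; blast)+
      have "\<bar>\<gamma>1 h - P1 h T\<bar> \<le> \<epsilon> / 4"
      proof (rule tendsto_upperbound[OF tendsto_rabs[OF tendsto_diff[OF \<gamma>_lim(1)[OF h b] tendsto_const]]])
        show "\<forall>\<^sub>F S in at_top. \<bar>P1 h S - P1 h T\<bar> \<le> \<epsilon> / 4"
          using eventually_ge_at_top[of T]
          by (rule eventually_mono) (rule order_trans[OF r.tail_p(1)[OF t, unfolded p_P[OF h]] k1])
      qed simp
      moreover have "\<bar>\<gamma>2 h - P2 h T\<bar> \<le> \<epsilon> / 4"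
      proof (rule tendsto_upperbound[OF tendsto_rabs[OF tendsto_diff[OF \<gamma>_lim(2)[OF h b] tendsto_const]]])
        show "\<forall>\<^sub>F S in at_top. \<bar>P2 h S - P2 h T\<bar> \<le> \<epsilon> / 4"
          using eventually_ge_at_top[of T]
          by (rule eventually_mono) (rule order_trans[OF r.tail_p(2)[OF t, unfolded p_P[OF h]] k2])
      qed simp
      ultimately show "bdd h \<and> \<bar>\<gamma>1 h - l1\<bar> < \<epsilon> \<and> \<bar>\<gamma>2 h - l2\<bar> < \<epsilon>" using b elim \<epsilon> by linarith
    qed
  qed
qed

lemma vortex:
  fixes p :: "real^2"
  assumes k: "0 < k" "0 < \<sigma>" and h: "0 < fst h" "0 < snd h" and b: "bdd h"
  defines "c \<equiv> \<sigma> * k / (2 * pi)"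
  defines "l \<equiv> 8 * pi\<^sup>2 / k\<^sup>2 * c\<^sup>2 / (2 * fst h * snd h)"
  shows "\<exists>S. vortex_solution k \<sigma> p N1 N2 S \<and> \<gamma>1 h = 1 / (2 * pi) * flux (A1 S) \<and> \<gamma>2 h = 1 / (2 * pi) * flux (A2 S) \<and>
    (\<forall>x. (norm (phi1 S x))\<^sup>2 = c / fst h * l ^ N1 * ((norm (x - p))\<^sup>2) ^ N1 * exp (Z1 (l * (norm (x - p))\<^sup>2) h)) \<and>
    (\<forall>x. (norm (phi2 S x))\<^sup>2 = c / snd h * l ^ N2 * ((norm (x - p))\<^sup>2) ^ N2 * exp (Z2 (l * (norm (x - p))\<^sup>2) h))"
proof -
  have h': "0 \<le> fst h" "0 \<le> snd h" using h by simp_all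
  interpret r: radial_system N1 N2 "fst h" "snd h" "\<lambda>s. Z1 s h" "\<lambda>s. Z2 s h" "x1 h" "x2 h" "g1 h" "g2 h" by (rule rs[OF h'])
  obtain B where B: "r.bounded_mass B" using b unfolding bdd_def by blast
  obtain S where S: "vortex_solution k \<sigma> p N1 N2 S"
    "(r.p1 \<longlongrightarrow> 1 / (2 * pi) * flux (A1 S)) at_top" "(r.p2 \<longlongrightarrow> 1 / (2 * pi) * flux (A2 S)) at_top"
    "\<And>x. (norm (phi1 S x))\<^sup>2 = c / fst h * l ^ N1 * ((norm (x - p))\<^sup>2) ^ N1 * exp (Z1 (l * (norm (x - p))\<^sup>2) h)"
    "\<And>x. (norm (phi2 S x))\<^sup>2 = c / snd h * l ^ N2 * ((norm (x - p))\<^sup>2) ^ N2 * exp (Z2 (l * (norm (x - p))\<^sup>2) h)"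
    using r.radial_vortex[OF k h N B, of p] unfolding c_def l_def by blast
  have "\<gamma>1 h = 1 / (2 * pi) * flux (A1 S)" "\<gamma>2 h = 1 / (2 * pi) * flux (A2 S)"
    unfolding \<gamma>1_def \<gamma>2_def using S(2,3) unfolding p_P[OF h'] by (intro tendsto_Lim trivial_limit_at_top_linorder; simp)+
  with S show ?thesis by blast
qed

text \<open>The fluxes depend on \<open>h\<close> alone, so the asymptotic theorem for one choice of
  k, \<sigma> and p gives a priori bounds. In particular finite mass with positive masses h1, h2
  already entails the excess over N_i + 1 that \<open>near\<close> asks for.\<close>

lemma \<gamma>_bounds:
  assumes h: "0 < fst h" "0 < snd h" "bdd h"
  shows "real N1 + 1 < \<gamma>1 h" "real N2 + 1 < \<gamma>2 h" "(\<gamma>1 h - real N1) * (\<gamma>2 h - real N2 - 1) < real N1 * (real N2 + 1)"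
proof -
  obtain S where S: "vortex_solution 1 1 (0 :: real^2) N1 N2 S" "\<gamma>1 h = 1 / (2 * pi) * flux (A1 S)" "\<gamma>2 h = 1 / (2 * pi) * flux (A2 S)"
    using vortex[of 1 1 h 0] h by auto
  note V = vortex_solution_asymptotics(11-13)[OF S(1) _ _ N refl refl, folded S(2,3)]
  show "real N1 + 1 < \<gamma>1 h" "real N2 + 1 < \<gamma>2 h" "(\<gamma>1 h - real N1) * (\<gamma>2 h - real N2 - 1) < real N1 * (real N2 + 1)"
    using V by simp_all
qed

text \<open>On the unit interval X1 \<le> 1 and X2 \<le> exp \<eta>, hence q2 \<le> exp \<eta> and
  Z2 \<ge> -exp \<eta>, all independently of \<open>e\<close>. So X2 has a mass there bounded below
  independently of \<open>e\<close>, and the first flux contains \<open>e\<close> times this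
  mass.\<close>

lemma \<gamma>1_lower:
  assumes e: "0 < e" and \<eta>: "0 \<le> \<eta>" and b: "bdd (e, \<eta>)"
  shows "e * (exp (- exp \<eta>) / (real N2 + 1)) \<le> \<gamma>1 (e, \<eta>)"
proof -
  let ?h = "(e, \<eta>)"
  have h: "0 \<le> fst ?h" "0 \<le> snd ?h" using e \<eta> by simp_all
  interpret r: radial_system N1 N2 "fst ?h" "snd ?h" "\<lambda>s. Z1 s ?h" "\<lambda>s. Z2 s ?h" "x1 ?h" "x2 ?h" "g1 ?h" "g2 ?h" by (rule rs[OF h])
  have xx: "x1 ?h s * x2 ?h s \<le> exp \<eta>" if s: "0 \<le> s" "s \<le> 1" for s
  proof -
    have "x1 ?h s \<le> 1" unfolding x1_def using Z_le(1)[of s e \<eta>] e \<eta> s by (intro mult_le_one power_le_one) auto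
    moreover have "x2 ?h s \<le> exp \<eta>"
    proof -
      have "Z2 s ?h \<le> \<eta>" using Z_le(2)[of s e \<eta>] mult_left_le[of "s ^ (N1 + 1)" \<eta>] power_le_one[of s "N1 + 1"] e \<eta> s by linarith
      then have "x2 ?h s \<le> 1 * exp \<eta>" unfolding x2_def using s by (intro mult_mono power_le_one) auto
      then show ?thesis by simp
    qed
    ultimately have "x1 ?h s * x2 ?h s \<le> 1 * exp \<eta>" using r.X_nonneg[OF s(1)] by (intro mult_mono) auto
    then show ?thesis by simp
  qed
  have q: "r.q2 s \<le> exp \<eta>" if s: "0 < s" "s \<le> 1" for s
  proof -
    have "s * r.q2 s = integral {0..s} (\<lambda>s. x1 ?h s * x2 ?h s) - \<eta> * integral {0..s} (x1 ?h)"
      using r.q_p(2)[of s] r.p_eq(2)[of s] s by simp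
    also have "\<dots> \<le> integral {0..s} (\<lambda>s. x1 ?h s * x2 ?h s)" using r.X_integral_nonneg(1)[of 0 s] \<eta> by simp
    also have "\<dots> \<le> integral {0..s} (\<lambda>s. exp \<eta>)"
      using xx s r.X_integrable(3)[of 0 s] by (intro integral_le) auto
    finally show ?thesis using s by simp
  qed
  have Z: "- exp \<eta> \<le> Z2 s ?h" if s: "0 \<le> s" "s \<le> 1" for s
  proof -
    have "Z2 0 ?h + 0 * exp \<eta> \<le> Z2 s ?h + s * exp \<eta>"
    proof (rule DERIV_nonneg_imp_increasing_open[OF s(1), where f="\<lambda>s. Z2 s ?h + s * exp \<eta>"])
      fix u assume u: "0 < u" "u < s"
      have "at u within {0..} = at u" using u by (intro at_within_interior) auto
      then have "((\<lambda>s. Z2 s ?h) has_real_derivative - r.q2 u) (at u)" using r.Z_deriv(2)[of u] u by simp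
      then have "((\<lambda>s. Z2 s ?h + s * exp \<eta>) has_real_derivative - r.q2 u + exp \<eta>) (at u)"
        by (auto intro!: derivative_eq_intros)
      moreover have "0 \<le> - r.q2 u + exp \<eta>" using q[of u] u s by simp
      ultimately show "\<exists>y. ((\<lambda>s. Z2 s ?h + s * exp \<eta>) has_real_derivative y) (at u) \<and> 0 \<le> y" by blast
    qed (intro continuous_intros continuous_on_subset[OF r.Z_cont(2)], auto)
    moreover have "s * exp \<eta> \<le> 1 * exp \<eta>" using s by (intro mult_right_mono) auto
    ultimately show ?thesis using r.Z_0(2) unfolding mult_1 mult_zero_left by linarith
  qed
  have "((\<lambda>s::real. s ^ N2 * exp (- exp \<eta>)) has_integral 1 ^ (N2 + 1) * (exp (- exp \<eta>) / (real N2 + 1)) - 0 ^ (N2 + 1) * (exp (- exp \<eta>) / (real N2 + 1))) {0..1}"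
  proof (rule fundamental_theorem_of_calculus)
    fix s :: real
    have "((\<lambda>s. s ^ (N2 + 1) * (exp (- exp \<eta>) / (real N2 + 1))) has_real_derivative real (N2 + 1) * s ^ N2 * (exp (- exp \<eta>) / (real N2 + 1))) (at s within {0..1})"
      by (rule DERIV_cmult_right, rule DERIV_cong[OF DERIV_power[OF DERIV_ident]]) simp
    moreover have "real (N2 + 1) * s ^ N2 * (exp (- exp \<eta>) / (real N2 + 1)) = s ^ N2 * exp (- exp \<eta>)" by (simp add: field_simps)
    ultimately show "((\<lambda>s. s ^ (N2 + 1) * (exp (- exp \<eta>) / (real N2 + 1))) has_vector_derivative s ^ N2 * exp (- exp \<eta>)) (at s within {0..1})"
      by (simp only: has_real_derivative_iff_has_vector_derivative)
  qed simp
  then have c: "((\<lambda>s::real. s ^ N2 * exp (- exp \<eta>)) has_integral exp (- exp \<eta>) / (real N2 + 1)) {0..1}" by simp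
  have low: "exp (- exp \<eta>) / (real N2 + 1) \<le> integral {0..1} (x2 ?h)"
    using Z by (intro has_integral_le[OF c integrable_integral[OF r.X_integrable(2)]]) (auto simp: x2_def intro!: mult_left_mono)
  have "e * (exp (- exp \<eta>) / (real N2 + 1)) \<le> P1 ?h 1"
    using mult_left_mono[OF low, of e] e r.p_eq(1)[of 1, unfolded p_P[OF h]] r.X_integral_nonneg(3)[of 0 1] by simp
  moreover have "P1 ?h 1 \<le> \<gamma>1 ?h"
    by (rule tendsto_lowerbound[OF \<gamma>_lim(1)[OF h b]], rule eventually_mono[OF eventually_ge_at_top[of 1]])
       (use r.p1_mono[of 1, unfolded p_P[OF h]] in auto)
  ultimately show ?thesis by linarith
qed

text \<open>The first flux is a sum of nonnegative terms and dominates the masses of X1 X2 and, with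
  weight u, of X2. The mass of X1 enters only the second flux, with a negative sign, and is bounded
  because that flux stays positive.\<close>

lemma mass_bound:
  assumes u: "0 < e0" "e0 \<le> u" and \<eta>: "0 < \<eta>" and b: "bdd (u, \<eta>)" and M: "\<gamma>1 (u, \<eta>) \<le> M" "0 \<le> M" and T: "0 \<le> T"
  shows "integral {0..T} (x1 (u, \<eta>)) \<le> M / \<eta>" "integral {0..T} (x2 (u, \<eta>)) \<le> M / e0"
    "integral {0..T} (\<lambda>s. x1 (u, \<eta>) s * x2 (u, \<eta>) s) \<le> M"
proof -
  let ?h = "(u, \<eta>)"
  have h: "0 \<le> fst ?h" "0 \<le> snd ?h" using u \<eta> by simp_all
  interpret r: radial_system N1 N2 "fst ?h" "snd ?h" "\<lambda>s. Z1 s ?h" "\<lambda>s. Z2 s ?h" "x1 ?h" "x2 ?h" "g1 ?h" "g2 ?h" by (rule rs[OF h])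
  have P1: "P1 ?h S \<le> M" if "0 \<le> S" for S
  proof -
    have "P1 ?h S \<le> \<gamma>1 ?h"
      by (rule tendsto_lowerbound[OF \<gamma>_lim(1)[OF h b]], rule eventually_mono[OF eventually_ge_at_top[of S]])
         (use r.p1_mono[of S, unfolded p_P[OF h]] that in auto)
    with M show ?thesis by simp
  qed
  have XX: "integral {0..S} (\<lambda>s. x1 ?h s * x2 ?h s) \<le> M" and X2: "u * integral {0..S} (x2 ?h) \<le> M" if "0 \<le> S" for S
  proof -
    have "0 \<le> u * integral {0..S} (x2 ?h)" using r.X_integral_nonneg(2)[of 0 S] u by simp
    then show "integral {0..S} (\<lambda>s. x1 ?h s * x2 ?h s) \<le> M" "u * integral {0..S} (x2 ?h) \<le> M"
      using P1[OF that] r.p_eq(1)[of S, unfolded p_P[OF h]] r.X_integral_nonneg(3)[of 0 S] by simp_all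
  qed
  show "integral {0..T} (\<lambda>s. x1 ?h s * x2 ?h s) \<le> M" by (rule XX[OF T])
  have "e0 * integral {0..T} (x2 ?h) \<le> u * integral {0..T} (x2 ?h)"
    using r.X_integral_nonneg(2)[of 0 T] u by (intro mult_right_mono) auto
  then show "integral {0..T} (x2 ?h) \<le> M / e0" using X2[OF T] u by (simp add: field_simps)
  \<comment> \<open>Positivity at some late time beyond \<open>T\<close> means \<eta> times the mass
    of X1 is less than the mass of X1 X2 up to that time.\<close>
  have "0 < \<gamma>2 ?h" using \<gamma>_bounds(2)[of ?h] u \<eta> b by simp
  then have "\<forall>\<^sub>F S in at_top. 0 < P2 ?h S \<and> T \<le> S"
    by (intro eventually_conj order_tendstoD(1)[OF \<gamma>_lim(2)[OF h b]] eventually_ge_at_top)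
  then obtain S where S: "0 < P2 ?h S" "T \<le> S" using eventually_happens'[OF trivial_limit_at_top_linorder] by blast
  have "\<eta> * integral {0..T} (x1 ?h) \<le> \<eta> * integral {0..S} (x1 ?h)"
    using S T \<eta> r.X_integrable r.X_nonneg by (intro mult_left_mono integral_subset_le) auto
  also have "\<dots> \<le> M" using S(1) XX[of S] S(2) T r.p_eq(2)[of S, unfolded p_P[OF h]] by simp
  finally show "integral {0..T} (x1 ?h) \<le> M / \<eta>" using \<eta> by (simp add: field_simps)
qed

text \<open>Continuation in the first mass. If the first flux stayed at most \<open>M\<close>, then
  \<open>\<gamma>1_lower\<close> would bound the masses reached. At their supremum the bounds of
  \<open>mass_bound\<close> pass to the limit and give finite mass, the a priori bounds give the
  strict excess, and \<open>near\<close> continues past the supremum.\<close>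

lemma unbounded:
  assumes \<eta>: "0 < \<eta>" and e0: "0 < e0" "bdd (e0, \<eta>)"
  shows "\<exists>e1\<ge>e0. (\<forall>e\<in>{e0..e1}. bdd (e, \<eta>)) \<and> M < \<gamma>1 (e1, \<eta>)"
proof (rule ccontr)
  assume no: "\<not> ?thesis"
  define J where "J = {e. e0 \<le> e \<and> (\<forall>u\<in>{e0..e}. bdd (u, \<eta>))}"
  have J0: "e0 \<in> J" using e0 by (simp add: J_def)
  have JM: "\<gamma>1 (e, \<eta>) \<le> M" and Jb: "bdd (e, \<eta>)" "e0 \<le> e" if "e \<in> J" for e using no that by (force simp: J_def)+
  have M: "0 \<le> M" using JM[OF J0] \<gamma>_bounds(1)[of "(e0, \<eta>)"] e0 \<eta> by simp
  define c where "c = exp (- exp \<eta>) / (real N2 + 1)"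
  have c: "0 < c" by (simp add: c_def)
  have "e \<le> M / c" if "e \<in> J" for e
    using \<gamma>1_lower[of e \<eta>, folded c_def] JM[OF that] Jb[OF that] e0 \<eta> c by (simp add: field_simps)
  then have bdJ: "bdd_above J" by (rule bdd_aboveI)
  define s where "s = Sup J"
  have s0: "e0 \<le> s" unfolding s_def by (rule cSup_upper[OF J0 bdJ])
  have cl: "s \<in> closure J" unfolding s_def by (rule closure_contains_Sup[OF _ bdJ]) (use J0 in auto)
  have lim: "integral {0..T} (f (s, \<eta>)) \<le> C"
    if f: "continuous_on UNIV (\<lambda>(h, s). f h s)" and le: "\<And>u. u \<in> J \<Longrightarrow> integral {0..T} (f (u, \<eta>)) \<le> C" for f :: "real \<times> real \<Rightarrow> real \<Rightarrow> real" and T C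
  proof -
    have "continuous_on UNIV (\<lambda>u. integral {0..T} (f (u, \<eta>)))"
      using continuous_on_compose_UNIV[OF joint_integral[OF f], of UNIV "\<lambda>u. (u, \<eta>)"] by (simp add: continuous_on_Pair)
    then have "closed {u. integral {0..T} (f (u, \<eta>)) \<le> C}" by (intro closed_Collect_le continuous_on_const)
    then have "closure J \<subseteq> {u. integral {0..T} (f (u, \<eta>)) \<le> C}" using le by (intro closure_minimal) auto
    with cl show ?thesis by auto
  qed
  have h: "0 < fst (s, \<eta>)" "0 < snd (s, \<eta>)" using s0 e0 \<eta> by simp_all
  have h': "0 \<le> fst (s, \<eta>)" "0 \<le> snd (s, \<eta>)" using h by simp_all
  interpret r: radial_system N1 N2 "fst (s, \<eta>)" "snd (s, \<eta>)" "\<lambda>t. Z1 t (s, \<eta>)" "\<lambda>t. Z2 t (s, \<eta>)" "x1 (s, \<eta>)" "x2 (s, \<eta>)" "g1 (s, \<eta>)" "g2 (s, \<eta>)"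
    by (rule rs[OF h'])
  have xx: "continuous_on UNIV (\<lambda>(h, s). x1 h s * x2 h s)"
    using continuous_on_mult[OF joint(1,2)] by (simp add: split_beta')
  have "r.bounded_mass (max M (max (M / \<eta>) (M / e0)))"
    unfolding r.bounded_mass_def
  proof (intro allI impI)
    fix T :: real assume T: "0 \<le> T"
    note m = mass_bound[OF e0(1) Jb(2) \<eta> Jb(1) JM M T]
    show "integral {0..T} (x1 (s, \<eta>)) \<le> max M (max (M / \<eta>) (M / e0)) \<and> integral {0..T} (x2 (s, \<eta>)) \<le> max M (max (M / \<eta>) (M / e0)) \<and>
        integral {0..T} (\<lambda>t. x1 (s, \<eta>) t * x2 (s, \<eta>) t) \<le> max M (max (M / \<eta>) (M / e0))"
      using lim[OF joint(1) m(1)] lim[OF joint(2) m(2)] lim[OF xx m(3)] by (simp add: le_max_iff_disj)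
  qed
  then have bs: "bdd (s, \<eta>)" unfolding bdd_def by blast
  have "\<forall>\<^sub>F h in nhds (s, \<eta>). 0 \<le> fst h \<longrightarrow> 0 \<le> snd h \<longrightarrow> bdd h \<and> \<bar>\<gamma>1 h - \<gamma>1 (s, \<eta>)\<bar> < 1 \<and> \<bar>\<gamma>2 h - \<gamma>2 (s, \<eta>)\<bar> < 1"
    using \<gamma>_lim[OF h' bs] \<gamma>_bounds(1,2)[OF h bs] by (intro near h' bs) auto
  then obtain d where d: "0 < d" "\<And>h. dist h (s, \<eta>) < d \<Longrightarrow> 0 \<le> fst h \<Longrightarrow> 0 \<le> snd h \<Longrightarrow> bdd h"
    unfolding eventually_nhds_metric by blast
  have "bdd (u, \<eta>)" if u: "e0 \<le> u" "u \<le> s + d / 2" for u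
  proof (cases "u < s")
    case True
    then obtain e where "e \<in> J" "u < e" using less_cSup_iff[OF _ bdJ, of u] J0 by (auto simp: s_def)
    then show ?thesis using u by (auto simp: J_def)
  next
    case False
    then show ?thesis using u d(1) e0 \<eta> by (intro d(2)) (auto simp: dist_Pair_Pair dist_real_def)
  qed
  then have "s + d / 2 \<in> J" using s0 d(1) by (auto simp: J_def)
  then have "s + d / 2 \<le> s" unfolding s_def by (rule cSup_upper[OF _ bdJ])
  with d(1) show False by simp
qed

lemma \<gamma>_continuous:
  assumes \<eta>: "0 < \<eta>" and e0: "0 < e0" and b: "\<And>e. e \<in> {e0..e1} \<Longrightarrow> bdd (e, \<eta>)"
  shows "continuous_on {e0..e1} (\<lambda>e. \<gamma>1 (e, \<eta>))" "continuous_on {e0..e1} (\<lambda>e. \<gamma>2 (e, \<eta>))"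
proof -
  have *: "\<exists>d>0. \<forall>u\<in>{e0..e1}. dist u e < d \<longrightarrow> \<bar>\<gamma>1 (u, \<eta>) - \<gamma>1 (e, \<eta>)\<bar> < \<epsilon> \<and> \<bar>\<gamma>2 (u, \<eta>) - \<gamma>2 (e, \<eta>)\<bar> < \<epsilon>"
    if e: "e \<in> {e0..e1}" and \<epsilon>: "0 < \<epsilon>" for e \<epsilon>
  proof -
    have h: "0 < fst (e, \<eta>)" "0 < snd (e, \<eta>)" using e e0 \<eta> by simp_all
    have h': "0 \<le> fst (e, \<eta>)" "0 \<le> snd (e, \<eta>)" using h by simp_all
    have "\<forall>\<^sub>F h in nhds (e, \<eta>). 0 \<le> fst h \<longrightarrow> 0 \<le> snd h \<longrightarrow> bdd h \<and> \<bar>\<gamma>1 h - \<gamma>1 (e, \<eta>)\<bar> < \<epsilon> \<and> \<bar>\<gamma>2 h - \<gamma>2 (e, \<eta>)\<bar> < \<epsilon>"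
      using \<gamma>_lim[OF h' b[OF e]] \<gamma>_bounds(1,2)[OF h b[OF e]] \<epsilon> by (intro near h' b[OF e]) auto
    then obtain d where d: "0 < d" "\<And>h. dist h (e, \<eta>) < d \<Longrightarrow> 0 \<le> fst h \<Longrightarrow> 0 \<le> snd h \<Longrightarrow> \<bar>\<gamma>1 h - \<gamma>1 (e, \<eta>)\<bar> < \<epsilon> \<and> \<bar>\<gamma>2 h - \<gamma>2 (e, \<eta>)\<bar> < \<epsilon>"
      unfolding eventually_nhds_metric by blast
    have "\<bar>\<gamma>1 (u, \<eta>) - \<gamma>1 (e, \<eta>)\<bar> < \<epsilon> \<and> \<bar>\<gamma>2 (u, \<eta>) - \<gamma>2 (e, \<eta>)\<bar> < \<epsilon>" if "u \<in> {e0..e1}" "dist u e < d" for u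
      using that e0 \<eta> by (intro d(2)) (auto simp: dist_Pair_Pair)
    with d(1) show ?thesis by blast
  qed
  show "continuous_on {e0..e1} (\<lambda>e. \<gamma>1 (e, \<eta>))" "continuous_on {e0..e1} (\<lambda>e. \<gamma>2 (e, \<eta>))"
    unfolding continuous_on_iff dist_real_def using * unfolding dist_real_def by meson+
qed

text \<open>For a small mass \<open>h2 = \<eta>\<close>, increasing \<open>h1\<close> from \<open>0\<close> moves the fluxes continuously from near
  \<open>N1 + N2 + 1\<close>, the massless values, to \<open>\<gamma>1 \<longlonglongrightarrow> \<infinity>\<close>.\<close>

lemma hit:
  assumes t: "(a + b) * (real N1 + real N2 + 1) < t"
    and big: "\<And>u v. M < u \<Longrightarrow> real N2 + 1 < v \<Longrightarrow> (u - real N1) * (v - real N2 - 1) < real N1 * (real N2 + 1) \<Longrightarrow> t < a * u + b * v"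
  shows "\<exists>\<rho>>0. \<forall>\<eta>. 0 < \<eta> \<and> \<eta> < \<rho> \<longrightarrow> (\<exists>e>0. bdd (e, \<eta>) \<and> a * \<gamma>1 (e, \<eta>) + b * \<gamma>2 (e, \<eta>) = t)"
proof -
  let ?m = "real N1 + real N2 + 1"
  \<comment> \<open>Fluxes within \<epsilon> of the massless values keep the combination below
    \<open>t\<close>; the 1 keeps the denominator positive.\<close>
  define \<epsilon> where "\<epsilon> = (t - (a + b) * ?m) / (1 + \<bar>a\<bar> + \<bar>b\<bar>)"
  have pos: "0 < 1 + \<bar>a\<bar> + \<bar>b\<bar>" by simp
  have \<epsilon>: "0 < \<epsilon>" unfolding \<epsilon>_def using t pos by (intro divide_pos_pos) auto
  have \<epsilon>t: "(1 + \<bar>a\<bar> + \<bar>b\<bar>) * \<epsilon> = t - (a + b) * ?m" unfolding \<epsilon>_def using pos by simp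
  let ?z = "(0, 0) :: real \<times> real"
  have z: "0 \<le> fst ?z" "0 \<le> snd ?z" by simp_all
  interpret r: radial_system N1 N2 "fst ?z" "snd ?z" "\<lambda>s. Z1 s ?z" "\<lambda>s. Z2 s ?z" "x1 ?z" "x2 ?z" "g1 ?z" "g2 ?z" by (rule rs[OF z])
  have m: "bdd ?z" "(P1 ?z \<longlongrightarrow> ?m) at_top" "(P2 ?z \<longlongrightarrow> ?m) at_top"
    using r.massless[OF _ _ N] by (simp_all add: bdd_def p_P[OF z])
  have "\<forall>\<^sub>F h in nhds ?z. 0 \<le> fst h \<longrightarrow> 0 \<le> snd h \<longrightarrow> bdd h \<and> \<bar>\<gamma>1 h - ?m\<bar> < \<epsilon> \<and> \<bar>\<gamma>2 h - ?m\<bar> < \<epsilon>"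
    using N by (intro near[OF z m] \<epsilon>) auto
  then obtain d where d: "0 < d"
    "\<And>h. dist h ?z < d \<Longrightarrow> 0 \<le> fst h \<Longrightarrow> 0 \<le> snd h \<Longrightarrow> bdd h \<and> \<bar>\<gamma>1 h - ?m\<bar> < \<epsilon> \<and> \<bar>\<gamma>2 h - ?m\<bar> < \<epsilon>"
    unfolding eventually_nhds_metric by blast
  have "\<exists>e>0. bdd (e, \<eta>) \<and> a * \<gamma>1 (e, \<eta>) + b * \<gamma>2 (e, \<eta>) = t" if \<eta>: "0 < \<eta>" "\<eta> < d / 2" for \<eta>
  proof -
    let ?e = "d / 2"
    have "dist (?e, \<eta>) ?z = norm (?e, \<eta>)" by (simp add: dist_norm)
    also have "\<dots> \<le> norm ?e + norm \<eta>" by (rule norm_Pair_le)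
    finally have "dist (?e, \<eta>) ?z \<le> \<bar>?e\<bar> + \<bar>\<eta>\<bar>" by (simp only: real_norm_def)
    then have e: "bdd (?e, \<eta>)" "\<bar>\<gamma>1 (?e, \<eta>) - ?m\<bar> < \<epsilon>" "\<bar>\<gamma>2 (?e, \<eta>) - ?m\<bar> < \<epsilon>"
      using d(2)[of "(?e, \<eta>)"] \<eta> d(1) by auto
    obtain e1 where e1: "?e \<le> e1" "\<forall>e\<in>{?e..e1}. bdd (e, \<eta>)" "M < \<gamma>1 (e1, \<eta>)"
      using unbounded[OF \<eta>(1) _ e(1), of M] d(1) by auto
    let ?f = "\<lambda>e. a * \<gamma>1 (e, \<eta>) + b * \<gamma>2 (e, \<eta>)"
    have "a * (\<gamma>1 (?e, \<eta>) - ?m) \<le> \<bar>a\<bar> * \<epsilon>" "b * (\<gamma>2 (?e, \<eta>) - ?m) \<le> \<bar>b\<bar> * \<epsilon>"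
      using e(2,3) mult_left_mono[of "\<bar>\<gamma>1 (?e, \<eta>) - ?m\<bar>" \<epsilon> "\<bar>a\<bar>"] mult_left_mono[of "\<bar>\<gamma>2 (?e, \<eta>) - ?m\<bar>" \<epsilon> "\<bar>b\<bar>"]
        abs_ge_self[of "a * (\<gamma>1 (?e, \<eta>) - ?m)"] abs_ge_self[of "b * (\<gamma>2 (?e, \<eta>) - ?m)"] unfolding abs_mult by linarith+
    moreover have "\<bar>a\<bar> * \<epsilon> + \<bar>b\<bar> * \<epsilon> \<le> t - (a + b) * ?m" using \<epsilon>t \<epsilon> by (simp add: algebra_simps)
    moreover have "?f ?e = a * (\<gamma>1 (?e, \<eta>) - ?m) + b * (\<gamma>2 (?e, \<eta>) - ?m) + (a + b) * ?m" by (simp add: algebra_simps)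
    ultimately have lo: "?f ?e \<le> t" by linarith
    \<comment> \<open>The a priori bounds at this end point are the premises of \<open>big\<close>,
      so the combination has passed \<open>t\<close> and the intermediate value theorem
      applies.\<close>
    have "t < ?f e1"
      using \<gamma>_bounds[of "(e1, \<eta>)"] e1 \<eta> d(1) by (intro big) auto
    then obtain e where "?e \<le> e" "e \<le> e1" "?f e = t"
      using IVT'[of ?f ?e t e1] lo e1 d(1) \<eta> \<gamma>_continuous[OF \<eta>(1), of ?e e1] by (force intro!: continuous_intros)
    with e1 d(1) show ?thesis by (intro exI[of _ e]) auto
  qed
  with d(1) show ?thesis by (intro exI[of _ "d / 2"]) auto
qed

section \<open>Parametrisation of the families by the second mass\<close>

text \<open>Only the leading coefficients at \<open>p\<close> are compared, read off as x tends to
  \<open>p\<close> since Z1 and Z2 vanish at s = 0. Their logarithms give a linear system for the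
  logarithms of the mass ratios, with determinant N1 + N2 + 1.\<close>

lemma moduli_determine_mass:
  fixes p :: "real^2" and K :: real
  assumes h: "0 < fst h" "0 < snd h" "0 < fst h'" "0 < snd h'" and c: "0 < c" "0 < K"
  defines "l \<equiv> \<lambda>h :: real \<times> real. K / (2 * fst h * snd h)"
  assumes e1: "\<And>x. c / fst h * l h ^ N1 * ((norm (x - p))\<^sup>2) ^ N1 * exp (Z1 (l h * (norm (x - p))\<^sup>2) h)
      = c / fst h' * l h' ^ N1 * ((norm (x - p))\<^sup>2) ^ N1 * exp (Z1 (l h' * (norm (x - p))\<^sup>2) h')"
    and e2: "\<And>x. c / snd h * l h ^ N2 * ((norm (x - p))\<^sup>2) ^ N2 * exp (Z2 (l h * (norm (x - p))\<^sup>2) h)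
      = c / snd h' * l h' ^ N2 * ((norm (x - p))\<^sup>2) ^ N2 * exp (Z2 (l h' * (norm (x - p))\<^sup>2) h')"
  shows "snd h = snd h'"
proof -
  have key: "A = A'"
    if eq: "\<And>x. A * ((norm (x - p))\<^sup>2) ^ n * exp (Z (k * (norm (x - p))\<^sup>2) h) = A' * ((norm (x - p))\<^sup>2) ^ n * exp (Z (k' * (norm (x - p))\<^sup>2) h')"
      and Z: "continuous_on UNIV (\<lambda>(s, h). Z s h)" and Z0: "Z 0 h = 0" "Z 0 h' = 0" for A A' k k' :: real and n and Z :: "real \<Rightarrow> real \<times> real \<Rightarrow> real"
  proof -
    have c: "continuous_on UNIV (\<lambda>r. Z (j * r\<^sup>2) g)" for j :: real and g
      using continuous_on_compose_UNIV[OF Z, of UNIV "\<lambda>r. (j * r\<^sup>2, g)"] by (simp add: continuous_intros)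
    have t: "((\<lambda>r. B * exp (Z (j * r\<^sup>2) g)) \<longlongrightarrow> B) (at 0)" if "Z 0 g = 0" for B j :: real and g
    proof -
      have "isCont (\<lambda>r. Z (j * r\<^sup>2) g) 0" using c[of j g] by (simp add: continuous_on_eq_continuous_at)
      from isContD[OF this] have "((\<lambda>r. Z (j * r\<^sup>2) g) \<longlongrightarrow> Z (j * 0\<^sup>2) g) (at 0)" .
      from tendsto_mult[OF tendsto_const tendsto_exp[OF this], of B] show ?thesis using that by simp
    qed
    have "norm (axis 1 1 :: real^2) = 1" using norm_to_complex[of "axis 1 1", unfolded plane_axis(1)] by simp
    then have "A * exp (Z (k * r\<^sup>2) h) = A' * exp (Z (k' * r\<^sup>2) h')" if "r \<noteq> 0" for r
      using eq[of "p + r *\<^sub>R axis 1 1"] that by simp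
    then have "\<forall>\<^sub>F r in at 0. A * exp (Z (k * r\<^sup>2) h) = A' * exp (Z (k' * r\<^sup>2) h')"
      by (auto simp: eventually_at intro!: exI[of _ 1])
    from Lim_transform_eventually[OF t[OF Z0(1), of A k] this] t[OF Z0(2), of A' k']
    show ?thesis using tendsto_unique[OF trivial_limit_at] by blast
  qed
  have Z0: "Z1 0 g = 0" "Z2 0 g = 0" if "0 < fst g" "0 < snd g" for g
    using radial_system.Z_0[OF rs[of g]] that by simp_all
  have k1: "c / fst h * l h ^ N1 = c / fst h' * l h' ^ N1" by (rule key[OF e1 Z_joint(1)]) (use Z0 h in auto)
  have k2: "c / snd h * l h ^ N2 = c / snd h' * l h' ^ N2" by (rule key[OF e2 Z_joint(2)]) (use Z0 h in auto)
  have L: "ln (c / x * l g ^ n) = ln c - ln x + real n * (ln K - ln 2 - ln (fst g) - ln (snd g))" if "0 < x" "0 < fst g" "0 < snd g" for x g n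
    using that c by (simp add: l_def ln_mult ln_div ln_realpow)
  let ?x = "ln (fst h) - ln (fst h')" and ?y = "ln (snd h) - ln (snd h')"
  have 1: "(real N1 + 1) * ?x + real N1 * ?y = 0" and 2: "real N2 * ?x + (real N2 + 1) * ?y = 0"
    using arg_cong[OF k1, of ln, unfolded L[OF h(1) h(1,2)] L[OF h(3) h(3,4)]]
      arg_cong[OF k2, of ln, unfolded L[OF h(2) h(1,2)] L[OF h(4) h(3,4)]]
    by (simp_all add: algebra_simps)
  have "(real N1 + real N2 + 1) * ?y = (real N1 + 1) * (real N2 * ?x + (real N2 + 1) * ?y) - real N2 * ((real N1 + 1) * ?x + real N1 * ?y)"
    by (simp add: algebra_simps)
  also have "\<dots> = 0" unfolding 1 2 by simp
  finally have "?y = 0" using N by (simp only: mult_eq_0_iff) auto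
  then show ?thesis using h by simp
qed

text \<open>The second mass can be recovered from the moduli, so it serves as the parameter. The
  first mass is chosen separately for each value; no continuity of this choice is involved.\<close>

lemma family:
  fixes p :: "real^2"
  assumes k: "0 < k" "0 < \<sigma>"
    and \<rho>: "\<exists>\<rho>>0. \<forall>\<eta>. 0 < \<eta> \<and> \<eta> < \<rho> \<longrightarrow> (\<exists>e>0. bdd (e, \<eta>) \<and> a * \<gamma>1 (e, \<eta>) + b * \<gamma>2 (e, \<eta>) = t)"
  shows "\<exists>F. vortex_family k \<sigma> p N1 N2 F \<and> (\<forall>L. a * (1 / (2 * pi) * flux (A1 (F L))) + b * (1 / (2 * pi) * flux (A2 (F L))) = t)"
proof -
  obtain \<rho> where \<rho>: "0 < \<rho>" "\<And>\<eta>. 0 < \<eta> \<Longrightarrow> \<eta> < \<rho> \<Longrightarrow> \<exists>e>0. bdd (e, \<eta>) \<and> a * \<gamma>1 (e, \<eta>) + b * \<gamma>2 (e, \<eta>) = t"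
    using \<rho> by blast
  \<comment> \<open>An injective map of the whole real line into the interval between 0 and \<rho>,
    since the family is indexed by all real numbers.\<close>
  define \<eta> where "\<eta> L = \<rho> / (1 + exp L)" for L :: real
  have e1: "1 < 1 + exp L" for L :: real by simp
  have \<eta>: "0 < \<eta> L" "\<eta> L < \<rho>" for L
    using \<rho>(1) e1[of L] by (auto simp: \<eta>_def divide_less_eq add_pos_pos)
  define c where "c = \<sigma> * k / (2 * pi)"
  define K where "K = 8 * pi\<^sup>2 / k\<^sup>2 * c\<^sup>2"
  have cK: "0 < c" "0 < K" using k by (simp_all add: c_def K_def)
  define good where "good S h \<longleftrightarrow> 0 < fst h \<and> 0 < snd h \<and> vortex_solution k \<sigma> p N1 N2 S \<and> \<gamma>1 h = 1 / (2 * pi) * flux (A1 S) \<and> \<gamma>2 h = 1 / (2 * pi) * flux (A2 S) \<and>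
    (\<forall>x. (norm (phi1 S x))\<^sup>2 = c / fst h * (K / (2 * fst h * snd h)) ^ N1 * ((norm (x - p))\<^sup>2) ^ N1 * exp (Z1 (K / (2 * fst h * snd h) * (norm (x - p))\<^sup>2) h)) \<and>
    (\<forall>x. (norm (phi2 S x))\<^sup>2 = c / snd h * (K / (2 * fst h * snd h)) ^ N2 * ((norm (x - p))\<^sup>2) ^ N2 * exp (Z2 (K / (2 * fst h * snd h) * (norm (x - p))\<^sup>2) h))" for S h
  have "\<exists>S e. good S (e, \<eta> L) \<and> a * \<gamma>1 (e, \<eta> L) + b * \<gamma>2 (e, \<eta> L) = t" for L
  proof -
    obtain e where e: "0 < e" "bdd (e, \<eta> L)" "a * \<gamma>1 (e, \<eta> L) + b * \<gamma>2 (e, \<eta> L) = t" using \<rho>(2)[OF \<eta>] by blast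
    have "\<exists>S. good S (e, \<eta> L)"
      unfolding good_def using vortex[OF k _ _ e(2), of p, folded c_def, folded K_def] e(1) \<eta>(1)[of L] unfolding fst_conv snd_conv by blast
    with e(3) show ?thesis by blast
  qed
  then obtain F e where F: "\<And>L. good (F L) (e L, \<eta> L)" "\<And>L. a * \<gamma>1 (e L, \<eta> L) + b * \<gamma>2 (e L, \<eta> L) = t" by metis
  have "inj (\<lambda>L. (\<lambda>x. norm (phi1 (F L) x), \<lambda>x. norm (phi2 (F L) x)))"
  proof (rule injI)
    fix L L' assume "(\<lambda>x. norm (phi1 (F L) x), \<lambda>x. norm (phi2 (F L) x)) = (\<lambda>x. norm (phi1 (F L') x), \<lambda>x. norm (phi2 (F L') x))"
    then have n: "norm (phi1 (F L) x) = norm (phi1 (F L') x)" "norm (phi2 (F L) x) = norm (phi2 (F L') x)" for x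
      by (auto simp: fun_eq_iff)
    note G = F(1)[of L, unfolded good_def] F(1)[of L', unfolded good_def]
    have "snd (e L, \<eta> L) = snd (e L', \<eta> L')"
      by (rule moduli_determine_mass[OF _ _ _ _ cK, of _ _ p]) (use G n in metis)+
    then have "exp L = exp L'" using \<rho>(1) e1[of L] e1[of L'] by (simp add: \<eta>_def field_simps)
    then show "L = L'" by simp
  qed
  then have "vortex_family k \<sigma> p N1 N2 F" using F(1) by (simp add: vortex_family_def good_def)
  moreover have "a * (1 / (2 * pi) * flux (A1 (F L))) + b * (1 / (2 * pi) * flux (A2 (F L))) = t" for L
    using F(1)[of L] F(2)[of L] by (simp add: good_def)
  ultimately show ?thesis by blast
qed

end

section \<open>Energy and the existence statements\<close>

lemma total_energy_flux:
  assumes "vortex_solution k \<sigma> p N1 N2 S"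
  shows "total_energy N k \<sigma> S = real N * (real N - 1) * \<sigma> * k / (4 * pi) * (flux (A1 S) - flux (A2 S))"
proof -
  have SD: "SD_solution k \<sigma> S" and fin: "finite_energy S" using assms by (simp_all add: vortex_solution_def)
  let ?K = "8 * pi\<^sup>2 / k\<^sup>2" and ?c = "\<sigma> * k / (2 * pi)" and ?u = "\<lambda>x. (norm (phi1 S x))\<^sup>2" and ?v = "\<lambda>x. (norm (phi2 S x))\<^sup>2"
  have c: "curvature (A1 S) x = ?K * ((?u x * ?v x) + ?c * ?v x)" "curvature (A2 S) x = ?K * ((?u x * ?v x) - ?c * ?u x)" for x
  proof -
    have "curvature (A1 S) x = ?K * ?v x * (?u x + ?c)" "curvature (A2 S) x = ?K * ?u x * (?v x - ?c)"
      using SD unfolding SD_solution_def Let_def by blast+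
    then show "curvature (A1 S) x = ?K * ((?u x * ?v x) + ?c * ?v x)" "curvature (A2 S) x = ?K * ((?u x * ?v x) - ?c * ?u x)"
      by (simp_all only: distrib_left right_diff_distrib mult_ac)
  qed
  have "integrable lborel (curvature (A1 S))" "integrable lborel (curvature (A2 S))"
    unfolding c[abs_def] using fin unfolding finite_energy_def
    by (intro integrable_mult_right Bochner_Integration.integrable_add Bochner_Integration.integrable_diff; simp)+
  then show ?thesis unfolding total_energy_def flux_def by simp
qed

text \<open>The existence claims prescribe a \<gamma>1 + b \<gamma>2 with (a, b) equal to (0, -1),
  (1, 0) and (1, -1). At the massless corner the combination is (a + b)(N1 + N2 + 1), which explains
  the end point N1 + N2 + 1 of the flux ranges and the value 0 for the energy.\<close>

theorem theorem3:
  fixes k \<sigma> :: real and p :: "real^2" and N N1 N2 :: nat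
  assumes "N \<ge> 2" and "k > 0" and "\<sigma> > 0" and "N1 \<ge> 1" and "N2 \<ge> 1"
  shows
    "(\<forall>\<gamma>2::real. real N2 + 1 < \<gamma>2 \<and> \<gamma>2 < real N1 + real N2 + 1 \<longrightarrow>
        (\<exists>F. vortex_family k \<sigma> p N1 N2 F \<and> (\<forall>L. \<gamma>2 = 1 / (2 * pi) * flux (A2 (F L))))) \<and>
     (\<forall>\<gamma>1::real. \<gamma>1 > real N1 + real N2 + 1 \<longrightarrow>
        (\<exists>F. vortex_family k \<sigma> p N1 N2 F \<and> (\<forall>L. \<gamma>1 = 1 / (2 * pi) * flux (A1 (F L))))) \<and>
     (\<forall>E::real. E > 0 \<longrightarrow>
        (\<exists>F. vortex_family k \<sigma> p N1 N2 F \<and> (\<forall>L. E = total_energy N k \<sigma> (F L)))) \<and>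
     (\<forall>S. vortex_solution k \<sigma> p N1 N2 S \<longrightarrow>
        (let \<beta>1 = 1 / (2 * pi) * flux (A1 S) - real N1;
             \<beta>2 = 1 / (2 * pi) * flux (A2 S) - real N2
         in (\<lambda>x. (norm (phi1 S x))^2) \<in> O[at_infinity](\<lambda>x. norm x powr (- 2 * \<beta>1)) \<and>
            (\<lambda>x. (norm (phi2 S x))^2) \<in> O[at_infinity](\<lambda>x. norm x powr (- 2 * \<beta>2)) \<and>
            (\<forall>j. (\<lambda>x. (norm (cov_deriv (A1 S) j (phi1 S) x))^2)
                    \<in> O[at_infinity](\<lambda>x. norm x powr (- 2 * (\<beta>1 + 1)))) \<and>
            (\<forall>j. (\<lambda>x. (norm (cov_deriv (A2 S) j (phi2 S) x))^2)
                    \<in> O[at_infinity](\<lambda>x. norm x powr (- 2 * (\<beta>2 + 1)))) \<and>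
            curvature (A1 S) \<in> O[at_infinity](\<lambda>x. norm x powr (- 2 * \<beta>2)) \<and>
            curvature (A2 S) \<in> O[at_infinity](\<lambda>x. norm x powr (- 2 * \<beta>1)) \<and>
            0 < (\<beta>1 - 1) * (\<beta>2 - 1) \<and>
            (\<beta>1 - 1) * (\<beta>2 - 1) < (real N1 + 1) * (real N2 + 1) \<and>
            \<beta>2 * (\<beta>1 - 1) > real N2 * (real N1 + 1) \<and>
            0 < \<beta>1 * (\<beta>2 - 1) \<and>
            \<beta>1 * (\<beta>2 - 1) < real N1 * (real N2 + 1)))"
proof -
  have "\<exists>Z1 Z2. radial_family N1 N2 Z1 Z2"
  proof (rule radial_system_exists[of N1 N2], goal_cases)
    case (1 Z1 Z2)
    from radial_family.intro[OF assms(4,5) 1] show ?case by blast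
  qed
  then obtain Z1 Z2 where "radial_family N1 N2 Z1 Z2" by blast
  then interpret radial_family N1 N2 Z1 Z2 .
  let ?a = "real N1 * (real N2 + 1)"
  have first: "\<exists>F. vortex_family k \<sigma> p N1 N2 F \<and> (\<forall>L. g = 1 / (2 * pi) * flux (A2 (F L)))"
    if g: "real N2 + 1 < g" "g < real N1 + real N2 + 1" for g
  proof -
    \<comment> \<open>For a first flux above this threshold, (u - N1)(v - N2 - 1) <
      \<open>?a\<close> forces v < g. Signs are reversed because \<open>hit\<close> reaches its
      target from below, while the second flux starts near N1 + N2 + 1 and has to come down to
      g.\<close>
    have "- g < 0 * u + (- 1) * v" if u: "real N1 + ?a / (g - real N2 - 1) < u" and v: "(u - real N1) * (v - real N2 - 1) < ?a" for u v
    proof (rule ccontr)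
      assume "\<not> - g < 0 * u + (- 1) * v"
      then have gv: "g - real N2 - 1 \<le> v - real N2 - 1" by simp
      have d: "0 < g - real N2 - 1" using g by simp
      have q: "0 \<le> ?a / (g - real N2 - 1)" using d by (intro divide_nonneg_pos) auto
      have "?a / (g - real N2 - 1) * (g - real N2 - 1) \<le> (u - real N1) * (v - real N2 - 1)"
        using u d gv q by (intro mult_mono) linarith+
      with v d show False by simp
    qed
    then have "\<exists>\<rho>>0. \<forall>\<eta>. 0 < \<eta> \<and> \<eta> < \<rho> \<longrightarrow> (\<exists>e>0. bdd (e, \<eta>) \<and> 0 * \<gamma>1 (e, \<eta>) + (- 1) * \<gamma>2 (e, \<eta>) = - g)"
      using g by (intro hit[where M="real N1 + ?a / (g - real N2 - 1)"]) auto
    from family[OF assms(2,3) this, of p] obtain F where "vortex_family k \<sigma> p N1 N2 F"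
      "\<And>L. 0 * (1 / (2 * pi) * flux (A1 (F L))) + - 1 * (1 / (2 * pi) * flux (A2 (F L))) = - g" by blast
    then show ?thesis by (intro exI[of _ F]) simp
  qed
  have second: "\<exists>F. vortex_family k \<sigma> p N1 N2 F \<and> (\<forall>L. g = 1 / (2 * pi) * flux (A1 (F L)))"
    if g: "real N1 + real N2 + 1 < g" for g
  proof -
    have "\<exists>\<rho>>0. \<forall>\<eta>. 0 < \<eta> \<and> \<eta> < \<rho> \<longrightarrow> (\<exists>e>0. bdd (e, \<eta>) \<and> 1 * \<gamma>1 (e, \<eta>) + 0 * \<gamma>2 (e, \<eta>) = g)"
      using g by (intro hit[where M=g]) auto
    from family[OF assms(2,3) this, of p] obtain F where "vortex_family k \<sigma> p N1 N2 F"
      "\<And>L. 1 * (1 / (2 * pi) * flux (A1 (F L))) + 0 * (1 / (2 * pi) * flux (A2 (F L))) = g" by blast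
    then show ?thesis by (intro exI[of _ F]) simp
  qed
  have third: "\<exists>F. vortex_family k \<sigma> p N1 N2 F \<and> (\<forall>L. E = total_energy N k \<sigma> (F L))" if E: "0 < E" for E
  proof -
    \<comment> \<open>The energy factor times 2 pi, because \<open>t\<close> is the difference of
      the fluxes divided by 2 pi.\<close>
    define C where "C = real N * (real N - 1) * \<sigma> * k / 2"
    have C: "0 < C" using assms by (simp add: C_def)
    define t where "t = E / C"
    have t: "0 < t" "C * t = E" using C E by (simp_all add: t_def)
    \<comment> \<open>As soon as u - N1 is at least 1, the product inequality bounds v by N2 + 1 +
      \<open>?a\<close>, so u - v exceeds any given value for large u.\<close>
    have "t < 1 * u + (- 1) * v" if u: "t + real N1 + 1 + (real N2 + 1) + ?a < u" and v: "real N2 + 1 < v" "(u - real N1) * (v - real N2 - 1) < ?a" for u v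
    proof -
      have "0 \<le> ?a" by simp
      then have "1 * (v - real N2 - 1) \<le> (u - real N1) * (v - real N2 - 1)" using u v(1) t(1) by (intro mult_right_mono) linarith+
      then have "v - real N2 - 1 < ?a" using v(2) by simp
      moreover have "0 \<le> real N1" by simp
      ultimately show ?thesis using u t(1) by linarith
    qed
    then have "\<exists>\<rho>>0. \<forall>\<eta>. 0 < \<eta> \<and> \<eta> < \<rho> \<longrightarrow> (\<exists>e>0. bdd (e, \<eta>) \<and> 1 * \<gamma>1 (e, \<eta>) + (- 1) * \<gamma>2 (e, \<eta>) = t)"
      using t by (intro hit[where M="t + real N1 + 1 + (real N2 + 1) + ?a"]) auto
    from family[OF assms(2,3) this, of p] obtain F where F: "vortex_family k \<sigma> p N1 N2 F"
      "\<And>L. 1 * (1 / (2 * pi) * flux (A1 (F L))) + - 1 * (1 / (2 * pi) * flux (A2 (F L))) = t" by blast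
    have "total_energy N k \<sigma> (F L) = E" for L
    proof -
      have "vortex_solution k \<sigma> p N1 N2 (F L)" using F(1) by (simp add: vortex_family_def)
      from total_energy_flux[OF this, of N]
      have "total_energy N k \<sigma> (F L) = C * (1 * (1 / (2 * pi) * flux (A1 (F L))) + - 1 * (1 / (2 * pi) * flux (A2 (F L))))"
        by (simp add: C_def field_simps)
      then show ?thesis unfolding F(2) t(2) .
    qed
    with F(1) show ?thesis by (intro exI[of _ F]) simp
  qed
  show ?thesis
    unfolding Let_def
    by (intro conjI allI impI first second third; (elim conjE)?; (assumption)?)
       (rule vortex_solution_asymptotics[OF _ assms(2-5) refl refl], assumption)+
qed

end
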